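(* Let $Y=(Y_t)_{t\in\mathbb{R}}$ be the regularly varying MCARMA$(p,q)$ process with index $\alpha\in(1,2]$ driven by the Lévy process $L$ with autoregressive polynomial $P(z)=z^p\mathrm{I}_d+z^{p-1}A_1+\dots+A_p$ and moving average polynomial $Q(z)=z^qB_0+\dots+B_q$, and suppose that $\mathcal{N}(P)=\{z\in\mathbb{C}:\det(P(z))=0\}\subseteq(-\infty,0)+i\mathbb{R}$. Then $Y$ coincides with the causal MCARMA process driven by $L$ with the same polynomials, i.e. for every $t\in\mathbb{R}$, almost surely, $$Y_t=\int_{-\infty}^{t}\left(\mathrm{I}_d,0,\dots,0\right)e^{(t-s)A}\beta\,L(ds),$$ where $A\in M_{dp}(\mathbb{R})$ is the block companion matrix $$A:=\begin{pmatrix}0&\mathrm{I}_d&0&\ldots&0\\0&0&\mathrm{I}_d&\ddots&\vdots\\\vdots&\vdots&\ddots&\ddots&0\\0&0&\ldots&0&\mathrm{I}_d\\-A_p&-A_{p-1}&\ldots&\ldots&-A_1\end{pmatrix}$$ and $\beta$ is the $dp\times d$ block column with $d\times d$ blocks $\beta_1,\dots,\beta_p$ given by $\beta_{p-j}:=-\sum_{i=1}^{p-j-1}A_i\beta_{p-j-i}+B_{q-j}$, $j=0,1,\dots,p-1$, with $B_i=0$ for $i<0$.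
   Context: Regularly varying MCARMA$(p,q)$ process: let $L=(L_t)_{t\in\mathbb{R}}$ be a two-sided $d$-dimensional Lévy process with generating triplet $(\gamma,\Sigma,\nu)$, where $\nu$ is regularly varying with index $\alpha\in(1,2]$ and limiting measure $\kappa_\nu$, and $\mathbb{E}[L_1]=0$. Let $M(A)=\frac{1}{\sqrt{2\pi}}\int\widehat{1_A}(\mu)L(d\mu)$ for sets $A\in\mathcal{E}(\mathbb{R})$ (the ring generated by half-open bounded intervals $[a,b)$). Let $p,q\in\mathbb{N}_0$, $p>q$, and let $P,Q$ have real $d\times d$ matrix coefficients $A_i,B_j$, $B_0\ne0$, such that all zeros of $\det P$ have nonzero real part. Let $g(\mu)=P(i\mu)^{-1}Q(i\mu)$, $h=\widehat g(-\,\cdot)$, and assume that it is not the case that $\kappa_\nu(\{x\in\mathbb{R}^d:h(s)x\ne0\})=0$ for almost every $s$. Then $$Y_t:=\mathop{\mathbb{P}\text{-}\lim}_{\lambda\to\infty}\int_{-\lambda}^{\lambda}e^{it\mu}P(i\mu)^{-1}Q(i\mu)\left(1-\frac{|\mu|}{\lambda}\right)M(d\mu),\quad t\in\mathbb{R}$$ (limit in probability) is the regularly varying MCARMA$(p,q)$ process with index $\alpha$. The Fourier transform is $\widehat f(\xi)=\frac{1}{\sqrt{2\pi}}\int e^{-i\xi x}f(x)dx$ for $f\in L^1$, componentwise, and by continuity on $L^p$, $1<p\le2$. Two-sided Lévy process: $L_0=0$ a.s., independent stationary increments; generating triplet with truncation function $1_{[0,1]}(\|x\|)$ in the Lévy–Khintchine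 formula. $\nu$ is regularly varying with index $\alpha$ and limiting measure $\kappa_\nu$ if, for some $l$ slowly varying at infinity and a non-zero Radon measure $\kappa_\nu$ on $[-\infty,\infty]^d\setminus\{0\}$ with $\kappa_\nu([-\infty,\infty]^d\setminus\mathbb{R}^d)=0$, $u^\alpha l(u)\nu(u\,\cdot)\to\kappa_\nu$ vaguely on $[-\infty,\infty]^d\setminus\{0\}$ as $u\to\infty$ (relatively compact sets: those bounded away from $0$). Integrals with respect to $L$ are in the sense of Rajput and Rosiński: $L([a,b))=L_b-L_a$ defines an independently scattered random measure on bounded Borel sets; for simple $f=\sum_if_i1_{A_i}$, $\int_Bf\,dL=\sum_if_iL(A_i\cap B)$; a measurable $f$ is $L$-integrable if there are simple $f_n\to f$ a.e. with $\int_Bf_n\,dL$ convergent in probability for every Borel $B$, and $\int_Bf\,dL$ is the limit. Complex integrands: identify $\mathbb{C}$ with $\mathbb{R}^2$. Integration with respect to $M$: for $f=\sum_if_i1_{A_i}$ ($f_i$ complex $d\times d$ matrices, $A_i\in\mathcal{E}(\mathbb{R})$ disjoint), $\int f\,dM=\sum_if_iM(A_i)$. A function $f\in L^r(M_d(\mathbb{C}))$ (measurable complex $d\times d$ matrix-valued functions on $\mathbb{R}$ with $\int\|f\|^r<\infty$) for some $r\in[1,2]$ is $M$-integrable if there are $\mathcal{E}(\mathbb{R})$-simple $f_n$ with $\widehat{f_n}\to\widehat f$ in $L^\delta(M_d(\mathbb{C}))$ for some $\delta<\alpha$ and $\|\widehat{f_n}(\mu)-\widehat f(\mu)\|+\|\widehat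 f(\mu)\|\le C$ for all $n,\mu$; then $\int f\,dM$ is the limit in probability of $\int f_n\,dM$ (which equals $\frac{1}{\sqrt{2\pi}}\int\widehat f\,dL$). $\int_{-\lambda}^{\lambda}f\,dM=\int f1_{[-\lambda,\lambda]}\,dM$. The causal MCARMA process (introduced in earlier work) is the process given by the moving average formula on the right-hand side of the displayed equation in the claim. *)

theory Defs
  imports "HOL-Probability.Probability"
begin

text \<open>Random variables are plain measurable functions on the probability space \<open>M\<close>; stochastic
  integrals are determined only up to almost sure equality and are therefore given by relations
  \<open>has_levy_integral\<close>, \<open>has_M_integral\<close> (in the style of \<open>has_integral\<close>). Since \<open>\<complex>\<close> is a real vector
  space, complex integrands are handled by embedding \<open>\<real>\<^sup>d\<close> into \<open>\<complex>\<^sup>d\<close>; all integrands are complex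
  \<open>d \<times> d\<close> matrices, and a scalar \<open>c\<close> is the matrix \<open>mat c\<close>.\<close>

definition cvec :: "real ^ 'd \<Rightarrow> complex ^ 'd" where
  "cvec x = (\<chi> i. complex_of_real (x $ i))"

definition cmat :: "real ^ 'm ^ 'n \<Rightarrow> complex ^ 'm ^ 'n" where
  "cmat X = (\<chi> i j. complex_of_real (X $ i $ j))"


subsection \<open>Convergence in probability and in \<open>L\<^sup>r\<close>\<close>

definition tendsto_in_prob ::
    "'w measure \<Rightarrow> ('i \<Rightarrow> 'w \<Rightarrow> 'b::metric_space) \<Rightarrow> ('w \<Rightarrow> 'b) \<Rightarrow> 'i filter \<Rightarrow> bool" where
  "tendsto_in_prob M X Z F \<longleftrightarrow>
     (\<forall>\<^sub>F i in F. X i \<in> borel_measurable M) \<and> Z \<in> borel_measurable M \<and>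
     (\<forall>\<epsilon>>0. ((\<lambda>i. measure M {\<omega> \<in> space M. dist (X i \<omega>) (Z \<omega>) > \<epsilon>}) \<longlongrightarrow> 0) F)"

definition Lr_function :: "real \<Rightarrow> (real \<Rightarrow> 'a::real_normed_vector) \<Rightarrow> bool" where
  "Lr_function r f \<longleftrightarrow> f \<in> borel_measurable borel \<and> integrable lborel (\<lambda>x. norm (f x) powr r)"

definition tendsto_Lr ::
    "real \<Rightarrow> (nat \<Rightarrow> real \<Rightarrow> 'a::real_normed_vector) \<Rightarrow> (real \<Rightarrow> 'a) \<Rightarrow> bool" where
  "tendsto_Lr r F f \<longleftrightarrow> (\<forall>n. Lr_function r (F n)) \<and> Lr_function r f \<and>
     (\<lambda>n. LINT x|lborel. norm (F n x - f x) powr r) \<longlonglongrightarrow> 0"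


subsection \<open>Fourier transform\<close>

definition fourier_L1 :: "(real \<Rightarrow> complex) \<Rightarrow> real \<Rightarrow> complex" where
  "fourier_L1 f \<xi> = (1 / sqrt (2 * pi)) * (LINT x|lborel. exp (- \<i> * of_real (\<xi> * x)) * f x)"

definition fourier_L1_mat :: "(real \<Rightarrow> complex ^ 'd ^ 'd) \<Rightarrow> real \<Rightarrow> complex ^ 'd ^ 'd" where
  "fourier_L1_mat f \<xi> = (\<chi> i j. fourier_L1 (\<lambda>x. f x $ i $ j) \<xi>)"

text \<open>\<open>g\<close> is a version of the Fourier transform of \<open>f \<in> L\<^sup>r\<close>, \<open>1 \<le> r \<le> 2\<close>. For \<open>r > 1\<close> this is the
  continuous extension \<open>L\<^sup>r \<rightarrow> L\<^sup>r\<^sup>'\<close>, \<open>r' = r / (r - 1)\<close>, from the dense subspace \<open>L\<^sup>1 \<inter> L\<^sup>r\<close>.\<close>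

definition has_fourier :: "real \<Rightarrow> (real \<Rightarrow> complex) \<Rightarrow> (real \<Rightarrow> complex) \<Rightarrow> bool" where
  "has_fourier r f g \<longleftrightarrow> Lr_function r f \<and> g \<in> borel_measurable borel \<and>
     (if r = 1 then AE \<xi> in lborel. g \<xi> = fourier_L1 f \<xi>
      else \<exists>F. (\<forall>n. Lr_function 1 (F n)) \<and> tendsto_Lr r F f \<and>
               tendsto_Lr (r / (r - 1)) (\<lambda>n. fourier_L1 (F n)) g)"

definition has_fourier_mat ::
    "real \<Rightarrow> (real \<Rightarrow> complex ^ 'd ^ 'd) \<Rightarrow> (real \<Rightarrow> complex ^ 'd ^ 'd) \<Rightarrow> bool" where
  "has_fourier_mat r f g \<longleftrightarrow> (\<forall>i j. has_fourier r (\<lambda>x. f x $ i $ j) (\<lambda>\<xi>. g \<xi> $ i $ j))"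


subsection \<open>Two-sided Levy processes\<close>

definition two_sided_levy_process :: "'w measure \<Rightarrow> (real \<Rightarrow> 'w \<Rightarrow> real ^ 'd) \<Rightarrow> bool" where
  "two_sided_levy_process M L \<longleftrightarrow>
     prob_space M \<and> (\<forall>t. L t \<in> borel_measurable M) \<and> (AE \<omega> in M. L 0 \<omega> = 0) \<and>
     (\<forall>(\<tau>::nat \<Rightarrow> real) n. (\<forall>i<n. \<tau> i \<le> \<tau> (Suc i)) \<longrightarrow>
        prob_space.indep_vars M (\<lambda>_. borel) (\<lambda>i \<omega>. L (\<tau> (Suc i)) \<omega> - L (\<tau> i) \<omega>) {..<n}) \<and>
     (\<forall>s t h. distr M borel (\<lambda>\<omega>. L (t + h) \<omega> - L (s + h) \<omega>) =
              distr M borel (\<lambda>\<omega>. L t \<omega> - L s \<omega>))"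

definition levy_measure :: "(real ^ 'd) measure \<Rightarrow> bool" where
  "levy_measure \<nu> \<longleftrightarrow> sets \<nu> = sets borel \<and> emeasure \<nu> {0} = 0 \<and>
     (\<integral>\<^sup>+x. ennreal (min 1 ((norm x)\<^sup>2)) \<partial>\<nu>) < \<infinity>"

definition levy_exponent ::
    "real ^ 'd \<Rightarrow> real ^ 'd ^ 'd \<Rightarrow> (real ^ 'd) measure \<Rightarrow> real ^ 'd \<Rightarrow> complex" where
  "levy_exponent \<gamma> \<Sigma> \<nu> u =
     \<i> * of_real (\<gamma> \<bullet> u) - of_real (u \<bullet> (\<Sigma> *v u)) / 2 +
     (LINT x|\<nu>. exp (\<i> * of_real (u \<bullet> x)) - 1
                  - \<i> * of_real (u \<bullet> x) * of_real (indicator {0..1} (norm x)))"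

text \<open>The formula for all \<open>t \<ge> 0\<close> (not just \<open>t = 1\<close>) entails stochastic continuity.\<close>

definition has_generating_triplet ::
    "'w measure \<Rightarrow> (real \<Rightarrow> 'w \<Rightarrow> real ^ 'd) \<Rightarrow> real ^ 'd \<Rightarrow> real ^ 'd ^ 'd \<Rightarrow>
     (real ^ 'd) measure \<Rightarrow> bool" where
  "has_generating_triplet M L \<gamma> \<Sigma> \<nu> \<longleftrightarrow>
     transpose \<Sigma> = \<Sigma> \<and> (\<forall>u. u \<bullet> (\<Sigma> *v u) \<ge> 0) \<and> levy_measure \<nu> \<and>
     (\<forall>t\<ge>0. \<forall>u. (LINT \<omega>|M. exp (\<i> * of_real (u \<bullet> L t \<omega>))) =
                exp (of_real t * levy_exponent \<gamma> \<Sigma> \<nu> u))"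


subsection \<open>Regular variation of measures\<close>

definition slowly_varying :: "(real \<Rightarrow> real) \<Rightarrow> bool" where
  "slowly_varying l \<longleftrightarrow> l \<in> borel_measurable borel \<and> (\<forall>u>0. l u > 0) \<and>
     (\<forall>c>0. ((\<lambda>u. l (c * u) / l u) \<longlongrightarrow> 1) at_top)"

definition evec :: "real ^ 'd \<Rightarrow> ereal ^ 'd" where
  "evec x = (\<chi> i. ereal (x $ i))"

text \<open>A measure on \<open>[-\<infinity>,\<infinity>]\<^sup>d - {0}\<close> is represented by a Borel measure on \<open>[-\<infinity>,\<infinity>]\<^sup>d\<close> that does not
  charge \<open>0\<close>. On this locally compact Polish space a Borel measure is Radon iff it is finite on
  compact sets. A test function in \<open>C\<^sub>c([-\<infinity>,\<infinity>]\<^sup>d - {0})\<close> is a continuous function on \<open>[-\<infinity>,\<infinity>]\<^sup>d\<close>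
  vanishing outside a compact set that does not contain \<open>0\<close>. The integral of \<open>f\<close> with respect to
  \<open>\<nu>(u \<sqdot>)\<close> is \<open>\<integral> f (x / u) \<nu>(dx)\<close>.\<close>

definition regularly_varying_measure ::
    "(real ^ 'd) measure \<Rightarrow> real \<Rightarrow> (ereal ^ 'd) measure \<Rightarrow> bool" where
  "regularly_varying_measure \<nu> \<alpha> \<kappa> \<longleftrightarrow>
     sets \<kappa> = sets borel \<and> emeasure \<kappa> {0} = 0 \<and> emeasure \<kappa> (space \<kappa>) \<noteq> 0 \<and>
     (\<forall>K. compact K \<and> 0 \<notin> K \<longrightarrow> emeasure \<kappa> K < \<infinity>) \<and>
     emeasure \<kappa> (- range evec) = 0 \<and>
     (\<exists>l. slowly_varying l \<and>
        (\<forall>f::ereal ^ 'd \<Rightarrow> real.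
           continuous_on UNIV f \<and> (\<exists>K. compact K \<and> 0 \<notin> K \<and> (\<forall>x. x \<notin> K \<longrightarrow> f x = 0)) \<longrightarrow>
           ((\<lambda>u. u powr \<alpha> * l u * (LINT x|\<nu>. f (evec (x /\<^sub>R u)))) \<longlongrightarrow> (LINT x|\<kappa>. f x)) at_top))"


subsection \<open>Integration with respect to a Levy process\<close>

definition bounded_borel :: "real set set" where
  "bounded_borel = {A \<in> sets borel. bounded A}"

text \<open>\<open>\<Lambda>\<close> is (a version of) the independently scattered random measure on the bounded Borel sets
  that is determined by \<open>L([a,b)) = L\<^sub>b - L\<^sub>a\<close>. Finite families are covered by padding with \<open>{}\<close>.\<close>

definition levy_random_measure ::
    "'w measure \<Rightarrow> (real \<Rightarrow> 'w \<Rightarrow> real ^ 'd) \<Rightarrow> (real set \<Rightarrow> 'w \<Rightarrow> real ^ 'd) \<Rightarrow> bool" where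
  "levy_random_measure M L \<Lambda> \<longleftrightarrow>
     (\<forall>A\<in>bounded_borel. \<Lambda> A \<in> borel_measurable M) \<and>
     (\<forall>A::nat \<Rightarrow> real set. disjoint_family A \<and> range A \<subseteq> bounded_borel \<longrightarrow>
        prob_space.indep_vars M (\<lambda>_. borel) (\<lambda>n. \<Lambda> (A n)) UNIV \<and>
        ((\<Union>n. A n) \<in> bounded_borel \<longrightarrow>
           (AE \<omega> in M. (\<lambda>n. \<Lambda> (A n) \<omega>) sums \<Lambda> (\<Union>n. A n) \<omega>))) \<and>
     (\<forall>a b. a \<le> b \<longrightarrow> (AE \<omega> in M. \<Lambda> {a..<b} \<omega> = L b \<omega> - L a \<omega>))"

text \<open>A simple function \<open>\<Sum>\<^sub>i f\<^sub>i 1\<^bsub>A\<^sub>i\<^esub>\<close> is represented by the list of the pairs \<open>(f\<^sub>i, A\<^sub>i)\<close>.\<close>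

definition simple_over :: "real set set \<Rightarrow> ('c \<times> real set) list \<Rightarrow> bool" where
  "simple_over \<A> S \<longleftrightarrow> snd ` set S \<subseteq> \<A> \<and> sorted_wrt disjnt (map snd S)"

definition simple_fun :: "('c::real_vector \<times> real set) list \<Rightarrow> real \<Rightarrow> 'c" where
  "simple_fun S x = (\<Sum>(c, A)\<leftarrow>S. indicator A x *\<^sub>R c)"

definition simple_integral ::
    "(real set \<Rightarrow> 'w \<Rightarrow> complex ^ 'd) \<Rightarrow> ((complex ^ 'd ^ 'd) \<times> real set) list \<Rightarrow>
     'w \<Rightarrow> complex ^ 'd" where
  "simple_integral V S \<omega> = (\<Sum>(c, A)\<leftarrow>S. c *v V A \<omega>)"

text \<open>Rajput--Rosinski integral: \<open>f\<close> is \<open>L\<close>-integrable and \<open>X\<close> is a version of \<open>\<integral> f dL\<close>.\<close>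

definition has_levy_integral ::
    "'w measure \<Rightarrow> (real set \<Rightarrow> 'w \<Rightarrow> real ^ 'd) \<Rightarrow> (real \<Rightarrow> complex ^ 'd ^ 'd) \<Rightarrow>
     ('w \<Rightarrow> complex ^ 'd) \<Rightarrow> bool" where
  "has_levy_integral M \<Lambda> f X \<longleftrightarrow>
     f \<in> borel_measurable borel \<and>
     (\<exists>S. (\<forall>n. simple_over bounded_borel (S n)) \<and>
          (AE x in lborel. (\<lambda>n. simple_fun (S n) x) \<longlonglongrightarrow> f x) \<and>
          (\<forall>D\<in>sets borel. \<exists>Z. tendsto_in_prob M
             (\<lambda>n::nat. simple_integral (\<lambda>A \<omega>. cvec (\<Lambda> (A \<inter> D) \<omega>)) (S n)) Z sequentially) \<and>
          tendsto_in_prob M (\<lambda>n. simple_integral (\<lambda>A \<omega>. cvec (\<Lambda> A \<omega>)) (S n)) X sequentially)"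


subsection \<open>Integration with respect to the random measure \<open>M\<close> (here \<open>\<Phi>\<close>)\<close>

definition interval_ring :: "real set set" where
  "interval_ring = ring_of_sets UNIV hull {{a..<b} | a b. True}"

definition fourier_random_measure ::
    "'w measure \<Rightarrow> (real set \<Rightarrow> 'w \<Rightarrow> real ^ 'd) \<Rightarrow> (real set \<Rightarrow> 'w \<Rightarrow> complex ^ 'd) \<Rightarrow> bool" where
  "fourier_random_measure M \<Lambda> \<Phi> \<longleftrightarrow>
     (\<forall>A\<in>interval_ring. has_levy_integral M \<Lambda>
        (\<lambda>\<mu>. mat ((1 / sqrt (2 * pi)) * fourier_L1 (indicator A) \<mu>)) (\<Phi> A))"

text \<open>\<open>g\<close> is the version of the Fourier transform of \<open>f\<close> for which the uniform bound holds
  everywhere.\<close>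

definition has_M_integral ::
    "'w measure \<Rightarrow> real \<Rightarrow> (real set \<Rightarrow> 'w \<Rightarrow> complex ^ 'd) \<Rightarrow> (real \<Rightarrow> complex ^ 'd ^ 'd) \<Rightarrow>
     ('w \<Rightarrow> complex ^ 'd) \<Rightarrow> bool" where
  "has_M_integral M \<alpha> \<Phi> f X \<longleftrightarrow>
     (\<exists>r\<in>{1..2}. Lr_function r f \<and>
       (\<exists>g \<delta> C S. has_fourier_mat r f g \<and> 0 < \<delta> \<and> \<delta> < \<alpha> \<and>
          (\<forall>n. simple_over interval_ring (S n)) \<and>
          tendsto_Lr \<delta> (\<lambda>n. fourier_L1_mat (simple_fun (S n))) g \<and>
          (\<forall>n \<mu>. norm (fourier_L1_mat (simple_fun (S n)) \<mu> - g \<mu>) + norm (g \<mu>) \<le> C) \<and>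
          tendsto_in_prob M (\<lambda>n. simple_integral \<Phi> (S n)) X sequentially))"


subsection \<open>MCARMA processes\<close>

definition ar_poly :: "nat \<Rightarrow> (nat \<Rightarrow> real ^ 'd ^ 'd) \<Rightarrow> complex \<Rightarrow> complex ^ 'd ^ 'd" where
  "ar_poly p A z = mat (z ^ p) + (\<Sum>i = 1..p. mat (z ^ (p - i)) ** cmat (A i))"

definition ma_poly :: "nat \<Rightarrow> (nat \<Rightarrow> real ^ 'd ^ 'd) \<Rightarrow> complex \<Rightarrow> complex ^ 'd ^ 'd" where
  "ma_poly q B z = (\<Sum>j = 0..q. mat (z ^ (q - j)) ** cmat (B j))"

definition ar_zeros :: "nat \<Rightarrow> (nat \<Rightarrow> real ^ 'd ^ 'd) \<Rightarrow> complex set" where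
  "ar_zeros p A = {z. det (ar_poly p A z) = 0}"

definition transfer_fun ::
    "nat \<Rightarrow> nat \<Rightarrow> (nat \<Rightarrow> real ^ 'd ^ 'd) \<Rightarrow> (nat \<Rightarrow> real ^ 'd ^ 'd) \<Rightarrow> real \<Rightarrow>
     complex ^ 'd ^ 'd" where
  "transfer_fun p q A B \<mu> =
     matrix_inv (ar_poly p A (\<i> * of_real \<mu>)) ** ma_poly q B (\<i> * of_real \<mu>)"

definition nondegenerate_kernel ::
    "(ereal ^ 'd) measure \<Rightarrow> (real \<Rightarrow> complex ^ 'd ^ 'd) \<Rightarrow> bool" where
  "nondegenerate_kernel \<kappa> h \<longleftrightarrow>
     \<not> (AE s in lborel. emeasure \<kappa> (evec ` {x. h s *v cvec x \<noteq> 0}) = 0)"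

definition regularly_varying_mcarma ::
    "'w measure \<Rightarrow> real \<Rightarrow> (real set \<Rightarrow> 'w \<Rightarrow> complex ^ 'd) \<Rightarrow> nat \<Rightarrow> nat \<Rightarrow>
     (nat \<Rightarrow> real ^ 'd ^ 'd) \<Rightarrow> (nat \<Rightarrow> real ^ 'd ^ 'd) \<Rightarrow> (real \<Rightarrow> 'w \<Rightarrow> complex ^ 'd) \<Rightarrow> bool" where
  "regularly_varying_mcarma M \<alpha> \<Phi> p q A B Y \<longleftrightarrow>
     (\<forall>t. \<exists>J. (\<forall>\<rho>>0. has_M_integral M \<alpha> \<Phi>
                 (\<lambda>\<mu>. indicator {-\<rho>..\<rho>} \<mu> *\<^sub>R
                       (mat (exp (\<i> * of_real (t * \<mu>)) * of_real (1 - \<bar>\<mu>\<bar> / \<rho>))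
                        ** transfer_fun p q A B \<mu>)) (J \<rho>)) \<and>
              tendsto_in_prob M J (Y t) at_top)"

text \<open>\<open>M\<^sub>d\<^sub>p(\<real>)\<close> is \<open>real^('p \<times> 'd)^('p \<times> 'd)\<close> with \<open>p = CARD('p)\<close>; \<open>pos k\<close> is the position
  (counted from \<open>0\<close>) of the block index \<open>k\<close>.\<close>

definition pos :: "'p::{finite,linorder} \<Rightarrow> nat" where
  "pos k = card {l. l < k}"

definition companion ::
    "(nat \<Rightarrow> real ^ 'd ^ 'd) \<Rightarrow> real ^ ('p::{finite,linorder} \<times> 'd) ^ ('p \<times> 'd)" where
  "companion A = (\<chi> r c. case r of (k, i) \<Rightarrow> case c of (l, j) \<Rightarrow>
     if Suc (pos k) = CARD('p) then - A (CARD('p) - pos l) $ i $ j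
     else if pos l = Suc (pos k) then mat 1 $ i $ j
     else 0)"

text \<open>\<open>beta_block p q A B k\<close> is \<open>\<beta>\<^sub>k\<close>, \<open>1 \<le> k \<le> p\<close>; with \<open>k = p - j\<close> one has
  \<open>p - j - i = k - i\<close>, and \<open>B\<^bsub>q - j\<^esub> = 0\<close> if \<open>j > q\<close>.\<close>

function beta_block ::
    "nat \<Rightarrow> nat \<Rightarrow> (nat \<Rightarrow> real ^ 'd ^ 'd) \<Rightarrow> (nat \<Rightarrow> real ^ 'd ^ 'd) \<Rightarrow> nat \<Rightarrow> real ^ 'd ^ 'd"
where
  "beta_block p q A B k =
     - (\<Sum>i\<in>{1..k - 1}. A i ** beta_block p q A B (k - i)) +
     (if p - k \<le> q then B (q - (p - k)) else 0)"
  by auto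
termination
  by (relation "Wellfounded.measure (\<lambda>(p, q, A, B, k). k)") auto

declare beta_block.simps [simp del]

definition beta_column ::
    "nat \<Rightarrow> (nat \<Rightarrow> real ^ 'd ^ 'd) \<Rightarrow> (nat \<Rightarrow> real ^ 'd ^ 'd) \<Rightarrow>
     real ^ 'd ^ ('p::{finite,linorder} \<times> 'd)" where
  "beta_column q A B = (\<chi> r j. case r of (k, i) \<Rightarrow>
     beta_block (CARD('p)) q A B (Suc (pos k)) $ i $ j)"

definition first_block_row :: "real ^ ('p::{finite,linorder} \<times> 'd) ^ 'd" where
  "first_block_row = (\<chi> i c. case c of (l, j) \<Rightarrow> if pos l = 0 then mat 1 $ i $ j else 0)"

definition matrix_exp :: "real ^ 'n ^ 'n \<Rightarrow> real ^ 'n ^ 'n" where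
  "matrix_exp X = (\<Sum>k. (((**) X ^^ k) (mat 1)) /\<^sub>R fact k)"

definition causal_kernel ::
    "'p::{finite,linorder} itself \<Rightarrow> nat \<Rightarrow> (nat \<Rightarrow> real ^ 'd ^ 'd) \<Rightarrow>
     (nat \<Rightarrow> real ^ 'd ^ 'd) \<Rightarrow> real \<Rightarrow> real ^ 'd ^ 'd" where
  "causal_kernel _ q A B u =
     (first_block_row :: real ^ ('p \<times> 'd) ^ 'd) ** matrix_exp (u *\<^sub>R companion A) **
     beta_column q A B"

end

theory Submission
  imports Defs "HOL-Computational_Algebra.Fundamental_Theorem_Algebra" "HOL-Real_Asymp.Real_Asymp"
begin

text \<open>The tails of an integral of a simple function \<open>f\<close> are controlled by \<open>\<integral> w \<parallel>f\<parallel>\<close>, where the modular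
  \<open>w\<close> dominates the Levy exponent of the centred process; regular variation of \<open>\<nu>\<close> gives
  \<open>w x \<le> C (x\<^sup>2 + x\<^bsup>\<beta>\<^esup>)\<close> for all \<open>\<beta> < \<alpha>\<close>. A gliding hump argument shows that convergence of the
  integrals over all Borel sets already pins down the Rajput--Rosinski integral, so that it coincides with
  the continuous extension from simple functions in this modular.

  The Markov parameters \<open>(I,0,\<dots>,0) A\<^sup>k \<beta>\<close> satisfy a linear recurrence, so they are annihilated by a
  polynomial in the shift whose roots can be taken among the zeros of \<open>det P\<close>; therefore the causal kernel
  \<open>K\<close> decays exponentially when these zeros lie in the left half plane, and
  \<open>P(i\<mu>) \<integral> e\<^bsup>-iu\<mu>\<^esup> K(u) du = Q(i\<mu>)\<close> because \<open>\<beta>\<close> is defined to make the initial terms match. Hence the kernels of the integrals defining \<open>Y t\<close> are the Fejer means of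
  \<open>s \<mapsto> K(t - s) 1\<^bsub>s \<le> t\<^esub>\<close>. These are uniformly bounded and converge in \<open>L\<^sup>1\<close>, hence in the modular.\<close>

subsection \<open>Regular variation and the Levy exponent\<close>

text \<open>The driving process need not have finite variance, not even for index 2, so no L^2
  isometry is available. First moments exist, and E L_1 = 0 removes the drift; what remains of the
  exponent is of order above 1 near 0. This is why transforms of indicators, of size 1/|\<xi>| and
  hence not integrable in general, have finite modular. The obstacle is that \<open>\<Phi> A\<close>
  is known only as some Levy integral: its approximating simple functions converge almost
  everywhere, with no control in the modular. Everything that enters \<open>Y t\<close> is built
  from such integrals, so \<open>has_levy_integral\<close> must first be shown to determine its
  value. From then on all work is done with \<open>good_integral\<close>, where linearity and limits
  are matters of estimates. The M-integral is defined by a uniform bound and L^\<delta> convergence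
  with \<delta> < \<alpha>. On bounded functions the powers that bound w are at most multiples of
  the power \<delta>, so this is convergence in the modular too, and \<delta> = 1 is admissible for
  the Fejer means because \<alpha> > 1.\<close>

lemma compact_UNIV_ereal_vec: "compact (UNIV :: (ereal ^ 'd) set)"
proof -
  have "compact_space (product_topology (\<lambda>_::'d. euclidean :: ereal topology) UNIV)"
    by (intro iffD2[OF compact_space_product_topology] disjI2)
      (auto simp: compact_space_def intro: compact_UNIV)
  then have *: "compact (UNIV :: ('d \<Rightarrow> ereal) set)"
    by (simp add: euclidean_product_topology compact_space_def)
  have "continuous_on UNIV (\<lambda>x :: 'd \<Rightarrow> ereal. \<chi> i. x i)"
    by (rule continuous_on_vec_lambda) (rule continuous_on_product_coordinates)
  from compact_continuous_image[OF this *] have "compact (range (\<lambda>x :: 'd \<Rightarrow> ereal. \<chi> i. x i))" .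
  moreover have "range (\<lambda>x :: 'd \<Rightarrow> ereal. \<chi> i. x i) = UNIV"
    by (metis surjI vec_nth_inverse)
  ultimately show ?thesis by simp
qed

text \<open>Piecewise linear: 0 up to modulus 1/2 and 1 from modulus 1 on, infinities included.
  Clamping to [-1, 1] comes first because \<open>real_of_ereal\<close> is continuous only where the
  values are finite.\<close>

definition cutoff :: "ereal \<Rightarrow> real" where
  "cutoff y = max 0 (2 * \<bar>real_of_ereal (max (-1) (min 1 y))\<bar> - 1)"

lemma cutoff_ereal: "cutoff (ereal a) = max 0 (2 * \<bar>max (-1) (min 1 a)\<bar> - 1)"
  by (simp add: cutoff_def max_def min_def one_ereal_def)

lemma cutoff_bounds: "0 \<le> cutoff y" "cutoff y \<le> 1"
proof -
  show "0 \<le> cutoff y" by (simp add: cutoff_def)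
  show "cutoff y \<le> 1" by (cases y; auto simp add: cutoff_def max_def min_def one_ereal_def)
qed

lemma continuous_cutoff: "continuous_on UNIV cutoff"
proof -
  have "continuous_on UNIV (real_of_ereal \<circ> (\<lambda>y. max (-1) (min 1 y)))"
  proof (subst continuous_on_iff_real[symmetric])
    show "\<bar>max (-1) (min 1 x)\<bar> \<noteq> \<infinity>" for x :: ereal
      by (cases x) (auto simp: max_def min_def one_ereal_def)
    show "continuous_on UNIV (\<lambda>y::ereal. max (-1) (min 1 y))"
      by (intro continuous_intros)
  qed
  then show ?thesis
    unfolding cutoff_def[abs_def] by (intro continuous_intros) (simp add: comp_def)
qed

lemma cutoff_eq_0: "\<bar>a\<bar> < 1/2 \<Longrightarrow> cutoff (ereal a) = 0"
  by (simp add: cutoff_ereal)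

lemma cutoff_eq_1: "1 \<le> \<bar>a\<bar> \<Longrightarrow> cutoff (ereal a) = 1"
  by (simp add: cutoff_ereal)

text \<open>A continuous stand-in for the indicator of the complement of a ball, on the extended
  space: regular variation is defined by vague convergence, which can be tested with continuous
  functions only.\<close>

definition tail_test :: "ereal ^ 'd \<Rightarrow> real" where
  "tail_test x = (\<Sum>i\<in>UNIV. cutoff (x $ i))"

lemma continuous_tail_test: "continuous_on UNIV (tail_test :: ereal ^ 'd \<Rightarrow> real)"
  unfolding tail_test_def
  by (intro continuous_on_sum continuous_on_compose2[OF continuous_cutoff] continuous_intros) auto

text \<open>The extended cube is compact, hence so are its closed subsets. Collecting the points
  with some coordinate of modulus at least 1/2 gives a closed set that stays away from 0.\<close>

lemma tail_test_support:
  "\<exists>K. compact K \<and> 0 \<notin> K \<and> (\<forall>x. x \<notin> K \<longrightarrow> tail_test (x :: ereal ^ 'd) = 0)"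
proof -
  define K :: "(ereal ^ 'd) set" where "K = (\<Union>i. {x. ereal (1/2) \<le> x $ i} \<union> {x. x $ i \<le> ereal (-1/2)})"
  have "closed K"
    unfolding K_def by (intro closed_UN closed_Un closed_Collect_le continuous_intros ballI finite)
  then have "compact K"
    using compact_UNIV_ereal_vec compact_Int_closed by fastforce
  moreover have "0 \<notin> K"
    by (auto simp: K_def zero_ereal_def)
  moreover have "tail_test x = 0" if "x \<notin> K" for x
  proof -
    have "cutoff (x $ i) = 0" for i
    proof -
      have "x $ i < ereal (1/2)" "ereal (-1/2) < x $ i"
        using that by (auto simp: K_def not_le)
      then show ?thesis
        by (cases "x $ i") (auto intro!: cutoff_eq_0)
    qed
    then show ?thesis by (simp add: tail_test_def)
  qed
  ultimately show ?thesis by blast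
qed

lemma tail_test_bounds: "0 \<le> tail_test x" "tail_test (x :: ereal ^ 'd) \<le> CARD('d)"
  unfolding tail_test_def using sum_bounded_above[of UNIV "\<lambda>i. cutoff (x $ i)" 1]
  by (auto intro: sum_nonneg cutoff_bounds)

lemma tail_test_zero:
  fixes y :: "real ^ 'd"
  assumes "norm y < 1/2"
  shows "tail_test (evec y) = 0"
proof -
  have "\<bar>y $ i\<bar> < 1/2" for i
    using component_le_norm_cart[of y i] assms by simp
  then show ?thesis
    by (auto simp: tail_test_def evec_def intro!: sum.neutral cutoff_eq_0)
qed

text \<open>If every coordinate had modulus below 1, the norm, being at most the sum of these
  moduli, could not exceed the dimension.\<close>

lemma tail_test_ge_1:
  fixes y :: "real ^ 'd"
  assumes "norm y > CARD('d)"
  shows "tail_test (evec y) \<ge> 1"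
proof -
  have "\<exists>i. \<bar>y $ i\<bar> \<ge> 1"
  proof (rule ccontr)
    assume "\<nexists>i. \<bar>y $ i\<bar> \<ge> 1"
    then have "(\<Sum>i\<in>UNIV. \<bar>y $ i\<bar>) \<le> (\<Sum>i\<in>(UNIV::'d set). 1)"
      by (intro sum_mono) (meson linear not_le)
    then show False using norm_le_l1_cart[of y] assms by simp
  qed
  then obtain i where "\<bar>y $ i\<bar> \<ge> 1" by blast
  then have "cutoff (evec y $ i) = 1" by (simp add: evec_def cutoff_eq_1)
  moreover have "cutoff (evec y $ i) \<le> tail_test (evec y)"
    unfolding tail_test_def by (rule member_le_sum) (auto intro: cutoff_bounds)
  ultimately show ?thesis by simp
qed

lemma borel_measurable_tail_test:
  "(\<lambda>y :: real ^ 'd. tail_test (evec (y /\<^sub>R u))) \<in> borel_measurable borel"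
proof -
  have "continuous_on UNIV (\<lambda>y :: real ^ 'd. evec (y /\<^sub>R u))"
    unfolding evec_def by (intro continuous_on_vec_lambda continuous_on_ereal continuous_intros)
  then show ?thesis
    by (intro borel_measurable_continuous_onI continuous_on_compose2[OF continuous_tail_test]) auto
qed

text \<open>Slow variation makes \<open>l (2\<^sup>k u)\<close> decay slower than any geometric sequence, so the tail of
  \<open>\<nu>\<close> along \<open>2\<^sup>k u\<close> decays like \<open>2\<^bsup>-k(\<alpha>-\<epsilon>)\<^esup>\<close>.\<close>

lemma regularly_varying_tail:
  fixes \<nu> :: "(real ^ 'd) measure"
  assumes \<nu>: "levy_measure \<nu>" and rv: "regularly_varying_measure \<nu> \<alpha> \<kappa>" and "\<beta> < \<alpha>"
  obtains R C where "R > 0" "C \<ge> 0"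
    "\<And>k::nat. emeasure \<nu> {y. norm y > R * 2 ^ k} \<le> ennreal (C * (2 powr (- \<beta>)) ^ k)"
proof -
  have sets[measurable_cong]: "sets \<nu> = sets borel" using \<nu> by (simp add: levy_measure_def)
  define d where "d = real CARD('d)"
  have d: "d \<ge> 1" by (auto simp: d_def Suc_le_eq)
  have "\<exists>l. slowly_varying l \<and> (\<forall>f::ereal ^ 'd \<Rightarrow> real.
           continuous_on UNIV f \<and> (\<exists>K. compact K \<and> 0 \<notin> K \<and> (\<forall>x. x \<notin> K \<longrightarrow> f x = 0)) \<longrightarrow>
           ((\<lambda>u. u powr \<alpha> * l u * (LINT x|\<nu>. f (evec (x /\<^sub>R u)))) \<longlongrightarrow> (LINT x|\<kappa>. f x)) at_top)" (is "\<exists>l. _ \<and> ?Q l")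
    using rv unfolding regularly_varying_measure_def by (elim conjE) assumption
  then obtain l where l: "slowly_varying l" and Q: "?Q l"
    by (elim exE conjE) (rule that)
  note lim = Q[rule_format, OF conjI[OF continuous_tail_test tail_test_support]]
  define I where "I u = (LINT y|\<nu>. tail_test (evec (y /\<^sub>R u)))" for u
  have "((\<lambda>u. u powr \<alpha> * l u * I u) \<longlongrightarrow> (LINT x|\<kappa>. tail_test x)) at_top"
    unfolding I_def by (fact lim)
  then have "\<forall>\<^sub>F u in at_top. u powr \<alpha> * l u * I u < (LINT x|\<kappa>. tail_test x) + 1"
    by (rule order_tendstoD) simp
  \<comment> \<open>As \<beta> < \<alpha>, the threshold lies below 1, the limit of the ratio. From
    some point on a doubling of u costs l at most this factor, so u powr \<alpha> * l u grows at
    least by 2 powr \<beta>.\<close>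
  moreover have "\<forall>\<^sub>F u in at_top. l (2 * u) / l u > 2 powr (\<beta> - \<alpha>)"
  proof (rule order_tendstoD)
    show "((\<lambda>u. l (2 * u) / l u) \<longlongrightarrow> 1) at_top"
      using l by (simp add: slowly_varying_def)
    show "2 powr (\<beta> - \<alpha>) < (1::real)" using \<open>\<beta> < \<alpha>\<close> powr_less_mono[of "\<beta> - \<alpha>" 0 2] by simp
  qed
  ultimately have "\<forall>\<^sub>F u in at_top. u powr \<alpha> * l u * I u < (LINT x|\<kappa>. tail_test x) + 1 \<and>
      l (2 * u) / l u > 2 powr (\<beta> - \<alpha>) \<and> u > 0"
    by (intro eventually_conj eventually_gt_at_top)
  then obtain u0 where u0: "\<And>u. u \<ge> u0 \<Longrightarrow> u powr \<alpha> * l u * I u < (LINT x|\<kappa>. tail_test x) + 1 \<and>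
      l (2 * u) / l u > 2 powr (\<beta> - \<alpha>) \<and> u > 0"
    unfolding eventually_at_top_linorder by blast
  define C where "C = max 0 ((LINT x|\<kappa>. tail_test x) + 1)"
  have u0_pos: "u0 > 0" using u0[of u0] by simp
  have lpos: "l u > 0" if "u > 0" for u using l that by (simp add: slowly_varying_def)
  have ge: "u0 * 2 ^ k \<ge> u0" for k :: nat using u0_pos by simp
  have lk: "l (u0 * 2 ^ k) \<ge> (2 powr (\<beta> - \<alpha>)) ^ k * l u0" for k :: nat
  proof (induction k)
    case (Suc k)
    have "l (2 * (u0 * 2 ^ k)) \<ge> 2 powr (\<beta> - \<alpha>) * l (u0 * 2 ^ k)"
      using u0[OF ge[of k]] lpos[of "u0 * 2 ^ k"] u0_pos by (simp add: field_simps)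
    with order_trans[OF mult_left_mono[OF Suc, of "2 powr (\<beta> - \<alpha>)"] this]
    show ?case by (simp add: mult_ac)
  qed simp
  have I_nonneg: "I u \<ge> 0" for u unfolding I_def by (intro integral_nonneg_AE) (auto intro: tail_test_bounds)
  define c where "c = u0 powr \<alpha> * l u0"
  have c: "c > 0" using u0_pos lpos by (simp add: c_def)
  have Ik: "I (u0 * 2 ^ k) \<le> C / c * (2 powr (- \<beta>)) ^ k" for k :: nat
  proof -
    have "(2 powr \<beta>) ^ k * c * I (u0 * 2 ^ k) = (u0 * 2 ^ k) powr \<alpha> * ((2 powr (\<beta> - \<alpha>)) ^ k * l u0) * I (u0 * 2 ^ k)"
    proof -
      have e: "(2 powr a) ^ k = 2 powr (a * real k)" for a :: real
        by (simp add: powr_powr[symmetric] powr_realpow)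
      have "(u0 * 2 ^ k) powr \<alpha> = u0 powr \<alpha> * 2 powr (\<alpha> * k)"
        using u0_pos by (simp add: powr_mult powr_powr mult.commute[of \<alpha>] powr_realpow[symmetric])
      moreover have "2 powr (\<alpha> * k) * (2 powr (\<beta> - \<alpha>)) ^ k = (2 powr \<beta>) ^ k"
        unfolding e powr_add[symmetric] by (simp add: algebra_simps)
      ultimately show ?thesis by (simp add: c_def mult_ac)
    qed
    also have "\<dots> \<le> (u0 * 2 ^ k) powr \<alpha> * l (u0 * 2 ^ k) * I (u0 * 2 ^ k)"
      by (intro mult_right_mono mult_left_mono lk I_nonneg) simp
    also have "\<dots> \<le> C" using u0[OF ge[of k]] unfolding C_def by (intro max.coboundedI2) linarith
    finally have "x * c * I (u0 * 2 ^ k) \<le> C" if "x = (2 powr \<beta>) ^ k" for x using that by simp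
    moreover define x where "x = (2 powr \<beta>) ^ k"
    ultimately have "x * c * I (u0 * 2 ^ k) \<le> C" "x > 0" by simp_all
    then have "I (u0 * 2 ^ k) \<le> C / c * (1 / x)" using c by (simp add: field_simps)
    also have "1 / x = (2 powr (- \<beta>)) ^ k"
      unfolding x_def powr_minus power_inverse by (rule inverse_eq_divide[symmetric])
    finally show ?thesis .
  qed
  have tail: "emeasure \<nu> {y. norm y > d * u} \<le> ennreal (I u)" if "u > 0" for u
  proof -
    have "emeasure \<nu> {y. norm y > d * u} = (\<integral>\<^sup>+y. indicator {y. norm y > d * u} y \<partial>\<nu>)"
      by (rule nn_integral_indicator[symmetric]) measurable
    also have "\<dots> \<le> (\<integral>\<^sup>+y. ennreal (tail_test (evec (y /\<^sub>R u))) \<partial>\<nu>)"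
    proof (rule nn_integral_mono)
      fix y :: "real ^ 'd"
      have "tail_test (evec (y /\<^sub>R u)) \<ge> 1" if "norm y > d * u"
        using that \<open>u > 0\<close> by (intro tail_test_ge_1) (simp add: d_def field_simps)
      then show "indicator {y. norm y > d * u} y \<le> ennreal (tail_test (evec (y /\<^sub>R u)))"
        by (auto simp: indicator_def)
    qed
    also have "\<dots> = ennreal (I u)"
      unfolding I_def
    proof (rule nn_integral_eq_integral)
      show "integrable \<nu> (\<lambda>y. tail_test (evec (y /\<^sub>R u)))"
      proof (rule integrableI_bounded)
        show "(\<lambda>y. tail_test (evec (y /\<^sub>R u))) \<in> borel_measurable \<nu>"
          using borel_measurable_tail_test by measurable
        \<comment> \<open>The test function is at most d and vanishes below norm u / 2. Above it, 4
          / u^2 times the squared norm is at least 1, so the integrability condition on a Levy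
          measure takes over.\<close>
        define b where "b = d * max 1 (4 / u\<^sup>2)"
        have "(\<integral>\<^sup>+ y. ennreal (norm (tail_test (evec (y /\<^sub>R u)))) \<partial>\<nu>) \<le>
          (\<integral>\<^sup>+ y. ennreal b * ennreal (min 1 ((norm y)\<^sup>2)) \<partial>\<nu>)"
        proof (rule nn_integral_mono)
          fix y :: "real ^ 'd"
          have "tail_test (evec (y /\<^sub>R u)) \<le> b * min 1 ((norm y)\<^sup>2)"
          proof (cases "norm y < u / 2")
            case True
            then have "tail_test (evec (y /\<^sub>R u)) = 0"
              using \<open>u > 0\<close> by (intro tail_test_zero) (simp add: field_simps)
            then show ?thesis using d by (simp add: b_def)
          next
            case False
            then have "(u/2)\<^sup>2 \<le> (norm y)\<^sup>2" using \<open>u > 0\<close> by (intro power_mono) auto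
            then have "1 \<le> 4 / u\<^sup>2 * (norm y)\<^sup>2" using \<open>u > 0\<close> by (simp add: field_simps power2_eq_square)
            also have "\<dots> \<le> max 1 (4 / u\<^sup>2) * (norm y)\<^sup>2"
              by (intro mult_right_mono) auto
            finally have le: "1 \<le> max 1 (4 / u\<^sup>2) * (norm y)\<^sup>2" .
            define m where "m = max 1 (4 / u\<^sup>2)"
            have m: "1 \<le> m" "1 \<le> m * (norm y)\<^sup>2" using le by (simp_all add: m_def)
            have "1 \<le> m * min 1 ((norm y)\<^sup>2)"
              using m by (cases "1 \<le> (norm y)\<^sup>2") (simp_all add: min_def)
            then have "d * 1 \<le> d * (m * min 1 ((norm y)\<^sup>2))"
              using d by (intro mult_left_mono) auto
            moreover have "b = d * m" by (simp add: b_def m_def)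
            moreover have "tail_test (evec (y /\<^sub>R u)) \<le> d"
              using tail_test_bounds(2)[of "evec (y /\<^sub>R u)"] by (simp add: d_def)
            ultimately show ?thesis by (metis mult.assoc mult.right_neutral order_trans)
          qed
          moreover have "b \<ge> 0" using d by (simp add: b_def)
          ultimately show "ennreal (norm (tail_test (evec (y /\<^sub>R u)))) \<le> ennreal b * ennreal (min 1 ((norm y)\<^sup>2))"
            using tail_test_bounds(1)[of "evec (y /\<^sub>R u)"] by (simp add: ennreal_mult'[symmetric] ennreal_leI)
        qed
        also have "\<dots> = ennreal b * (\<integral>\<^sup>+ y. ennreal (min 1 ((norm y)\<^sup>2)) \<partial>\<nu>)"
          by (rule nn_integral_cmult) measurable
        also have "\<dots> < \<infinity>" using \<nu> by (simp add: levy_measure_def ennreal_mult_less_top)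
        finally show "(\<integral>\<^sup>+ y. ennreal (norm (tail_test (evec (y /\<^sub>R u)))) \<partial>\<nu>) < \<infinity>" .
      qed
    qed (auto intro: tail_test_bounds)
    finally show ?thesis .
  qed
  show thesis
  proof (rule that)
    show "0 < d * u0" using d u0_pos by simp
    show "0 \<le> C / c" using c by (simp add: C_def)
    fix k :: nat
    have "emeasure \<nu> {y. norm y > d * u0 * 2 ^ k} \<le> ennreal (I (u0 * 2 ^ k))"
      using tail[of "u0 * 2 ^ k"] u0_pos by (simp add: mult_ac)
    also have "\<dots> \<le> ennreal (C / c * (2 powr (- \<beta>)) ^ k)" by (intro ennreal_leI Ik)
    finally show "emeasure \<nu> {y. norm y > d * u0 * 2 ^ k} \<le> ennreal (C / c * (2 powr (- \<beta>)) ^ k)" .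
  qed
qed

text \<open>Large jumps are split into layers between R * 2^k and R * 2^(k+1). Layer k contributes
  at most a multiple of (2 powr \<beta>)^k times a tail of size (2 powr (- \<beta>'))^k, a geometric
  series once \<beta> < \<beta>' < \<alpha>. Small jumps are covered by the square in the definition
  of a Levy measure.\<close>

lemma regularly_varying_moment:
  fixes \<nu> :: "(real ^ 'd) measure"
  assumes \<nu>: "levy_measure \<nu>" and rv: "regularly_varying_measure \<nu> \<alpha> \<kappa>" and "1 < \<beta>" "\<beta> < \<alpha>"
  shows "integrable \<nu> (\<lambda>y. min ((norm y)\<^sup>2) (norm y powr \<beta>))"
proof (rule integrableI_bounded)
  have sets[measurable_cong]: "sets \<nu> = sets borel" using \<nu> by (simp add: levy_measure_def)
  show "(\<lambda>y. min ((norm y)\<^sup>2) (norm y powr \<beta>)) \<in> borel_measurable \<nu>" by measurable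
  obtain \<beta>' where \<beta>': "\<beta> < \<beta>'" "\<beta>' < \<alpha>" using dense[OF \<open>\<beta> < \<alpha>\<close>] by blast
  obtain R C where R: "R > 0" and C: "C \<ge> 0" and
    tail: "\<And>k::nat. emeasure \<nu> {y. norm y > R * 2 ^ k} \<le> ennreal (C * (2 powr (- \<beta>')) ^ k)"
    using regularly_varying_tail[OF \<nu> rv \<beta>'(2)] by metis
  \<comment> \<open>Covers the norms up to R: the square serves below 1, and from 1 to R the power
    is at most R powr \<beta>.\<close>
  define D where "D = max 1 (R powr \<beta>)"
  define a where "a k = (R * 2 ^ Suc k) powr \<beta>" for k :: nat
  have pw: "ennreal (norm (min ((norm y)\<^sup>2) (norm y powr \<beta>))) \<le>
     ennreal D * ennreal (min 1 ((norm y)\<^sup>2)) + (\<Sum>k. ennreal (a k) * indicator {y. norm y > R * 2 ^ k} y)"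
    (is "_ \<le> ?A + ?B") for y :: "real ^ 'd"
  proof (cases "norm y > R")
    case False
    have "min ((norm y)\<^sup>2) (norm y powr \<beta>) \<le> D * min 1 ((norm y)\<^sup>2)"
    proof (cases "norm y \<le> 1")
      case True
      then have "(norm y)\<^sup>2 \<le> 1" by (simp add: power_le_one)
      moreover have "1 * (norm y)\<^sup>2 \<le> D * (norm y)\<^sup>2" by (intro mult_right_mono) (auto simp: D_def)
      ultimately show ?thesis by auto
    next
      case F: False
      have "norm y powr \<beta> \<le> R powr \<beta>"
        using False F \<open>1 < \<beta>\<close> by (intro powr_mono2) auto
      moreover have "1 \<le> (norm y)\<^sup>2" using F by (simp add: one_le_power)
      ultimately show ?thesis by (auto simp: D_def)
    qed
    then have "ennreal (norm (min ((norm y)\<^sup>2) (norm y powr \<beta>))) \<le> ?A"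
      by (simp add: D_def ennreal_mult[symmetric] ennreal_leI)
    also have "\<dots> \<le> ?A + ?B" by simp
    finally show ?thesis .
  next
    case True
    \<comment> \<open>The layer that contains y. Minimality of k gives the lower bound, except for k
      = 0, where the case assumption does.\<close>
    define k where "k = (LEAST k. norm y \<le> R * 2 ^ Suc k)"
    have "\<exists>k. norm y / R < 2 ^ k" by (rule real_arch_pow) simp
    then obtain k0 where "norm y / R < 2 ^ k0" by blast
    then have "norm y < R * 2 ^ k0" using R by (simp add: field_simps)
    also have "\<dots> \<le> R * 2 ^ Suc k0" using R by simp
    finally have "norm y \<le> R * 2 ^ Suc k0" by simp
    then have le: "norm y \<le> R * 2 ^ Suc k" unfolding k_def by (rule LeastI)
    have gt: "norm y > R * 2 ^ k"
    proof (cases k)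
      case (Suc j)
      then have "\<not> norm y \<le> R * 2 ^ Suc j" using not_less_Least[of j "\<lambda>k. norm y \<le> R * 2 ^ Suc k"] unfolding k_def by simp
      then show ?thesis using Suc by simp
    qed (use True in simp)
    have "norm y powr \<beta> \<le> a k" unfolding a_def using le \<open>1 < \<beta>\<close> by (intro powr_mono2) auto
    then have "ennreal (norm (min ((norm y)\<^sup>2) (norm y powr \<beta>))) \<le> ennreal (a k)"
      by (intro ennreal_leI) auto
    also have "\<dots> = (\<Sum>k\<in>{k}. ennreal (a k) * indicator {y. norm y > R * 2 ^ k} y)"
      using gt by simp
    also have "\<dots> \<le> ?B" by (rule sum_le_suminf) auto
    also have "\<dots> \<le> ?A + ?B" by simp
    finally show ?thesis .
  qed
  have "(\<integral>\<^sup>+ y. ennreal (norm (min ((norm y)\<^sup>2) (norm y powr \<beta>))) \<partial>\<nu>) \<le>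
     (\<integral>\<^sup>+ y. ennreal D * ennreal (min 1 ((norm y)\<^sup>2)) + (\<Sum>k. ennreal (a k) * indicator {y. norm y > R * 2 ^ k} y) \<partial>\<nu>)"
    by (rule nn_integral_mono) (rule pw)
  also have "\<dots> = ennreal D * (\<integral>\<^sup>+ y. ennreal (min 1 ((norm y)\<^sup>2)) \<partial>\<nu>) +
      (\<Sum>k. ennreal (a k) * emeasure \<nu> {y. norm y > R * 2 ^ k})"
    by (simp add: nn_integral_add nn_integral_cmult nn_integral_suminf nn_integral_cmult_indicator)
  also have "\<dots> < \<infinity>"
  proof -
    define b where "b = C * (2 * R) powr \<beta>"
    define q where "q = (2::real) powr (\<beta> - \<beta>')"
    have q: "0 < q" "q < 1" using \<beta>' powr_less_mono[of "\<beta> - \<beta>'" 0 2] by (simp_all add: q_def)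
    have "(\<Sum>k. ennreal (a k) * emeasure \<nu> {y. norm y > R * 2 ^ k}) \<le> (\<Sum>k. ennreal (b * q ^ k))"
    proof (rule suminf_le)
      fix k
      have ak: "a k = (2 * R) powr \<beta> * (2 powr \<beta>) ^ k"
      proof -
        have "a k = ((2 * R) * 2 powr (real k)) powr \<beta>"
          by (simp add: a_def powr_realpow mult_ac)
        also have "\<dots> = (2 * R) powr \<beta> * (2 powr \<beta>) powr (real k)"
          using R by (simp add: powr_mult powr_powr mult.commute)
        finally show ?thesis by (simp add: powr_realpow)
      qed
      have "ennreal (a k) * emeasure \<nu> {y. norm y > R * 2 ^ k} \<le>
         ennreal (a k) * ennreal (C * (2 powr (- \<beta>')) ^ k)"
        by (intro mult_left_mono tail) auto
      also have "\<dots> = ennreal (a k * (C * (2 powr (- \<beta>')) ^ k))"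
        by (rule ennreal_mult'[symmetric]) (simp add: a_def)
      also have "q ^ k = (2 powr \<beta>) ^ k * (2 powr (- \<beta>')) ^ k"
        by (simp add: q_def power_mult_distrib[symmetric] powr_add[symmetric])
      then have "a k * (C * (2 powr (- \<beta>')) ^ k) = b * q ^ k"
        unfolding ak b_def by (simp only: mult_ac)
      finally show "ennreal (a k) * emeasure \<nu> {y. norm y > R * 2 ^ k} \<le> ennreal (b * q ^ k)" .
    qed auto
    also have "\<dots> = ennreal (\<Sum>k. b * q ^ k)"
      using q C by (intro suminf_ennreal2) (auto simp: b_def intro!: summable_mult summable_geometric)
    also have "\<dots> < \<infinity>" by simp
    finally show ?thesis
      using \<nu> by (simp add: levy_measure_def ennreal_mult_less_top)
  qed
  finally show "(\<integral>\<^sup>+ y. ennreal (norm (min ((norm y)\<^sup>2) (norm y powr \<beta>))) \<partial>\<nu>) < \<infinity>" .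
qed

section \<open>The modular that dominates the Levy exponent\<close>

lemma iexp_minus_linear_bound: "cmod (exp (\<i> * of_real a) - 1 - \<i> * of_real a) \<le> 2 * min (a\<^sup>2) \<bar>a\<bar>"
proof -
  have "cmod (exp (\<i> * of_real a) - 1 - \<i> * of_real a) \<le> a\<^sup>2 / 2"
    using iexp_approx1[of a 1] by (simp add: algebra_simps power2_eq_square)
  moreover have "a\<^sup>2 / 2 \<le> 2 * a\<^sup>2" by simp
  moreover have "cmod (exp (\<i> * of_real a) - 1 - \<i> * of_real a) \<le> 2 * \<bar>a\<bar>"
    using iexp_approx2[of a 1] by (simp add: algebra_simps)
  ultimately show ?thesis by linarith
qed

text \<open>A variant, for a centred process, of the modular by which Rajput and Rosinski describe
  integrability: jumps count quadratically while x * norm y is small and linearly when it is large.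
  The factor 2 is the one of \<open>iexp_minus_linear_bound\<close>.\<close>

definition levy_modular :: "real ^ 'd ^ 'd \<Rightarrow> (real ^ 'd) measure \<Rightarrow> real \<Rightarrow> real" where
  "levy_modular \<Sigma> \<nu> x = onorm ((*v) \<Sigma>) * x\<^sup>2 + 2 * (LINT y|\<nu>. min ((x * norm y)\<^sup>2) (\<bar>x\<bar> * norm y))"

lemma min_square_abs_le_powr:
  fixes a \<beta> :: real
  assumes "0 \<le> a" "1 \<le> \<beta>" "\<beta> \<le> 2"
  shows "min (a\<^sup>2) a \<le> a powr \<beta>"
proof (cases "a \<le> 1")
  case True
  then have "a powr 2 \<le> a powr \<beta>"
    using assms True by (intro powr_mono') auto
  then show ?thesis using assms(1) by (auto simp: powr_numeral)
next
  case False
  then have "a powr 1 \<le> a powr \<beta>" using assms by (intro powr_mono) auto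
  then show ?thesis using assms(1) False by auto
qed

locale reg_var_levy =
  fixes \<Sigma> :: "real ^ 'd ^ 'd" and \<nu> :: "(real ^ 'd) measure" and \<alpha> :: real and \<kappa> :: "(ereal ^ 'd) measure"
  assumes \<nu>: "levy_measure \<nu>" and rv: "regularly_varying_measure \<nu> \<alpha> \<kappa>" and \<alpha>: "1 < \<alpha>" "\<alpha> \<le> 2"
begin

abbreviation "w \<equiv> levy_modular \<Sigma> \<nu>"

lemma sets_\<nu>[measurable_cong]: "sets \<nu> = sets borel" using \<nu> by (simp add: levy_measure_def)

text \<open>The minimum of the square and the first power lies below every power between 1 and 2.
  For norm y above 1 the power \<beta> is used, otherwise the square, so that in both cases the
  integrable factor in y splits off.\<close>

lemma kernel_le:
  assumes "0 \<le> x" "1 < \<beta>" "\<beta> < \<alpha>"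
  shows "min ((x * norm y)\<^sup>2) (x * norm y) \<le> (x\<^sup>2 + x powr \<beta>) * min ((norm y)\<^sup>2) (norm y powr \<beta>)"
proof (cases "norm y \<le> 1")
  case True
  then have "norm y powr 2 \<le> norm y powr \<beta>"
    using assms \<alpha> True by (intro powr_mono') auto
  then have "min ((norm y)\<^sup>2) (norm y powr \<beta>) = (norm y)\<^sup>2" by (simp add: powr_numeral)
  then show ?thesis by (simp add: power_mult_distrib distrib_right min.coboundedI1)
next
  case False
  then have "norm y powr \<beta> \<le> norm y powr 2"
    using assms \<alpha> by (intro powr_mono) auto
  then have "min ((norm y)\<^sup>2) (norm y powr \<beta>) = norm y powr \<beta>" using False by (subst (asm) powr_numeral) auto
  moreover have "min ((x * norm y)\<^sup>2) (x * norm y) \<le> (x * norm y) powr \<beta>"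
    using assms \<alpha> by (intro min_square_abs_le_powr) auto
  ultimately show ?thesis using assms by (simp add: powr_mult distrib_right add_increasing)
qed

lemma integrable_kernel: "integrable \<nu> (\<lambda>y. min ((x * norm y)\<^sup>2) (\<bar>x\<bar> * norm y))"
proof -
  obtain \<beta> where \<beta>: "1 < \<beta>" "\<beta> < \<alpha>" using dense[OF \<alpha>(1)] by blast
  show ?thesis
  proof (rule Bochner_Integration.integrable_bound)
    show "integrable \<nu> (\<lambda>y. (\<bar>x\<bar>\<^sup>2 + \<bar>x\<bar> powr \<beta>) * min ((norm y)\<^sup>2) (norm y powr \<beta>))"
      by (intro integrable_mult_right regularly_varying_moment[OF \<nu> rv] \<beta>)
    show "AE y in \<nu>. norm (min ((x * norm y)\<^sup>2) (\<bar>x\<bar> * norm y)) \<le>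
       norm ((\<bar>x\<bar>\<^sup>2 + \<bar>x\<bar> powr \<beta>) * min ((norm y)\<^sup>2) (norm y powr \<beta>))"
      using kernel_le[OF _ \<beta>, of "\<bar>x\<bar>"] by (intro AE_I2) (auto simp: power_mult_distrib abs_mult)
  qed measurable
qed

lemma onorm_\<Sigma>: "0 \<le> onorm ((*v) \<Sigma>)"
  by (intro onorm_pos_le matrix_vector_mul_bounded_linear)

lemma modular_nonneg: "0 \<le> w x"
  unfolding levy_modular_def using onorm_\<Sigma> by (auto intro!: add_nonneg_nonneg mult_nonneg_nonneg integral_nonneg_AE)

lemma modular_zero [simp]: "w 0 = 0"
  by (simp add: levy_modular_def)

lemma modular_mono:
  assumes "0 \<le> x" "x \<le> y"
  shows "w x \<le> w y"
  unfolding levy_modular_def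
proof (intro add_mono mult_left_mono onorm_\<Sigma> integral_mono integrable_kernel)
  show "x\<^sup>2 \<le> y\<^sup>2" using assms by (simp add: power_mono)
  fix z :: "real ^ 'd"
  show "min ((x * norm z)\<^sup>2) (\<bar>x\<bar> * norm z) \<le> min ((y * norm z)\<^sup>2) (\<bar>y\<bar> * norm z)"
    using assms by (intro min.mono power_mono mult_right_mono) auto
qed auto

text \<open>The factor is b^2 with b at least 1, not c^2, because the linear branch of the minimum
  scales like c only, which for c < 1 exceeds c^2.\<close>

lemma modular_scale:
  assumes "0 \<le> c" "c \<le> b" "1 \<le> b"
  shows "w (c * x) \<le> b\<^sup>2 * w x"
proof -
  have "min ((c * x * norm z)\<^sup>2) (\<bar>c * x\<bar> * norm z) \<le> b\<^sup>2 * min ((x * norm z)\<^sup>2) (\<bar>x\<bar> * norm z)" for z :: "real ^ 'd"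
  proof -
    have "c\<^sup>2 * (x * norm z)\<^sup>2 \<le> b\<^sup>2 * (x * norm z)\<^sup>2"
      using assms by (intro mult_right_mono power_mono) auto
    then have "(c * x * norm z)\<^sup>2 \<le> b\<^sup>2 * (x * norm z)\<^sup>2"
      by (simp only: power_mult_distrib mult.assoc)
    moreover have "b * 1 \<le> b * b" using assms by (intro mult_left_mono) auto
    then have "c \<le> b\<^sup>2" unfolding power2_eq_square using assms(2) by linarith
    then have "c * (\<bar>x\<bar> * norm z) \<le> b\<^sup>2 * (\<bar>x\<bar> * norm z)"
      by (intro mult_right_mono) auto
    then have "\<bar>c * x\<bar> * norm z \<le> b\<^sup>2 * (\<bar>x\<bar> * norm z)"
      using assms by (simp add: abs_mult mult.assoc)
    ultimately show ?thesis by (auto simp: min_def)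
  qed
  then have "(LINT z|\<nu>. min ((c * x * norm z)\<^sup>2) (\<bar>c * x\<bar> * norm z)) \<le>
      (LINT z|\<nu>. b\<^sup>2 * min ((x * norm z)\<^sup>2) (\<bar>x\<bar> * norm z))"
    by (intro integral_mono integrable_kernel integrable_mult_right) auto
  then have 1: "(LINT z|\<nu>. min ((c * x * norm z)\<^sup>2) (\<bar>c * x\<bar> * norm z)) \<le>
      b\<^sup>2 * (LINT z|\<nu>. min ((x * norm z)\<^sup>2) (\<bar>x\<bar> * norm z))"
    using integrable_kernel by simp
  have "c\<^sup>2 * x\<^sup>2 \<le> b\<^sup>2 * x\<^sup>2" using assms by (intro mult_right_mono power_mono) auto
  then have "onorm ((*v) \<Sigma>) * (c * x)\<^sup>2 \<le> b\<^sup>2 * (onorm ((*v) \<Sigma>) * x\<^sup>2)"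
    using mult_left_mono[OF _ onorm_\<Sigma>] by (simp add: power_mult_distrib mult.left_commute)
  then have "onorm ((*v) \<Sigma>) * (c * x)\<^sup>2 + 2 * (LINT z|\<nu>. min ((c * x * norm z)\<^sup>2) (\<bar>c * x\<bar> * norm z)) \<le>
    b\<^sup>2 * (onorm ((*v) \<Sigma>) * x\<^sup>2) + 2 * (b\<^sup>2 * (LINT z|\<nu>. min ((x * norm z)\<^sup>2) (\<bar>x\<bar> * norm z)))"
    by (intro add_mono mult_left_mono 1) auto
  then show ?thesis unfolding levy_modular_def by (simp only: distrib_left mult.left_commute)
qed

lemma modular_le_powr:
  assumes "1 < \<beta>" "\<beta> < \<alpha>"
  obtains C where "0 \<le> C" "\<And>x. 0 \<le> x \<Longrightarrow> w x \<le> C * (x\<^sup>2 + x powr \<beta>)"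
proof -
  define m where "m = (LINT y|\<nu>. min ((norm y)\<^sup>2) (norm y powr \<beta>))"
  have m: "m \<ge> 0" unfolding m_def by (intro integral_nonneg_AE) auto
  show thesis
  proof
    show "0 \<le> onorm ((*v) \<Sigma>) + 2 * m" using onorm_\<Sigma> m by simp
    fix x :: real assume x: "0 \<le> x"
    have "(LINT y|\<nu>. min ((x * norm y)\<^sup>2) (\<bar>x\<bar> * norm y)) \<le> (LINT y|\<nu>. (x\<^sup>2 + x powr \<beta>) * min ((norm y)\<^sup>2) (norm y powr \<beta>))"
      using kernel_le[OF x assms] x
      by (intro integral_mono integrable_kernel integrable_mult_right regularly_varying_moment[OF \<nu> rv] assms) auto
    also have "\<dots> = (x\<^sup>2 + x powr \<beta>) * m" unfolding m_def by simp
    finally have "w x \<le> onorm ((*v) \<Sigma>) * x\<^sup>2 + 2 * ((x\<^sup>2 + x powr \<beta>) * m)"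
      by (simp add: levy_modular_def)
    also have "\<dots> \<le> (onorm ((*v) \<Sigma>) + 2 * m) * (x\<^sup>2 + x powr \<beta>)"
      using onorm_\<Sigma> by (simp add: algebra_simps)
    finally show "w x \<le> (onorm ((*v) \<Sigma>) + 2 * m) * (x\<^sup>2 + x powr \<beta>)" .
  qed
qed

text \<open>The Levy exponent with every jump compensated, not only those of norm at most 1; the
  integral converges because large jumps have a first moment.\<close>

definition centred :: "real ^ 'd \<Rightarrow> complex" where
  "centred u = - of_real (u \<bullet> (\<Sigma> *v u)) / 2 + (LINT x|\<nu>. exp (\<i> * of_real (u \<bullet> x)) - 1 - \<i> * of_real (u \<bullet> x))"

lemma centred_integrand_bound:
  "cmod (exp (\<i> * of_real (u \<bullet> x)) - 1 - \<i> * of_real (u \<bullet> x)) \<le> 2 * min ((norm u * norm x)\<^sup>2) (\<bar>norm u\<bar> * norm x)"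
proof -
  have c: "\<bar>u \<bullet> x\<bar> \<le> norm u * norm x" by (rule Cauchy_Schwarz_ineq2)
  then have "\<bar>u \<bullet> x\<bar>\<^sup>2 \<le> (norm u * norm x)\<^sup>2" by (rule power_mono) simp
  then have "min ((u \<bullet> x)\<^sup>2) \<bar>u \<bullet> x\<bar> \<le> min ((norm u * norm x)\<^sup>2) (\<bar>norm u\<bar> * norm x)"
    using c unfolding power2_abs abs_norm_cancel by (rule min.mono)
  then have "2 * min ((u \<bullet> x)\<^sup>2) \<bar>u \<bullet> x\<bar> \<le> 2 * min ((norm u * norm x)\<^sup>2) (\<bar>norm u\<bar> * norm x)"
    by (rule mult_left_mono) simp
  with iexp_minus_linear_bound[of "u \<bullet> x"] show ?thesis by (rule order_trans)
qed

lemma integrable_centred: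
  "integrable \<nu> (\<lambda>x. exp (\<i> * of_real (u \<bullet> x)) - 1 - \<i> * of_real (u \<bullet> x))"
proof (rule Bochner_Integration.integrable_bound)
  show "integrable \<nu> (\<lambda>x. 2 * min ((norm u * norm x)\<^sup>2) (\<bar>norm u\<bar> * norm x))"
    by (intro integrable_mult_right integrable_kernel)
  show "AE x in \<nu>. norm (exp (\<i> * of_real (u \<bullet> x)) - 1 - \<i> * of_real (u \<bullet> x)) \<le>
    norm (2 * min ((norm u * norm x)\<^sup>2) (\<bar>norm u\<bar> * norm x))"
    using centred_integrand_bound[of u] by (intro AE_I2) (simp add: abs_mult)
qed measurable

lemma centred_bound: "cmod (centred u) \<le> w (norm u)"
proof -
  have "cmod (LINT x|\<nu>. exp (\<i> * of_real (u \<bullet> x)) - 1 - \<i> * of_real (u \<bullet> x)) \<le>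
      (LINT x|\<nu>. 2 * min ((norm u * norm x)\<^sup>2) (\<bar>norm u\<bar> * norm x))"
    by (rule Bochner_Integration.integral_norm_bound_integral[OF integrable_centred _ centred_integrand_bound])
       (intro integrable_mult_right integrable_kernel)
  also have "\<dots> = 2 * (LINT x|\<nu>. min ((norm u * norm x)\<^sup>2) (\<bar>norm u\<bar> * norm x))" by simp
  finally have 1: "cmod (LINT x|\<nu>. exp (\<i> * of_real (u \<bullet> x)) - 1 - \<i> * of_real (u \<bullet> x)) \<le> \<dots>" .
  have "\<bar>u \<bullet> (\<Sigma> *v u)\<bar> \<le> norm u * norm (\<Sigma> *v u)" by (rule Cauchy_Schwarz_ineq2)
  also have "\<dots> \<le> norm u * (onorm ((*v) \<Sigma>) * norm u)"
    by (intro mult_left_mono onorm matrix_vector_mul_bounded_linear) auto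
  finally have "\<bar>u \<bullet> (\<Sigma> *v u)\<bar> / 2 \<le> onorm ((*v) \<Sigma>) * (norm u)\<^sup>2"
    using onorm_\<Sigma> by (simp add: power2_eq_square mult_ac)
  moreover have "cmod (- of_real (u \<bullet> (\<Sigma> *v u)) / 2) = \<bar>u \<bullet> (\<Sigma> *v u)\<bar> / 2" by (simp add: norm_divide)
  ultimately show ?thesis
    unfolding centred_def levy_modular_def by (intro norm_triangle_mono 1) simp
qed

lemma integrable_large_jumps: "integrable \<nu> (\<lambda>x. indicator {1<..} (norm x) *\<^sub>R x)"
proof (rule Bochner_Integration.integrable_bound[OF integrable_kernel[of 1]])
  show "AE x in \<nu>. norm (indicator {1<..} (norm x) *\<^sub>R x) \<le> norm (min ((1 * norm x)\<^sup>2) (\<bar>1\<bar> * norm x))"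
  proof (rule AE_I2)
    fix x :: "real ^ 'd"
    have "norm x \<le> (norm x)\<^sup>2" if "1 < norm x" using that mult_left_mono[of 1 "norm x" "norm x"] by (simp add: power2_eq_square)
    then show "norm (indicator {1<..} (norm x) *\<^sub>R x) \<le> norm (min ((1 * norm x)\<^sup>2) (\<bar>1\<bar> * norm x))"
      by (auto simp: indicator_def)
  qed
qed measurable

text \<open>The mean of the law with triplet (\<gamma>, \<Sigma>, \<nu>): compensating the large
  jumps as well shifts \<gamma> by their mean.\<close>

definition drift :: "real ^ 'd \<Rightarrow> real ^ 'd" where
  "drift \<gamma> = \<gamma> + (LINT x|\<nu>. indicator {1<..} (norm x) *\<^sub>R x)"

lemma levy_exponent_eq_centred:
  "levy_exponent \<gamma> \<Sigma> \<nu> u = \<i> * of_real (drift \<gamma> \<bullet> u) + centred u"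
proof -
  let ?J = "\<lambda>x. indicator {1<..} (norm x) *\<^sub>R x"
  have "(LINT x|\<nu>. exp (\<i> * of_real (u \<bullet> x)) - 1 - \<i> * of_real (u \<bullet> x) * of_real (indicator {0..1} (norm x))) =
        (LINT x|\<nu>. (exp (\<i> * of_real (u \<bullet> x)) - 1 - \<i> * of_real (u \<bullet> x)) + \<i> * of_real (?J x \<bullet> u))"
  proof (rule Bochner_Integration.integral_cong[OF refl])
    fix x :: "real ^ 'd"
    show "exp (\<i> * of_real (u \<bullet> x)) - 1 - \<i> * of_real (u \<bullet> x) * of_real (indicator {0..1} (norm x)) =
       exp (\<i> * of_real (u \<bullet> x)) - 1 - \<i> * of_real (u \<bullet> x) + \<i> * of_real (?J x \<bullet> u)"
      by (cases "norm x \<le> 1") (simp_all add: inner_commute[of x u])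
  qed
  also have "\<dots> = (LINT x|\<nu>. exp (\<i> * of_real (u \<bullet> x)) - 1 - \<i> * of_real (u \<bullet> x)) + (LINT x|\<nu>. \<i> * of_real (?J x \<bullet> u))"
    by (intro Bochner_Integration.integral_add integrable_centred integrable_mult_right integrable_of_real integrable_inner_left integrable_large_jumps)
  also have "(LINT x|\<nu>. \<i> * of_real (?J x \<bullet> u)) = \<i> * complex_of_real (LINT x|\<nu>. ?J x \<bullet> u)"
    unfolding integral_mult_right_zero integral_complex_of_real by (rule refl)
  also have "(LINT x|\<nu>. ?J x \<bullet> u) = (LINT x|\<nu>. ?J x) \<bullet> u"
    by (intro integral_inner_left integrable_large_jumps)
  finally show ?thesis
    by (simp add: levy_exponent_def centred_def drift_def inner_add_left distrib_left)
qed

text \<open>Near 0 the modular is of order x powr \<beta> with \<beta> > 1, so the centred exponent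
  has no first-order part. The expression is its difference quotient at 0 in direction u, along
  steps 1 / (n + 1).\<close>

lemma centred_little_o: "(\<lambda>n. of_real (real (Suc n)) * centred (u /\<^sub>R real (Suc n))) \<longlonglongrightarrow> 0"
proof -
  obtain \<beta> where \<beta>: "1 < \<beta>" "\<beta> < \<alpha>" using dense[OF \<alpha>(1)] by blast
  obtain C where C: "0 \<le> C" "\<And>x. 0 \<le> x \<Longrightarrow> w x \<le> C * (x\<^sup>2 + x powr \<beta>)"
    using modular_le_powr[OF \<beta>] by metis
  define r where "r = norm u"
  show ?thesis
  proof (rule Lim_null_comparison[OF always_eventually], rule allI)
    fix n
    let ?N = "real (Suc n)"
    have "norm (of_real ?N * centred (u /\<^sub>R ?N)) = ?N * cmod (centred (u /\<^sub>R ?N))"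
      unfolding norm_mult norm_of_real by simp
    also have "\<dots> \<le> ?N * w (norm (u /\<^sub>R ?N))" by (intro mult_left_mono centred_bound) auto
    also have "norm (u /\<^sub>R ?N) = r / ?N" unfolding norm_scaleR r_def by (simp add: divide_inverse)
    also have "?N * w (r / ?N) \<le> ?N * (C * ((r / ?N)\<^sup>2 + (r / ?N) powr \<beta>))"
      by (intro mult_left_mono C) (auto simp: r_def)
    finally show "norm (of_real ?N * centred (u /\<^sub>R ?N)) \<le> ?N * (C * ((r / ?N)\<^sup>2 + (r / ?N) powr \<beta>))" .
  next
    have lim: "(\<lambda>n. r\<^sup>2 * inverse (real (Suc n)) + r powr \<beta> * real (Suc n) powr (1 - \<beta>)) \<longlonglongrightarrow> r\<^sup>2 * 0 + r powr \<beta> * 0"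
      using \<beta> by (intro tendsto_intros LIMSEQ_inverse_real_of_nat
        tendsto_neg_powr filterlim_compose[OF filterlim_real_sequentially filterlim_Suc]) auto
    have eq: "real (Suc n) * (C * ((r / real (Suc n))\<^sup>2 + (r / real (Suc n)) powr \<beta>)) =
       C * (r\<^sup>2 * inverse (real (Suc n)) + r powr \<beta> * real (Suc n) powr (1 - \<beta>))" for n
    proof -
      define N where "N = real (Suc n)"
      have N: "N > 0" by (simp add: N_def)
      have "N * (r / N)\<^sup>2 = r\<^sup>2 * inverse N" using N by (simp add: power2_eq_square field_simps)
      moreover have "N * (r / N) powr \<beta> = r powr \<beta> * N powr (1 - \<beta>)"
        using N by (simp add: powr_divide r_def powr_diff)
      ultimately show ?thesis unfolding N_def[symmetric] by (metis distrib_left mult.left_commute)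
    qed
    show "(\<lambda>n. real (Suc n) * (C * ((r / real (Suc n))\<^sup>2 + (r / real (Suc n)) powr \<beta>))) \<longlonglongrightarrow> 0"
      unfolding eq using tendsto_mult[OF tendsto_const[of C] lim] by simp
  qed
qed

text \<open>Two computations of the derivative of the characteristic function at 0 in direction u.
  Dominated convergence gives i times the inner product of u with the mean, which is 0; the exponent
  gives i times its inner product with the drift, since the centred part is of smaller order. Taking
  the drift itself for u leaves its squared norm.\<close>

lemma drift_eq_0:
  fixes X :: "'w \<Rightarrow> real ^ 'd"
  assumes "prob_space M" and X: "integrable M X" and mean: "(LINT \<omega>|M. X \<omega>) = 0"
    and cf: "\<And>u. (LINT \<omega>|M. exp (\<i> * of_real (u \<bullet> X \<omega>))) = exp (levy_exponent \<gamma> \<Sigma> \<nu> u)"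
  shows "drift \<gamma> = 0"
proof -
  interpret prob_space M by fact
  note [measurable] = borel_measurable_integrable[OF X]
  define u where "u = drift \<gamma>"
  define N where "N n = real (Suc n)" for n
  define z where "z n = levy_exponent \<gamma> \<Sigma> \<nu> (u /\<^sub>R N n)" for n
  have N: "N n > 0" for n by (simp add: N_def)
  have lim1: "(\<lambda>n. of_real (N n) * z n) \<longlonglongrightarrow> \<i> * of_real (u \<bullet> u) + 0"
  proof -
    have "of_real (N n) * z n = \<i> * of_real (u \<bullet> u) + of_real (N n) * centred (u /\<^sub>R N n)" for n
      unfolding z_def levy_exponent_eq_centred u_def[symmetric] using N[of n] by (simp add: field_simps)
    then show ?thesis unfolding N_def by (simp only:) (intro tendsto_add tendsto_const centred_little_o)
  qed
  have "(\<lambda>n. inverse (of_real (N n)) * (of_real (N n) * z n)) \<longlonglongrightarrow> 0 * (\<i> * of_real (u \<bullet> u) + 0)"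
    unfolding N_def of_real_inverse[symmetric]
    by (intro tendsto_mult lim1[unfolded N_def] tendsto_of_real[where 'a=complex, OF LIMSEQ_inverse_real_of_nat, simplified of_real_0])
  moreover have "inverse (of_real (N n)) * (of_real (N n) * z n) = z n" for n
    using N[of n] by simp
  ultimately have z0: "z \<longlonglongrightarrow> 0" by simp
  \<comment> \<open>The continuous extension of (exp x - 1) / x to 0, used in place of a quotient
    because \<open>z n\<close> may vanish.\<close>
  define Q where "Q x = (if x = 0 then 1 else (exp x - 1) / x)" for x :: complex
  have Q0: "Q 0 = 1" by (simp add: Q_def)
  have "Q \<midarrow>0\<rightarrow> 1"
    using lim_exp_minus_1[where 'a=complex] by (rule Lim_transform_eventually) (auto simp: Q_def eventually_at_filter)
  then have "isCont Q 0" by (simp add: isCont_def Q_def)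
  then have "(\<lambda>n. Q (z n)) \<longlonglongrightarrow> Q 0" using z0 by (rule isCont_tendsto_compose)
  then have "(\<lambda>n. Q (z n) * (of_real (N n) * z n)) \<longlonglongrightarrow> Q 0 * (\<i> * of_real (u \<bullet> u) + 0)"
    by (rule tendsto_mult[OF _ lim1])
  moreover have "Q (z n) * (of_real (N n) * z n) = of_real (N n) * (exp (z n) - 1)" for n
    by (simp add: Q_def)
  ultimately have lim2: "(\<lambda>n. of_real (N n) * (exp (z n) - 1)) \<longlonglongrightarrow> \<i> * of_real (u \<bullet> u)"
    by (simp add: Q0)
  have "(\<lambda>n. LINT \<omega>|M. of_real (N n) * (exp (\<i> * of_real (u \<bullet> X \<omega> / N n)) - 1)) \<longlonglongrightarrow> (LINT \<omega>|M. \<i> * of_real (u \<bullet> X \<omega>))"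
  proof (rule integral_dominated_convergence[where w="\<lambda>\<omega>. norm u * norm (X \<omega>)"])
    show "integrable M (\<lambda>\<omega>. norm u * norm (X \<omega>))" using X by auto
    show "AE \<omega> in M. norm (of_real (N n) * (exp (\<i> * of_real (u \<bullet> X \<omega> / N n)) - 1)) \<le> norm u * norm (X \<omega>)" for n
    proof (rule AE_I2)
      fix \<omega>
      have "cmod (exp (\<i> * of_real (u \<bullet> X \<omega> / N n)) - 1) \<le> \<bar>u \<bullet> X \<omega> / N n\<bar>"
        using iexp_approx1[of "u \<bullet> X \<omega> / N n" 0] by simp
      then have "N n * cmod (exp (\<i> * of_real (u \<bullet> X \<omega> / N n)) - 1) \<le> N n * \<bar>u \<bullet> X \<omega> / N n\<bar>"
        by (rule mult_left_mono) (use N[of n] in simp)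
      then have "norm (of_real (N n) * (exp (\<i> * of_real (u \<bullet> X \<omega> / N n)) - 1)) \<le> N n * \<bar>u \<bullet> X \<omega> / N n\<bar>"
        unfolding norm_mult norm_of_real abs_of_pos[OF N] .
      also have "\<dots> = \<bar>u \<bullet> X \<omega>\<bar>" using N[of n] by simp
      also have "\<dots> \<le> norm u * norm (X \<omega>)" by (rule Cauchy_Schwarz_ineq2)
      finally show "norm (of_real (N n) * (exp (\<i> * of_real (u \<bullet> X \<omega> / N n)) - 1)) \<le> norm u * norm (X \<omega>)" .
    qed
    show "AE \<omega> in M. (\<lambda>n. of_real (N n) * (exp (\<i> * of_real (u \<bullet> X \<omega> / N n)) - 1)) \<longlonglongrightarrow> \<i> * of_real (u \<bullet> X \<omega>)"
    proof (rule AE_I2)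
      fix \<omega>
      define y where "y n = \<i> * of_real (u \<bullet> X \<omega> / N n)" for n
      have "(\<lambda>n. \<i> * of_real (u \<bullet> X \<omega> * inverse (N n))) \<longlonglongrightarrow> \<i> * of_real (u \<bullet> X \<omega> * 0)"
        unfolding N_def by (intro tendsto_intros LIMSEQ_inverse_real_of_nat)
      also have "(\<lambda>n. \<i> * of_real (u \<bullet> X \<omega> * inverse (N n))) = y"
        by (rule ext) (simp only: y_def divide_inverse)
      finally have "y \<longlonglongrightarrow> 0" by simp
      then have "(\<lambda>n. Q (y n)) \<longlonglongrightarrow> Q 0" by (rule isCont_tendsto_compose[OF \<open>isCont Q 0\<close>])
      then have "(\<lambda>n. Q (y n) * (\<i> * of_real (u \<bullet> X \<omega>))) \<longlonglongrightarrow> Q 0 * (\<i> * of_real (u \<bullet> X \<omega>))"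
        by (intro tendsto_mult tendsto_const)
      moreover have "Q (y n) * (\<i> * of_real (u \<bullet> X \<omega>)) = of_real (N n) * (exp (y n) - 1)" for n
      proof -
        have "\<i> * of_real (u \<bullet> X \<omega>) = of_real (N n) * y n" using N[of n] by (simp add: y_def)
        then show ?thesis by (simp add: Q_def)
      qed
      ultimately show "(\<lambda>n. of_real (N n) * (exp (\<i> * of_real (u \<bullet> X \<omega> / N n)) - 1)) \<longlonglongrightarrow> \<i> * of_real (u \<bullet> X \<omega>)"
        unfolding y_def[symmetric] by (simp add: Q0)
    qed
  qed measurable
  moreover have "(LINT \<omega>|M. of_real (N n) * (exp (\<i> * of_real (u \<bullet> X \<omega> / N n)) - 1)) = of_real (N n) * (exp (z n) - 1)" for n
  proof -
    have "integrable M (\<lambda>\<omega>. exp (\<i> * of_real (u \<bullet> X \<omega> / N n)))"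
      by (intro integrable_iexp) auto
    then have "(LINT \<omega>|M. of_real (N n) * (exp (\<i> * of_real (u \<bullet> X \<omega> / N n)) - 1)) =
       of_real (N n) * ((LINT \<omega>|M. exp (\<i> * of_real (u \<bullet> X \<omega> / N n))) - 1)"
      by (simp add: prob_space)
    also have "(LINT \<omega>|M. exp (\<i> * of_real (u \<bullet> X \<omega> / N n))) = (LINT \<omega>|M. exp (\<i> * of_real ((u /\<^sub>R N n) \<bullet> X \<omega>)))"
      by (simp add: divide_inverse mult.commute)
    also have "\<dots> = exp (z n)" by (simp only: cf z_def)
    finally show ?thesis .
  qed
  moreover have "(LINT \<omega>|M. \<i> * complex_of_real (u \<bullet> X \<omega>)) = 0"
    using X mean by (simp add: integral_inner_right)
  ultimately have "(\<lambda>n. of_real (N n) * (exp (z n) - 1)) \<longlonglongrightarrow> 0" by (simp only:)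
  from LIMSEQ_unique[OF this lim2] have "u \<bullet> u = 0" by simp
  then show ?thesis by (simp add: u_def)
qed

end

subsection \<open>Integrals of simple functions\<close>

text \<open>The derivative of exp has modulus at most 1 on the closed left half plane, which is
  convex and contains both z and 0.\<close>

lemma norm_exp_minus_1_le:
  assumes "cmod (exp z) \<le> 1"
  shows "cmod (exp z - 1) \<le> cmod z"
proof -
  have "cmod (exp z - exp 0) \<le> 1 * cmod (z - 0)"
  proof (rule field_differentiable_bound[where S = "{z. Re z \<le> 0}" and f' = exp])
    show "convex {z. Re z \<le> 0}" by (rule convex_halfspace_Re_le)
    show "z \<in> {z. Re z \<le> 0}" using assms by simp
    show "(exp has_field_derivative exp w) (at w within {z. Re z \<le> 0})" for w :: complex
      by (rule has_field_derivative_at_within) (rule DERIV_exp)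
  qed auto
  then show ?thesis by simp
qed

text \<open>Truncation inequality: the average of \<open>1 - cos (\<theta> Z)\<close> over \<open>0 \<le> \<theta> \<le> 2 / \<epsilon>\<close> is at least
  \<open>1/2\<close> where \<open>\<bar>Z\<bar> > \<epsilon>\<close>.\<close>

lemma (in prob_space) prob_gt_le_one_minus_cos:
  fixes Z :: "'a \<Rightarrow> real"
  assumes Z[measurable]: "random_variable borel Z" and \<epsilon>: "0 < \<epsilon>" and B: "0 \<le> B"
    and bound: "\<And>\<theta>. 0 \<le> \<theta> \<Longrightarrow> \<theta> \<le> 2 / \<epsilon> \<Longrightarrow> expectation (\<lambda>\<omega>. 1 - cos (\<theta> * Z \<omega>)) \<le> B"
  shows "prob {\<omega> \<in> space M. \<bar>Z \<omega>\<bar> > \<epsilon>} \<le> 2 * B"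
proof -
  define a where "a = 2 / \<epsilon>"
  have a: "a > 0" using \<epsilon> by (simp add: a_def)
  interpret P: pair_sigma_finite M lborel ..
  have inner: "(\<integral>\<^sup>+\<theta>. ennreal (1 - cos (\<theta> * z)) * indicator {0..a} \<theta> \<partial>lborel) \<ge> ennreal (a / 2)"
    if "\<bar>z\<bar> > \<epsilon>" for z :: real
  proof -
    have z: "z \<noteq> 0" using that \<epsilon> by auto
    have "(\<integral>\<^sup>+\<theta>. ennreal (1 - cos (\<theta> * z)) * indicator {0..a} \<theta> \<partial>lborel) =
      ennreal ((a - sin (a * z) / z) - (0 - sin (0 * z) / z))"
    proof (rule nn_integral_FTC_Icc)
      fix x :: real
      have "((\<lambda>\<theta>. \<theta> - sin (\<theta> * z) / z) has_real_derivative 1 - cos (x * z) * z / z) (at x)"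
        by (auto intro!: derivative_eq_intros)
      then show "((\<lambda>\<theta>. \<theta> - sin (\<theta> * z) / z) has_real_derivative 1 - cos (x * z)) (at x)" using z by simp
    qed (use a in auto)
    \<comment> \<open>The choice a = 2 / \<epsilon> makes the oscillating part at most 1 /
      \<epsilon> = a / 2.\<close>
    moreover have "a / 2 \<le> a - sin (a * z) / z"
    proof -
      have "\<bar>sin (a * z) / z\<bar> \<le> 1 / \<bar>z\<bar>" by (simp add: divide_right_mono)
      also have "\<dots> \<le> 1 / \<epsilon>" using that \<epsilon> by (intro divide_left_mono) auto
      also have "\<dots> = a / 2" by (simp add: a_def)
      finally show ?thesis by linarith
    qed
    ultimately show ?thesis by (simp add: ennreal_leI)
  qed
  have "ennreal (a / 2) * emeasure M {\<omega> \<in> space M. \<bar>Z \<omega>\<bar> > \<epsilon>} =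
     (\<integral>\<^sup>+\<omega>. ennreal (a / 2) * indicator {\<omega> \<in> space M. \<bar>Z \<omega>\<bar> > \<epsilon>} \<omega> \<partial>M)"
    by (subst nn_integral_cmult_indicator) auto
  also have "\<dots> \<le> (\<integral>\<^sup>+\<omega>. (\<integral>\<^sup>+\<theta>. ennreal (1 - cos (\<theta> * Z \<omega>)) * indicator {0..a} \<theta> \<partial>lborel) \<partial>M)"
    using inner by (intro nn_integral_mono) (auto simp: indicator_def)
  also have "\<dots> = (\<integral>\<^sup>+\<theta>. (\<integral>\<^sup>+\<omega>. ennreal (1 - cos (\<theta> * Z \<omega>)) * indicator {0..a} \<theta> \<partial>M) \<partial>lborel)"
    by (rule P.Fubini'[symmetric]) measurable
  also have "\<dots> \<le> (\<integral>\<^sup>+\<theta>. ennreal B * indicator {0..a} \<theta> \<partial>lborel)"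
  proof (rule nn_integral_mono)
    fix \<theta> :: real
    show "(\<integral>\<^sup>+\<omega>. ennreal (1 - cos (\<theta> * Z \<omega>)) * indicator {0..a} \<theta> \<partial>M) \<le> ennreal B * indicator {0..a} \<theta>"
    proof (cases "\<theta> \<in> {0..a}")
      case True
      have "(\<integral>\<^sup>+\<omega>. ennreal (1 - cos (\<theta> * Z \<omega>)) \<partial>M) = ennreal (expectation (\<lambda>\<omega>. 1 - cos (\<theta> * Z \<omega>)))"
      proof (rule nn_integral_eq_integral)
        show "integrable M (\<lambda>\<omega>. 1 - cos (\<theta> * Z \<omega>))"
        proof (rule integrable_const_bound[where B=2])
          have "norm (1 - cos x) \<le> 2" for x :: real using cos_le_one[of x] cos_ge_minus_one[of x] by auto
          then show "AE \<omega> in M. norm (1 - cos (\<theta> * Z \<omega>)) \<le> 2" by (intro AE_I2)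
        qed measurable
      qed auto
      also have "\<dots> \<le> ennreal B" using True by (intro ennreal_leI bound) (auto simp: a_def)
      finally show ?thesis using True by simp
    qed simp
  qed
  also have "\<dots> = ennreal B * ennreal a" using a by (subst nn_integral_cmult_indicator) auto
  finally have "ennreal (a / 2) * ennreal (prob {\<omega> \<in> space M. \<bar>Z \<omega>\<bar> > \<epsilon>}) \<le> ennreal B * ennreal a"
    by (simp only: emeasure_eq_measure)
  then have "ennreal (a / 2 * prob {\<omega> \<in> space M. \<bar>Z \<omega>\<bar> > \<epsilon>}) \<le> ennreal (B * a)"
    using a B by (subst (1 2) ennreal_mult) auto
  then have "a / 2 * prob {\<omega> \<in> space M. \<bar>Z \<omega>\<bar> > \<epsilon>} \<le> B * a"
    using a B by (subst (asm) ennreal_le_iff) auto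
  then show ?thesis using a by (simp add: field_simps)
qed

text \<open>What the integration theory uses of \<open>levy_modular\<close>. In place of convexity
  there is \<open>scale\<close>: with factor 2 it acts as a doubling condition, so that sums cost a
  factor 4 where a norm would have the triangle inequality.\<close>

locale modular =
  fixes w :: "real \<Rightarrow> real"
  assumes nonneg: "\<And>x. 0 \<le> w x" and zero [simp]: "w 0 = 0"
    and mono: "\<And>x y. 0 \<le> x \<Longrightarrow> x \<le> y \<Longrightarrow> w x \<le> w y"
    and scale: "\<And>b c x. 0 \<le> c \<Longrightarrow> c \<le> b \<Longrightarrow> 1 \<le> b \<Longrightarrow> w (c * x) \<le> b\<^sup>2 * w x"
    and tendsto_0: "(w \<longlongrightarrow> 0) (at_right 0)"
begin

lemma add_le:
  assumes "0 \<le> x" "0 \<le> y" shows "w (x + y) \<le> 4 * (w x + w y)"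
proof -
  have *: "w (2 * z) \<le> 4 * w z" for z using scale[of 2 2 z] by simp
  have "w (x + y) \<le> w (2 * max x y)" using assms by (intro mono) auto
  also have "\<dots> \<le> 4 * w (max x y)" by (rule *)
  also have "\<dots> \<le> 4 * (w x + w y)" using nonneg[of x] nonneg[of y] by (auto simp: max_def)
  finally show ?thesis .
qed

text \<open>A monotone function is Borel. Monotonicity is available on nonnegative reals, hence the
  detour through the maximum with 0.\<close>

lemma measurable_comp [measurable]:
  assumes [measurable]: "f \<in> borel_measurable N"
  shows "(\<lambda>x. w (norm (f x))) \<in> borel_measurable N"
proof -
  have "(\<lambda>x. w (max 0 x)) \<in> borel_measurable borel"
    by (rule borel_measurable_mono) (auto intro!: monoI mono)
  then have "(\<lambda>x. w (max 0 (norm (f x)))) \<in> borel_measurable N" by measurable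
  then show ?thesis by simp
qed

lemma tendsto_norm_0:
  assumes "((\<lambda>x. f x) \<longlongrightarrow> 0) F"
  shows "((\<lambda>x. w (norm (f x))) \<longlongrightarrow> 0) F"
proof (rule tendstoI)
  fix e :: real assume "e > 0"
  then have "\<forall>\<^sub>F x in at_right 0. w x < e" using tendsto_0 by (intro order_tendstoD)
  then obtain b where b: "b > 0" "\<And>y. 0 < y \<Longrightarrow> y < b \<Longrightarrow> w y < e"
    unfolding eventually_at_right_field by auto
  have "\<forall>\<^sub>F x in F. norm (f x) < b"
    using assms b(1) by (auto dest: tendstoD simp: dist_norm)
  then show "\<forall>\<^sub>F x in F. dist (w (norm (f x))) 0 < e"
  proof eventually_elim
    case (elim x)
    then show ?case using b(2)[of "norm (f x)"] \<open>e > 0\<close> nonneg by (cases "f x = 0") auto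
  qed
qed

definition modint :: "(real \<Rightarrow> 'c::real_normed_vector) \<Rightarrow> ennreal" where
  "modint f = (\<integral>\<^sup>+x. ennreal (w (norm (f x))) \<partial>lborel)"

lemma modint_mono_AE:
  assumes "AE x in lborel. norm (f x) \<le> norm (g x)"
  shows "modint f \<le> modint g"
  unfolding modint_def using assms by (intro nn_integral_mono_AE) (auto intro!: ennreal_leI mono)

lemma modint_cong_AE:
  assumes "AE x in lborel. norm (f x) = norm (g x)"
  shows "modint f = modint g"
  using assms by (intro antisym modint_mono_AE) auto

lemma modint_mono: "(\<And>x. norm (f x) \<le> norm (g x)) \<Longrightarrow> modint f \<le> modint g"
  by (rule modint_mono_AE) simp

lemma modint_add:
  assumes [measurable]: "f \<in> borel_measurable borel" "g \<in> borel_measurable borel"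
    and le: "\<And>x. norm (h x) \<le> norm (f x) + norm (g x)"
  shows "modint h \<le> 4 * (modint f + modint g)"
proof -
  have "modint h \<le> (\<integral>\<^sup>+x. 4 * (ennreal (w (norm (f x))) + ennreal (w (norm (g x)))) \<partial>lborel)"
    unfolding modint_def
  proof (rule nn_integral_mono)
    fix x
    have "w (norm (h x)) \<le> 4 * (w (norm (f x)) + w (norm (g x)))"
      by (rule order_trans[OF mono[OF _ le] add_le]) auto
    then show "ennreal (w (norm (h x))) \<le> 4 * (ennreal (w (norm (f x))) + ennreal (w (norm (g x))))"
      using nonneg by (simp add: ennreal_plus[symmetric] ennreal_mult'[symmetric] ennreal_leI
          ennreal_numeral[symmetric] del: ennreal_plus ennreal_numeral)
  qed
  also have "\<dots> = 4 * (modint f + modint g)"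
    unfolding modint_def by (subst nn_integral_cmult) (auto simp: nn_integral_add)
  finally show ?thesis .
qed

lemma modint_scale:
  assumes [measurable]: "f \<in> borel_measurable borel" and "0 \<le> c" "c \<le> b" "1 \<le> b"
    and le: "\<And>x. norm (h x) \<le> c * norm (f x)"
  shows "modint h \<le> ennreal (b\<^sup>2) * modint f"
proof -
  have "modint h \<le> (\<integral>\<^sup>+x. ennreal (b\<^sup>2) * ennreal (w (norm (f x))) \<partial>lborel)"
    unfolding modint_def
  proof (rule nn_integral_mono)
    fix x
    have "w (norm (h x)) \<le> b\<^sup>2 * w (norm (f x))"
      by (rule order_trans[OF mono[OF _ le] scale]) (use assms in auto)
    then show "ennreal (w (norm (h x))) \<le> ennreal (b\<^sup>2) * ennreal (w (norm (f x)))"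
      using nonneg by (simp add: ennreal_mult'[symmetric] ennreal_leI)
  qed
  also have "\<dots> = ennreal (b\<^sup>2) * modint f"
    unfolding modint_def by (subst nn_integral_cmult) auto
  finally show ?thesis .
qed

end

section \<open>Simple functions as lists of pieces, and their disjoint refinement\<close>

lemma simple_fun_Nil [simp]: "simple_fun [] x = 0"
  and simple_fun_Cons [simp]: "simple_fun ((c, A) # S) x = indicator A x *\<^sub>R c + simple_fun S x"
  and simple_fun_append [simp]: "simple_fun (S @ T) x = simple_fun S x + simple_fun T x"
  by (simp_all add: simple_fun_def)

lemma simple_fun_eq_0: "x \<notin> \<Union>(snd ` set S) \<Longrightarrow> simple_fun S x = 0"
  by (induction S) (auto simp: indicator_def)

lemma simple_fun_linear:
  assumes "linear h"
  shows "simple_fun (map (\<lambda>(c, A). (h c, A)) S) x = h (simple_fun S x)"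
  by (induction S) (auto simp: linear_0[OF assms] linear_add[OF assms] linear_cmul[OF assms])

lemma simple_fun_restrict: "simple_fun (map (\<lambda>(c, A). (c, A \<inter> D)) S) x = indicator D x *\<^sub>R simple_fun S x"
  by (induction S) (auto simp: indicator_def)

lemma bounded_borel_Int [intro]: "A \<in> bounded_borel \<Longrightarrow> D \<in> sets borel \<Longrightarrow> A \<inter> D \<in> bounded_borel"
  and bounded_borel_Diff [intro]: "A \<in> bounded_borel \<Longrightarrow> D \<in> sets borel \<Longrightarrow> A - D \<in> bounded_borel"
  and bounded_borel_Un [intro]: "A \<in> bounded_borel \<Longrightarrow> B \<in> bounded_borel \<Longrightarrow> A \<union> B \<in> bounded_borel"
  and bounded_borel_empty [simp]: "{} \<in> bounded_borel"
  and bounded_borel_sets [dest]: "A \<in> bounded_borel \<Longrightarrow> A \<in> sets borel"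
  by (auto simp: bounded_borel_def intro: bounded_subset)

lemma bounded_borel_finite_emeasure: "A \<in> bounded_borel \<Longrightarrow> emeasure lborel A < \<infinity>"
  using emeasure_bounded_finite[of A] by (auto simp: bounded_borel_def)

lemma borel_measurable_simple_fun:
  fixes S :: "('c::euclidean_space \<times> real set) list"
  assumes "snd ` set S \<subseteq> sets borel"
  shows "simple_fun S \<in> borel_measurable borel"
  using assms
proof (induction S)
  case (Cons p S)
  obtain c A where p: "p = (c, A)" by (cases p)
  have [measurable]: "A \<in> sets borel" "simple_fun S \<in> borel_measurable borel" using Cons p by auto
  have "simple_fun (p # S) = (\<lambda>x. indicator A x *\<^sub>R c + simple_fun S x)" by (auto simp: p)
  then show ?case by simp
qed (simp add: simple_fun_def[abs_def])

text \<open>Differences of simple functions are formed by concatenating lists, which destroys the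
  disjointness that independence requires. Inserting pieces one at a time restores it without
  changing the function: where sets overlap, the coefficients add, and what is left of the new piece
  moves on.\<close>

primrec insert_piece :: "'c::real_vector \<times> real set \<Rightarrow> ('c \<times> real set) list \<Rightarrow> ('c \<times> real set) list" where
  "insert_piece p [] = [p]"
| "insert_piece p (b # T) =
     (fst b + fst p, snd b \<inter> snd p) # (fst b, snd b - snd p) # insert_piece (fst p, snd p - snd b) T"

lemma insert_piece_subset: "\<Union>(snd ` set (insert_piece p T)) \<subseteq> snd p \<union> \<Union>(snd ` set T)"
  by (induction T arbitrary: p) (auto, fastforce)

lemma insert_piece_bounded_borel:
  "snd p \<in> bounded_borel \<Longrightarrow> snd ` set T \<subseteq> bounded_borel \<Longrightarrow> snd ` set (insert_piece p T) \<subseteq> bounded_borel"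
proof (induction T arbitrary: p)
  case (Cons b T)
  have "snd ` set (insert_piece (fst p, snd p - snd b) T) \<subseteq> bounded_borel"
    using Cons.prems by (intro Cons.IH) auto
  then show ?case using Cons.prems by auto
qed simp

lemma insert_piece_disjoint:
  "sorted_wrt disjnt (map snd T) \<Longrightarrow> sorted_wrt disjnt (map snd (insert_piece p T))"
proof (induction T arbitrary: p)
  case (Cons b T)
  let ?R = "insert_piece (fst p, snd p - snd b) T"
  have T: "disjnt (snd b) X" if "X \<in> snd ` set T" for X using Cons.prems that by auto
  have sub: "X \<subseteq> (snd p - snd b) \<union> \<Union>(snd ` set T)" if "X \<in> snd ` set ?R" for X
    using insert_piece_subset[of "(fst p, snd p - snd b)" T] that by auto
  have "disjnt (snd b) X" if "X \<in> snd ` set ?R" for X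
    using sub[OF that] T by (auto simp: disjnt_def)
  then have "\<forall>X\<in>snd ` set ?R. disjnt (snd b \<inter> snd p) X \<and> disjnt (snd b - snd p) X"
    by (auto simp: disjnt_def)
  then show ?case using Cons by (auto simp: disjnt_def)
qed simp

lemma insert_piece_simple_fun:
  "simple_fun (insert_piece p T) x = indicator (snd p) x *\<^sub>R fst p + simple_fun T x"
proof (induction T arbitrary: p)
  case Nil
  then show ?case by (cases p) simp
next
  case (Cons b T)
  then show ?case by (cases b) (auto simp: indicator_def scaleR_add_right)
qed

section \<open>Characteristic functions of the random measure and tails of simple integrals\<close>

locale levy_integrator = modular w + prob_space M
  for w :: "real \<Rightarrow> real" and M :: "'w measure" +
  fixes L :: "real \<Rightarrow> 'w \<Rightarrow> real ^ 'd" and \<Lambda> :: "real set \<Rightarrow> 'w \<Rightarrow> real ^ 'd" and \<psi> :: "real ^ 'd \<Rightarrow> complex"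
  assumes L_measurable [measurable]: "\<And>t. L t \<in> borel_measurable M"
    and \<Lambda>: "levy_random_measure M L \<Lambda>"
    and cf_increment: "\<And>a b u. a \<le> b \<Longrightarrow>
      (LINT \<omega>|M. exp (\<i> * of_real (u \<bullet> (L b \<omega> - L a \<omega>)))) = exp (of_real (b - a) * \<psi> u)"
    and \<psi>_bound: "\<And>u. cmod (\<psi> u) \<le> w (norm u)"
begin

lemma \<Lambda>_measurable [measurable]: "A \<in> bounded_borel \<Longrightarrow> random_variable borel (\<Lambda> A)"
  using \<Lambda> by (auto simp: levy_random_measure_def)

lemma \<Lambda>_indep:
  "disjoint_family A \<Longrightarrow> range A \<subseteq> bounded_borel \<Longrightarrow> indep_vars (\<lambda>_. borel) (\<lambda>n::nat. \<Lambda> (A n)) UNIV"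
  using \<Lambda> by (auto simp: levy_random_measure_def)

lemma \<Lambda>_sums:
  "disjoint_family A \<Longrightarrow> range A \<subseteq> bounded_borel \<Longrightarrow> (\<Union>n. A n) \<in> bounded_borel \<Longrightarrow>
     AE \<omega> in M. (\<lambda>n::nat. \<Lambda> (A n) \<omega>) sums \<Lambda> (\<Union>n. A n) \<omega>"
  using \<Lambda> by (auto simp: levy_random_measure_def)

text \<open>The constant family of empty sets is disjoint, and the terms of a convergent series tend
  to 0, so the constant term is 0.\<close>

lemma \<Lambda>_empty: "AE \<omega> in M. \<Lambda> {} \<omega> = 0"
proof -
  have "AE \<omega> in M. (\<lambda>n::nat. \<Lambda> ((\<lambda>_. {}) n) \<omega>) sums \<Lambda> (\<Union>n::nat. (\<lambda>_. {}) n) \<omega>"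
    by (rule \<Lambda>_sums) (auto simp: disjoint_family_on_def)
  then show ?thesis
  proof (rule AE_mp, intro AE_I2 impI)
    fix \<omega> assume "(\<lambda>n::nat. \<Lambda> ((\<lambda>_. {}) n) \<omega>) sums \<Lambda> (\<Union>n::nat. (\<lambda>_. {}) n) \<omega>"
    then have "(\<lambda>n::nat. \<Lambda> {} \<omega>) \<longlonglongrightarrow> 0" by (intro summable_LIMSEQ_zero) (auto simp: sums_iff)
    then show "\<Lambda> {} \<omega> = 0" by (simp add: tendsto_const_iff)
  qed
qed

text \<open>Independence and additivity are given for sequences of sets; padding by empty sets
  reduces the case of two sets to them.\<close>

definition pair_family :: "real set \<Rightarrow> real set \<Rightarrow> nat \<Rightarrow> real set" where
  "pair_family A B n = (if n = 0 then A else if n = 1 then B else {})"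

lemma pair_family:
  assumes "A \<in> bounded_borel" "B \<in> bounded_borel" "A \<inter> B = {}"
  shows "disjoint_family (pair_family A B)" "range (pair_family A B) \<subseteq> bounded_borel" "(\<Union>n. pair_family A B n) = A \<union> B"
  using assms by (auto simp: pair_family_def disjoint_family_on_def split: if_splits)

lemma \<Lambda>_Un:
  assumes "A \<in> bounded_borel" "B \<in> bounded_borel" "A \<inter> B = {}"
  shows "AE \<omega> in M. \<Lambda> (A \<union> B) \<omega> = \<Lambda> A \<omega> + \<Lambda> B \<omega>"
proof -
  have "A \<union> B \<in> bounded_borel" using assms by auto
  then have "AE \<omega> in M. (\<lambda>n. \<Lambda> (pair_family A B n) \<omega>) sums \<Lambda> (A \<union> B) \<omega>"
    using \<Lambda>_sums[OF pair_family(1,2)[OF assms]] unfolding pair_family(3)[OF assms] by auto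
  then show ?thesis using \<Lambda>_empty
  proof eventually_elim
    case (elim \<omega>)
    have "(\<lambda>n. \<Lambda> (pair_family A B n) \<omega>) sums (\<Sum>n\<in>{0,1}. \<Lambda> (pair_family A B n) \<omega>)"
      using elim by (intro sums_finite) (auto simp: pair_family_def)
    then show ?case using elim sums_unique2 by (fastforce simp: pair_family_def)
  qed
qed

lemma cf_sum:
  fixes u :: "nat \<Rightarrow> real ^ 'd"
  assumes "disjoint_family A" "range A \<subseteq> bounded_borel" "finite K"
  shows "(LINT \<omega>|M. exp (\<i> * of_real (\<Sum>k\<in>K. u k \<bullet> \<Lambda> (A k) \<omega>))) = (\<Prod>k\<in>K. LINT \<omega>|M. exp (\<i> * of_real (u k \<bullet> \<Lambda> (A k) \<omega>)))"
proof -
  have "indep_vars (\<lambda>_. borel) (\<lambda>n. \<Lambda> (A n)) K"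
    using \<Lambda>_indep[OF assms(1,2)] by (rule indep_vars_subset) simp
  then have "indep_vars (\<lambda>_. borel) (\<lambda>k \<omega>. exp (\<i> * of_real (u k \<bullet> \<Lambda> (A k) \<omega>)) :: complex) K"
    by (rule indep_vars_compose2) measurable
  moreover have "integrable M (\<lambda>\<omega>. exp (\<i> * of_real (u k \<bullet> \<Lambda> (A k) \<omega>)))" for k
  proof -
    have [measurable]: "A k \<in> bounded_borel" using assms(2) by auto
    show ?thesis by (intro integrable_iexp) auto
  qed
  ultimately have "(LINT \<omega>|M. (\<Prod>k\<in>K. exp (\<i> * of_real (u k \<bullet> \<Lambda> (A k) \<omega>)))) = (\<Prod>k\<in>K. LINT \<omega>|M. exp (\<i> * of_real (u k \<bullet> \<Lambda> (A k) \<omega>)))"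
    using \<open>finite K\<close> by (intro indep_vars_lebesgue_integral) auto
  then show ?thesis using \<open>finite K\<close> by (simp add: exp_sum sum_distrib_left)
qed

lemma cf_cong_AE:
  assumes "AE \<omega> in M. X \<omega> = Y \<omega>" "random_variable borel X" "random_variable borel Y"
  shows "(LINT \<omega>|M. exp (\<i> * of_real (X \<omega>))) = (LINT \<omega>|M. exp (\<i> * of_real (Y \<omega>)))"
  using assms by (intro integral_cong_AE) auto

lemma cf_interval:
  "(LINT \<omega>|M. exp (\<i> * of_real (u \<bullet> \<Lambda> {a..<b} \<omega>))) = exp (of_real (measure lborel {a..<b}) * \<psi> u)"
proof (cases "a \<le> b")
  case True
  have "{a..<b} \<in> bounded_borel" by (auto simp: bounded_borel_def)
  then have [measurable]: "random_variable borel (\<Lambda> {a..<b})" by (rule \<Lambda>_measurable)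
  have "AE \<omega> in M. \<Lambda> {a..<b} \<omega> = L b \<omega> - L a \<omega>" using \<Lambda> True by (simp add: levy_random_measure_def)
  have "(LINT \<omega>|M. exp (\<i> * of_real (u \<bullet> \<Lambda> {a..<b} \<omega>))) = (LINT \<omega>|M. exp (\<i> * of_real (u \<bullet> (L b \<omega> - L a \<omega>))))"
  proof (rule cf_cong_AE)
    show "AE \<omega> in M. u \<bullet> \<Lambda> {a..<b} \<omega> = u \<bullet> (L b \<omega> - L a \<omega>)"
      using \<open>AE \<omega> in M. \<Lambda> {a..<b} \<omega> = L b \<omega> - L a \<omega>\<close> by eventually_elim simp
  qed measurable
  then show ?thesis using True by (simp add: cf_increment)
next
  case False
  have "(LINT \<omega>|M. exp (\<i> * of_real (u \<bullet> \<Lambda> {a..<b} \<omega>))) = (LINT \<omega>|M. 1)"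
    using False \<Lambda>_empty by (intro integral_cong_AE) (auto elim!: AE_mp)
  then show ?thesis using False by (simp add: prob_space)
qed

text \<open>Dynkin's argument on half-open intervals. Every set is intersected with one bounded
  interval I, since \<Lambda> is meaningful on bounded sets only. For complements, the
  characteristic functions of the two parts multiply to that of I; for disjoint unions, dominated
  convergence is applied to the partial sums.\<close>

lemma cf_\<Lambda>:
  assumes "A \<in> bounded_borel"
  shows "(LINT \<omega>|M. exp (\<i> * of_real (u \<bullet> \<Lambda> A \<omega>))) = exp (of_real (measure lborel A) * \<psi> u)"
proof -
  obtain n :: real where n: "A \<subseteq> {-n..<n}"
  proof -
    obtain n where "\<forall>x\<in>A. norm x \<le> n" using assms by (auto simp: bounded_borel_def bounded_iff)
    then have "A \<subseteq> {-(n+1)..<n+1}" by force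
    then show thesis by (rule that)
  qed
  define I where "I = {-n..<n}"
  have I: "I \<in> bounded_borel" by (auto simp: bounded_borel_def I_def)
  let ?G = "range (\<lambda>(a, b). {a ..< b :: real})"
  let ?P = "\<lambda>D. (LINT \<omega>|M. exp (\<i> * of_real (u \<bullet> \<Lambda> (D \<inter> I) \<omega>))) = exp (of_real (measure lborel (D \<inter> I)) * \<psi> u)"
  have borel: "sigma_sets UNIV ?G = sets borel" by (subst borel_eq_atLeastLessThan) simp
  have "A \<in> sigma_sets UNIV ?G" using assms by (auto simp: borel bounded_borel_def)
  have "?P A"
  proof (rule sigma_sets_induct_disjoint[where P = ?P and A = A and G = ?G and \<Omega> = UNIV])
    show "Int_stable ?G"
    proof (rule Int_stableI_image)
      show "\<exists>k\<in>UNIV. (case i of (a, b) \<Rightarrow> {a..<b}) \<inter> (case j of (a, b) \<Rightarrow> {a..<b}) = (case k of (a, b) \<Rightarrow> {a..<b})"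
        for i j :: "real \<times> real"
        by (intro bexI[of _ "(max (fst i) (fst j), min (snd i) (snd j))"]) (auto split: prod.splits)
    qed
  next
    fix D assume "D \<in> ?G"
    then obtain a b where "D = {a..<b}" by auto
    then have "D \<inter> I = {max a (-n)..<min b n}" by (auto simp: I_def)
    then show "?P D" by (simp only: cf_interval)
  next
    have "(LINT \<omega>|M. exp (\<i> * of_real (u \<bullet> \<Lambda> {} \<omega>))) = (LINT \<omega>|M. 1)"
      using \<Lambda>_empty by (intro integral_cong_AE) (auto elim!: AE_mp)
    then show "?P {}" by (simp add: prob_space)
  next
    fix D assume "D \<in> sigma_sets UNIV ?G" and D: "?P D"
    then have [measurable]: "D \<in> sets borel" by (simp add: borel)
    have bb: "D \<inter> I \<in> bounded_borel" "I - D \<in> bounded_borel" "(D \<inter> I) \<inter> (I - D) = {}"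
      using bounded_borel_Int[OF I, of D] I by (auto simp: Int_commute[of I D])
    note [measurable] = \<Lambda>_measurable[OF bb(1)] \<Lambda>_measurable[OF bb(2)] \<Lambda>_measurable[OF I]
    have Un: "(D \<inter> I) \<union> (I - D) = I" by auto
    have "(LINT \<omega>|M. exp (\<i> * of_real (\<Sum>k\<in>{0,1}. u \<bullet> \<Lambda> (pair_family (D \<inter> I) (I - D) k) \<omega>))) =
       (\<Prod>k\<in>{0,1}. LINT \<omega>|M. exp (\<i> * of_real (u \<bullet> \<Lambda> (pair_family (D \<inter> I) (I - D) k) \<omega>)))"
      by (intro cf_sum pair_family bb) auto
    then have "(LINT \<omega>|M. exp (\<i> * of_real (u \<bullet> \<Lambda> (D \<inter> I) \<omega> + u \<bullet> \<Lambda> (I - D) \<omega>))) =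
      (LINT \<omega>|M. exp (\<i> * of_real (u \<bullet> \<Lambda> (D \<inter> I) \<omega>))) * (LINT \<omega>|M. exp (\<i> * of_real (u \<bullet> \<Lambda> (I - D) \<omega>)))"
      by (simp add: pair_family_def)
    also have "(LINT \<omega>|M. exp (\<i> * of_real (u \<bullet> \<Lambda> (D \<inter> I) \<omega> + u \<bullet> \<Lambda> (I - D) \<omega>))) = (LINT \<omega>|M. exp (\<i> * of_real (u \<bullet> \<Lambda> I \<omega>)))"
    proof (rule cf_cong_AE)
      show "AE \<omega> in M. u \<bullet> \<Lambda> (D \<inter> I) \<omega> + u \<bullet> \<Lambda> (I - D) \<omega> = u \<bullet> \<Lambda> I \<omega>"
        using \<Lambda>_Un[OF bb] unfolding Un by eventually_elim (simp add: inner_add_right)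
    qed measurable
    also have "\<dots> = exp (of_real (measure lborel I) * \<psi> u)" unfolding I_def by (rule cf_interval)
    finally have eq: "exp (of_real (measure lborel I) * \<psi> u) =
      exp (of_real (measure lborel (D \<inter> I)) * \<psi> u) * (LINT \<omega>|M. exp (\<i> * of_real (u \<bullet> \<Lambda> (I - D) \<omega>)))"
      by (simp only: D)
    have "measure lborel (D \<inter> I) + measure lborel (I - D) = measure lborel ((D \<inter> I) \<union> (I - D))"
      using bb bounded_borel_finite_emeasure[OF bb(1)] bounded_borel_finite_emeasure[OF bb(2)]
      by (intro measure_Union[symmetric]) auto
    then have "exp (of_real (measure lborel I) * \<psi> u) =
      exp (of_real (measure lborel (D \<inter> I)) * \<psi> u) * exp (of_real (measure lborel (I - D)) * \<psi> u)"
      unfolding Un by (simp add: exp_add[symmetric] distrib_right[symmetric] of_real_add[symmetric] del: of_real_add)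
    \<comment> \<open>The exponential never vanishes, so the factor that belongs to D inside I can
      be cancelled.\<close>
    with eq have "(LINT \<omega>|M. exp (\<i> * of_real (u \<bullet> \<Lambda> (I - D) \<omega>))) = exp (of_real (measure lborel (I - D)) * \<psi> u)"
      by (metis exp_not_eq_zero mult_left_cancel)
    moreover have "(UNIV - D) \<inter> I = I - D" by auto
    ultimately show "?P (UNIV - D)" by (simp only:)
  next
    fix D :: "nat \<Rightarrow> real set"
    assume D: "disjoint_family D" "range D \<subseteq> sigma_sets UNIV ?G" and P: "\<And>i. ?P (D i)"
    define E where "E i = D i \<inter> I" for i
    have Db: "D i \<in> sets borel" for i using D(2) by (auto simp: borel)
    have E: "disjoint_family E" "range E \<subseteq> bounded_borel"
      using D(1) I Db by (auto simp: disjoint_family_on_def E_def Int_commute)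
    have UE: "(\<Union>i. E i) = (\<Union>i. D i) \<inter> I" by (auto simp: E_def)
    have UE_bb: "(\<Union>i. E i) \<in> bounded_borel" unfolding UE using I Db by (subst Int_commute) auto
    have E_bb: "E i \<in> bounded_borel" for i using E(2) by auto
    note [measurable] = \<Lambda>_measurable[OF E_bb] \<Lambda>_measurable[OF UE_bb]
    have "(\<lambda>n. LINT \<omega>|M. exp (\<i> * of_real (\<Sum>k<n. u \<bullet> \<Lambda> (E k) \<omega>))) \<longlonglongrightarrow> (LINT \<omega>|M. exp (\<i> * of_real (u \<bullet> \<Lambda> (\<Union>i. E i) \<omega>)))"
    proof (rule integral_dominated_convergence[where w="\<lambda>_. 1"])
      show "AE \<omega> in M. (\<lambda>n. exp (\<i> * of_real (\<Sum>k<n. u \<bullet> \<Lambda> (E k) \<omega>))) \<longlonglongrightarrow> exp (\<i> * of_real (u \<bullet> \<Lambda> (\<Union>i. E i) \<omega>))"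
        using \<Lambda>_sums[OF E UE_bb]
      proof eventually_elim
        case (elim \<omega>)
        then have "(\<lambda>n. u \<bullet> \<Lambda> (E n) \<omega>) sums (u \<bullet> \<Lambda> (\<Union>i. E i) \<omega>)"
          by (rule bounded_linear.sums[OF bounded_linear_inner_right])
        then show ?case unfolding sums_def by (intro tendsto_intros)
      qed
    qed auto
    moreover have "(LINT \<omega>|M. exp (\<i> * of_real (\<Sum>k<n. u \<bullet> \<Lambda> (E k) \<omega>))) = exp (of_real (\<Sum>k<n. measure lborel (E k)) * \<psi> u)" for n
    proof -
      have "(LINT \<omega>|M. exp (\<i> * of_real (\<Sum>k<n. u \<bullet> \<Lambda> (E k) \<omega>))) = (\<Prod>k<n. exp (of_real (measure lborel (E k)) * \<psi> u))"
        using P by (subst cf_sum[OF E]) (auto simp: E_def)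
      then show ?thesis by (simp add: exp_sum sum_distrib_right)
    qed
    moreover have "(\<lambda>n. exp (of_real (\<Sum>k<n. measure lborel (E k)) * \<psi> u)) \<longlonglongrightarrow> exp (of_real (measure lborel (\<Union>i. E i)) * \<psi> u)"
    proof -
      have "(\<lambda>k. measure lborel (E k)) sums measure lborel (\<Union>i. E i)"
        using E E_bb bounded_borel_finite_emeasure[OF UE_bb] by (intro measure_UNION) auto
      then show ?thesis unfolding sums_def by (intro tendsto_intros)
    qed
    ultimately show "?P (\<Union>i. D i)" unfolding UE[symmetric] using LIMSEQ_unique by auto
  qed (use \<open>A \<in> sigma_sets UNIV ?G\<close> in auto)
  moreover have "A \<inter> I = A" using n by (auto simp: I_def)
  ultimately show ?thesis by simp
qed

text \<open>Real and imaginary parts of the coordinates of a matrix-valued integral are scalars of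
  this form, so characteristic functions are only needed here.\<close>

definition row_integral :: "((real ^ 'd) \<times> real set) list \<Rightarrow> 'w \<Rightarrow> real" where
  "row_integral S \<omega> = (\<Sum>(v, A)\<leftarrow>S. v \<bullet> \<Lambda> A \<omega>)"

lemma row_integral_simps [simp]:
  "row_integral [] \<omega> = 0" "row_integral (p # S) \<omega> = fst p \<bullet> \<Lambda> (snd p) \<omega> + row_integral S \<omega>"
  by (simp_all add: row_integral_def split_beta)

lemma row_integral_measurable: "snd ` set S \<subseteq> bounded_borel \<Longrightarrow> random_variable borel (row_integral S)"
proof (induction S)
  case (Cons p S)
  then have [measurable]: "random_variable borel (row_integral S)" "snd p \<in> bounded_borel" by auto
  have "row_integral (p # S) = (\<lambda>\<omega>. fst p \<bullet> \<Lambda> (snd p) \<omega> + row_integral S \<omega>)" by auto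
  then show ?case by simp
next
  case Nil
  have "row_integral [] = (\<lambda>_. 0)" by (simp add: fun_eq_iff)
  then show ?case by simp
qed

lemma row_integral_insert_piece:
  assumes "snd p \<in> bounded_borel" "snd ` set T \<subseteq> bounded_borel"
  shows "AE \<omega> in M. row_integral (insert_piece p T) \<omega> = fst p \<bullet> \<Lambda> (snd p) \<omega> + row_integral T \<omega>"
  using assms
proof (induction T arbitrary: p)
  case (Cons b T)
  have b: "snd b \<in> bounded_borel" using Cons.prems by auto
  have IH: "AE \<omega> in M. row_integral (insert_piece (fst p, snd p - snd b) T) \<omega> = fst p \<bullet> \<Lambda> (snd p - snd b) \<omega> + row_integral T \<omega>"
    using Cons.IH[of "(fst p, snd p - snd b)"] Cons.prems by auto
  have "AE \<omega> in M. \<Lambda> ((snd b \<inter> snd p) \<union> (snd b - snd p)) \<omega> = \<Lambda> (snd b \<inter> snd p) \<omega> + \<Lambda> (snd b - snd p) \<omega>"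
    using Cons.prems b by (intro \<Lambda>_Un) auto
  moreover have "AE \<omega> in M. \<Lambda> ((snd b \<inter> snd p) \<union> (snd p - snd b)) \<omega> = \<Lambda> (snd b \<inter> snd p) \<omega> + \<Lambda> (snd p - snd b) \<omega>"
    using Cons.prems b by (intro \<Lambda>_Un) auto
  moreover have "(snd b \<inter> snd p) \<union> (snd b - snd p) = snd b" "(snd b \<inter> snd p) \<union> (snd p - snd b) = snd p" by auto
  ultimately have 1: "AE \<omega> in M. \<Lambda> (snd b) \<omega> = \<Lambda> (snd b \<inter> snd p) \<omega> + \<Lambda> (snd b - snd p) \<omega>"
    and 2: "AE \<omega> in M. \<Lambda> (snd p) \<omega> = \<Lambda> (snd b \<inter> snd p) \<omega> + \<Lambda> (snd p - snd b) \<omega>" by simp_all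
  show ?case using IH 1 2
    by eventually_elim (simp add: inner_add_left inner_add_right)
qed simp

lemma disjoint_refinement:
  assumes "snd ` set S \<subseteq> bounded_borel"
  shows "\<exists>S'. snd ` set S' \<subseteq> bounded_borel \<and> sorted_wrt disjnt (map snd S') \<and>
    simple_fun S' = simple_fun S \<and> (AE \<omega> in M. row_integral S' \<omega> = row_integral S \<omega>)"
  using assms
proof (induction S)
  case Nil
  show ?case by (rule exI[of _ "[]"]) simp
next
  case (Cons p S)
  then have "snd ` set S \<subseteq> bounded_borel" by simp
  from Cons.IH[OF this] obtain S' where S': "snd ` set S' \<subseteq> bounded_borel" "sorted_wrt disjnt (map snd S')"
    "simple_fun S' = simple_fun S" "AE \<omega> in M. row_integral S' \<omega> = row_integral S \<omega>"
    by (elim exE conjE)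
  have p: "snd p \<in> bounded_borel" using Cons.prems by simp
  show ?case
  proof (intro exI conjI)
    show "snd ` set (insert_piece p S') \<subseteq> bounded_borel" by (intro insert_piece_bounded_borel p S')
    show "sorted_wrt disjnt (map snd (insert_piece p S'))" by (intro insert_piece_disjoint S')
    show "simple_fun (insert_piece p S') = simple_fun (p # S)"
      by (cases p) (simp add: fun_eq_iff insert_piece_simple_fun S'(3))
    show "AE \<omega> in M. row_integral (insert_piece p S') \<omega> = row_integral (p # S) \<omega>"
      using row_integral_insert_piece[OF p S'(1)] S'(4) by eventually_elim simp
  qed
qed

lemma cf_row_integral_disjoint:
  assumes S: "snd ` set S \<subseteq> bounded_borel" and disj: "sorted_wrt disjnt (map snd S)"
  shows "(LINT \<omega>|M. exp (\<i> * of_real (row_integral S \<omega>))) = exp (\<Sum>(v, A)\<leftarrow>S. of_real (measure lborel A) * \<psi> v)"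
proof -
  define A where "A n = (if n < length S then snd (S ! n) else {})" for n
  have A: "range A \<subseteq> bounded_borel" using S by (auto simp: A_def)
  have "A m \<inter> A n = {}" if "m < n" for m n
    using disj that by (auto simp: A_def sorted_wrt_iff_nth_less disjnt_def)
  then have disjA: "disjoint_family A" unfolding disjoint_family_on_def by (metis Int_commute linorder_neqE_nat)
  have row: "row_integral S \<omega> = (\<Sum>k<length S. fst (S ! k) \<bullet> \<Lambda> (A k) \<omega>)" for \<omega>
    unfolding row_integral_def sum_list_sum_nth by (auto simp: A_def split_beta atLeast0LessThan intro!: sum.cong)
  have "(LINT \<omega>|M. exp (\<i> * of_real (row_integral S \<omega>))) = (\<Prod>k<length S. exp (of_real (measure lborel (A k)) * \<psi> (fst (S ! k))))"
    unfolding row using A by (subst cf_sum[OF disjA A]) (auto intro!: prod.cong cf_\<Lambda>)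
  also have "\<dots> = exp (\<Sum>k<length S. of_real (measure lborel (A k)) * \<psi> (fst (S ! k)))"
    by (simp add: exp_sum)
  also have "(\<Sum>k<length S. of_real (measure lborel (A k)) * \<psi> (fst (S ! k))) = (\<Sum>(v, A)\<leftarrow>S. of_real (measure lborel A) * \<psi> v)"
    unfolding sum_list_sum_nth by (auto simp: A_def split_beta atLeast0LessThan intro!: sum.cong)
  finally show ?thesis .
qed

lemma modint_simple_fun_disjoint:
  fixes S :: "('c::euclidean_space \<times> real set) list"
  assumes S: "snd ` set S \<subseteq> bounded_borel" and disj: "sorted_wrt disjnt (map snd S)"
  shows "ennreal (\<Sum>(v, A)\<leftarrow>S. measure lborel A * w (norm v)) = modint (simple_fun S)"
  using assms
proof (induction S)
  case (Cons p S)
  obtain v A where p: "p = (v, A)" by (cases p)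
  have A: "A \<in> bounded_borel" using Cons.prems p by auto
  have [measurable]: "A \<in> sets borel" "simple_fun S \<in> borel_measurable borel"
    using A Cons.prems by (auto intro!: borel_measurable_simple_fun)
  have zero_S: "simple_fun S x = 0" if "x \<in> A" for x
  proof (rule simple_fun_eq_0)
    show "x \<notin> \<Union>(snd ` set S)" using Cons.prems(2) that p by (force simp: disjnt_def)
  qed
  have "modint (simple_fun (p # S)) = (\<integral>\<^sup>+x. ennreal (w (norm v)) * indicator A x + ennreal (w (norm (simple_fun S x))) \<partial>lborel)"
    unfolding modint_def by (intro nn_integral_cong) (auto simp: p indicator_def zero_S)
  also have "\<dots> = ennreal (w (norm v)) * emeasure lborel A + modint (simple_fun S)"
    unfolding modint_def by (subst nn_integral_add) (auto simp: nn_integral_cmult_indicator)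
  also have "emeasure lborel A = ennreal (measure lborel A)"
    using bounded_borel_finite_emeasure[OF A] by (intro emeasure_eq_ennreal_measure) auto
  also have "modint (simple_fun S) = ennreal (\<Sum>(v, A)\<leftarrow>S. measure lborel A * w (norm v))"
    using Cons by simp
  also have "ennreal (w (norm v)) * ennreal (measure lborel A) + \<dots> =
      ennreal (w (norm v) * measure lborel A + (\<Sum>(v, A)\<leftarrow>S. measure lborel A * w (norm v)))"
  proof -
    have "0 \<le> (\<Sum>(v, A)\<leftarrow>S. measure lborel A * w (norm v))"
      by (intro sum_list_nonneg) (auto simp: nonneg)
    then show ?thesis using nonneg by (simp add: ennreal_mult' ennreal_plus)
  qed
  finally show ?case by (simp add: p mult.commute)
qed (simp add: modint_def simple_fun_def)

lemma modint_simple_fun_finite: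
  fixes S :: "('c::euclidean_space \<times> real set) list"
  assumes "snd ` set S \<subseteq> bounded_borel"
  shows "modint (simple_fun S) < \<infinity>"
  using assms
proof (induction S)
  case (Cons p S)
  obtain c A where p: "p = (c, A)" by (cases p)
  have A: "A \<in> bounded_borel" using Cons.prems p by simp
  then have [measurable]: "A \<in> sets borel" by auto
  have [measurable]: "simple_fun S \<in> borel_measurable borel"
    using Cons.prems by (intro borel_measurable_simple_fun) auto
  have "modint (\<lambda>x. indicator A x *\<^sub>R c) = (\<integral>\<^sup>+x. ennreal (w (norm c)) * indicator A x \<partial>lborel)"
    unfolding modint_def by (intro nn_integral_cong) (auto simp: indicator_def)
  also have "\<dots> = ennreal (w (norm c)) * emeasure lborel A" by (rule nn_integral_cmult_indicator) simp
  also have "\<dots> < \<infinity>" using bounded_borel_finite_emeasure[OF A] by (simp add: ennreal_mult_less_top)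
  finally have 1: "modint (\<lambda>x. indicator A x *\<^sub>R c) < \<infinity>" .
  have "modint (simple_fun (p # S)) \<le> 4 * (modint (\<lambda>x. indicator A x *\<^sub>R c) + modint (simple_fun S))"
    by (rule modint_add) (auto simp: p indicator_def norm_triangle_ineq)
  also have "\<dots> < \<infinity>" using 1 Cons by (simp add: ennreal_mult_less_top)
  finally show ?case .
qed (simp add: modint_def simple_fun_def)

text \<open>On a disjoint list, independence turns the characteristic function into exp z with |z|
  at most the modular. Since a characteristic function has modulus at most 1, z lies in the left
  half plane, where exp z - 1 is no larger than z.\<close>

lemma cf_row_integral_bound:
  assumes S: "snd ` set S \<subseteq> bounded_borel"
  shows "ennreal (cmod ((LINT \<omega>|M. exp (\<i> * of_real (row_integral S \<omega>))) - 1)) \<le> modint (simple_fun S)"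
proof -
  obtain S' where S': "snd ` set S' \<subseteq> bounded_borel" "sorted_wrt disjnt (map snd S')"
    "simple_fun S' = simple_fun S" "AE \<omega> in M. row_integral S' \<omega> = row_integral S \<omega>"
    using disjoint_refinement[OF S] by (elim exE conjE)
  define z where "z = (\<Sum>(v, A)\<leftarrow>S'. of_real (measure lborel A) * \<psi> v)"
  have "(LINT \<omega>|M. exp (\<i> * of_real (row_integral S \<omega>))) = (LINT \<omega>|M. exp (\<i> * of_real (row_integral S' \<omega>)))"
    using S'(4) by (intro cf_cong_AE row_integral_measurable S S') (auto elim: AE_mp)
  also have "\<dots> = exp z" unfolding z_def by (rule cf_row_integral_disjoint[OF S'(1,2)])
  finally have eq: "(LINT \<omega>|M. exp (\<i> * of_real (row_integral S \<omega>))) = exp z" .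
  have "cmod (exp z) \<le> (LINT \<omega>|M. cmod (exp (\<i> * of_real (row_integral S \<omega>))))"
    unfolding eq[symmetric] by (rule integral_norm_bound)
  also have "\<dots> = 1" by (simp add: prob_space)
  finally have "cmod (exp z - 1) \<le> cmod z" by (rule norm_exp_minus_1_le)
  also have "\<dots> \<le> (\<Sum>(v, A)\<leftarrow>S'. cmod (of_real (measure lborel A) * \<psi> v))"
    unfolding z_def
  proof (induction S')
    case (Cons p S)
    then show ?case by (cases p) (simp add: norm_triangle_le)
  qed simp
  also have "\<dots> \<le> (\<Sum>(v, A)\<leftarrow>S'. measure lborel A * w (norm v))"
    by (intro sum_list_mono) (auto simp: norm_mult intro!: mult_left_mono \<psi>_bound)
  finally show ?thesis
    unfolding eq modint_simple_fun_disjoint[OF S'(1,2), unfolded S'(3), symmetric] by (rule ennreal_leI)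
qed

lemma row_integral_scale: "row_integral (map (\<lambda>(v, A). (\<theta> *\<^sub>R v, A)) S) \<omega> = \<theta> * row_integral S \<omega>"
  by (induction S) (auto simp: distrib_left)

text \<open>The truncation inequality asks for \<theta> up to 2 / \<epsilon>. Multiplying the
  coefficients by \<theta> costs the factor b^2 of \<open>modint_scale\<close> with b = max 1 (2 /
  \<epsilon>); the remaining 2 is that of \<open>prob_gt_le_one_minus_cos\<close>.\<close>

lemma row_integral_tail:
  assumes S: "snd ` set S \<subseteq> bounded_borel" and \<epsilon>: "0 < \<epsilon>"
  shows "ennreal (prob {\<omega> \<in> space M. \<bar>row_integral S \<omega>\<bar> > \<epsilon>}) \<le> ennreal (2 * (max 1 (2 / \<epsilon>))\<^sup>2) * modint (simple_fun S)"
proof -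
  note [measurable] = row_integral_measurable[OF S]
  have [measurable]: "simple_fun S \<in> borel_measurable borel" using S by (intro borel_measurable_simple_fun) auto
  define b where "b = max 1 (2 / \<epsilon>)"
  have "modint (simple_fun S) < \<infinity>" by (rule modint_simple_fun_finite[OF S])
  then obtain m where m: "modint (simple_fun S) = ennreal m" "0 \<le> m"
    by (cases "modint (simple_fun S)") auto
  have "prob {\<omega> \<in> space M. \<bar>row_integral S \<omega>\<bar> > \<epsilon>} \<le> 2 * (b\<^sup>2 * m)"
  proof (rule prob_gt_le_one_minus_cos)
    fix \<theta> assume \<theta>: "0 \<le> \<theta>" "\<theta> \<le> 2 / \<epsilon>"
    define S\<theta> where "S\<theta> = map (\<lambda>(v, A). (\<theta> *\<^sub>R v, A)) S"
    have S\<theta>: "snd ` set S\<theta> \<subseteq> bounded_borel" using S by (auto simp: S\<theta>_def)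
    have sf: "simple_fun S\<theta> x = \<theta> *\<^sub>R simple_fun S x" for x
      unfolding S\<theta>_def by (rule simple_fun_linear[of "(*\<^sub>R) \<theta>"]) (rule linear_scaleR)
    have int: "integrable M (\<lambda>\<omega>. exp (\<i> * of_real (\<theta> * row_integral S \<omega>)))"
      by (intro integrable_iexp) auto
    have "expectation (\<lambda>\<omega>. 1 - cos (\<theta> * row_integral S \<omega>)) = expectation (\<lambda>\<omega>. - Re (exp (\<i> * of_real (\<theta> * row_integral S \<omega>)) - 1))"
      by (intro Bochner_Integration.integral_cong) (auto simp: Re_exp)
    also have "\<dots> = - Re (LINT \<omega>|M. exp (\<i> * of_real (\<theta> * row_integral S \<omega>)) - 1)"
      using int by (subst Bochner_Integration.integral_minus, subst integral_Re) auto
    also have "(LINT \<omega>|M. exp (\<i> * of_real (\<theta> * row_integral S \<omega>)) - 1) = (LINT \<omega>|M. exp (\<i> * of_real (\<theta> * row_integral S \<omega>))) - 1"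
      using int by (subst Bochner_Integration.integral_diff) (auto simp: prob_space)
    also have "- Re \<dots> \<le> cmod \<dots>" using abs_Re_le_cmod by (metis abs_le_D2)
    finally have "ennreal (expectation (\<lambda>\<omega>. 1 - cos (\<theta> * row_integral S \<omega>))) \<le>
      ennreal (cmod ((LINT \<omega>|M. exp (\<i> * of_real (\<theta> * row_integral S \<omega>))) - 1))" by (rule ennreal_leI)
    also have "\<dots> \<le> modint (simple_fun S\<theta>)"
      using cf_row_integral_bound[OF S\<theta>] unfolding S\<theta>_def row_integral_scale .
    also have "\<dots> \<le> ennreal (b\<^sup>2) * modint (simple_fun S)"
      using \<theta> by (intro modint_scale[where c=\<theta>]) (auto simp: sf b_def)
    also have "\<dots> = ennreal (b\<^sup>2 * m)" unfolding m(1) by (simp add: ennreal_mult')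
    finally show "expectation (\<lambda>\<omega>. 1 - cos (\<theta> * row_integral S \<omega>)) \<le> b\<^sup>2 * m"
      using m(2) by (subst (asm) ennreal_le_iff) auto
  qed (use \<epsilon> m in auto)
  then have "ennreal (prob {\<omega> \<in> space M. \<bar>row_integral S \<omega>\<bar> > \<epsilon>}) \<le> ennreal (2 * b\<^sup>2 * m)"
    by (intro ennreal_leI) (simp add: mult.assoc)
  also have "\<dots> = ennreal (2 * b\<^sup>2) * ennreal m" by (rule ennreal_mult) (use m in auto)
  finally show ?thesis by (simp only: b_def m(1))
qed

end

subsection \<open>Convergence in probability\<close>

lemma measurable_dist_gt [measurable]:
  fixes X Z :: "'w \<Rightarrow> 'b::euclidean_space"
  assumes "X \<in> borel_measurable M" "Z \<in> borel_measurable M"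
  shows "{\<omega> \<in> space M. dist (X \<omega>) (Z \<omega>) > \<epsilon>} \<in> sets M"
  using assms by measurable

context prob_space
begin

lemma prob_gt_add:
  fixes X :: "'a \<Rightarrow> 'b::euclidean_space" and Y :: "'a \<Rightarrow> 'c::euclidean_space" and Z :: "'a \<Rightarrow> 'd::euclidean_space"
  assumes [measurable]: "X \<in> borel_measurable M" "Y \<in> borel_measurable M" "Z \<in> borel_measurable M"
    and le: "\<And>\<omega>. \<omega> \<in> space M \<Longrightarrow> norm (Z \<omega>) \<le> norm (X \<omega>) + norm (Y \<omega>)"
  shows "prob {\<omega> \<in> space M. norm (Z \<omega>) > a + b} \<le> prob {\<omega> \<in> space M. norm (X \<omega>) > a} + prob {\<omega> \<in> space M. norm (Y \<omega>) > b}"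
proof -
  have "{\<omega> \<in> space M. norm (Z \<omega>) > a + b} \<subseteq> {\<omega> \<in> space M. norm (X \<omega>) > a} \<union> {\<omega> \<in> space M. norm (Y \<omega>) > b}"
    using le by (force simp: not_less)
  then have "prob {\<omega> \<in> space M. norm (Z \<omega>) > a + b} \<le> prob ({\<omega> \<in> space M. norm (X \<omega>) > a} \<union> {\<omega> \<in> space M. norm (Y \<omega>) > b})"
    by (intro finite_measure_mono) auto
  also have "\<dots> \<le> prob {\<omega> \<in> space M. norm (X \<omega>) > a} + prob {\<omega> \<in> space M. norm (Y \<omega>) > b}"
    by (intro measure_Un_le) auto
  finally show ?thesis .
qed

lemma tendsto_in_prob_norm:
  fixes X :: "'i \<Rightarrow> 'a \<Rightarrow> 'b::euclidean_space"
  shows "tendsto_in_prob M X Z F \<longleftrightarrow> (\<forall>\<^sub>F i in F. X i \<in> borel_measurable M) \<and> Z \<in> borel_measurable M \<and>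
     (\<forall>\<epsilon>>0. ((\<lambda>i. prob {\<omega> \<in> space M. norm (X i \<omega> - Z \<omega>) > \<epsilon>}) \<longlongrightarrow> 0) F)"
  by (simp add: tendsto_in_prob_def dist_norm)

lemma tendsto_in_probI:
  fixes X :: "'i \<Rightarrow> 'a \<Rightarrow> 'b::euclidean_space"
  assumes "\<forall>\<^sub>F i in F. X i \<in> borel_measurable M" "Z \<in> borel_measurable M"
     "\<And>\<epsilon>. \<epsilon> > 0 \<Longrightarrow> ((\<lambda>i. prob {\<omega> \<in> space M. norm (X i \<omega> - Z \<omega>) > \<epsilon>}) \<longlongrightarrow> 0) F"
   shows "tendsto_in_prob M X Z F"
  using assms by (simp add: tendsto_in_prob_norm)

text \<open>Each half of \<epsilon> / c is allotted to one of the two error terms. Sums are the case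
  of different terms, linear images that of equal ones.\<close>

lemma tendsto_in_prob_lipschitz:
  fixes X :: "'i \<Rightarrow> 'a \<Rightarrow> 'b::euclidean_space" and Y :: "'i \<Rightarrow> 'a \<Rightarrow> 'c::euclidean_space"
    and X' :: "'i \<Rightarrow> 'a \<Rightarrow> 'd::euclidean_space"
  assumes X: "tendsto_in_prob M X Z F" and Y: "tendsto_in_prob M Y W F" and c: "0 < c"
    and m: "\<forall>\<^sub>F i in F. X' i \<in> borel_measurable M" "V \<in> borel_measurable M"
    and le: "\<forall>\<^sub>F i in F. \<forall>\<omega>\<in>space M. norm (X' i \<omega> - V \<omega>) \<le> c * (norm (X i \<omega> - Z \<omega>) + norm (Y i \<omega> - W \<omega>))"
  shows "tendsto_in_prob M X' V F"
proof (rule tendsto_in_probI[OF m])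
  fix \<epsilon> :: real assume \<epsilon>: "\<epsilon> > 0"
  note [measurable] = m(2)
  have [measurable]: "Z \<in> borel_measurable M" "W \<in> borel_measurable M" using X Y by (auto simp: tendsto_in_prob_norm)
  define e where "e = \<epsilon> / (2 * c)"
  have e: "e > 0" using \<epsilon> c by (simp add: e_def)
  have nsc: "norm ((1 / c) *\<^sub>R v) = norm v / c" for v :: 'd using c by (simp only: norm_scaleR) simp
  have "\<forall>\<^sub>F i in F. X i \<in> borel_measurable M" "\<forall>\<^sub>F i in F. Y i \<in> borel_measurable M" using X Y by (auto simp: tendsto_in_prob_norm)
  then have *: "\<forall>\<^sub>F i in F. prob {\<omega> \<in> space M. norm (X' i \<omega> - V \<omega>) > \<epsilon>} \<le>
     prob {\<omega> \<in> space M. norm (X i \<omega> - Z \<omega>) > e} + prob {\<omega> \<in> space M. norm (Y i \<omega> - W \<omega>) > e}"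
    using m(1) le
  proof eventually_elim
    case (elim i)
    note [measurable] = elim(1-3)
    have "{\<omega> \<in> space M. norm (X' i \<omega> - V \<omega>) > \<epsilon>} = {\<omega> \<in> space M. norm ((1 / c) *\<^sub>R (X' i \<omega> - V \<omega>)) > e + e}"
      unfolding nsc using c by (auto simp: e_def field_simps)
    also have "prob \<dots> \<le> prob {\<omega> \<in> space M. norm (X i \<omega> - Z \<omega>) > e} + prob {\<omega> \<in> space M. norm (Y i \<omega> - W \<omega>) > e}"
    proof (rule prob_gt_add)
      fix \<omega> assume "\<omega> \<in> space M"
      then have "norm (X' i \<omega> - V \<omega>) \<le> c * (norm (X i \<omega> - Z \<omega>) + norm (Y i \<omega> - W \<omega>))" using elim(4) by blast
      then show "norm ((1 / c) *\<^sub>R (X' i \<omega> - V \<omega>)) \<le> norm (X i \<omega> - Z \<omega>) + norm (Y i \<omega> - W \<omega>)"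
        unfolding nsc using c by (simp add: field_simps)
    qed measurable
    finally show ?case .
  qed
  have "((\<lambda>i. prob {\<omega> \<in> space M. norm (X i \<omega> - Z \<omega>) > e} + prob {\<omega> \<in> space M. norm (Y i \<omega> - W \<omega>) > e}) \<longlongrightarrow> 0 + 0) F"
    using X Y e unfolding tendsto_in_prob_norm by (intro tendsto_add) auto
  then show "((\<lambda>i. prob {\<omega> \<in> space M. norm (X' i \<omega> - V \<omega>) > \<epsilon>}) \<longlongrightarrow> 0) F"
    using * by (intro tendsto_sandwich[OF _ *, of "\<lambda>_. 0"]) auto
qed

lemma tendsto_in_prob_add:
  fixes X Y :: "'i \<Rightarrow> 'a \<Rightarrow> 'b::euclidean_space"
  assumes X: "tendsto_in_prob M X Z F" and Y: "tendsto_in_prob M Y W F"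
  shows "tendsto_in_prob M (\<lambda>i \<omega>. X i \<omega> + Y i \<omega>) (\<lambda>\<omega>. Z \<omega> + W \<omega>) F"
proof (rule tendsto_in_prob_lipschitz[OF X Y, of 1])
  have "\<forall>\<^sub>F i in F. X i \<in> borel_measurable M" "\<forall>\<^sub>F i in F. Y i \<in> borel_measurable M" using X Y by (auto simp: tendsto_in_prob_norm)
  then show "\<forall>\<^sub>F i in F. (\<lambda>\<omega>. X i \<omega> + Y i \<omega>) \<in> borel_measurable M"
    by eventually_elim measurable
  have [measurable]: "Z \<in> borel_measurable M" "W \<in> borel_measurable M" using X Y by (auto simp: tendsto_in_prob_norm)
  show "(\<lambda>\<omega>. Z \<omega> + W \<omega>) \<in> borel_measurable M" by measurable
  show "\<forall>\<^sub>F i in F. \<forall>\<omega>\<in>space M. norm (X i \<omega> + Y i \<omega> - (Z \<omega> + W \<omega>)) \<le> 1 * (norm (X i \<omega> - Z \<omega>) + norm (Y i \<omega> - W \<omega>))"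
    by (intro always_eventually allI ballI) (simp add: norm_diff_triangle_ineq)
qed simp

lemma tendsto_in_prob_linear:
  fixes X :: "'i \<Rightarrow> 'a \<Rightarrow> 'b::euclidean_space" and h :: "'b \<Rightarrow> 'c::euclidean_space"
  assumes X: "tendsto_in_prob M X Z F" and h: "linear h"
  shows "tendsto_in_prob M (\<lambda>i \<omega>. h (X i \<omega>)) (\<lambda>\<omega>. h (Z \<omega>)) F"
proof -
  have [measurable]: "h \<in> borel_measurable borel"
    using h by (intro borel_measurable_continuous_onI linear_continuous_on) (simp add: linear_conv_bounded_linear)
  obtain c where c: "c > 0" "\<And>x. norm (h x) \<le> c * norm x"
    using bounded_linear.pos_bounded[of h] h by (auto simp: linear_conv_bounded_linear mult.commute)
  show ?thesis
  proof (rule tendsto_in_prob_lipschitz[OF X X c(1)])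
    have "\<forall>\<^sub>F i in F. X i \<in> borel_measurable M" using X by (auto simp: tendsto_in_prob_norm)
    then show "\<forall>\<^sub>F i in F. (\<lambda>\<omega>. h (X i \<omega>)) \<in> borel_measurable M"
      by eventually_elim measurable
    have [measurable]: "Z \<in> borel_measurable M" using X by (auto simp: tendsto_in_prob_norm)
    show "(\<lambda>\<omega>. h (Z \<omega>)) \<in> borel_measurable M" by measurable
    have "norm (h x - h y) \<le> c * (norm (x - y) + norm (x - y))" for x y
      using c(2)[of "x - y"] c(1) by (simp add: linear_diff[OF h]) (smt (verit) mult_nonneg_nonneg norm_ge_zero distrib_left)
    then show "\<forall>\<^sub>F i in F. \<forall>\<omega>\<in>space M. norm (h (X i \<omega>) - h (Z \<omega>)) \<le> c * (norm (X i \<omega> - Z \<omega>) + norm (X i \<omega> - Z \<omega>))"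
      by (intro always_eventually allI ballI)
  qed
qed

lemma AE_zeroI_prob:
  fixes X :: "'a \<Rightarrow> 'b::euclidean_space"
  assumes [measurable]: "X \<in> borel_measurable M" and z: "\<And>\<epsilon>. \<epsilon> > 0 \<Longrightarrow> prob {\<omega> \<in> space M. norm (X \<omega>) > \<epsilon>} = 0"
  shows "AE \<omega> in M. X \<omega> = 0"
proof -
  have "AE \<omega> in M. \<forall>n. \<not> norm (X \<omega>) > inverse (real (Suc n))"
  proof (intro AE_all_countable[THEN iffD2] allI)
    fix n
    have "prob {\<omega> \<in> space M. norm (X \<omega>) > inverse (real (Suc n))} = 0" by (rule z) simp
    then have "AE \<omega> in M. \<omega> \<notin> {\<omega> \<in> space M. norm (X \<omega>) > inverse (real (Suc n))}"
      by (subst (asm) prob_eq_0) auto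
    then show "AE \<omega> in M. \<not> norm (X \<omega>) > inverse (real (Suc n))"
      using AE_space by eventually_elim auto
  qed
  then show ?thesis
  proof eventually_elim
    case (elim \<omega>)
    show ?case
    proof (rule ccontr)
      assume "X \<omega> \<noteq> 0"
      then obtain n where "inverse (real (Suc n)) < norm (X \<omega>)" using reals_Archimedean[of "norm (X \<omega>)"] by auto
      then show False using elim by auto
    qed
  qed
qed

lemma tendsto_in_prob_unique:
  fixes X :: "'i \<Rightarrow> 'a \<Rightarrow> 'b::euclidean_space"
  assumes X: "tendsto_in_prob M X Z F" "tendsto_in_prob M X W F" and F: "F \<noteq> bot"
  shows "AE \<omega> in M. Z \<omega> = W \<omega>"
proof -
  have [measurable]: "Z \<in> borel_measurable M" "W \<in> borel_measurable M" using X by (auto simp: tendsto_in_prob_norm)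
  have "AE \<omega> in M. Z \<omega> - W \<omega> = 0"
  proof (rule AE_zeroI_prob)
    fix \<epsilon> :: real assume \<epsilon>: "\<epsilon> > 0"
    define e where "e = \<epsilon> / 2"
    have e: "e > 0" using \<epsilon> by (simp add: e_def)
    have "\<forall>\<^sub>F i in F. X i \<in> borel_measurable M" using X by (auto simp: tendsto_in_prob_norm)
    then have "\<forall>\<^sub>F i in F. prob {\<omega> \<in> space M. norm (Z \<omega> - W \<omega>) > e + e} \<le>
      prob {\<omega> \<in> space M. norm (X i \<omega> - Z \<omega>) > e} + prob {\<omega> \<in> space M. norm (X i \<omega> - W \<omega>) > e}"
    proof eventually_elim
      case (elim i)
      note [measurable] = this
      show ?case by (rule prob_gt_add) (measurable, metis norm_minus_commute norm_triangle_sub diff_add_cancel add_diff_eq norm_triangle_ineq)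
    qed
    moreover have "((\<lambda>i. prob {\<omega> \<in> space M. norm (X i \<omega> - Z \<omega>) > e} + prob {\<omega> \<in> space M. norm (X i \<omega> - W \<omega>) > e}) \<longlongrightarrow> 0 + 0) F"
      using X e unfolding tendsto_in_prob_norm by (intro tendsto_add) auto
    ultimately have "prob {\<omega> \<in> space M. norm (Z \<omega> - W \<omega>) > e + e} \<le> 0 + 0"
      by (intro tendsto_lowerbound[OF _ _ F]) auto
    then show "prob {\<omega> \<in> space M. norm (Z \<omega> - W \<omega>) > \<epsilon>} = 0" by (simp add: e_def antisym)
  qed measurable
  then show ?thesis by eventually_elim simp
qed

lemma tendsto_in_prob_cong_AE:
  fixes X :: "'i \<Rightarrow> 'a \<Rightarrow> 'b::euclidean_space"
  assumes X: "tendsto_in_prob M X Z F"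
    and m: "\<forall>\<^sub>F i in F. Y i \<in> borel_measurable M" "W \<in> borel_measurable M"
    and eq: "\<forall>\<^sub>F i in F. AE \<omega> in M. X i \<omega> = Y i \<omega>" "AE \<omega> in M. Z \<omega> = W \<omega>"
  shows "tendsto_in_prob M Y W F"
proof (rule tendsto_in_probI[OF m])
  fix \<epsilon> :: real assume "\<epsilon> > 0"
  then have lim: "((\<lambda>i. prob {\<omega> \<in> space M. norm (X i \<omega> - Z \<omega>) > \<epsilon>}) \<longlongrightarrow> 0) F"
    using X by (auto simp: tendsto_in_prob_norm)
  note [measurable] = m(2)
  have [measurable]: "Z \<in> borel_measurable M" using X by (auto simp: tendsto_in_prob_norm)
  have "\<forall>\<^sub>F i in F. X i \<in> borel_measurable M" using X by (auto simp: tendsto_in_prob_norm)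
  then have "\<forall>\<^sub>F i in F. prob {\<omega> \<in> space M. norm (X i \<omega> - Z \<omega>) > \<epsilon>} = prob {\<omega> \<in> space M. norm (Y i \<omega> - W \<omega>) > \<epsilon>}"
    using m(1) eq(1)
  proof eventually_elim
    case (elim i)
    note [measurable] = elim(1,2)
    show ?case
      using elim(3) eq(2) by (intro finite_measure_eq_AE) (auto elim!: AE_mp)
  qed
  then show "((\<lambda>i. prob {\<omega> \<in> space M. norm (Y i \<omega> - W \<omega>) > \<epsilon>}) \<longlongrightarrow> 0) F"
    using lim by (rule Lim_transform_eventually[rotated])
qed

lemma AE_tendsto_in_prob:
  fixes X :: "nat \<Rightarrow> 'a \<Rightarrow> 'b::euclidean_space"
  assumes [measurable]: "\<And>n. X n \<in> borel_measurable M" "Z \<in> borel_measurable M"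
    and ae: "AE \<omega> in M. (\<lambda>n. X n \<omega>) \<longlonglongrightarrow> Z \<omega>"
  shows "tendsto_in_prob M X Z sequentially"
proof (rule tendsto_in_probI)
  fix \<epsilon> :: real assume \<epsilon>: "\<epsilon> > 0"
  have "(\<lambda>n. LINT \<omega>|M. indicator {\<omega> \<in> space M. norm (X n \<omega> - Z \<omega>) > \<epsilon>} \<omega>) \<longlonglongrightarrow> (LINT \<omega>|M. (0::real))"
  proof (rule integral_dominated_convergence[where w="\<lambda>_. 1"])
    show "AE \<omega> in M. (\<lambda>n. indicator {\<omega> \<in> space M. norm (X n \<omega> - Z \<omega>) > \<epsilon>} \<omega> :: real) \<longlonglongrightarrow> 0"
      using ae
    proof eventually_elim
      case (elim \<omega>)
      then have "(\<lambda>n. norm (X n \<omega> - Z \<omega>)) \<longlonglongrightarrow> 0" using LIM_zero tendsto_norm_zero by blast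
      then have "\<forall>\<^sub>F n in sequentially. norm (X n \<omega> - Z \<omega>) < \<epsilon>" using \<epsilon> by (rule order_tendstoD)
      then show ?case by (intro tendsto_eventually) (auto elim!: eventually_mono)
    qed
  qed (auto simp: indicator_def)
  then show "(\<lambda>n. prob {\<omega> \<in> space M. norm (X n \<omega> - Z \<omega>) > \<epsilon>}) \<longlonglongrightarrow> 0"
    by simp
qed auto

text \<open>By Borel-Cantelli, almost every path has increments that are eventually below a
  geometric sequence, so the telescoping series converges absolutely; almost sure convergence then
  implies convergence in probability.\<close>

lemma fast_cauchy_in_prob_convergent:
  fixes X :: "nat \<Rightarrow> 'a \<Rightarrow> 'b::euclidean_space"
  assumes [measurable]: "\<And>n. X n \<in> borel_measurable M"
    and fast: "\<And>n. prob {\<omega> \<in> space M. norm (X (Suc n) \<omega> - X n \<omega>) > (1/2)^n} \<le> (1/2)^n"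
  shows "\<exists>Z. tendsto_in_prob M X Z sequentially"
proof -
  have "AE \<omega> in M. \<forall>\<^sub>F n in sequentially. \<omega> \<in> space M - {\<omega> \<in> space M. norm (X (Suc n) \<omega> - X n \<omega>) > (1/2)^n}"
  proof (rule borel_cantelli_AE1)
    show "summable (\<lambda>n. measure M {\<omega> \<in> space M. norm (X (Suc n) \<omega> - X n \<omega>) > (1/2)^n})"
      by (rule summable_comparison_test_ev[of _ "\<lambda>n. (1/2)^n"]) (use fast in \<open>auto intro!: summable_geometric\<close>)
  qed (auto simp: less_top[symmetric])
  then have ae: "AE \<omega> in M. (\<lambda>n. X n \<omega>) \<longlonglongrightarrow> lim (\<lambda>n. X n \<omega>)"
  proof eventually_elim
    case (elim \<omega>)
    have "summable (\<lambda>n. X (Suc n) \<omega> - X n \<omega>)"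
    proof (rule summable_comparison_test_ev)
      show "\<forall>\<^sub>F n in sequentially. norm (X (Suc n) \<omega> - X n \<omega>) \<le> (1/2)^n"
        using elim by eventually_elim auto
    qed (auto intro: summable_geometric)
    then have "(\<lambda>n. \<Sum>k<n. X (Suc k) \<omega> - X k \<omega>) \<longlonglongrightarrow> (\<Sum>k. X (Suc k) \<omega> - X k \<omega>)"
      by (rule summable_LIMSEQ)
    then have "(\<lambda>n. (X n \<omega> - X 0 \<omega>) + X 0 \<omega>) \<longlonglongrightarrow> (\<Sum>k. X (Suc k) \<omega> - X k \<omega>) + X 0 \<omega>"
      unfolding sum_lessThan_telescope[of "\<lambda>k. X k \<omega>"] by (intro tendsto_intros)
    then have "convergent (\<lambda>n. X n \<omega>)" by (auto simp: convergent_def)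
    then show ?case by (simp add: convergent_LIMSEQ_iff)
  qed
  show ?thesis
    by (intro exI[of _ "\<lambda>\<omega>. lim (\<lambda>n. X n \<omega>)"] AE_tendsto_in_prob ae) (auto intro: borel_measurable_lim_metric)
qed

end

subsection \<open>Matrix-valued integrands\<close>

lemma linear_cvec: "linear cvec"
  by (rule linearI) (simp_all add: cvec_def vec_eq_iff complex_eq_iff)

lemma linear_cmat: "linear cmat"
  by (rule linearI) (simp_all add: cmat_def vec_eq_iff complex_eq_iff)

lemma linear_borel_measurable:
  fixes h :: "'b::euclidean_space \<Rightarrow> 'c::euclidean_space"
  shows "linear h \<Longrightarrow> h \<in> borel_measurable borel"
  by (intro borel_measurable_continuous_onI linear_continuous_on) (simp add: linear_conv_bounded_linear)

lemma linear_matrix_vector_left: "linear (\<lambda>x :: complex ^ 'm. (c :: complex ^ 'm ^ 'n) *v x)"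
  by (rule linearI) (auto simp: matrix_vector_mult_def vec_eq_iff sum.distrib distrib_left scaleR_sum_right)

lemma linear_matrix_matrix_left: "linear (\<lambda>x :: complex ^ 'm ^ 'k. (c :: complex ^ 'k ^ 'n) ** x)"
  by (rule linearI) (auto simp: matrix_matrix_mult_def vec_eq_iff sum.distrib distrib_left scaleR_sum_right)

lemma linear_row_Re: "linear (\<lambda>c :: complex ^ 'm ^ 'n. \<chi> k. Re (c $ j $ k))"
  by (rule linearI) (auto simp: vec_eq_iff)

lemma linear_row_Im: "linear (\<lambda>c :: complex ^ 'm ^ 'n. \<chi> k. Im (c $ j $ k))"
  by (rule linearI) (auto simp: vec_eq_iff)

lemma norm_row_Re_le: "norm (\<chi> k. Re (c $ j $ k)) \<le> norm (c :: complex ^ 'm ^ 'n)"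
proof -
  have "norm (\<chi> k. Re (c $ j $ k)) \<le> norm (c $ j)"
    unfolding norm_vec_def by (intro L2_set_mono) (simp_all add: abs_Re_le_cmod)
  also have "\<dots> \<le> norm c" by (rule Finite_Cartesian_Product.norm_nth_le)
  finally show ?thesis .
qed

lemma norm_row_Im_le: "norm (\<chi> k. Im (c $ j $ k)) \<le> norm (c :: complex ^ 'm ^ 'n)"
proof -
  have "norm (\<chi> k. Im (c $ j $ k)) \<le> norm (c $ j)"
    unfolding norm_vec_def by (intro L2_set_mono) (simp_all add: abs_Im_le_cmod)
  also have "\<dots> \<le> norm c" by (rule Finite_Cartesian_Product.norm_nth_le)
  finally show ?thesis .
qed

text \<open>The norm is at most the sum of the moduli of twice as many real coordinates as the
  dimension, so these cannot all stay below an equal share of \<epsilon>.\<close>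

lemma norm_cvec_component_gt:
  fixes z :: "complex ^ 'd"
  assumes "norm z > \<epsilon>"
  shows "\<exists>j. \<bar>Re (z $ j)\<bar> > \<epsilon> / (2 * CARD('d)) \<or> \<bar>Im (z $ j)\<bar> > \<epsilon> / (2 * CARD('d))"
proof (rule ccontr)
  assume c: "\<nexists>j. \<bar>Re (z $ j)\<bar> > \<epsilon> / (2 * CARD('d)) \<or> \<bar>Im (z $ j)\<bar> > \<epsilon> / (2 * CARD('d))"
  define e where "e = \<epsilon> / (2 * CARD('d))"
  have "norm z \<le> (\<Sum>j\<in>UNIV. norm (z $ j))"
    unfolding norm_vec_def by (rule L2_set_le_sum) simp
  also have "\<dots> \<le> (\<Sum>j\<in>(UNIV::'d set). 2 * e)"
  proof (rule sum_mono)
    fix j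
    have "norm (z $ j) \<le> \<bar>Re (z $ j)\<bar> + \<bar>Im (z $ j)\<bar>" by (rule cmod_le)
    also have "\<dots> \<le> e + e" using c by (intro add_mono) (auto simp: e_def not_less)
    finally show "norm (z $ j) \<le> 2 * e" by simp
  qed
  also have "\<dots> = \<epsilon>" by (simp add: e_def)
  finally show False using assms by simp
qed

definition restrict_pieces :: "real set \<Rightarrow> ('c \<times> real set) list \<Rightarrow> ('c \<times> real set) list" where
  "restrict_pieces D S = map (\<lambda>(c, A). (c, A \<inter> D)) S"

definition map_pieces :: "('b \<Rightarrow> 'c) \<Rightarrow> ('b \<times> real set) list \<Rightarrow> ('c \<times> real set) list" where
  "map_pieces h S = map (\<lambda>(c, A). (h c, A)) S"

lemma simple_fun_map_pieces: "linear h \<Longrightarrow> simple_fun (map_pieces h S) x = h (simple_fun S x)"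
  unfolding map_pieces_def by (rule simple_fun_linear)

lemma simple_fun_restrict_pieces: "simple_fun (restrict_pieces D S) x = indicator D x *\<^sub>R simple_fun S x"
  unfolding restrict_pieces_def by (rule simple_fun_restrict)

lemma pieces_sets [simp]:
  "snd ` set (map_pieces h S) = snd ` set S"
  "snd ` set S \<subseteq> bounded_borel \<Longrightarrow> D \<in> sets borel \<Longrightarrow> snd ` set (restrict_pieces D S) \<subseteq> bounded_borel"
  by (force simp: map_pieces_def restrict_pieces_def)+

lemma restrict_pieces_UNIV [simp]: "restrict_pieces UNIV S = S"
  by (simp add: restrict_pieces_def)

lemma linear_uminus: "linear (uminus :: 'c::real_vector \<Rightarrow> 'c)"
  by (rule linearI) auto

section \<open>Approximation by simple functions in the modular\<close>

context modular
begin

text \<open>The pieces are level sets of simple functions that are dominated by twice F, cut off to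
  [-n, n] to make them bounded. Pointwise convergence passes to the modular by dominated
  convergence.\<close>

lemma simple_approximation:
  fixes F :: "real \<Rightarrow> 'c::euclidean_space"
  assumes [measurable]: "F \<in> borel_measurable borel" and fin: "modint F < \<infinity>"
  shows "\<exists>S. (\<forall>n. simple_over bounded_borel (S n)) \<and> (\<forall>x. (\<lambda>n. simple_fun (S n) x) \<longlonglongrightarrow> F x) \<and>
    (\<lambda>n. modint (\<lambda>x. simple_fun (S n) x - F x)) \<longlonglongrightarrow> 0"
proof -
  obtain f where f: "\<And>i. simple_function borel (f i)" "\<And>x. (\<lambda>i. f i x) \<longlonglongrightarrow> F x"
    "\<And>i x. dist (f i x) 0 \<le> 2 * dist (F x) 0"
    using borel_measurable_implies_sequence_metric[of F borel 0] by auto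
  have f_fin: "finite (range (f i))" for i
    using f(1)[of i] by (simp add: simple_function_def)
  have f_sets: "f i -` {v} \<in> sets borel" for i v
    using measurable_sets[OF borel_measurable_simple_function[OF f(1)[of i]], of "{v}"] by simp
  define vs where "vs i = (SOME xs. set xs = range (f i) \<and> distinct xs)" for i
  have vs: "set (vs i) = range (f i)" "distinct (vs i)" for i
    using someI_ex[OF finite_distinct_list[OF f_fin[of i]]] by (auto simp: vs_def)
  define S where "S n = map (\<lambda>v. (v, f n -` {v} \<inter> {- real n..real n})) (vs n)" for n
  have sf: "simple_fun (S n) x = indicator {- real n..real n} x *\<^sub>R f n x" for n x
  proof -
    have "simple_fun (S n) x = (\<Sum>v\<leftarrow>vs n. indicator (f n -` {v} \<inter> {- real n..real n}) x *\<^sub>R v)"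
      by (simp add: simple_fun_def S_def comp_def)
    also have "\<dots> = (\<Sum>v\<in>range (f n). indicator (f n -` {v} \<inter> {- real n..real n}) x *\<^sub>R v)"
      using vs by (simp add: sum_list_distinct_conv_sum_set)
    also have "\<dots> = (\<Sum>v\<in>{f n x}. indicator (f n -` {v} \<inter> {- real n..real n}) x *\<^sub>R v)"
      using f_fin by (intro sum.mono_neutral_right) (auto simp: indicator_def)
    finally show ?thesis by (simp add: indicator_def)
  qed
  have "simple_over bounded_borel (S n)" for n
    unfolding simple_over_def
  proof
    show "snd ` set (S n) \<subseteq> bounded_borel"
      using f_sets by (auto simp: S_def bounded_borel_def intro: bounded_subset[OF bounded_closed_interval])
    have "distinct xs \<Longrightarrow> sorted_wrt disjnt (map (\<lambda>v. f n -` {v} \<inter> {- real n..real n}) xs)" for xs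
      by (induction xs) (auto simp: disjnt_def)
    then show "sorted_wrt disjnt (map snd (S n))"
      using vs(2)[of n] by (simp add: S_def comp_def)
  qed
  moreover have pt: "(\<lambda>n. simple_fun (S n) x) \<longlonglongrightarrow> F x" for x
  proof -
    have "\<forall>\<^sub>F n in sequentially. \<bar>x\<bar> \<le> real n"
      using filterlim_real_sequentially by (auto simp: filterlim_at_top)
    then have "\<forall>\<^sub>F n in sequentially. f n x = simple_fun (S n) x"
      by eventually_elim (auto simp: sf indicator_def)
    with f(2) show ?thesis by (rule Lim_transform_eventually)
  qed
  moreover have "(\<lambda>n. modint (\<lambda>x. simple_fun (S n) x - F x)) \<longlonglongrightarrow> (\<integral>\<^sup>+(x::real). 0 \<partial>lborel)"
    unfolding modint_def
  \<comment> \<open>The error is at most three times the norm of F, and \<open>scale\<close> bounds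
    w (3 x) by 9 w x.\<close>
  proof (rule nn_integral_dominated_convergence[where w="\<lambda>x. ennreal 9 * ennreal (w (norm (F x)))"])
    have [measurable]: "simple_fun (S n) \<in> borel_measurable borel" for n
      by (rule borel_measurable_simple_fun) (use f_sets in \<open>auto simp: S_def\<close>)
    show "(\<lambda>x. ennreal (w (norm (simple_fun (S n) x - F x)))) \<in> borel_measurable lborel" for n by measurable
    show "(\<integral>\<^sup>+ x. ennreal 9 * ennreal (w (norm (F x))) \<partial>lborel) < \<infinity>"
      using fin unfolding modint_def by (subst nn_integral_cmult) (auto simp: ennreal_mult_less_top)
    show "AE x in lborel. ennreal (w (norm (simple_fun (S n) x - F x))) \<le> ennreal 9 * ennreal (w (norm (F x)))" for n
    proof (rule AE_I2)
      fix x
      have "norm (simple_fun (S n) x - F x) \<le> norm (simple_fun (S n) x) + norm (F x)" by (rule norm_triangle_ineq4)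
      also have "\<dots> \<le> 3 * norm (F x)" using f(3)[of n x] by (auto simp: sf indicator_def)
      finally have "w (norm (simple_fun (S n) x - F x)) \<le> w (3 * norm (F x))" by (intro mono) auto
      also have "\<dots> \<le> 3\<^sup>2 * w (norm (F x))" by (intro scale) auto
      finally show "ennreal (w (norm (simple_fun (S n) x - F x))) \<le> ennreal 9 * ennreal (w (norm (F x)))"
        using nonneg by (subst ennreal_mult[symmetric]) (auto intro!: ennreal_leI)
    qed
    show "AE x in lborel. (\<lambda>n. ennreal (w (norm (simple_fun (S n) x - F x)))) \<longlonglongrightarrow> 0"
    proof (rule AE_I2)
      fix x
      have "(\<lambda>n. w (norm (simple_fun (S n) x - F x))) \<longlonglongrightarrow> 0"
        by (rule tendsto_norm_0) (rule LIM_zero[OF pt])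
      then show "(\<lambda>n. ennreal (w (norm (simple_fun (S n) x - F x)))) \<longlonglongrightarrow> 0"
        using tendsto_ennrealI[of _ 0] by simp
    qed
  qed auto
  ultimately show ?thesis by (intro exI[of _ S]) simp
qed

text \<open>A subsequence achieves any rate. A prescribed rate is what will make the simple
  integrals a fast Cauchy sequence in probability.\<close>

lemma fast_simple_approximation:
  fixes F :: "real \<Rightarrow> 'c::euclidean_space"
  assumes F: "F \<in> borel_measurable borel" "modint F < \<infinity>" and e: "\<And>n. e n > (0::real)"
  shows "\<exists>S. (\<forall>n. simple_over bounded_borel (S n)) \<and> (\<forall>x. (\<lambda>n. simple_fun (S n) x) \<longlonglongrightarrow> F x) \<and>
    (\<lambda>n. modint (\<lambda>x. simple_fun (S n) x - F x)) \<longlonglongrightarrow> 0 \<and> (\<forall>n. modint (\<lambda>x. simple_fun (S n) x - F x) \<le> ennreal (e n))"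
proof -
  obtain S where S: "\<forall>n. simple_over bounded_borel (S n)" "\<forall>x. (\<lambda>n. simple_fun (S n) x) \<longlonglongrightarrow> F x"
    "(\<lambda>n. modint (\<lambda>x. simple_fun (S n) x - F x)) \<longlonglongrightarrow> 0"
    using simple_approximation[OF F] by (elim exE conjE) (rule that)
  have "\<exists>k\<ge>n. modint (\<lambda>x. simple_fun (S k) x - F x) \<le> ennreal (e n)" for n
  proof -
    have "\<forall>\<^sub>F k in sequentially. modint (\<lambda>x. simple_fun (S k) x - F x) < ennreal (e n)"
      using S(3) by (rule order_tendstoD) (use e in simp)
    then obtain N where "\<forall>k\<ge>N. modint (\<lambda>x. simple_fun (S k) x - F x) < ennreal (e n)"
      by (auto simp: eventually_sequentially)
    then show ?thesis by (intro exI[of _ "max n N"]) (auto intro: less_imp_le)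
  qed
  then obtain k where k: "\<And>n. k n \<ge> n" "\<And>n. modint (\<lambda>x. simple_fun (S (k n)) x - F x) \<le> ennreal (e n)"
    by metis
  have kk: "filterlim k at_top sequentially"
    by (rule filterlim_at_top_mono[OF filterlim_ident]) (simp add: k(1))
  show ?thesis
  proof (intro exI[of _ "\<lambda>n. S (k n)"] conjI allI)
    show "simple_over bounded_borel (S (k n))" for n using S(1) by simp
    show "(\<lambda>n. simple_fun (S (k n)) x) \<longlonglongrightarrow> F x" for x by (rule filterlim_compose[OF S(2)[rule_format] kk])
    show "(\<lambda>n. modint (\<lambda>x. simple_fun (S (k n)) x - F x)) \<longlonglongrightarrow> 0" by (rule filterlim_compose[OF S(3) kk])
    show "modint (\<lambda>x. simple_fun (S (k n)) x - F x) \<le> ennreal (e n)" for n by (rule k(2))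
  qed
qed

end

context levy_integrator
begin

abbreviation mat_integral :: "((complex ^ 'd ^ 'd) \<times> real set) list \<Rightarrow> 'w \<Rightarrow> complex ^ 'd" where
  "mat_integral \<equiv> simple_integral (\<lambda>A \<omega>. cvec (\<Lambda> A \<omega>))"

lemma mat_integral_Cons [simp]: "mat_integral (p # S) \<omega> = fst p *v cvec (\<Lambda> (snd p) \<omega>) + mat_integral S \<omega>"
  and mat_integral_Nil [simp]: "mat_integral [] \<omega> = 0"
  and mat_integral_append [simp]: "mat_integral (S @ T) \<omega> = mat_integral S \<omega> + mat_integral T \<omega>"
  by (simp_all add: simple_integral_def split_beta)

lemma mat_integral_restrict:
  "simple_integral (\<lambda>A \<omega>. cvec (\<Lambda> (A \<inter> D) \<omega>)) S \<omega> = mat_integral (restrict_pieces D S) \<omega>"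
  by (induction S) (auto simp: simple_integral_def restrict_pieces_def)

lemma mat_integral_left_mult: "mat_integral (map_pieces ((**) c) S) \<omega> = c *v mat_integral S \<omega>"
  by (induction S) (auto simp: map_pieces_def linear_add[OF linear_matrix_vector_left] matrix_vector_mul_assoc)

lemma mat_integral_uminus: "mat_integral (map_pieces uminus S) \<omega> = - mat_integral S \<omega>"
proof (induction S)
  case (Cons p S)
  have "(- fst p) *v x = - (fst p *v x)" for x :: "complex ^ 'd"
    by (simp add: matrix_vector_mult_def vec_eq_iff sum_negf)
  then show ?case using Cons by (auto simp: map_pieces_def split_beta)
qed (simp add: map_pieces_def)

lemma mat_integral_measurable: "snd ` set S \<subseteq> bounded_borel \<Longrightarrow> random_variable borel (mat_integral S)"
proof (induction S)
  case (Cons p S)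
  then have [measurable]: "random_variable borel (mat_integral S)" "snd p \<in> bounded_borel" by auto
  have [measurable]: "(\<lambda>x. fst p *v cvec x) \<in> borel_measurable borel"
    using linear_compose[OF linear_cvec linear_matrix_vector_left] by (intro linear_borel_measurable) (simp add: comp_def)
  have "mat_integral (p # S) = (\<lambda>\<omega>. fst p *v cvec (\<Lambda> (snd p) \<omega>) + mat_integral S \<omega>)" by auto
  then show ?case by simp
next
  case Nil
  have "mat_integral [] = (\<lambda>_. 0)" by (simp add: fun_eq_iff)
  then show ?case by simp
qed

lemma Re_mult_cvec: "Re ((c *v cvec x) $ j) = (\<chi> k. Re (c $ j $ k)) \<bullet> x"
  by (simp add: matrix_vector_mult_def inner_vec_def cvec_def)

lemma Re_mat_integral: "Re (mat_integral S \<omega> $ j) = row_integral (map_pieces (\<lambda>c. \<chi> k. Re (c $ j $ k)) S) \<omega>"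
  by (induction S) (simp_all add: map_pieces_def split_beta Re_mult_cvec)

lemma Im_mult_cvec: "Im ((c *v cvec x) $ j) = (\<chi> k. Im (c $ j $ k)) \<bullet> x"
  by (simp add: matrix_vector_mult_def inner_vec_def cvec_def)

lemma Im_mat_integral: "Im (mat_integral S \<omega> $ j) = row_integral (map_pieces (\<lambda>c. \<chi> k. Im (c $ j $ k)) S) \<omega>"
  by (induction S) (simp_all add: map_pieces_def split_beta Im_mult_cvec)

text \<open>The factors are the number of coordinates, 2 for real and imaginary parts, and the
  constant of \<open>row_integral_tail\<close> at the level that
  \<open>norm_cvec_component_gt\<close> provides.\<close>

definition tail_const :: "real \<Rightarrow> real" where
  "tail_const \<epsilon> = real (CARD('d)) * (2 * (2 * (max 1 (2 / (\<epsilon> / (2 * CARD('d)))))\<^sup>2))"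

lemma tail_const_pos: "tail_const \<epsilon> > 0"
  unfolding tail_const_def by (auto intro!: mult_pos_pos zero_less_power simp: less_max_iff_disj)

lemma mat_integral_tail:
  assumes S: "snd ` set S \<subseteq> bounded_borel" and \<epsilon>: "0 < \<epsilon>"
  shows "ennreal (prob {\<omega> \<in> space M. norm (mat_integral S \<omega>) > \<epsilon>}) \<le> ennreal (tail_const \<epsilon>) * modint (simple_fun S)"
proof -
  define e where "e = \<epsilon> / (2 * CARD('d))"
  have e: "e > 0" using \<epsilon> by (simp add: e_def)
  let ?R = "\<lambda>j. map_pieces (\<lambda>c. \<chi> k. Re (c $ j $ k)) S" and ?I = "\<lambda>j. map_pieces (\<lambda>c. \<chi> k. Im (c $ j $ k)) S"
  have SR: "snd ` set (?R j) \<subseteq> bounded_borel" and SI: "snd ` set (?I j) \<subseteq> bounded_borel" for j using S by auto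
  note [measurable] = row_integral_measurable[OF SR] row_integral_measurable[OF SI] mat_integral_measurable[OF S]
  define K where "K = 2 * (max 1 (2 / e))\<^sup>2"
  have R: "emeasure M {\<omega> \<in> space M. \<bar>row_integral (?R j) \<omega>\<bar> > e} \<le> ennreal K * modint (simple_fun S)" for j
  proof -
    have "emeasure M {\<omega> \<in> space M. \<bar>row_integral (?R j) \<omega>\<bar> > e} \<le> ennreal K * modint (simple_fun (?R j))"
      unfolding K_def emeasure_eq_measure by (rule row_integral_tail[OF SR e])
    also have "\<dots> \<le> ennreal K * modint (simple_fun S)"
      by (intro mult_left_mono modint_mono) (auto simp: simple_fun_map_pieces[OF linear_row_Re] norm_row_Re_le)
    finally show ?thesis .
  qed
  have I: "emeasure M {\<omega> \<in> space M. \<bar>row_integral (?I j) \<omega>\<bar> > e} \<le> ennreal K * modint (simple_fun S)" for j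
  proof -
    have "emeasure M {\<omega> \<in> space M. \<bar>row_integral (?I j) \<omega>\<bar> > e} \<le> ennreal K * modint (simple_fun (?I j))"
      unfolding K_def emeasure_eq_measure by (rule row_integral_tail[OF SI e])
    also have "\<dots> \<le> ennreal K * modint (simple_fun S)"
      by (intro mult_left_mono modint_mono) (auto simp: simple_fun_map_pieces[OF linear_row_Im] norm_row_Im_le)
    finally show ?thesis .
  qed
  have "{\<omega> \<in> space M. norm (mat_integral S \<omega>) > \<epsilon>} \<subseteq>
    (\<Union>j. {\<omega> \<in> space M. \<bar>row_integral (?R j) \<omega>\<bar> > e} \<union> {\<omega> \<in> space M. \<bar>row_integral (?I j) \<omega>\<bar> > e})"
    using norm_cvec_component_gt[of \<epsilon> "mat_integral S _"] unfolding Re_mat_integral Im_mat_integral e_def[symmetric] by blast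
  then have "emeasure M {\<omega> \<in> space M. norm (mat_integral S \<omega>) > \<epsilon>} \<le>
    emeasure M (\<Union>j. {\<omega> \<in> space M. \<bar>row_integral (?R j) \<omega>\<bar> > e} \<union> {\<omega> \<in> space M. \<bar>row_integral (?I j) \<omega>\<bar> > e})"
    by (intro emeasure_mono) auto
  also have "\<dots> \<le> (\<Sum>j\<in>UNIV. emeasure M ({\<omega> \<in> space M. \<bar>row_integral (?R j) \<omega>\<bar> > e} \<union> {\<omega> \<in> space M. \<bar>row_integral (?I j) \<omega>\<bar> > e}))"
    by (rule emeasure_subadditive_finite) auto
  also have "\<dots> \<le> (\<Sum>j\<in>(UNIV::'d set). 2 * (ennreal K * modint (simple_fun S)))"
  proof (rule sum_mono)
    fix j
    have "emeasure M ({\<omega> \<in> space M. \<bar>row_integral (?R j) \<omega>\<bar> > e} \<union> {\<omega> \<in> space M. \<bar>row_integral (?I j) \<omega>\<bar> > e}) \<le>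
      emeasure M {\<omega> \<in> space M. \<bar>row_integral (?R j) \<omega>\<bar> > e} + emeasure M {\<omega> \<in> space M. \<bar>row_integral (?I j) \<omega>\<bar> > e}"
      by (rule emeasure_subadditive) auto
    also have "\<dots> \<le> ennreal K * modint (simple_fun S) + ennreal K * modint (simple_fun S)" by (intro add_mono R I)
    finally show "emeasure M ({\<omega> \<in> space M. \<bar>row_integral (?R j) \<omega>\<bar> > e} \<union> {\<omega> \<in> space M. \<bar>row_integral (?I j) \<omega>\<bar> > e}) \<le> 2 * (ennreal K * modint (simple_fun S))"
      by (simp add: mult_2)
  qed
  also have "\<dots> = ennreal (real CARD('d)) * (ennreal 2 * ennreal K) * modint (simple_fun S)"
    by (simp add: mult.assoc ennreal_of_nat_eq_real_of_nat)
  also have "ennreal (real CARD('d)) * (ennreal 2 * ennreal K) = ennreal (tail_const \<epsilon>)"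
  proof -
    have "ennreal (real CARD('d) * (2 * K)) = ennreal (real CARD('d)) * ennreal (2 * K)" by (rule ennreal_mult') simp
    also have "ennreal (2 * K) = ennreal 2 * ennreal K" by (rule ennreal_mult') simp
    finally show ?thesis by (simp add: tail_const_def e_def K_def)
  qed
  finally show ?thesis by (simp add: emeasure_eq_measure)
qed

lemma mat_integral_split:
  assumes "snd ` set S \<subseteq> bounded_borel" and D: "D \<in> sets borel"
  shows "AE \<omega> in M. mat_integral (restrict_pieces D S) \<omega> + mat_integral (restrict_pieces (- D) S) \<omega> = mat_integral S \<omega>"
  using assms(1)
proof (induction S)
  case (Cons p S)
  have p: "snd p \<in> bounded_borel" using Cons.prems by simp
  have "AE \<omega> in M. \<Lambda> ((snd p \<inter> D) \<union> (snd p \<inter> - D)) \<omega> = \<Lambda> (snd p \<inter> D) \<omega> + \<Lambda> (snd p \<inter> - D) \<omega>"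
    using p D by (intro \<Lambda>_Un) auto
  moreover have "(snd p \<inter> D) \<union> (snd p \<inter> - D) = snd p" by auto
  ultimately have "AE \<omega> in M. \<Lambda> (snd p) \<omega> = \<Lambda> (snd p \<inter> D) \<omega> + \<Lambda> (snd p \<inter> - D) \<omega>" by simp
  moreover have "AE \<omega> in M. mat_integral (restrict_pieces D S) \<omega> + mat_integral (restrict_pieces (- D) S) \<omega> = mat_integral S \<omega>"
    using Cons by simp
  ultimately show ?case
  proof eventually_elim
    case (elim \<omega>)
    show ?case
      unfolding mat_integral_Cons elim(2)[symmetric] elim(1)
      by (simp add: restrict_pieces_def split_beta linear_add[OF linear_cvec] linear_add[OF linear_matrix_vector_left])
  qed
qed (simp add: restrict_pieces_def)

lemma borel_measurable_simple_fun_bounded: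
  fixes S :: "('c::euclidean_space \<times> real set) list"
  shows "snd ` set S \<subseteq> bounded_borel \<Longrightarrow> simple_fun S \<in> borel_measurable borel"
  by (rule borel_measurable_simple_fun) auto

text \<open>Gliding hump. If the limit \<open>Z\<close> were not \<open>0\<close>, the mass of the integrals would escape along
  disjoint sets \<open>H\<^sub>k = G (j (k + 1)) - G (j k)\<close>; over the union of the \<open>H\<^sub>k\<close> with \<open>k\<close> even, the
  integrals would then alternate between being close to \<open>Z\<close> and close to \<open>0\<close>.\<close>

lemma gliding_hump:
  assumes S: "\<And>n. snd ` set (S n) \<subseteq> bounded_borel" and ae: "AE x in lborel. (\<lambda>n. simple_fun (S n) x) \<longlonglongrightarrow> 0"
    and conv: "\<And>D. D \<in> sets borel \<Longrightarrow> \<exists>Z. tendsto_in_prob M (\<lambda>n. mat_integral (restrict_pieces D (S n))) Z sequentially"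
  shows "tendsto_in_prob M (\<lambda>n. mat_integral (S n)) (\<lambda>_. 0) sequentially"
proof -
  define N where "N n D = modint (\<lambda>x. indicator D x *\<^sub>R simple_fun (S n) x)" for n D
  note [measurable] = borel_measurable_simple_fun_bounded[OF S]
  \<comment> \<open>On G j the constant w 1 on [-j, j] dominates the modular densities for all n
    from j on, so N n (G j) tends to 0 as n grows. By almost everywhere convergence these sets
    increase to the line up to a null set, so N n (- G j) tends to 0 as j grows.\<close>
  define G where "G j = {x. \<bar>x\<bar> \<le> real j \<and> (\<forall>n. n \<ge> j \<longrightarrow> norm (simple_fun (S n) x) \<le> 1)}" for j :: nat
  have G_meas [measurable]: "G j \<in> sets borel" for j
    unfolding G_def by measurable
  have G_mono: "G i \<subseteq> G j" if "i \<le> j" for i j using that by (force simp: G_def)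
  have G_ev: "AE x in lborel. \<forall>\<^sub>F j in sequentially. x \<in> G j"
    using ae
  proof eventually_elim
    case (elim x)
    have "\<forall>\<^sub>F n in sequentially. norm (simple_fun (S n) x) < 1"
      using elim by (intro order_tendstoD(2)[of _ 0]) (auto intro: tendsto_norm_zero)
    then obtain n0 where "\<And>n. n \<ge> n0 \<Longrightarrow> norm (simple_fun (S n) x) < 1" by (auto simp: eventually_sequentially)
    moreover obtain n1 where "\<bar>x\<bar> \<le> real n1" using real_arch_simple by blast
    ultimately show ?case unfolding eventually_sequentially
    proof (intro exI[of _ "max n0 n1"] allI impI)
      fix n assume "max n0 n1 \<le> n"
      then show "x \<in> G n"
        using \<open>\<bar>x\<bar> \<le> real n1\<close> \<open>\<And>n. n \<ge> n0 \<Longrightarrow> norm (simple_fun (S n) x) < 1\<close> by (auto simp: G_def less_imp_le)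
    qed
  qed
  have N_in: "(\<lambda>n. N n (G j)) \<longlonglongrightarrow> 0" for j
  proof -
    have "(\<lambda>n. N (n + j) (G j)) \<longlonglongrightarrow> (\<integral>\<^sup>+(x::real). 0 \<partial>lborel)"
      unfolding N_def modint_def
    proof (rule nn_integral_dominated_convergence[where w="\<lambda>x. ennreal (w 1) * indicator {- real j..real j} x"])
      show "(\<lambda>x. ennreal (w (norm (indicator (G j) x *\<^sub>R simple_fun (S (n + j)) x)))) \<in> borel_measurable lborel" for n
        by measurable
      show "AE x in lborel. ennreal (w (norm (indicator (G j) x *\<^sub>R simple_fun (S (n + j)) x))) \<le> ennreal (w 1) * indicator {- real j..real j} x" for n
      proof (rule AE_I2)
        fix x
        show "ennreal (w (norm (indicator (G j) x *\<^sub>R simple_fun (S (n + j)) x))) \<le> ennreal (w 1) * indicator {- real j..real j} x"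
          by (auto simp: indicator_def G_def intro!: ennreal_leI mono)
      qed
      show "AE x in lborel. (\<lambda>n. ennreal (w (norm (indicator (G j) x *\<^sub>R simple_fun (S (n + j)) x)))) \<longlonglongrightarrow> 0"
        using ae
      proof eventually_elim
        case (elim x)
        then have "(\<lambda>n. indicator (G j) x *\<^sub>R simple_fun (S (n + j)) x) \<longlonglongrightarrow> indicator (G j) x *\<^sub>R 0"
          by (intro tendsto_intros LIMSEQ_ignore_initial_segment)
        then have "(\<lambda>n. w (norm (indicator (G j) x *\<^sub>R simple_fun (S (n + j)) x))) \<longlonglongrightarrow> 0"
          by (intro tendsto_norm_0) simp
        then show ?case using tendsto_ennrealI[of _ 0] by simp
      qed
      show "(\<integral>\<^sup>+ x. ennreal (w 1) * indicator {- real j..real j} x \<partial>lborel) < \<infinity>"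
        by (subst nn_integral_cmult_indicator) (auto simp: ennreal_mult_less_top)
    qed auto
    then show ?thesis using LIMSEQ_offset[of "\<lambda>n. N n (G j)" j] by simp
  qed
  have N_out: "(\<lambda>j. N n (- G j)) \<longlonglongrightarrow> 0" for n
  proof -
    have "(\<lambda>j. N n (- G j)) \<longlonglongrightarrow> (\<integral>\<^sup>+(x::real). 0 \<partial>lborel)"
      unfolding N_def modint_def
    proof (rule nn_integral_dominated_convergence[where w="\<lambda>x. ennreal (w (norm (simple_fun (S n) x)))"])
      show "(\<lambda>x. ennreal (w (norm (indicator (- G j) x *\<^sub>R simple_fun (S n) x)))) \<in> borel_measurable lborel" for j
        by measurable
      show "AE x in lborel. ennreal (w (norm (indicator (- G j) x *\<^sub>R simple_fun (S n) x))) \<le> ennreal (w (norm (simple_fun (S n) x)))" for j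
        by (intro AE_I2 ennreal_leI) (auto simp: indicator_def nonneg)
      show "AE x in lborel. (\<lambda>j. ennreal (w (norm (indicator (- G j) x *\<^sub>R simple_fun (S n) x)))) \<longlonglongrightarrow> 0"
        using G_ev
      proof eventually_elim
        case (elim x)
        then have "\<forall>\<^sub>F j in sequentially. ennreal (w (norm (indicator (- G j) x *\<^sub>R simple_fun (S n) x))) = 0"
          by eventually_elim simp
        then show ?case by (rule tendsto_eventually)
      qed
      show "(\<integral>\<^sup>+ x. ennreal (w (norm (simple_fun (S n) x))) \<partial>lborel) < \<infinity>"
        using modint_simple_fun_finite[OF S] unfolding modint_def .
    qed auto
    then show ?thesis by simp
  qed
  obtain Z where Z: "tendsto_in_prob M (\<lambda>n. mat_integral (S n)) Z sequentially"
    using conv[of UNIV] by auto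
  have [measurable]: "Z \<in> borel_measurable M" using Z by (simp add: tendsto_in_prob_norm)
  have key: "prob {\<omega> \<in> space M. norm (Z \<omega>) > 4 * \<epsilon>} \<le> 4 * \<eta>" if \<epsilon>: "\<epsilon> > 0" and \<eta>: "\<eta> > 0" for \<epsilon> \<eta> :: real
  proof -
    \<comment> \<open>The two parts of an integrand off its hump have modular at most h each, which
      \<open>mat_integral_tail\<close> turns into a probability of at most 2 \<eta>.\<close>
    define h where "h = ennreal (\<eta> / tail_const \<epsilon>)"
    have h: "h > 0" using \<eta> tail_const_pos by (simp add: h_def)
    have "\<exists>n\<ge>k. N n (G j) \<le> h" for j k
    proof -
      have "\<forall>\<^sub>F n in sequentially. N n (G j) < h" using N_in h by (rule order_tendstoD)
      then obtain n0 where "\<And>n. n \<ge> n0 \<Longrightarrow> N n (G j) < h" by (auto simp: eventually_sequentially)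
      then show ?thesis by (intro exI[of _ "max k n0"]) (simp add: less_imp_le)
    qed
    note ex_f = this
    define f where "f j k = (SOME n. n \<ge> k \<and> N n (G j) \<le> h)" for j k
    have f: "f j k \<ge> k" "N (f j k) (G j) \<le> h" for j k
      using someI_ex[OF ex_f[of k j]] by (simp_all add: f_def)
    have "\<exists>i\<ge>j. N n (- G i) \<le> h" for j n
    proof -
      have "\<forall>\<^sub>F i in sequentially. N n (- G i) < h" using N_out h by (rule order_tendstoD)
      then obtain n0 where "\<And>i. i \<ge> n0 \<Longrightarrow> N n (- G i) < h" by (auto simp: eventually_sequentially)
      then show ?thesis by (intro exI[of _ "max j n0"]) (simp add: less_imp_le)
    qed
    note ex_g = this
    define g where "g n j = (SOME i. i \<ge> j \<and> N n (- G i) \<le> h)" for n j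
    have g: "g n j \<ge> j" "N n (- G (g n j)) \<le> h" for j n
      using someI_ex[OF ex_g[of j n]] by (simp_all add: g_def)
    \<comment> \<open>Alternating choice: given G (J k), f finds an integrand with index at least k
      that has almost no mass on this set, and g then enlarges the set until it holds almost all
      mass of that integrand. Thus the mass of S (\<nu> k) sits in H k, up to 2 h.\<close>
    define J where "J = rec_nat 0 (\<lambda>k j. g (f j k) j)"
    have J_Suc: "J (Suc k) = g (f (J k) k) (J k)" for k by (simp add: J_def)
    define \<nu> where "\<nu> k = f (J k) k" for k
    have \<nu>_ge: "\<nu> k \<ge> k" for k by (simp add: \<nu>_def f)
    have J_mono: "J i \<le> J k" if "i \<le> k" for i k
      using that by (rule lift_Suc_mono_le[rotated]) (simp add: J_Suc g)
    have N1: "N (\<nu> k) (G (J k)) \<le> h" for k by (simp add: \<nu>_def f)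
    have N2: "N (\<nu> k) (- G (J (Suc k))) \<le> h" for k by (simp add: \<nu>_def J_Suc g)
    define H where "H k = G (J (Suc k)) - G (J k)" for k
    have H_meas [measurable]: "H k \<in> sets borel" for k by (simp add: H_def)
    define D where "D = (\<Union>k. H (2 * k))"
    have D_meas [measurable]: "D \<in> sets borel" unfolding D_def by measurable
    have H_disj: "H i \<inter> H k = {}" if "i \<noteq> k" for i k
    proof -
      have "H i \<inter> H k = {}" if "i < k" for i k
        using G_mono[OF J_mono[of "Suc i" k]] that by (auto simp: H_def)
      then show ?thesis using that by (metis Int_commute linorder_neqE_nat)
    qed
    \<comment> \<open>For odd k the set D misses the hump H k, for even k its complement does. So
      the integrals over D are small along odd k and those over the complement are small along even
      k; both limits W and V are small, and their sum is Z.\<close>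
    have odd: "D \<subseteq> G (J k) \<union> - G (J (Suc k))" if "odd k" for k
    proof -
      have "H (2 * i) \<inter> H k = {}" for i by (rule H_disj) (use that in auto)
      then have "D \<inter> H k = {}" unfolding D_def by auto
      then show ?thesis by (auto simp: H_def)
    qed
    have even: "- D \<subseteq> G (J k) \<union> - G (J (Suc k))" if "even k" for k
    proof -
      obtain i where "k = 2 * i" using \<open>even k\<close> by (rule evenE)
      then have "H k \<subseteq> D" unfolding D_def by auto
      then show ?thesis by (auto simp: H_def)
    qed
    have small: "prob {\<omega> \<in> space M. norm (mat_integral (restrict_pieces E (S (\<nu> k))) \<omega>) > \<epsilon>} \<le> 2 * \<eta>"
      if E: "E \<subseteq> G (J k) \<union> - G (J (Suc k))" and E_meas: "E \<in> sets borel" for E k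
    proof -
      have "modint (simple_fun (restrict_pieces E (S (\<nu> k)))) \<le>
         (\<integral>\<^sup>+ x. ennreal (w (norm (indicator (G (J k)) x *\<^sub>R simple_fun (S (\<nu> k)) x))) +
               ennreal (w (norm (indicator (- G (J (Suc k))) x *\<^sub>R simple_fun (S (\<nu> k)) x))) \<partial>lborel)"
        unfolding modint_def
        proof (rule nn_integral_mono)
          fix x
          consider "x \<notin> E" | "x \<in> G (J k)" | "x \<notin> G (J (Suc k))" using E by blast
          then show "ennreal (w (norm (simple_fun (restrict_pieces E (S (\<nu> k))) x))) \<le>
            ennreal (w (norm (indicator (G (J k)) x *\<^sub>R simple_fun (S (\<nu> k)) x))) +
               ennreal (w (norm (indicator (- G (J (Suc k))) x *\<^sub>R simple_fun (S (\<nu> k)) x)))"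
          proof cases
            case 1
            then show ?thesis by (simp add: simple_fun_restrict_pieces)
          next
            case 2
            have "ennreal (w (norm (simple_fun (restrict_pieces E (S (\<nu> k))) x))) \<le> ennreal (w (norm (simple_fun (S (\<nu> k)) x)))"
              by (intro ennreal_leI mono) (simp_all add: simple_fun_restrict_pieces indicator_def)
            with 2 show ?thesis by (simp add: add_increasing2)
          next
            case 3
            have "ennreal (w (norm (simple_fun (restrict_pieces E (S (\<nu> k))) x))) \<le> ennreal (w (norm (simple_fun (S (\<nu> k)) x)))"
              by (intro ennreal_leI mono) (simp_all add: simple_fun_restrict_pieces indicator_def)
            with 3 show ?thesis by (simp add: add_increasing)
          qed
        qed
      also have "\<dots> = N (\<nu> k) (G (J k)) + N (\<nu> k) (- G (J (Suc k)))"
        unfolding N_def modint_def by (rule nn_integral_add; measurable)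
      also have "\<dots> \<le> h + h" by (intro add_mono N1 N2)
      finally have m: "modint (simple_fun (restrict_pieces E (S (\<nu> k)))) \<le> h + h" .
      have "ennreal (prob {\<omega> \<in> space M. norm (mat_integral (restrict_pieces E (S (\<nu> k))) \<omega>) > \<epsilon>}) \<le>
        ennreal (tail_const \<epsilon>) * modint (simple_fun (restrict_pieces E (S (\<nu> k))))"
        using S E_meas by (intro mat_integral_tail \<epsilon> pieces_sets)
      also have "\<dots> \<le> ennreal (tail_const \<epsilon>) * (h + h)" by (intro mult_left_mono m) simp
      also have "\<dots> = ennreal (tail_const \<epsilon> * (\<eta> / tail_const \<epsilon> + \<eta> / tail_const \<epsilon>))"
      proof -
        have "h + h = ennreal (\<eta> / tail_const \<epsilon> + \<eta> / tail_const \<epsilon>)"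
          unfolding h_def using \<eta> tail_const_pos[of \<epsilon>] by (intro ennreal_plus[symmetric]) auto
        then show ?thesis using tail_const_pos[of \<epsilon>] by (simp only: ennreal_mult' less_imp_le)
      qed
      also have "tail_const \<epsilon> * (\<eta> / tail_const \<epsilon> + \<eta> / tail_const \<epsilon>) = 2 * \<eta>" using tail_const_pos[of \<epsilon>] by simp
      finally show ?thesis using \<eta> by (subst (asm) ennreal_le_iff) auto
    qed
    have lim_small: "prob {\<omega> \<in> space M. norm (W \<omega>) > \<epsilon> + \<epsilon>} \<le> 2 * \<eta>"
      if W: "tendsto_in_prob M (\<lambda>n. mat_integral (restrict_pieces E (S n))) W sequentially" and E_meas: "E \<in> sets borel"
      and E: "\<And>k. E \<subseteq> G (J (r k)) \<union> - G (J (Suc (r k)))" and r: "\<And>k. r k \<ge> k" for W E r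
    proof -
      have r': "filterlim (\<lambda>k. \<nu> (r k)) at_top sequentially"
        by (rule filterlim_at_top_mono[OF filterlim_ident]) (intro always_eventually allI order_trans[OF r \<nu>_ge])
      have [measurable]: "W \<in> borel_measurable M" using W by (simp add: tendsto_in_prob_norm)
      have X_meas: "mat_integral (restrict_pieces E (S n)) \<in> borel_measurable M" for n
        using S E_meas by (intro mat_integral_measurable pieces_sets)
      have "(\<lambda>n. prob {\<omega> \<in> space M. norm (mat_integral (restrict_pieces E (S n)) \<omega> - W \<omega>) > \<epsilon>}) \<longlonglongrightarrow> 0"
        using W \<epsilon> by (simp add: tendsto_in_prob_norm)
      from filterlim_compose[OF this r']
      have "(\<lambda>k. 2 * \<eta> + prob {\<omega> \<in> space M. norm (mat_integral (restrict_pieces E (S (\<nu> (r k)))) \<omega> - W \<omega>) > \<epsilon>}) \<longlonglongrightarrow> 2 * \<eta> + 0"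
        by (intro tendsto_intros)
      moreover have "prob {\<omega> \<in> space M. norm (W \<omega>) > \<epsilon> + \<epsilon>} \<le>
         2 * \<eta> + prob {\<omega> \<in> space M. norm (mat_integral (restrict_pieces E (S (\<nu> (r k)))) \<omega> - W \<omega>) > \<epsilon>}" for k
      proof -
        note [measurable] = X_meas[of "\<nu> (r k)"]
        have "prob {\<omega> \<in> space M. norm (W \<omega>) > \<epsilon> + \<epsilon>} \<le> prob {\<omega> \<in> space M. norm (mat_integral (restrict_pieces E (S (\<nu> (r k)))) \<omega>) > \<epsilon>}
          + prob {\<omega> \<in> space M. norm (mat_integral (restrict_pieces E (S (\<nu> (r k)))) \<omega> - W \<omega>) > \<epsilon>}"
          by (rule prob_gt_add) (measurable, metis norm_minus_commute norm_triangle_sub)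
        then show ?thesis using small[OF E[of k] E_meas] by linarith
      qed
      ultimately have "prob {\<omega> \<in> space M. norm (W \<omega>) > \<epsilon> + \<epsilon>} \<le> 2 * \<eta> + 0"
        by (intro LIMSEQ_le_const) auto
      then show ?thesis by simp
    qed
    obtain W where W: "tendsto_in_prob M (\<lambda>n. mat_integral (restrict_pieces D (S n))) W sequentially"
      using conv[OF D_meas] by blast
    have D'_meas: "- D \<in> sets borel" by measurable
    obtain V where V: "tendsto_in_prob M (\<lambda>n. mat_integral (restrict_pieces (- D) (S n))) V sequentially"
      using conv[OF D'_meas] by blast
    have [measurable]: "W \<in> borel_measurable M" "V \<in> borel_measurable M" using W V by (auto simp: tendsto_in_prob_norm)
    have "tendsto_in_prob M (\<lambda>n. mat_integral (S n)) (\<lambda>\<omega>. W \<omega> + V \<omega>) sequentially"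
    proof (rule tendsto_in_prob_cong_AE[OF tendsto_in_prob_add[OF W V]])
      show "\<forall>\<^sub>F n in sequentially. AE \<omega> in M. mat_integral (restrict_pieces D (S n)) \<omega> + mat_integral (restrict_pieces (- D) (S n)) \<omega> = mat_integral (S n) \<omega>"
        using mat_integral_split[OF S D_meas] by (intro always_eventually) auto
    qed (use mat_integral_measurable[OF S] in auto)
    from tendsto_in_prob_unique[OF this Z] have ZWV: "AE \<omega> in M. W \<omega> + V \<omega> = Z \<omega>" by simp
    have pW: "prob {\<omega> \<in> space M. norm (W \<omega>) > \<epsilon> + \<epsilon>} \<le> 2 * \<eta>"
      by (rule lim_small[OF W D_meas, of "\<lambda>k. 2 * k + 1"]) (rule odd, auto)
    have pV: "prob {\<omega> \<in> space M. norm (V \<omega>) > \<epsilon> + \<epsilon>} \<le> 2 * \<eta>"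
      by (rule lim_small[OF V D'_meas, of "\<lambda>k. 2 * k"]) (rule even, auto)
    have "prob {\<omega> \<in> space M. norm (Z \<omega>) > 4 * \<epsilon>} = prob {\<omega> \<in> space M. norm (W \<omega> + V \<omega>) > (\<epsilon> + \<epsilon>) + (\<epsilon> + \<epsilon>)}"
      using ZWV by (intro finite_measure_eq_AE) (auto elim!: AE_mp)
    also have "\<dots> \<le> prob {\<omega> \<in> space M. norm (W \<omega>) > \<epsilon> + \<epsilon>} + prob {\<omega> \<in> space M. norm (V \<omega>) > \<epsilon> + \<epsilon>}"
      by (rule prob_gt_add) (auto intro: norm_triangle_ineq)
    also have "\<dots> \<le> 4 * \<eta>" using pW pV by linarith
    finally show ?thesis .
  qed
  have "AE \<omega> in M. Z \<omega> = 0"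
  proof (rule AE_zeroI_prob)
    fix \<epsilon> :: real assume "\<epsilon> > 0"
    have "prob {\<omega> \<in> space M. norm (Z \<omega>) > \<epsilon>} \<le> \<eta>" if "\<eta> > 0" for \<eta>
      using key[of "\<epsilon> / 4" "\<eta> / 4"] \<open>\<epsilon> > 0\<close> that by simp
    then have "prob {\<omega> \<in> space M. norm (Z \<omega>) > \<epsilon>} \<le> 0" by (rule field_le_epsilon[of _ 0, simplified])
    then show "prob {\<omega> \<in> space M. norm (Z \<omega>) > \<epsilon>} = 0" by (simp add: antisym)
  qed measurable
  then show ?thesis
    using Z by (intro tendsto_in_prob_cong_AE[OF Z]) (use mat_integral_measurable[OF S] in auto)
qed

end

section \<open>The integral as a continuous extension in the modular\<close>

lemma tendsto_zero_ennreal_le: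
  fixes f g :: "'i \<Rightarrow> ennreal"
  assumes "\<And>i. f i \<le> g i" "(g \<longlongrightarrow> 0) F"
  shows "(f \<longlongrightarrow> 0) F"
  by (rule tendsto_sandwich[OF _ _ tendsto_const assms(2)]) (use assms(1) in auto)

context levy_integrator
begin

text \<open>\<open>good_integral F X\<close>: \<open>X\<close> is the limit in probability of integrals of simple functions that
  converge to \<open>F\<close> in the modular of \<open>w\<close>. On functions with finite modular this is the
  Rajput--Rosinski integral, but unlike the latter it is visibly linear and continuous in \<open>F\<close>.\<close>

definition good_integral :: "(real \<Rightarrow> complex ^ 'd ^ 'd) \<Rightarrow> ('w \<Rightarrow> complex ^ 'd) \<Rightarrow> bool" where
  "good_integral F X \<longleftrightarrow> F \<in> borel_measurable borel \<and> modint F < \<infinity> \<and>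
     (\<exists>S. (\<forall>n. snd ` set (S n) \<subseteq> bounded_borel) \<and> (\<lambda>n. modint (\<lambda>x. simple_fun (S n) x - F x)) \<longlonglongrightarrow> 0 \<and>
        tendsto_in_prob M (\<lambda>n. mat_integral (S n)) X sequentially)"

lemma good_integralI:
  assumes "F \<in> borel_measurable borel" "modint F < \<infinity>" "\<And>n. snd ` set (S n) \<subseteq> bounded_borel"
    "(\<lambda>n. modint (\<lambda>x. simple_fun (S n) x - F x)) \<longlonglongrightarrow> 0" "tendsto_in_prob M (\<lambda>n. mat_integral (S n)) X sequentially"
  shows "good_integral F X"
  unfolding good_integral_def using assms by (intro conjI exI[of _ S]) auto

lemma good_integralE:
  assumes "good_integral F X"
  obtains S where "F \<in> borel_measurable borel" "modint F < \<infinity>" "\<And>n. snd ` set (S n) \<subseteq> bounded_borel"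
    "(\<lambda>n. modint (\<lambda>x. simple_fun (S n) x - F x)) \<longlonglongrightarrow> 0" "tendsto_in_prob M (\<lambda>n. mat_integral (S n)) X sequentially"
    "X \<in> borel_measurable M"
proof -
  obtain S where S: "F \<in> borel_measurable borel" "modint F < \<infinity>" "\<forall>n. snd ` set (S n) \<subseteq> bounded_borel"
    "(\<lambda>n. modint (\<lambda>x. simple_fun (S n) x - F x)) \<longlonglongrightarrow> 0" "tendsto_in_prob M (\<lambda>n. mat_integral (S n)) X sequentially"
    using assms unfolding good_integral_def by (elim exE conjE) (rule that)
  show thesis by (rule that[OF S(1,2) S(3)[rule_format] S(4,5)]) (use S(5) in \<open>simp add: tendsto_in_prob_norm\<close>)
qed

lemma good_integral_add:
  assumes F: "good_integral F X" and G: "good_integral G Y"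
  shows "good_integral (\<lambda>x. F x + G x) (\<lambda>\<omega>. X \<omega> + Y \<omega>)"
proof -
  obtain S where S: "F \<in> borel_measurable borel" "modint F < \<infinity>" "\<And>n. snd ` set (S n) \<subseteq> bounded_borel"
    "(\<lambda>n. modint (\<lambda>x. simple_fun (S n) x - F x)) \<longlonglongrightarrow> 0" "tendsto_in_prob M (\<lambda>n. mat_integral (S n)) X sequentially"
    by (rule good_integralE[OF F], rule that)
  obtain T where T: "G \<in> borel_measurable borel" "modint G < \<infinity>" "\<And>n. snd ` set (T n) \<subseteq> bounded_borel"
    "(\<lambda>n. modint (\<lambda>x. simple_fun (T n) x - G x)) \<longlonglongrightarrow> 0" "tendsto_in_prob M (\<lambda>n. mat_integral (T n)) Y sequentially"
    by (rule good_integralE[OF G], rule that)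
  note [measurable] = S(1) T(1) borel_measurable_simple_fun_bounded[OF S(3)] borel_measurable_simple_fun_bounded[OF T(3)]
  show ?thesis
  proof (rule good_integralI[where S="\<lambda>n. S n @ T n"])
    show "(\<lambda>x. F x + G x) \<in> borel_measurable borel" by measurable
    have "modint (\<lambda>x. F x + G x) \<le> 4 * (modint F + modint G)"
      by (rule modint_add) (auto intro: norm_triangle_ineq S T)
    also have "\<dots> < \<infinity>" using S(2) T(2) by (simp add: ennreal_mult_less_top)
    finally show "modint (\<lambda>x. F x + G x) < \<infinity>" .
    show "snd ` set (S n @ T n) \<subseteq> bounded_borel" for n using S(3)[of n] T(3)[of n] by auto
    show "tendsto_in_prob M (\<lambda>n. mat_integral (S n @ T n)) (\<lambda>\<omega>. X \<omega> + Y \<omega>) sequentially"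
    proof -
      have "mat_integral (S n @ T n) = (\<lambda>\<omega>. mat_integral (S n) \<omega> + mat_integral (T n) \<omega>)" for n
        by (simp add: fun_eq_iff)
      then show ?thesis using tendsto_in_prob_add[OF S(5) T(5)] by simp
    qed
    have le: "modint (\<lambda>x. simple_fun (S n @ T n) x - (F x + G x)) \<le>
       4 * (modint (\<lambda>x. simple_fun (S n) x - F x) + modint (\<lambda>x. simple_fun (T n) x - G x))" for n
      by (rule modint_add) (auto simp: norm_diff_triangle_ineq)
    have "(\<lambda>n. 4 * (modint (\<lambda>x. simple_fun (S n) x - F x) + modint (\<lambda>x. simple_fun (T n) x - G x))) \<longlonglongrightarrow> 4 * (0 + 0)"
      by (intro ennreal_tendsto_cmult tendsto_add S T) simp
    then show "(\<lambda>n. modint (\<lambda>x. simple_fun (S n @ T n) x - (F x + G x))) \<longlonglongrightarrow> 0"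
      by (intro tendsto_zero_ennreal_le[OF le]) simp
  qed
qed

text \<open>Integrands are matrices and integrals are vectors, so an operation on the former, such
  as multiplication by a fixed matrix, needs a counterpart k on the latter.\<close>

lemma good_integral_linear:
  assumes F: "good_integral F X" and h: "linear h" and k: "linear k"
    and hk: "\<And>S \<omega>. mat_integral (map_pieces h S) \<omega> = k (mat_integral S \<omega>)"
  shows "good_integral (\<lambda>x. h (F x)) (\<lambda>\<omega>. k (X \<omega>))"
proof -
  obtain S where S: "F \<in> borel_measurable borel" "modint F < \<infinity>" "\<And>n. snd ` set (S n) \<subseteq> bounded_borel"
    "(\<lambda>n. modint (\<lambda>x. simple_fun (S n) x - F x)) \<longlonglongrightarrow> 0" "tendsto_in_prob M (\<lambda>n. mat_integral (S n)) X sequentially"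
    by (rule good_integralE[OF F], rule that)
  obtain b where b: "b > 0" "\<And>x. norm (h x) \<le> b * norm x"
    using bounded_linear.pos_bounded[of h] h by (auto simp: linear_conv_bounded_linear mult.commute)
  define B where "B = max 1 b"
  note [measurable] = S(1) borel_measurable_simple_fun_bounded[OF S(3)] linear_borel_measurable[OF h]
  show ?thesis
  proof (rule good_integralI[where S="\<lambda>n. map_pieces h (S n)"])
    show "(\<lambda>x. h (F x)) \<in> borel_measurable borel" by measurable
    have "modint (\<lambda>x. h (F x)) \<le> ennreal (B\<^sup>2) * modint F"
      by (rule modint_scale[where c=b]) (use b S in \<open>auto simp: B_def\<close>)
    also have "\<dots> < \<infinity>" using S(2) by (simp add: ennreal_mult_less_top)
    finally show "modint (\<lambda>x. h (F x)) < \<infinity>" .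
    show "snd ` set (map_pieces h (S n)) \<subseteq> bounded_borel" for n using S(3)[of n] by simp
    show "tendsto_in_prob M (\<lambda>n. mat_integral (map_pieces h (S n))) (\<lambda>\<omega>. k (X \<omega>)) sequentially"
      using tendsto_in_prob_linear[OF S(5) k] unfolding hk[symmetric] .
    have le: "modint (\<lambda>x. simple_fun (map_pieces h (S n)) x - h (F x)) \<le> ennreal (B\<^sup>2) * modint (\<lambda>x. simple_fun (S n) x - F x)" for n
      by (rule modint_scale[where c=b])
         (use b in \<open>auto simp: B_def simple_fun_map_pieces[OF h] linear_diff[OF h, symmetric]\<close>)
    have "(\<lambda>n. ennreal (B\<^sup>2) * modint (\<lambda>x. simple_fun (S n) x - F x)) \<longlonglongrightarrow> ennreal (B\<^sup>2) * 0"
      by (intro ennreal_tendsto_cmult S) simp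
    then show "(\<lambda>n. modint (\<lambda>x. simple_fun (map_pieces h (S n)) x - h (F x))) \<longlonglongrightarrow> 0"
      by (intro tendsto_zero_ennreal_le[OF le]) simp
  qed
qed

lemma good_integral_left_mult: "good_integral F X \<Longrightarrow> good_integral (\<lambda>x. c ** F x) (\<lambda>\<omega>. c *v X \<omega>)"
  by (rule good_integral_linear[OF _ linear_matrix_matrix_left linear_matrix_vector_left mat_integral_left_mult])

lemma good_integral_uminus: "good_integral F X \<Longrightarrow> good_integral (\<lambda>x. - F x) (\<lambda>\<omega>. - X \<omega>)"
  by (rule good_integral_linear[OF _ linear_uminus linear_uminus mat_integral_uminus])

lemma good_integral_diff:
  "good_integral F X \<Longrightarrow> good_integral G Y \<Longrightarrow> good_integral (\<lambda>x. F x - G x) (\<lambda>\<omega>. X \<omega> - Y \<omega>)"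
  using good_integral_add[OF _ good_integral_uminus, of F X G Y] by simp

lemma good_integral_zero: "good_integral (\<lambda>x. 0) (\<lambda>\<omega>. 0)"
proof (rule good_integralI[where S="\<lambda>_. []"])
  show "tendsto_in_prob M (\<lambda>n. mat_integral []) (\<lambda>\<omega>. 0) sequentially"
    by (rule AE_tendsto_in_prob) (use mat_integral_measurable[of "[]"] in simp_all)
qed (simp_all add: modint_def)

text \<open>Half of the threshold absorbs the distance to a simple integral, the other half falls
  under \<open>mat_integral_tail\<close>. The 4 is the price of splitting the modular by
  \<open>modint_add\<close>; the approximation error disappears in the limit.\<close>

lemma good_integral_tail:
  assumes F: "good_integral F X" and \<epsilon>: "\<epsilon> > 0"
  shows "ennreal (prob {\<omega> \<in> space M. norm (X \<omega>) > \<epsilon> + \<epsilon>}) \<le> ennreal (tail_const \<epsilon>) * (4 * modint F)"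
proof -
  obtain S where S: "F \<in> borel_measurable borel" "modint F < \<infinity>" "\<And>n. snd ` set (S n) \<subseteq> bounded_borel"
    "(\<lambda>n. modint (\<lambda>x. simple_fun (S n) x - F x)) \<longlonglongrightarrow> 0" "tendsto_in_prob M (\<lambda>n. mat_integral (S n)) X sequentially"
    and [measurable]: "X \<in> borel_measurable M" by (rule good_integralE[OF F], rule that)
  note [measurable] = S(1) borel_measurable_simple_fun_bounded[OF S(3)] mat_integral_measurable[OF S(3)]
  let ?P = "\<lambda>n. ennreal (prob {\<omega> \<in> space M. norm (mat_integral (S n) \<omega> - X \<omega>) > \<epsilon>})"
  have "ennreal (prob {\<omega> \<in> space M. norm (X \<omega>) > \<epsilon> + \<epsilon>}) \<le>
    ennreal (tail_const \<epsilon>) * (4 * (modint (\<lambda>x. simple_fun (S n) x - F x) + modint F)) + ?P n" for n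
  proof -
    have "prob {\<omega> \<in> space M. norm (X \<omega>) > \<epsilon> + \<epsilon>} \<le> prob {\<omega> \<in> space M. norm (mat_integral (S n) \<omega>) > \<epsilon>} +
        prob {\<omega> \<in> space M. norm (mat_integral (S n) \<omega> - X \<omega>) > \<epsilon>}"
      by (rule prob_gt_add) (measurable, metis norm_minus_commute norm_triangle_sub)
    then have "ennreal (prob {\<omega> \<in> space M. norm (X \<omega>) > \<epsilon> + \<epsilon>}) \<le>
      ennreal (prob {\<omega> \<in> space M. norm (mat_integral (S n) \<omega>) > \<epsilon>} + prob {\<omega> \<in> space M. norm (mat_integral (S n) \<omega> - X \<omega>) > \<epsilon>})"
      by (rule ennreal_leI)
    also have "\<dots> = ennreal (prob {\<omega> \<in> space M. norm (mat_integral (S n) \<omega>) > \<epsilon>}) + ?P n"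
      by (rule ennreal_plus) simp_all
    also have "\<dots> \<le> ennreal (tail_const \<epsilon>) * modint (simple_fun (S n)) + ?P n"
      by (intro add_right_mono mat_integral_tail S \<epsilon>)
    also have "modint (simple_fun (S n)) \<le> 4 * (modint (\<lambda>x. simple_fun (S n) x - F x) + modint F)"
      by (rule modint_add) (auto simp: norm_triangle_sub add.commute)
    finally show ?thesis by (simp add: mult_left_mono)
  qed
  moreover have "(\<lambda>n. ennreal (tail_const \<epsilon>) * (4 * (modint (\<lambda>x. simple_fun (S n) x - F x) + modint F)) + ?P n) \<longlonglongrightarrow>
     ennreal (tail_const \<epsilon>) * (4 * (0 + modint F)) + ennreal 0"
    using S(5) \<epsilon> unfolding tendsto_in_prob_norm
    by (intro tendsto_add ennreal_tendsto_cmult tendsto_const S tendsto_ennrealI) auto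
  ultimately show ?thesis by (intro LIMSEQ_le_const) auto
qed

lemma good_integral_unique:
  assumes F: "good_integral F X" and G: "good_integral G Y" and eq: "AE x in lborel. F x = G x"
  shows "AE \<omega> in M. X \<omega> = Y \<omega>"
proof -
  have [measurable]: "X \<in> borel_measurable M" "Y \<in> borel_measurable M"
    using F G by (auto elim: good_integralE)
  have g: "good_integral (\<lambda>x. F x - G x) (\<lambda>\<omega>. X \<omega> - Y \<omega>)" by (rule good_integral_diff[OF F G])
  have "modint (\<lambda>x. F x - G x) = modint (\<lambda>x::real. 0::complex^'d^'d)"
    using eq by (intro modint_cong_AE) (auto elim!: AE_mp)
  also have "\<dots> = 0" by (simp add: modint_def)
  finally have z: "modint (\<lambda>x. F x - G x) = 0" .
  have "AE \<omega> in M. X \<omega> - Y \<omega> = 0"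
  proof (rule AE_zeroI_prob)
    fix \<epsilon> :: real assume "\<epsilon> > 0"
    then have "ennreal (prob {\<omega> \<in> space M. norm (X \<omega> - Y \<omega>) > \<epsilon>/2 + \<epsilon>/2}) \<le> 0"
      using good_integral_tail[OF g, of "\<epsilon>/2"] by (simp only: z) simp
    then show "prob {\<omega> \<in> space M. norm (X \<omega> - Y \<omega>) > \<epsilon>} = 0" by simp
  qed measurable
  then show ?thesis by eventually_elim simp
qed

text \<open>The error at index n enters two increments, from n to n + 1 and from n - 1 to n, hence
  the minimum over both levels. The 8 cancels the 4 of \<open>modint_add\<close> and the sum of two
  errors. At n = 0 truncated subtraction makes the two terms coincide.\<close>

definition rate :: "nat \<Rightarrow> real" where
  "rate n = min ((1/2)^n / (8 * tail_const ((1/2)^n))) ((1/2)^(n-1) / (8 * tail_const ((1/2)^(n-1))))"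

lemma rate_pos: "rate n > 0"
  using tail_const_pos by (simp add: rate_def)

lemma rate_summable: "tail_const ((1/2)^n) * (4 * (rate (Suc n) + rate n)) \<le> (1/2)^n"
proof -
  define t where "t = tail_const ((1/2)^n)"
  have t: "t > 0" by (simp add: t_def tail_const_pos)
  have "rate (Suc n) \<le> (1/2)^n / (8 * t)" "rate n \<le> (1/2)^n / (8 * t)" by (simp_all add: rate_def t_def)
  then have "t * (4 * (rate (Suc n) + rate n)) \<le> t * (4 * ((1/2)^n / (8 * t) + (1/2)^n / (8 * t)))"
    using t by (intro mult_left_mono add_mono) auto
  also have "\<dots> = (1/2)^n" using t by (simp add: field_simps)
  finally show ?thesis by (simp add: t_def)
qed

text \<open>Restriction to D does not increase the modular, so one rate yields convergence on every
  Borel set at once, as the Rajput--Rosinski definition demands.\<close>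

lemma fast_mat_integral_convergent:
  assumes S: "\<And>n. snd ` set (S n) \<subseteq> bounded_borel" and [measurable]: "F \<in> borel_measurable borel"
    and fast: "\<And>n. modint (\<lambda>x. simple_fun (S n) x - F x) \<le> ennreal (rate n)" and D: "D \<in> sets borel"
  shows "\<exists>Z. tendsto_in_prob M (\<lambda>n. mat_integral (restrict_pieces D (S n))) Z sequentially"
proof (rule fast_cauchy_in_prob_convergent)
  note [measurable] = borel_measurable_simple_fun_bounded[OF S] D
  have SD: "snd ` set (restrict_pieces D (S n)) \<subseteq> bounded_borel" for n using S D by simp
  show "mat_integral (restrict_pieces D (S n)) \<in> borel_measurable M" for n by (rule mat_integral_measurable[OF SD])
  fix n
  define T where "T = restrict_pieces D (S (Suc n)) @ map_pieces uminus (restrict_pieces D (S n))"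
  have T: "snd ` set T \<subseteq> bounded_borel" using SD[of n] SD[of "Suc n"] by (simp add: T_def image_Un)
  have sT: "simple_fun T x = indicator D x *\<^sub>R (simple_fun (S (Suc n)) x - simple_fun (S n) x)" for x
    by (simp add: T_def simple_fun_map_pieces[OF linear_uminus] simple_fun_restrict_pieces algebra_simps)
  have "modint (simple_fun T) \<le> 4 * (modint (\<lambda>x. simple_fun (S (Suc n)) x - F x) + modint (\<lambda>x. simple_fun (S n) x - F x))"
  proof (rule modint_add)
    fix x
    have "norm (simple_fun T x) \<le> norm ((simple_fun (S (Suc n)) x - F x) - (simple_fun (S n) x - F x))"
      unfolding sT by (simp add: indicator_def)
    also have "\<dots> \<le> norm (simple_fun (S (Suc n)) x - F x) + norm (simple_fun (S n) x - F x)" by (rule norm_triangle_ineq4)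
    finally show "norm (simple_fun T x) \<le> norm (simple_fun (S (Suc n)) x - F x) + norm (simple_fun (S n) x - F x)" .
  qed measurable
  also have "\<dots> \<le> 4 * (ennreal (rate (Suc n)) + ennreal (rate n))" by (intro mult_left_mono add_mono fast) auto
  also have "\<dots> = ennreal (4 * (rate (Suc n) + rate n))"
    using rate_pos[of n] rate_pos[of "Suc n"] by (simp add: ennreal_mult' ennreal_plus less_imp_le)
  finally have m: "modint (simple_fun T) \<le> ennreal (4 * (rate (Suc n) + rate n))" .
  have "ennreal (prob {\<omega> \<in> space M. norm (mat_integral T \<omega>) > (1/2)^n}) \<le> ennreal (tail_const ((1/2)^n)) * modint (simple_fun T)"
    by (rule mat_integral_tail[OF T]) simp
  also have "\<dots> \<le> ennreal (tail_const ((1/2)^n)) * ennreal (4 * (rate (Suc n) + rate n))"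
    by (intro mult_left_mono m) simp
  also have "\<dots> = ennreal (tail_const ((1/2)^n) * (4 * (rate (Suc n) + rate n)))"
    by (rule ennreal_mult'[symmetric]) (simp add: tail_const_pos less_imp_le)
  also have "\<dots> \<le> ennreal ((1/2)^n)" by (rule ennreal_leI[OF rate_summable])
  finally have "prob {\<omega> \<in> space M. norm (mat_integral T \<omega>) > (1/2)^n} \<le> (1/2)^n"
    by (subst (asm) ennreal_le_iff) auto
  then show "prob {\<omega> \<in> space M. norm (mat_integral (restrict_pieces D (S (Suc n))) \<omega> - mat_integral (restrict_pieces D (S n)) \<omega>) > (1/2)^n} \<le> (1/2)^n"
    by (simp add: T_def mat_integral_uminus)
qed

lemma has_levy_integral_exists:
  assumes F: "F \<in> borel_measurable borel" "modint F < \<infinity>"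
    and S: "\<And>n. simple_over bounded_borel (S n)" "\<And>x. (\<lambda>n. simple_fun (S n) x) \<longlonglongrightarrow> F x"
      "(\<lambda>n. modint (\<lambda>x. simple_fun (S n) x - F x)) \<longlonglongrightarrow> 0" "\<And>n. modint (\<lambda>x. simple_fun (S n) x - F x) \<le> ennreal (rate n)"
  shows "\<exists>X. tendsto_in_prob M (\<lambda>n. mat_integral (S n)) X sequentially"
    and "\<And>X. tendsto_in_prob M (\<lambda>n. mat_integral (S n)) X sequentially \<Longrightarrow> good_integral F X \<and> has_levy_integral M \<Lambda> F X"
proof -
  have bb: "snd ` set (S n) \<subseteq> bounded_borel" for n using S(1)[of n] by (simp add: simple_over_def)
  note conv = fast_mat_integral_convergent[OF bb F(1) S(4)]
  show "\<exists>X. tendsto_in_prob M (\<lambda>n. mat_integral (S n)) X sequentially"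
    using conv[of UNIV] by simp
  fix X assume X: "tendsto_in_prob M (\<lambda>n. mat_integral (S n)) X sequentially"
  have "good_integral F X" by (rule good_integralI[OF F bb S(3) X])
  moreover have "has_levy_integral M \<Lambda> F X"
    unfolding has_levy_integral_def mat_integral_restrict[abs_def]
    using S F X conv by (intro conjI exI[of _ S] ballI) auto
  ultimately show "good_integral F X \<and> has_levy_integral M \<Lambda> F X" ..
qed

lemma good_integral_exists:
  assumes F: "F \<in> borel_measurable borel" "modint F < \<infinity>"
  shows "\<exists>X. good_integral F X"
proof -
  obtain S where "\<forall>n. simple_over bounded_borel (S n)" "\<forall>x. (\<lambda>n. simple_fun (S n) x) \<longlonglongrightarrow> F x"
    "(\<lambda>n. modint (\<lambda>x. simple_fun (S n) x - F x)) \<longlonglongrightarrow> 0" "\<forall>n. modint (\<lambda>x. simple_fun (S n) x - F x) \<le> ennreal (rate n)"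
    using fast_simple_approximation[where e = rate, OF F rate_pos] by (elim exE conjE) (rule that)
  with has_levy_integral_exists[OF F, of S] show ?thesis by auto
qed

text \<open>The approximation R that belongs to the given integral converges almost everywhere,
  whereas S converges in the modular as well. Their difference tends to 0 almost everywhere and its
  integrals converge on every Borel set, so \<open>gliding_hump\<close> sends them to 0 and the
  integrals of S have the same limit X.\<close>

lemma good_integral_of_levy:
  assumes int: "has_levy_integral M \<Lambda> F X" and fin: "modint F < \<infinity>"
  shows "good_integral F X"
proof -
  obtain R where R: "\<forall>n. simple_over bounded_borel (R n)" "AE x in lborel. (\<lambda>n. simple_fun (R n) x) \<longlonglongrightarrow> F x"
    "\<forall>D\<in>sets borel. \<exists>Z. tendsto_in_prob M
             (\<lambda>n::nat. simple_integral (\<lambda>A \<omega>. cvec (\<Lambda> (A \<inter> D) \<omega>)) (R n)) Z sequentially"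
    "tendsto_in_prob M (\<lambda>n. mat_integral (R n)) X sequentially"
    and F: "F \<in> borel_measurable borel"
    using int unfolding has_levy_integral_def by (elim exE conjE) (rule that)
  obtain S where S: "\<forall>n. simple_over bounded_borel (S n)" "\<forall>x. (\<lambda>n. simple_fun (S n) x) \<longlonglongrightarrow> F x"
    "(\<lambda>n. modint (\<lambda>x. simple_fun (S n) x - F x)) \<longlonglongrightarrow> 0" "\<forall>n. modint (\<lambda>x. simple_fun (S n) x - F x) \<le> ennreal (rate n)"
    using fast_simple_approximation[where e = rate, OF F fin rate_pos] by (elim exE conjE) (rule that)
  have Sbb: "snd ` set (S n) \<subseteq> bounded_borel" for n using S(1) by (simp add: simple_over_def)
  have Rbb: "snd ` set (R n) \<subseteq> bounded_borel" for n using R(1) by (simp add: simple_over_def)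
  define U where "U n = S n @ map_pieces uminus (R n)" for n
  have U: "snd ` set (U n) \<subseteq> bounded_borel" for n using Sbb[of n] Rbb[of n] by (simp add: U_def image_Un)
  have U0: "tendsto_in_prob M (\<lambda>n. mat_integral (U n)) (\<lambda>_. 0) sequentially"
  proof (rule gliding_hump[OF U])
    show "AE x in lborel. (\<lambda>n. simple_fun (U n) x) \<longlonglongrightarrow> 0"
      using R(2)
    proof eventually_elim
      case (elim x)
      have "(\<lambda>n. simple_fun (S n) x - simple_fun (R n) x) \<longlonglongrightarrow> F x - F x"
        using S(2) elim by (intro tendsto_diff) auto
      then show ?case by (simp add: U_def simple_fun_map_pieces[OF linear_uminus])
    qed
    fix D :: "real set" assume D: "D \<in> sets borel"
    obtain Z where Z: "tendsto_in_prob M (\<lambda>n. mat_integral (restrict_pieces D (S n))) Z sequentially"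
      using fast_mat_integral_convergent[of S, OF Sbb F S(4)[rule_format] D] by blast
    obtain W where W: "tendsto_in_prob M (\<lambda>n. mat_integral (restrict_pieces D (R n))) W sequentially"
      using R(3) D unfolding mat_integral_restrict[abs_def] by blast
    have "restrict_pieces D (U n) = restrict_pieces D (S n) @ map_pieces uminus (restrict_pieces D (R n))" for n
      by (simp add: U_def restrict_pieces_def map_pieces_def split_beta comp_def)
    then have "mat_integral (restrict_pieces D (U n)) = (\<lambda>\<omega>. mat_integral (restrict_pieces D (S n)) \<omega> + - mat_integral (restrict_pieces D (R n)) \<omega>)" for n
      by (simp add: mat_integral_uminus fun_eq_iff)
    then show "\<exists>Z. tendsto_in_prob M (\<lambda>n. mat_integral (restrict_pieces D (U n))) Z sequentially"
      using tendsto_in_prob_add[OF Z tendsto_in_prob_linear[OF W linear_uminus]] by auto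
  qed
  have "tendsto_in_prob M (\<lambda>n \<omega>. mat_integral (U n) \<omega> + mat_integral (R n) \<omega>) (\<lambda>\<omega>. 0 + X \<omega>) sequentially"
    by (rule tendsto_in_prob_add[OF U0 R(4)])
  then have "tendsto_in_prob M (\<lambda>n. mat_integral (S n)) X sequentially"
    by (simp add: U_def mat_integral_uminus)
  then show ?thesis by (rule good_integralI[OF F fin Sbb S(3)])
qed

text \<open>Some integral Z of G exists in any case. The tail bound for F i - G drives X i to Z in
  probability, and limits in probability are almost surely unique.\<close>

lemma good_integral_limit:
  assumes FX: "\<forall>\<^sub>F i in I. good_integral (F i) (X i)" and G: "G \<in> borel_measurable borel" "modint G < \<infinity>"
    and lim: "((\<lambda>i. modint (\<lambda>x. F i x - G x)) \<longlongrightarrow> 0) I" and X: "tendsto_in_prob M X Y I" and I: "I \<noteq> bot"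
  shows "good_integral G Y"
proof -
  obtain Z where Z: "good_integral G Z" using good_integral_exists[OF G] by blast
  have [measurable]: "Z \<in> borel_measurable M" using Z by (auto elim: good_integralE)
  have Ym [measurable]: "Y \<in> borel_measurable M" using X by (simp add: tendsto_in_prob_norm)
  have "tendsto_in_prob M X Z I"
  proof (rule tendsto_in_probI)
    show "\<forall>\<^sub>F i in I. X i \<in> borel_measurable M" using X by (simp add: tendsto_in_prob_norm)
    fix \<epsilon> :: real assume "\<epsilon> > 0"
    define e where "e = \<epsilon> / 2"
    have e: "e > 0" "e + e = \<epsilon>" using \<open>\<epsilon> > 0\<close> by (simp_all add: e_def)
    have b: "\<forall>\<^sub>F i in I. ennreal (prob {\<omega> \<in> space M. norm (X i \<omega> - Z \<omega>) > \<epsilon>}) \<le> ennreal (tail_const e) * (4 * modint (\<lambda>x. F i x - G x))"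
      using FX
    proof eventually_elim
      case (elim i)
      show ?case using good_integral_tail[OF good_integral_diff[OF elim Z] e(1)] unfolding e(2) .
    qed
    have "((\<lambda>i. ennreal (tail_const e) * (4 * modint (\<lambda>x. F i x - G x))) \<longlongrightarrow> ennreal (tail_const e) * (4 * 0)) I"
      by (intro ennreal_tendsto_cmult lim) simp_all
    then have "((\<lambda>i. ennreal (prob {\<omega> \<in> space M. norm (X i \<omega> - Z \<omega>) > \<epsilon>})) \<longlongrightarrow> ennreal 0) I"
      by (intro tendsto_sandwich[OF _ b tendsto_const]) auto
    then show "((\<lambda>i. prob {\<omega> \<in> space M. norm (X i \<omega> - Z \<omega>) > \<epsilon>}) \<longlongrightarrow> 0) I"
      by (subst (asm) tendsto_ennreal_iff) auto
  qed measurable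
  from tendsto_in_prob_unique[OF this X I] have "AE \<omega> in M. Z \<omega> = Y \<omega>" .
  moreover obtain S where S: "\<And>n. snd ` set (S n) \<subseteq> bounded_borel"
    "(\<lambda>n. modint (\<lambda>x. simple_fun (S n) x - G x)) \<longlonglongrightarrow> 0" "tendsto_in_prob M (\<lambda>n. mat_integral (S n)) Z sequentially"
    by (rule good_integralE[OF Z], rule that)
  ultimately have "tendsto_in_prob M (\<lambda>n. mat_integral (S n)) Y sequentially"
    by (intro tendsto_in_prob_cong_AE[OF S(3)]) (use mat_integral_measurable[OF S(1)] in auto)
  then show ?thesis by (rule good_integralI[OF G S(1,2)])
qed

lemma linear_real_part: "linear (\<lambda>z :: complex ^ 'd. cvec (\<chi> i. Re (z $ i)))"
  by (rule linearI) (simp_all add: cvec_def vec_eq_iff complex_eq_iff)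

lemma mat_integral_cmat_real: "cvec (\<chi> i. Re (mat_integral (map_pieces cmat S) \<omega> $ i)) = mat_integral (map_pieces cmat S) \<omega>"
proof (induction S)
  case (Cons p S)
  have *: "cvec (\<chi> i. Re ((cmat X *v cvec x) $ i)) = cmat X *v cvec x" for X :: "real ^ 'd ^ 'd" and x
    by (simp add: vec_eq_iff cvec_def cmat_def matrix_vector_mult_def complex_eq_iff)
  have "mat_integral (map_pieces cmat (p # S)) \<omega> = cmat (fst p) *v cvec (\<Lambda> (snd p) \<omega>) + mat_integral (map_pieces cmat S) \<omega>"
    by (simp add: map_pieces_def split_beta)
  then show ?case by (simp only: linear_add[OF linear_real_part] * Cons)
next
  case Nil
  show ?case unfolding map_pieces_def list.map mat_integral_Nil using linear_0[OF linear_real_part] by simp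
qed

lemma norm_cmat: "norm (cmat X) = norm X"
  by (simp add: norm_vec_def cmat_def)

text \<open>Integrals of real simple functions are real vectors, and the real part is a continuous
  linear map that fixes them, so the limit may be replaced by its real part.\<close>

lemma has_levy_integral_real_exists:
  fixes F :: "real \<Rightarrow> real ^ 'd ^ 'd"
  assumes F: "F \<in> borel_measurable borel" "modint F < \<infinity>"
  shows "\<exists>Z. good_integral (\<lambda>x. cmat (F x)) (\<lambda>\<omega>. cvec (Z \<omega>)) \<and> has_levy_integral M \<Lambda> (\<lambda>x. cmat (F x)) (\<lambda>\<omega>. cvec (Z \<omega>))"
proof -
  obtain S where S: "\<forall>n. simple_over bounded_borel (S n)" "\<forall>x. (\<lambda>n. simple_fun (S n) x) \<longlonglongrightarrow> F x"
    "(\<lambda>n. modint (\<lambda>x. simple_fun (S n) x - F x)) \<longlonglongrightarrow> 0" "\<forall>n. modint (\<lambda>x. simple_fun (S n) x - F x) \<le> ennreal (rate n)"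
    using fast_simple_approximation[where e = rate, OF F rate_pos] by (elim exE conjE) (rule that)
  have [measurable]: "cmat \<in> borel_measurable borel" by (rule linear_borel_measurable[OF linear_cmat])
  note [measurable] = F(1)
  define T where "T n = map_pieces cmat (S n)" for n
  have sT: "simple_fun (T n) x = cmat (simple_fun (S n) x)" for n x
    unfolding T_def by (rule simple_fun_map_pieces[OF linear_cmat])
  have mT: "modint (\<lambda>x. simple_fun (T n) x - cmat (F x)) = modint (\<lambda>x. simple_fun (S n) x - F x)" for n
    unfolding modint_def sT linear_diff[OF linear_cmat, symmetric] norm_cmat ..
  have T: "\<And>n. simple_over bounded_borel (T n)" "\<And>x. (\<lambda>n. simple_fun (T n) x) \<longlonglongrightarrow> cmat (F x)"
    "(\<lambda>n. modint (\<lambda>x. simple_fun (T n) x - cmat (F x))) \<longlonglongrightarrow> 0" "\<And>n. modint (\<lambda>x. simple_fun (T n) x - cmat (F x)) \<le> ennreal (rate n)"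
  proof -
    show "simple_over bounded_borel (T n)" for n
      using S(1) by (simp add: simple_over_def T_def map_pieces_def comp_def split_beta image_image)
    have "continuous_on UNIV cmat" using linear_cmat by (intro linear_continuous_on) (simp add: linear_conv_bounded_linear)
    then show "(\<lambda>n. simple_fun (T n) x) \<longlonglongrightarrow> cmat (F x)" for x
      unfolding sT by (intro continuous_on_tendsto_compose[OF _ S(2)[rule_format]]) auto
  qed (use S(3,4) in \<open>simp_all add: mT\<close>)
  have F': "(\<lambda>x. cmat (F x)) \<in> borel_measurable borel" "modint (\<lambda>x. cmat (F x)) < \<infinity>"
    using F(2) by (measurable, simp add: modint_def norm_cmat)
  obtain X where X: "tendsto_in_prob M (\<lambda>n. mat_integral (T n)) X sequentially"
    using has_levy_integral_exists(1)[OF F' T] by blast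
  define Z where "Z \<omega> = (\<chi> i. Re (X \<omega> $ i))" for \<omega>
  from tendsto_in_prob_linear[OF X linear_real_part]
  have "tendsto_in_prob M (\<lambda>n. mat_integral (T n)) (\<lambda>\<omega>. cvec (Z \<omega>)) sequentially"
    unfolding T_def Z_def mat_integral_cmat_real .
  from has_levy_integral_exists(2)[OF F' T this] show ?thesis by blast
qed

end

subsection \<open>Fourier transforms\<close>

inductive step_function :: "(real \<Rightarrow> complex) \<Rightarrow> bool" where
  step_zero: "step_function (\<lambda>x. 0)"
| step_add: "step_function f \<Longrightarrow> step_function (\<lambda>x. c * indicator {a..<b} x + f x)"

lemma step_function_plus: "step_function f \<Longrightarrow> step_function g \<Longrightarrow> step_function (\<lambda>x. f x + g x)"
proof (induction f rule: step_function.induct)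
  case (step_add f c a b)
  then show ?case using step_function.step_add[of "\<lambda>x. f x + g x" c a b] by (simp add: add.assoc)
qed simp

lemma step_function_scale_interval:
  "step_function f \<Longrightarrow> step_function (\<lambda>x. c * indicator {a..<b} x * f x)"
proof (induction f rule: step_function.induct)
  case (step_add f c' a' b')
  have "indicator {a..<b} x * indicator {a'..<b'} x = (indicator {max a a'..<min b b'} x :: complex)" for x
    by (auto simp: indicator_def)
  then have "c * indicator {a..<b} x * (c' * indicator {a'..<b'} x + f x) =
     (c * c') * indicator {max a a'..<min b b'} x + c * indicator {a..<b} x * f x" for x
    by (simp add: distrib_left mult_ac)
  then show ?case using step_function.step_add[OF step_add.IH, of "c * c'" "max a a'" "min b b'"] by simp
qed (simp add: step_function.step_zero)

lemma step_function_mult: "step_function f \<Longrightarrow> step_function g \<Longrightarrow> step_function (\<lambda>x. f x * g x)"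
proof (induction f rule: step_function.induct)
  case (step_add f c a b)
  have "step_function (\<lambda>x. c * indicator {a..<b} x * g x + f x * g x)"
    using step_add by (intro step_function_plus step_function_scale_interval)
  then show ?case by (simp add: distrib_right)
qed (simp add: step_function.step_zero)

lemma step_function_uminus: "step_function f \<Longrightarrow> step_function (\<lambda>x. - f x)"
proof (induction f rule: step_function.induct)
  case (step_add f c a b)
  show ?case using step_function.step_add[OF step_add.IH, of "- c" a b] by simp
qed (simp add: step_function.step_zero)

text \<open>The sets whose indicator is a step function form a ring that contains the half-open
  intervals, and the hull is the smallest such ring. Since the intervals of a step function may
  overlap, unions and differences reduce to sums and products of indicators.\<close>

lemma interval_ring_step_function:
  assumes "A \<in> interval_ring" shows "step_function (indicator A)"
proof -
  have "interval_ring \<subseteq> {A. step_function (indicator A)}"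
    unfolding interval_ring_def
  proof (rule hull_minimal)
    show "{{a..<b} |a b. True} \<subseteq> {A. step_function (indicator A)}"
      using step_function.step_add[OF step_function.step_zero, of 1] by auto
    show "ring_of_sets UNIV {A. step_function (indicator A)}"
      unfolding ring_of_sets_iff
    proof (intro conjI ballI)
      show "{} \<in> {A. step_function (indicator A)}"
      proof -
        have "(indicator {} :: real \<Rightarrow> complex) = (\<lambda>x. 0)" by (simp add: fun_eq_iff)
        then show ?thesis using step_function.step_zero by simp
      qed
      fix A B assume "A \<in> {A. step_function (indicator A)}" "B \<in> {A. step_function (indicator A)}"
      then have A: "step_function (indicator A)" and B: "step_function (indicator B)" by auto
      have eq1: "(indicator (A \<union> B) :: real \<Rightarrow> complex) = (\<lambda>x. (indicator A x + indicator B x) + - (indicator A x * indicator B x))"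
        by (auto simp: indicator_def fun_eq_iff)
      show "A \<union> B \<in> {A. step_function (indicator A)}"
        unfolding mem_Collect_eq eq1
        using A B by (intro step_function_plus step_function_uminus step_function_mult)
      have eq2: "(indicator (A - B) :: real \<Rightarrow> complex) = (\<lambda>x. indicator A x + - (indicator A x * indicator B x))"
        by (auto simp: indicator_def fun_eq_iff)
      show "A - B \<in> {A. step_function (indicator A)}"
        unfolding mem_Collect_eq eq2
        using A B by (intro step_function_plus step_function_uminus step_function_mult)
    qed auto
  qed
  then show ?thesis using assms by auto
qed

lemma integrable_step_function: "step_function f \<Longrightarrow> integrable lborel f"
proof (induction f rule: step_function.induct)
  case (step_add f c a b)
  have "integrable lborel (\<lambda>x. indicator {a..<b} x *\<^sub>R c)"
    by (intro integrable_scaleR_left integrable_real_indicator) (use emeasure_bounded_finite[of "{a..<b}"] in simp_all)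
  then have "integrable lborel (\<lambda>x. c * indicator {a..<b} x)"
    by (rule Bochner_Integration.integrable_cong[THEN iffD1, rotated 2]) (auto simp: indicator_def)
  then show ?case using step_add by auto
qed simp

definition fourier_kernel :: "real \<Rightarrow> real \<Rightarrow> complex" where
  "fourier_kernel \<xi> x = exp (- \<i> * of_real (\<xi> * x))"

lemma norm_fourier_kernel [simp]: "cmod (fourier_kernel \<xi> x) = 1"
  by (simp add: fourier_kernel_def)

lemma fourier_kernel_measurable [measurable]:
  assumes [measurable]: "f \<in> borel_measurable M" "g \<in> borel_measurable M"
  shows "(\<lambda>x. fourier_kernel (f x) (g x)) \<in> borel_measurable M"
  unfolding fourier_kernel_def by measurable

lemma integrable_fourier_kernel:
  assumes "integrable lborel f" shows "integrable lborel (\<lambda>x. fourier_kernel \<xi> x * f x)"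
proof (rule Bochner_Integration.integrable_bound[OF assms])
  have [measurable]: "f \<in> borel_measurable borel" using borel_measurable_integrable[OF assms] by simp
  show "(\<lambda>x. fourier_kernel \<xi> x * f x) \<in> borel_measurable lborel" by measurable
qed (simp add: norm_mult)

lemma fourier_L1_alt: "fourier_L1 f \<xi> = (1 / sqrt (2 * pi)) * (LINT x|lborel. fourier_kernel \<xi> x * f x)"
  by (simp add: fourier_L1_def fourier_kernel_def)

lemma fourier_L1_add:
  assumes "integrable lborel f" "integrable lborel g"
  shows "fourier_L1 (\<lambda>x. f x + g x) \<xi> = fourier_L1 f \<xi> + fourier_L1 g \<xi>"
  unfolding fourier_L1_alt distrib_left
  by (subst Bochner_Integration.integral_add) (auto intro: integrable_fourier_kernel assms simp: distrib_left)

lemma fourier_L1_cmult: "fourier_L1 (\<lambda>x. c * f x) \<xi> = c * fourier_L1 f \<xi>"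
  unfolding fourier_L1_alt by (simp add: mult.left_commute[of _ c])

lemma fourier_L1_measurable [measurable]:
  assumes [measurable]: "f \<in> borel_measurable borel"
  shows "fourier_L1 f \<in> borel_measurable borel"
  unfolding fourier_L1_alt[abs_def] by measurable

lemma fourier_L1_bound: "cmod (fourier_L1 f \<xi>) \<le> (LINT x|lborel. cmod (f x))"
proof -
  have "cmod (LINT x|lborel. fourier_kernel \<xi> x * f x) \<le> (LINT x|lborel. cmod (fourier_kernel \<xi> x * f x))"
    by (rule integral_norm_bound)
  then have *: "cmod (LINT x|lborel. fourier_kernel \<xi> x * f x) \<le> (LINT x|lborel. cmod (f x))" by (simp add: norm_mult)
  have "1 \<le> sqrt (2 * pi)" using pi_gt3 by simp
  then have "1 / sqrt (2 * pi) \<le> 1" by simp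
  then have "1 / sqrt (2 * pi) * cmod (LINT x|lborel. fourier_kernel \<xi> x * f x) \<le> 1 * (LINT x|lborel. cmod (f x))"
    by (intro mult_mono *) auto
  then show ?thesis by (simp add: fourier_L1_alt norm_mult norm_divide)
qed

text \<open>The antiderivative of the kernel has modulus 1 / |\<xi>| and is evaluated at two
  endpoints; the prefactor 1 / sqrt (2 pi) is below 1.\<close>

lemma fourier_L1_interval_decay: "cmod (fourier_L1 (indicator {a..<b}) \<xi>) * \<bar>\<xi>\<bar> \<le> 2"
proof (cases "\<xi> = 0 \<or> b < a")
  case False
  then have \<xi>: "\<xi> \<noteq> 0" and ab: "a \<le> b" by auto
  define F where "F x = (\<i> / of_real \<xi>) * fourier_kernel \<xi> x" for x
  have "(LINT x|lborel. fourier_kernel \<xi> x * indicator {a..<b} x) = (LINT x|lborel. indicator {a..b} x *\<^sub>R fourier_kernel \<xi> x)"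
  proof (rule integral_cong_AE)
    show "AE x in lborel. fourier_kernel \<xi> x * indicator {a..<b} x = indicator {a..b} x *\<^sub>R fourier_kernel \<xi> x"
      using AE_lborel_singleton[of b] by eventually_elim (auto simp: indicator_def)
  qed measurable
  also have "\<dots> = F b - F a"
  proof (rule integral_FTC_Icc[OF ab])
    fix x
    have "((\<lambda>x. (\<i> / of_real \<xi>) * exp (- \<i> * of_real (\<xi> * x))) has_vector_derivative fourier_kernel \<xi> x) (at x within {a..b})"
      unfolding fourier_kernel_def has_vector_derivative_complex_iff using \<xi>
      by (auto intro!: derivative_eq_intros simp: Re_exp Im_exp Re_divide Im_divide field_simps power2_eq_square)
    then show "(F has_vector_derivative fourier_kernel \<xi> x) (at x within {a..b})"
      by (simp add: F_def[abs_def] fourier_kernel_def)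
    show "continuous_on {a..b} (fourier_kernel \<xi>)" unfolding fourier_kernel_def by (intro continuous_intros)
  qed
  finally have "cmod (LINT x|lborel. fourier_kernel \<xi> x * indicator {a..<b} x) \<le> cmod (F b) + cmod (F a)"
    by (simp add: norm_triangle_ineq4)
  then have *: "cmod (LINT x|lborel. fourier_kernel \<xi> x * indicator {a..<b} x) * \<bar>\<xi>\<bar> \<le> 2"
    using \<xi> by (simp add: F_def norm_mult norm_divide field_simps)
  have "1 \<le> sqrt (2 * pi)" using pi_gt3 by simp
  then have "1 / sqrt (2 * pi) \<le> 1" by simp
  then have "1 / sqrt (2 * pi) * (cmod (LINT x|lborel. fourier_kernel \<xi> x * indicator {a..<b} x) * \<bar>\<xi>\<bar>) \<le> 1 * 2"
    by (intro mult_mono *) auto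
  then show ?thesis by (simp add: fourier_L1_alt norm_mult norm_divide)
next
  case True
  then have "\<xi> = 0 \<or> (indicator {a..<b} :: real \<Rightarrow> complex) = (\<lambda>_. 0)" by (auto simp: indicator_def fun_eq_iff)
  then show ?thesis by (auto simp: fourier_L1_def)
qed

text \<open>Boundedness near 0 and decay like 1 / |\<xi>| at infinity place the transform in every
  L^q with q > 1, though in general not in L^1.\<close>

lemma step_function_fourier_bound:
  assumes "step_function f"
  shows "\<exists>C\<ge>0. \<forall>\<xi>. cmod (fourier_L1 f \<xi>) * max 1 \<bar>\<xi>\<bar> \<le> C"
proof -
  have "\<exists>C\<ge>0. \<forall>\<xi>. cmod (fourier_L1 f \<xi>) * \<bar>\<xi>\<bar> \<le> C"
    using assms
  proof (induction f rule: step_function.induct)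
    case step_zero
    then show ?case by (auto simp: fourier_L1_def)
  next
    case (step_add f c a b)
    then obtain C where C: "C \<ge> 0" "\<And>\<xi>. cmod (fourier_L1 f \<xi>) * \<bar>\<xi>\<bar> \<le> C" by auto
    have int: "integrable lborel (\<lambda>x. c * indicator {a..<b} x)"
      using integrable_step_function[OF step_function.step_add[OF step_function.step_zero, of c a b]] by simp
    have "cmod (fourier_L1 (\<lambda>x. c * indicator {a..<b} x + f x) \<xi>) * \<bar>\<xi>\<bar> \<le> cmod c * 2 + C" for \<xi>
    proof -
      have "cmod (fourier_L1 (\<lambda>x. c * indicator {a..<b} x + f x) \<xi>) * \<bar>\<xi>\<bar> \<le>
        (cmod c * cmod (fourier_L1 (indicator {a..<b}) \<xi>) + cmod (fourier_L1 f \<xi>)) * \<bar>\<xi>\<bar>"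
        unfolding fourier_L1_add[OF int integrable_step_function[OF step_add.hyps]] fourier_L1_cmult
        by (intro mult_right_mono) (auto simp: norm_mult[symmetric] intro: norm_triangle_ineq)
      also have "\<dots> = cmod c * (cmod (fourier_L1 (indicator {a..<b}) \<xi>) * \<bar>\<xi>\<bar>) + cmod (fourier_L1 f \<xi>) * \<bar>\<xi>\<bar>"
        by (simp add: algebra_simps)
      also have "\<dots> \<le> cmod c * 2 + C" by (intro add_mono mult_left_mono fourier_L1_interval_decay C) auto
      finally show ?thesis .
    qed
    then show ?case using C(1) by (intro exI[of _ "cmod c * 2 + C"]) auto
  qed
  then obtain C where C: "C \<ge> 0" "\<And>\<xi>. cmod (fourier_L1 f \<xi>) * \<bar>\<xi>\<bar> \<le> C" by auto
  have "0 \<le> (LINT x|lborel. cmod (f x))" by simp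
  moreover have "cmod (fourier_L1 f \<xi>) * max 1 \<bar>\<xi>\<bar> \<le> max C (LINT x|lborel. cmod (f x))" for \<xi>
    using C(2)[of \<xi>] fourier_L1_bound[of f \<xi>] by (cases "\<bar>\<xi>\<bar> \<le> 1") (auto simp: max.coboundedI1 max.coboundedI2)
  ultimately show ?thesis by (intro exI[of _ "max C (LINT x|lborel. cmod (f x))"]) (auto simp: max.coboundedI2)
qed

lemma integrable_inverse_max_powr:
  assumes "1 < \<beta>"
  shows "integrable lborel (\<lambda>x::real. (1 / max 1 \<bar>x\<bar>) powr \<beta>)"
proof (rule integrableI_bounded)
  show "(\<lambda>x::real. (1 / max 1 \<bar>x\<bar>) powr \<beta>) \<in> borel_measurable lborel" by measurable
  have tail: "(\<integral>\<^sup>+x. ennreal (x powr (- \<beta>)) * indicator {1..} x \<partial>lborel) < \<infinity>"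
  proof -
    have "(\<integral>\<^sup>+x. ennreal (x powr (- \<beta>)) * indicator {1..} x \<partial>lborel) = ennreal (0 - (1 powr (1 - \<beta>) / (1 - \<beta>)))"
    proof (rule nn_integral_FTC_atLeast[where F = "\<lambda>x. x powr (1 - \<beta>) / (1 - \<beta>)"])
      fix x :: real assume "1 \<le> x"
      then show "((\<lambda>x. x powr (1 - \<beta>) / (1 - \<beta>)) has_real_derivative x powr (- \<beta>)) (at x)"
        using assms by (auto intro!: derivative_eq_intros)
    next
      show "((\<lambda>x. x powr (1 - \<beta>) / (1 - \<beta>)) \<longlongrightarrow> 0) at_top"
        using assms by (intro tendsto_divide_zero tendsto_neg_powr filterlim_ident) auto
    qed auto
    then show ?thesis by simp
  qed
  have tail': "(\<integral>\<^sup>+x. ennreal ((- x) powr (- \<beta>)) * indicator {1..} (- x) \<partial>lborel) < \<infinity>"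
    using tail nn_integral_real_affine[of "\<lambda>x. ennreal (x powr (- \<beta>)) * indicator {1..} x" "-1" 0] by simp
  have "(\<integral>\<^sup>+x. ennreal (norm ((1 / max 1 \<bar>x\<bar>) powr \<beta>)) \<partial>lborel) \<le>
    (\<integral>\<^sup>+x. indicator {-1..1} x + (ennreal (x powr (- \<beta>)) * indicator {1..} x + ennreal ((- x) powr (- \<beta>)) * indicator {1..} (- x)) \<partial>lborel)"
  proof (rule nn_integral_mono)
    fix x :: real
    consider "x \<in> {-1..1}" | "x > 1" | "x < -1" by force
    then show "ennreal (norm ((1 / max 1 \<bar>x\<bar>) powr \<beta>)) \<le> indicator {-1..1} x + (ennreal (x powr (- \<beta>)) * indicator {1..} x + ennreal ((- x) powr (- \<beta>)) * indicator {1..} (- x))"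
    proof cases
      case 1
      then have "max 1 \<bar>x\<bar> = 1" by auto
      then show ?thesis using 1 by (simp add: add_increasing2)
    next
      case 2
      then have "(1 / max 1 \<bar>x\<bar>) powr \<beta> = x powr (- \<beta>)" by (simp add: powr_divide powr_minus_divide)
      then show ?thesis using 2 by simp
    next
      case 3
      define y where "y = - x"
      have y: "y > 1" using 3 by (simp add: y_def)
      have "max 1 \<bar>x\<bar> = y" using 3 by (auto simp: y_def)
      moreover have "(1 / y) powr \<beta> = y powr (- \<beta>)" using y by (simp add: powr_divide powr_minus_divide)
      ultimately have "(1 / max 1 \<bar>x\<bar>) powr \<beta> = (- x) powr (- \<beta>)" by (simp add: y_def)
      then show ?thesis using 3 by simp
    qed
  qed
  also have "\<dots> < \<infinity>" using tail tail' by (simp add: nn_integral_add less_top[symmetric])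
  finally show "(\<integral>\<^sup>+x. ennreal (norm ((1 / max 1 \<bar>x\<bar>) powr \<beta>)) \<partial>lborel) < \<infinity>" .
qed

section \<open>Duality and the identification of the transform on integrable functions\<close>

lemma Lr_pairing:
  fixes h \<phi> :: "real \<Rightarrow> complex"
  assumes pq: "1 < p" "1 < q" "1 / p + 1 / q = 1"
    and h: "h \<in> borel_measurable borel" "integrable lborel (\<lambda>x. norm (h x) powr p)"
    and \<phi>: "\<phi> \<in> borel_measurable borel" "integrable lborel (\<lambda>x. norm (\<phi> x) powr q)" and \<epsilon>: "\<epsilon> > 0"
  shows "integrable lborel (\<lambda>x. h x * \<phi> x)"
    and "cmod (LINT x|lborel. h x * \<phi> x) \<le> (1 / \<epsilon>) powr p * (LINT x|lborel. norm (h x) powr p) + \<epsilon> powr q * (LINT x|lborel. norm (\<phi> x) powr q)"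
proof -
  note [measurable] = h(1) \<phi>(1)
  let ?b = "\<lambda>x. (1 / \<epsilon>) powr p * norm (h x) powr p + \<epsilon> powr q * norm (\<phi> x) powr q"
  have b: "integrable lborel ?b" by (intro Bochner_Integration.integrable_add integrable_mult_right h \<phi>)
  have le: "norm (h x * \<phi> x) \<le> ?b x" for x
  proof -
    have "norm (h x * \<phi> x) = (norm (h x) / \<epsilon>) * (\<epsilon> * norm (\<phi> x))" using \<epsilon> by (simp add: norm_mult)
    also have "\<dots> \<le> (norm (h x) / \<epsilon>) powr p / p + (\<epsilon> * norm (\<phi> x)) powr q / q"
      using \<epsilon> pq by (intro Youngs_inequality) auto
    also have "\<dots> \<le> (norm (h x) / \<epsilon>) powr p / 1 + (\<epsilon> * norm (\<phi> x)) powr q / 1"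
      using pq by (intro add_mono divide_left_mono) auto
    also have "\<dots> = ?b x" using \<epsilon> by (simp add: powr_mult powr_divide)
    finally show ?thesis .
  qed
  show int: "integrable lborel (\<lambda>x. h x * \<phi> x)"
  proof (rule Bochner_Integration.integrable_bound[OF b])
    show "AE x in lborel. norm (h x * \<phi> x) \<le> norm (?b x)"
      using le by (intro AE_I2) (smt (verit) real_norm_def)
  qed measurable
  have "cmod (LINT x|lborel. h x * \<phi> x) \<le> (LINT x|lborel. ?b x)"
    by (rule Bochner_Integration.integral_norm_bound_integral[OF int b le])
  also have "\<dots> = (1 / \<epsilon>) powr p * (LINT x|lborel. norm (h x) powr p) + \<epsilon> powr q * (LINT x|lborel. norm (\<phi> x) powr q)"
    using h \<phi> by (subst Bochner_Integration.integral_add) auto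
  finally show "cmod (LINT x|lborel. h x * \<phi> x) \<le> (1 / \<epsilon>) powr p * (LINT x|lborel. norm (h x) powr p) + \<epsilon> powr q * (LINT x|lborel. norm (\<phi> x) powr q)" .
qed

text \<open>Young's inequality with a free weight \<epsilon> takes the place of Hoelder's: the
  weight is chosen first, to make the \<phi>-term small, and then n, to make the other term
  small.\<close>

lemma Lr_pairing_tendsto:
  fixes h :: "nat \<Rightarrow> real \<Rightarrow> complex" and \<phi> :: "real \<Rightarrow> complex"
  assumes pq: "1 < p" "1 < q" "1 / p + 1 / q = 1"
    and h: "\<And>n. h n \<in> borel_measurable borel" "\<And>n. integrable lborel (\<lambda>x. norm (h n x) powr p)"
    and \<phi>: "\<phi> \<in> borel_measurable borel" "integrable lborel (\<lambda>x. norm (\<phi> x) powr q)"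
    and lim: "(\<lambda>n. LINT x|lborel. norm (h n x) powr p) \<longlonglongrightarrow> 0"
  shows "(\<lambda>n. LINT x|lborel. h n x * \<phi> x) \<longlonglongrightarrow> 0"
proof (rule LIMSEQ_I)
  fix e :: real assume e: "e > 0"
  define c where "c = (LINT x|lborel. norm (\<phi> x) powr q)"
  have c: "c \<ge> 0" by (simp add: c_def)
  \<comment> \<open>Chosen so that \<epsilon> powr q * c is at most e / 2; the added 1 avoids
    division by 0.\<close>
  define \<epsilon> where "\<epsilon> = (e / (2 * (c + 1))) powr (1 / q)"
  have \<epsilon>: "\<epsilon> > 0" using e c by (simp add: \<epsilon>_def)
  have "\<epsilon> powr q = e / (2 * (c + 1))" using e c pq by (simp add: \<epsilon>_def powr_powr)
  then have "\<epsilon> powr q * c = (e / 2) * (c / (c + 1))" by simp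
  also have "\<dots> \<le> (e / 2) * 1" using e c by (intro mult_left_mono) auto
  finally have half: "\<epsilon> powr q * c \<le> e / 2" by simp
  have "(\<lambda>n. (1 / \<epsilon>) powr p * (LINT x|lborel. norm (h n x) powr p)) \<longlonglongrightarrow> (1 / \<epsilon>) powr p * 0"
    by (intro tendsto_intros lim)
  then have "\<forall>\<^sub>F n in sequentially. (1 / \<epsilon>) powr p * (LINT x|lborel. norm (h n x) powr p) < e / 2"
    by (rule order_tendstoD) (use e in simp)
  then obtain N where N: "\<And>n. n \<ge> N \<Longrightarrow> (1 / \<epsilon>) powr p * (LINT x|lborel. norm (h n x) powr p) < e / 2"
    by (auto simp: eventually_sequentially)
  show "\<exists>N. \<forall>n\<ge>N. norm ((LINT x|lborel. h n x * \<phi> x) - 0) < e"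
  proof (intro exI allI impI)
    fix n assume "n \<ge> N"
    from N[OF this] half Lr_pairing(2)[OF pq h(1)[of n] h(2)[of n] \<phi> \<epsilon>]
    show "norm ((LINT x|lborel. h n x * \<phi> x) - 0) < e" unfolding c_def by simp
  qed
qed

text \<open>Fubini, for a kernel that is symmetric in its two arguments.\<close>

lemma fourier_L1_duality:
  assumes f: "integrable lborel f" and g: "integrable lborel g"
  shows "(LINT \<xi>|lborel. fourier_L1 f \<xi> * g \<xi>) = (LINT x|lborel. f x * fourier_L1 g x)"
proof -
  have [measurable]: "f \<in> borel_measurable borel" "g \<in> borel_measurable borel"
    using f g by (auto dest: borel_measurable_integrable)
  have int: "integrable (lborel \<Otimes>\<^sub>M lborel) (\<lambda>(x, \<xi>). fourier_kernel \<xi> x * f x * g \<xi>)"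
  proof (rule lborel_pair.Fubini_integrable)
    show "(\<lambda>(x, \<xi>). fourier_kernel \<xi> x * f x * g \<xi>) \<in> borel_measurable (lborel \<Otimes>\<^sub>M lborel)" by measurable
    have "(LINT \<xi>|lborel. norm (case (x, \<xi>) of (x, \<xi>) \<Rightarrow> fourier_kernel \<xi> x * f x * g \<xi>)) = cmod (f x) * (LINT \<xi>|lborel. cmod (g \<xi>))" for x
      by (simp add: norm_mult)
    then show "integrable lborel (\<lambda>x. LINT \<xi>|lborel. norm (case (x, \<xi>) of (x, \<xi>) \<Rightarrow> fourier_kernel \<xi> x * f x * g \<xi>))"
      using f by simp
    show "AE x in lborel. integrable lborel (\<lambda>\<xi>. case (x, \<xi>) of (x, \<xi>) \<Rightarrow> fourier_kernel \<xi> x * f x * g \<xi>)"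
    proof (rule AE_I2)
      fix x :: real
      have "integrable lborel (\<lambda>\<xi>. f x * (fourier_kernel x \<xi> * g \<xi>))" by (intro integrable_mult_right integrable_fourier_kernel g)
      then show "integrable lborel (\<lambda>\<xi>. case (x, \<xi>) of (x, \<xi>) \<Rightarrow> fourier_kernel \<xi> x * f x * g \<xi>)"
        by (simp add: fourier_kernel_def mult_ac)
    qed
  qed
  let ?c = "complex_of_real (1 / sqrt (2 * pi))"
  have "(LINT \<xi>|lborel. fourier_L1 f \<xi> * g \<xi>) = (LINT \<xi>|lborel. ?c * (LINT x|lborel. fourier_kernel \<xi> x * f x * g \<xi>))"
    by (subst integral_mult_left_zero) (simp add: fourier_L1_alt)
  also have "\<dots> = ?c * (LINT \<xi>|lborel. (LINT x|lborel. fourier_kernel \<xi> x * f x * g \<xi>))" by (rule integral_mult_right_zero)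
  also have "(LINT \<xi>|lborel. (LINT x|lborel. fourier_kernel \<xi> x * f x * g \<xi>)) = (LINT x|lborel. (LINT \<xi>|lborel. fourier_kernel \<xi> x * f x * g \<xi>))"
    by (rule lborel_pair.Fubini_integral[OF int])
  also have "?c * \<dots> = (LINT x|lborel. ?c * (LINT \<xi>|lborel. fourier_kernel \<xi> x * f x * g \<xi>))" by (rule integral_mult_right_zero[symmetric])
  also have "\<dots> = (LINT x|lborel. f x * fourier_L1 g x)"
  proof (rule Bochner_Integration.integral_cong[OF refl])
    fix x
    have "(LINT \<xi>|lborel. fourier_kernel \<xi> x * f x * g \<xi>) = (LINT \<xi>|lborel. f x * (fourier_kernel x \<xi> * g \<xi>))"
      by (simp add: fourier_kernel_def mult_ac)
    then show "?c * (LINT \<xi>|lborel. fourier_kernel \<xi> x * f x * g \<xi>) = f x * fourier_L1 g x"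
      by (simp add: fourier_L1_alt)
  qed
  finally show ?thesis .
qed

text \<open>Dynkin's argument carries the hypothesis from intervals to all Borel subsets of each
  [-n, n). Testing with the sets where the real or imaginary part is positive or negative then
  forces both parts to vanish.\<close>

lemma AE_zero_if_interval_integrals_zero:
  fixes d :: "real \<Rightarrow> complex"
  assumes [measurable]: "d \<in> borel_measurable borel"
    and int: "\<And>a b. integrable lborel (\<lambda>x. indicator {a..<b} x * d x)"
    and zero: "\<And>a b. (LINT x|lborel. indicator {a..<b} x * d x) = 0"
  shows "AE x in lborel. d x = 0"
proof -
  have "AE x in lborel. x \<in> {- real n..<real n} \<longrightarrow> d x = 0" for n
  proof -
    define u where "u x = indicator {- real n..<real n} x * d x" for x
    have [measurable]: "u \<in> borel_measurable borel" unfolding u_def by measurable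
    have u: "integrable lborel u" unfolding u_def by (rule int)
    have uA: "integrable lborel (\<lambda>x. indicator A x *\<^sub>R u x)" if "A \<in> sets borel" for A
      using u that by (intro integrable_mult_indicator) auto
    let ?G = "range (\<lambda>(a, b). {a ..< b :: real})"
    have borel: "sigma_sets UNIV ?G = sets borel" by (subst borel_eq_atLeastLessThan) simp
    have A: "(LINT x|lborel. indicator A x *\<^sub>R u x) = 0" if "A \<in> sets borel" for A
    proof (rule sigma_sets_induct_disjoint[where A = A and G = ?G and \<Omega> = UNIV])
      show "Int_stable ?G"
      proof (rule Int_stableI_image)
        show "\<exists>k\<in>UNIV. (case i of (a, b) \<Rightarrow> {a..<b}) \<inter> (case j of (a, b) \<Rightarrow> {a..<b}) = (case k of (a, b) \<Rightarrow> {a..<b})"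
          for i j :: "real \<times> real"
          by (intro bexI[of _ "(max (fst i) (fst j), min (snd i) (snd j))"]) (auto split: prod.splits)
      qed
    next
      fix D assume "D \<in> ?G"
      then obtain a b where "D = {a..<b}" by auto
      then have "(\<lambda>x. indicator D x *\<^sub>R u x) = (\<lambda>x. indicator {max a (- real n)..<min b (real n)} x * d x)"
        by (auto simp: u_def indicator_def fun_eq_iff)
      then show "(LINT x|lborel. indicator D x *\<^sub>R u x) = 0" by (simp add: zero)
    next
      fix D assume "D \<in> sigma_sets UNIV ?G" and D: "(LINT x|lborel. indicator D x *\<^sub>R u x) = 0"
      then have Dm: "D \<in> sets borel" by (simp add: borel)
      have "(LINT x|lborel. indicator (UNIV - D) x *\<^sub>R u x) = (LINT x|lborel. u x - indicator D x *\<^sub>R u x)"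
        by (intro Bochner_Integration.integral_cong) (auto simp: indicator_def)
      also have "\<dots> = (LINT x|lborel. u x) - 0" using u uA[OF Dm] D by simp
      finally show "(LINT x|lborel. indicator (UNIV - D) x *\<^sub>R u x) = 0" unfolding u_def by (simp add: zero)
    next
      fix D :: "nat \<Rightarrow> real set"
      assume D: "disjoint_family D" "range D \<subseteq> sigma_sets UNIV ?G" "\<And>i. (LINT x|lborel. indicator (D i) x *\<^sub>R u x) = 0"
      have Dm: "D i \<in> sets borel" for i using D(2) by (auto simp: borel)
      have "(LINT x:(\<Union>i. D i)|lborel. u x) = (\<Sum>i. (LINT x:(D i)|lborel. u x))"
        using D(1) Dm uA[of "\<Union>i. D i"]
        by (intro lebesgue_integral_countable_add) (auto simp: disjoint_family_on_def set_integrable_def)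
      then show "(LINT x|lborel. indicator (\<Union>i. D i) x *\<^sub>R u x) = 0"
        using D(3) by (simp add: set_lebesgue_integral_def)
    qed (use that in \<open>auto simp: borel\<close>)
    have part: "AE x in lborel. v x = 0"
      if v: "integrable lborel v" "\<And>A. A \<in> sets borel \<Longrightarrow> (LINT x|lborel. indicator A x *\<^sub>R v x) = 0" for v :: "real \<Rightarrow> real"
    proof -
      have [measurable]: "v \<in> borel_measurable borel" using v(1) by (auto dest: borel_measurable_integrable)
      have iA: "integrable lborel (\<lambda>x. indicator A x *\<^sub>R v x)" if "A \<in> sets borel" for A
        using v that by (intro integrable_mult_indicator) auto
      have "AE x in lborel. indicator {x. v x > 0} x *\<^sub>R v x = 0"
        using v(2)[of "{x. v x > 0}"] iA[of "{x. v x > 0}"]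
        by (subst integral_nonneg_eq_0_iff_AE[symmetric]) (auto simp: indicator_def)
      moreover have "AE x in lborel. - (indicator {x. v x < 0} x *\<^sub>R v x) = 0"
        using v(2)[of "{x. v x < 0}"] iA[of "{x. v x < 0}"]
        by (subst integral_nonneg_eq_0_iff_AE[symmetric]) (auto simp: indicator_def)
      ultimately show ?thesis by eventually_elim (auto simp: indicator_def split: if_splits)
    qed
    have "AE x in lborel. Re (u x) = 0"
    proof (rule part)
      fix A :: "real set" assume "A \<in> sets borel"
      then show "(LINT x|lborel. indicator A x *\<^sub>R Re (u x)) = 0"
        using A[of A] uA[of A] integral_Re[of lborel "\<lambda>x. indicator A x *\<^sub>R u x"] by simp
    qed (use u in simp)
    moreover have "AE x in lborel. Im (u x) = 0"
    proof (rule part)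
      fix A :: "real set" assume "A \<in> sets borel"
      then show "(LINT x|lborel. indicator A x *\<^sub>R Im (u x)) = 0"
        using A[of A] uA[of A] integral_Im[of lborel "\<lambda>x. indicator A x *\<^sub>R u x"] by simp
    qed (use u in simp)
    ultimately show ?thesis by eventually_elim (auto simp: u_def complex_eq_iff)
  qed
  then have "AE x in lborel. \<forall>n. x \<in> {- real n..<real n} \<longrightarrow> d x = 0" by (intro AE_all_countable[THEN iffD2] allI)
  then show ?thesis
  proof eventually_elim
    case (elim x)
    obtain n where "\<bar>x\<bar> < real n" using reals_Archimedean2 by blast
    then have "x \<in> {- real n..<real n}" by auto
    with elim show ?case by blast
  qed
qed

lemma powr_triangle:
  assumes "0 \<le> r"
  shows "norm (x - y) powr r \<le> 2 powr r * (norm x powr r + norm y powr r)"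
proof -
  have "norm (x - y) powr r \<le> (2 * max (norm x) (norm y)) powr r"
    using assms norm_triangle_ineq4[of x y] by (intro powr_mono2) auto
  also have "\<dots> = 2 powr r * max (norm x) (norm y) powr r" by (simp add: powr_mult)
  also have "\<dots> \<le> 2 powr r * (norm x powr r + norm y powr r)"
    by (intro mult_left_mono) (auto simp: max_def)
  finally show ?thesis .
qed

lemma Lr_function_diff:
  fixes f g :: "real \<Rightarrow> 'c::euclidean_space"
  assumes "0 \<le> r" "Lr_function r f" "Lr_function r g"
  shows "integrable lborel (\<lambda>x. norm (f x - g x) powr r)"
proof (rule Bochner_Integration.integrable_bound)
  have [measurable]: "f \<in> borel_measurable borel" "g \<in> borel_measurable borel" using assms by (auto simp: Lr_function_def)
  show "integrable lborel (\<lambda>x. 2 powr r * (norm (f x) powr r + norm (g x) powr r))"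
    using assms by (auto simp: Lr_function_def)
  show "(\<lambda>x. norm (f x - g x) powr r) \<in> borel_measurable lborel" by measurable
  show "AE x in lborel. norm (norm (f x - g x) powr r) \<le> norm (2 powr r * (norm (f x) powr r + norm (g x) powr r))"
    using powr_triangle[OF assms(1)] by (intro AE_I2) simp
qed

lemma Lr_function_1: "Lr_function 1 f \<longleftrightarrow> integrable lborel (f :: real \<Rightarrow> complex)"
proof -
  have eq: "(\<lambda>x. cmod (f x) powr 1) = (\<lambda>x. cmod (f x))" by simp
  show ?thesis
  proof
    assume "Lr_function 1 f"
    then have f: "f \<in> borel_measurable lborel" and "integrable lborel (\<lambda>x. cmod (f x))"
      by (simp_all add: Lr_function_def eq)
    then show "integrable lborel f" using integrable_norm_iff[OF f] by simp
  next
    assume f: "integrable lborel f"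
    then show "Lr_function 1 f"
      unfolding Lr_function_def eq using borel_measurable_integrable[OF f] by simp
  qed
qed

text \<open>For \<open>r > 1\<close> the transform is only given as a limit; testing against indicator functions of
  intervals, whose transforms lie in every \<open>L\<^sup>q\<close> with \<open>q > 1\<close>, identifies it on \<open>L\<^sup>1\<close>.\<close>

lemma has_fourier_eq_fourier_L1:
  assumes four: "has_fourier r f g" and r: "1 \<le> r" "r \<le> 2" and f: "integrable lborel f"
  shows "AE \<xi> in lborel. g \<xi> = fourier_L1 f \<xi>"
proof (cases "r = 1")
  case True
  then show ?thesis using four by (simp add: has_fourier_def)
next
  case False
  then have r1: "1 < r" using r by simp
  define q where "q = r / (r - 1)"
  have q1: "1 < q" using r1 by (simp add: q_def field_simps)
  have pq: "1 / r + 1 / q = 1" "1 / q + 1 / r = 1" using r1 by (simp_all add: q_def field_simps)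
  obtain F where F: "\<forall>n. Lr_function 1 (F n)" "tendsto_Lr r F f" "tendsto_Lr q (\<lambda>n. fourier_L1 (F n)) g"
    using four False unfolding has_fourier_def q_def by auto
  have F1: "integrable lborel (F n)" for n using F(1) by (simp add: Lr_function_1)
  have [measurable]: "f \<in> borel_measurable borel" "g \<in> borel_measurable borel" "F n \<in> borel_measurable borel" for n
    using F by (auto simp: tendsto_Lr_def Lr_function_def)
  have gq: "integrable lborel (\<lambda>x. norm (g x) powr q)" using F(3) by (simp add: tendsto_Lr_def Lr_function_def)
  have key: "integrable lborel (\<lambda>x. indicator {a..<b} x * g x)"
      "(LINT x|lborel. indicator {a..<b} x * g x) = (LINT x|lborel. indicator {a..<b} x * fourier_L1 f x)"
      "integrable lborel (\<lambda>x. indicator {a..<b} x * fourier_L1 f x)" for a b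
  proof -
    define I where "I = (indicator {a..<b} :: real \<Rightarrow> complex)"
    have [measurable]: "I \<in> borel_measurable borel" by (simp add: I_def)
    have step: "step_function I"
      unfolding I_def using step_function.step_add[OF step_function.step_zero, of 1] by simp
    have I: "integrable lborel I" by (rule integrable_step_function[OF step])
    have Ir: "integrable lborel (\<lambda>x. norm (I x) powr r)"
    proof -
      have "(\<lambda>x. norm (I x) powr r) = (\<lambda>x. norm (I x))" using r1 by (auto simp: I_def indicator_def fun_eq_iff)
      then show ?thesis using I by simp
    qed
    obtain C where C: "C \<ge> 0" "\<And>\<xi>. cmod (fourier_L1 I \<xi>) * max 1 \<bar>\<xi>\<bar> \<le> C"
      using step_function_fourier_bound[OF step] by auto
    have bnd: "cmod (fourier_L1 I \<xi>) \<le> C * (1 / max 1 \<bar>\<xi>\<bar>)" for \<xi>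
      using C(2)[of \<xi>] by (simp add: field_simps)
    have Iq: "integrable lborel (\<lambda>x. norm (fourier_L1 I x) powr q)"
    proof (rule Bochner_Integration.integrable_bound)
      show "integrable lborel (\<lambda>x. C powr q * (1 / max 1 \<bar>x\<bar>) powr q)"
        by (intro integrable_mult_right integrable_inverse_max_powr q1)
      show "AE x in lborel. norm (norm (fourier_L1 I x) powr q) \<le> norm (C powr q * (1 / max 1 \<bar>x\<bar>) powr q)"
      proof (rule AE_I2)
        fix x
        have "norm (fourier_L1 I x) powr q \<le> (C * (1 / max 1 \<bar>x\<bar>)) powr q"
          using q1 by (intro powr_mono2 bnd) auto
        also have "\<dots> = C powr q * (1 / max 1 \<bar>x\<bar>) powr q" by (rule powr_mult)
        finally show "norm (norm (fourier_L1 I x) powr q) \<le> norm (C powr q * (1 / max 1 \<bar>x\<bar>) powr q)" by simp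
      qed
    qed measurable
    have fb: "integrable lborel (\<lambda>x. v x * fourier_L1 I x)" if v: "integrable lborel v" for v
    proof (rule Bochner_Integration.integrable_bound)
      have [measurable]: "v \<in> borel_measurable borel" using v by (auto dest: borel_measurable_integrable)
      show "integrable lborel (\<lambda>x. v x * of_real (LINT x|lborel. cmod (I x)))" using v by simp
      show "(\<lambda>x. v x * fourier_L1 I x) \<in> borel_measurable lborel" by measurable
      show "AE x in lborel. norm (v x * fourier_L1 I x) \<le> norm (v x * of_real (LINT x|lborel. cmod (I x)))"
        using fourier_L1_bound[of I] by (intro AE_I2) (auto simp: norm_mult intro!: mult_left_mono)
    qed
    have Ib: "integrable lborel (\<lambda>x. fourier_L1 v x * I x)" if v: "integrable lborel v" for v
    proof (rule Bochner_Integration.integrable_bound)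
      have [measurable]: "v \<in> borel_measurable borel" using v by (auto dest: borel_measurable_integrable)
      show "integrable lborel (\<lambda>x. of_real (LINT x|lborel. cmod (v x)) * I x)" using I by simp
      show "(\<lambda>x. fourier_L1 v x * I x) \<in> borel_measurable lborel" by measurable
      show "AE x in lborel. norm (fourier_L1 v x * I x) \<le> norm (of_real (LINT x|lborel. cmod (v x)) * I x)"
        using fourier_L1_bound[of v] by (intro AE_I2) (auto simp: norm_mult intro!: mult_right_mono)
    qed
    have gI: "integrable lborel (\<lambda>x. g x * I x)"
      by (rule Lr_pairing(1)[OF q1 r1 pq(2) _ gq _ Ir, of 1]) auto
    have 1: "(\<lambda>n. LINT x|lborel. (F n x - f x) * fourier_L1 I x) \<longlonglongrightarrow> 0"
    proof (rule Lr_pairing_tendsto[OF r1 q1 pq(1)])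
      show "integrable lborel (\<lambda>x. norm (F n x - f x) powr r)" for n
        using F(2) r by (intro Lr_function_diff) (auto simp: tendsto_Lr_def)
      show "(\<lambda>n. LINT x|lborel. norm (F n x - f x) powr r) \<longlonglongrightarrow> 0" using F(2) by (simp add: tendsto_Lr_def)
    qed (use Iq in auto)
    have 2: "(\<lambda>n. LINT x|lborel. (fourier_L1 (F n) x - g x) * I x) \<longlonglongrightarrow> 0"
    proof (rule Lr_pairing_tendsto[OF q1 r1 pq(2)])
      show "integrable lborel (\<lambda>x. norm (fourier_L1 (F n) x - g x) powr q)" for n
        using F(3) q1 by (intro Lr_function_diff) (auto simp: tendsto_Lr_def)
      show "(\<lambda>n. LINT x|lborel. norm (fourier_L1 (F n) x - g x) powr q) \<longlonglongrightarrow> 0" using F(3) by (simp add: tendsto_Lr_def)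
    qed (use Ir in auto)
    \<comment> \<open>Duality for the integrable F n cancels everything that depends on n: two null
      sequences differ by a constant, which therefore is 0.\<close>
    have "(LINT x|lborel. (fourier_L1 (F n) x - g x) * I x) - (LINT x|lborel. (F n x - f x) * fourier_L1 I x) =
      (LINT x|lborel. f x * fourier_L1 I x) - (LINT x|lborel. g x * I x)" for n
      using fourier_L1_duality[OF F1[of n] I] Ib[OF F1[of n]] gI fb[OF F1[of n]] fb[OF f]
      by (simp add: left_diff_distrib)
    then have "(\<lambda>n. (LINT x|lborel. f x * fourier_L1 I x) - (LINT x|lborel. g x * I x)) \<longlonglongrightarrow> 0 - 0"
      using tendsto_diff[OF 2 1] by simp
    then have "(LINT x|lborel. f x * fourier_L1 I x) = (LINT x|lborel. g x * I x)" by (simp add: tendsto_const_iff)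
    then have "(LINT x|lborel. g x * I x) = (LINT x|lborel. fourier_L1 f x * I x)" by (simp add: fourier_L1_duality[OF f I])
    then show "integrable lborel (\<lambda>x. indicator {a..<b} x * g x)"
      "(LINT x|lborel. indicator {a..<b} x * g x) = (LINT x|lborel. indicator {a..<b} x * fourier_L1 f x)"
      "integrable lborel (\<lambda>x. indicator {a..<b} x * fourier_L1 f x)"
      using gI Ib[OF f] by (simp_all add: I_def mult.commute)
  qed
  have "AE x in lborel. g x - fourier_L1 f x = 0"
    by (rule AE_zero_if_interval_integrals_zero) (use key in \<open>auto simp: right_diff_distrib\<close>)
  then show ?thesis by eventually_elim simp
qed

section \<open>From the random measure \<open>\<Phi>\<close> back to Levy integrals\<close>

locale levy_integrator_index = levy_integrator w M L \<Lambda> \<psi>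
  for w :: "real \<Rightarrow> real" and M :: "'w measure" and L :: "real \<Rightarrow> 'w \<Rightarrow> real ^ 'd"
    and \<Lambda> :: "real set \<Rightarrow> 'w \<Rightarrow> real ^ 'd" and \<psi> :: "real ^ 'd \<Rightarrow> complex" +
  fixes \<alpha> :: real
  assumes \<alpha>: "1 < \<alpha>" "\<alpha> \<le> 2"
    and w_le: "\<And>\<beta>. 1 < \<beta> \<Longrightarrow> \<beta> < \<alpha> \<Longrightarrow> \<exists>C\<ge>0. \<forall>x\<ge>0. w x \<le> C * (x\<^sup>2 + x powr \<beta>)"
begin

lemma powr_le_of_bounded:
  assumes "0 \<le> y" "y \<le> C" "\<delta> \<le> \<beta>" "(0::real) < \<delta>"
  shows "y powr \<beta> \<le> C powr (\<beta> - \<delta>) * y powr \<delta>"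
proof -
  have "y powr \<beta> = y powr (\<beta> - \<delta>) * y powr \<delta>" by (simp add: powr_add[symmetric])
  also have "\<dots> \<le> C powr (\<beta> - \<delta>) * y powr \<delta>"
    using assms by (intro mult_right_mono powr_mono2) auto
  finally show ?thesis .
qed

text \<open>On values up to C, the square and the power \<beta> are at most multiples of the power
  \<delta> as long as \<delta> does not exceed \<beta>. This converts uniformly bounded L^\<delta>
  convergence, the mode in which the M-integral is defined, into convergence in the modular.\<close>

lemma modint_le_powr:
  assumes \<delta>: "0 < \<delta>" "\<delta> < \<alpha>"
  shows "\<exists>K\<ge>0. \<forall>H :: real \<Rightarrow> 'c::euclidean_space. H \<in> borel_measurable borel \<longrightarrow> (\<forall>x. norm (H x) \<le> C) \<longrightarrow>
     modint H \<le> ennreal K * (\<integral>\<^sup>+x. ennreal (norm (H x) powr \<delta>) \<partial>lborel)"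
proof -
  \<comment> \<open>This exponent has to lie strictly between 1 and \<alpha> and not below \<delta>,
    which itself may be less than 1.\<close>
  define \<beta> where "\<beta> = max \<delta> ((1 + \<alpha>) / 2)"
  have \<beta>: "1 < \<beta>" "\<beta> < \<alpha>" "\<delta> \<le> \<beta>" using \<delta> \<alpha> by (auto simp: \<beta>_def less_max_iff_disj)
  obtain C0 where C0: "C0 \<ge> 0" "\<And>x. x \<ge> 0 \<Longrightarrow> w x \<le> C0 * (x\<^sup>2 + x powr \<beta>)" using w_le[OF \<beta>(1,2)] by blast
  define K where "K = C0 * (C powr (2 - \<delta>) + C powr (\<beta> - \<delta>))"
  have K: "K \<ge> 0" using C0 by (simp add: K_def)
  have le: "w y \<le> K * y powr \<delta>" if "0 \<le> y" "y \<le> C" for y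
  proof -
    have "w y \<le> C0 * (y powr 2 + y powr \<beta>)" using C0(2)[OF that(1)] that(1) by (simp add: powr_numeral)
    also have "\<dots> \<le> C0 * (C powr (2 - \<delta>) * y powr \<delta> + C powr (\<beta> - \<delta>) * y powr \<delta>)"
      using that \<beta> \<delta> \<alpha> C0 by (intro mult_left_mono add_mono powr_le_of_bounded) auto
    also have "\<dots> = K * y powr \<delta>" by (simp add: K_def algebra_simps)
    finally show ?thesis .
  qed
  show ?thesis
  proof (intro exI[of _ K] conjI allI impI K)
    fix H :: "real \<Rightarrow> 'c" assume [measurable]: "H \<in> borel_measurable borel" and H: "\<forall>x. norm (H x) \<le> C"
    have "modint H \<le> (\<integral>\<^sup>+x. ennreal K * ennreal (norm (H x) powr \<delta>) \<partial>lborel)"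
      unfolding modint_def using K H by (intro nn_integral_mono) (auto simp: ennreal_mult[symmetric] intro!: ennreal_leI le)
    also have "\<dots> = ennreal K * (\<integral>\<^sup>+x. ennreal (norm (H x) powr \<delta>) \<partial>lborel)"
      by (rule nn_integral_cmult) measurable
    finally show "modint H \<le> ennreal K * (\<integral>\<^sup>+x. ennreal (norm (H x) powr \<delta>) \<partial>lborel)" .
  qed
qed

lemma modint_finite_if_Lr_bounded:
  fixes H :: "real \<Rightarrow> 'c::euclidean_space"
  assumes \<delta>: "0 < \<delta>" "\<delta> < \<alpha>" and H: "Lr_function \<delta> H" "\<And>x. norm (H x) \<le> C"
  shows "modint H < \<infinity>"
proof -
  obtain K where "K \<ge> 0" "\<forall>H :: real \<Rightarrow> 'c. H \<in> borel_measurable borel \<longrightarrow> (\<forall>x. norm (H x) \<le> C) \<longrightarrow>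
     modint H \<le> ennreal K * (\<integral>\<^sup>+x. ennreal (norm (H x) powr \<delta>) \<partial>lborel)"
    using modint_le_powr[OF \<delta>, where 'c='c] by blast
  then have "modint H \<le> ennreal K * (\<integral>\<^sup>+x. ennreal (norm (H x) powr \<delta>) \<partial>lborel)"
    using H by (simp add: Lr_function_def)
  also have "(\<integral>\<^sup>+x. ennreal (norm (H x) powr \<delta>) \<partial>lborel) = ennreal (LINT x|lborel. norm (H x) powr \<delta>)"
    using H(1) by (intro nn_integral_eq_integral) (auto simp: Lr_function_def)
  also have "ennreal K * \<dots> < \<infinity>" by (simp add: ennreal_mult_less_top)
  finally show ?thesis .
qed

lemma modint_tendsto_if_Lr_bounded:
  fixes F :: "nat \<Rightarrow> real \<Rightarrow> 'c::euclidean_space"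
  assumes \<delta>: "0 < \<delta>" "\<delta> < \<alpha>" and lim: "tendsto_Lr \<delta> F g" and C: "\<And>n x. norm (F n x - g x) \<le> C"
  shows "(\<lambda>n. modint (\<lambda>x. F n x - g x)) \<longlonglongrightarrow> 0"
proof -
  have [measurable]: "F n \<in> borel_measurable borel" "g \<in> borel_measurable borel" for n
    using lim by (auto simp: tendsto_Lr_def Lr_function_def)
  obtain K where K: "K \<ge> 0" "\<forall>H :: real \<Rightarrow> 'c. H \<in> borel_measurable borel \<longrightarrow> (\<forall>x. norm (H x) \<le> C) \<longrightarrow>
     modint H \<le> ennreal K * (\<integral>\<^sup>+x. ennreal (norm (H x) powr \<delta>) \<partial>lborel)"
    using modint_le_powr[OF \<delta>, where 'c='c] by blast
  have le: "modint (\<lambda>x. F n x - g x) \<le> ennreal (K * (LINT x|lborel. norm (F n x - g x) powr \<delta>))" for n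
  proof -
    have "(\<lambda>x. F n x - g x) \<in> borel_measurable borel" by measurable
    then have "modint (\<lambda>x. F n x - g x) \<le> ennreal K * (\<integral>\<^sup>+x. ennreal (norm (F n x - g x) powr \<delta>) \<partial>lborel)"
      using K(2) C by blast
    also have "(\<integral>\<^sup>+x. ennreal (norm (F n x - g x) powr \<delta>) \<partial>lborel) = ennreal (LINT x|lborel. norm (F n x - g x) powr \<delta>)"
      using lim \<delta> by (intro nn_integral_eq_integral Lr_function_diff) (auto simp: tendsto_Lr_def)
    finally show ?thesis using K(1) by (simp add: ennreal_mult')
  qed
  have "(\<lambda>n. K * (LINT x|lborel. norm (F n x - g x) powr \<delta>)) \<longlonglongrightarrow> K * 0"
    using lim by (intro tendsto_mult tendsto_const) (simp add: tendsto_Lr_def)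
  then have "(\<lambda>n. ennreal (K * (LINT x|lborel. norm (F n x - g x) powr \<delta>))) \<longlonglongrightarrow> ennreal 0"
    by (intro tendsto_ennrealI) simp
  then show ?thesis by (intro tendsto_zero_ennreal_le[OF le]) simp
qed

definition fourier_const :: complex where "fourier_const = complex_of_real (1 / sqrt (2 * pi))"

lemma linear_mat_complex: "linear (mat :: complex \<Rightarrow> complex ^ 'd ^ 'd)"
  by (rule linearI) (auto simp: mat_def vec_eq_iff)

text \<open>The kernel is bounded and of size 1 / |\<xi>| at infinity, hence in L^\<delta> for
  \<delta> = (1 + \<alpha>) / 2, which exceeds 1. Here \<alpha> > 1 makes the modular finite, so
  that \<open>good_integral_of_levy\<close> applies.\<close>

lemma good_integral_\<Phi>:
  assumes \<Phi>: "fourier_random_measure M \<Lambda> \<Phi>" and A: "A \<in> interval_ring"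
  shows "good_integral (\<lambda>\<mu>. mat (fourier_const * fourier_L1 (indicator A) \<mu>)) (\<Phi> A)"
proof (rule good_integral_of_levy)
  let ?F = "\<lambda>\<mu>. mat (fourier_const * fourier_L1 (indicator A) \<mu>) :: complex ^ 'd ^ 'd"
  show int: "has_levy_integral M \<Lambda> ?F (\<Phi> A)"
    using \<Phi> A by (auto simp: fourier_random_measure_def fourier_const_def)
  then have [measurable]: "?F \<in> borel_measurable borel" by (simp add: has_levy_integral_def)
  obtain C where C: "C \<ge> 0" "\<And>\<xi>. cmod (fourier_L1 (indicator A) \<xi>) * max 1 \<bar>\<xi>\<bar> \<le> C"
    using step_function_fourier_bound[OF interval_ring_step_function[OF A]] by blast
  obtain b where b: "b > 0" "\<And>z. norm (mat z :: complex ^ 'd ^ 'd) \<le> b * norm z"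
    using bounded_linear.pos_bounded[of "mat :: complex \<Rightarrow> complex ^ 'd ^ 'd"] linear_mat_complex
    by (auto simp: linear_conv_bounded_linear mult.commute)
  define D where "D = b * (cmod fourier_const * C)"
  have D: "D \<ge> 0" using b C by (simp add: D_def)
  have le: "norm (?F \<xi>) \<le> D * (1 / max 1 \<bar>\<xi>\<bar>)" for \<xi>
  proof -
    have "norm (?F \<xi>) \<le> b * (cmod fourier_const * cmod (fourier_L1 (indicator A) \<xi>))" using b(2) by (simp add: norm_mult[symmetric])
    also have "\<dots> \<le> b * (cmod fourier_const * (C * (1 / max 1 \<bar>\<xi>\<bar>)))"
      using C(2)[of \<xi>] b(1) by (intro mult_left_mono) (auto simp: field_simps)
    finally show ?thesis by (simp add: D_def)
  qed
  define \<delta> where "\<delta> = (1 + \<alpha>) / 2"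
  have \<delta>: "1 < \<delta>" "\<delta> < \<alpha>" "0 < \<delta>" using \<alpha> by (auto simp: \<delta>_def)
  show "modint ?F < \<infinity>"
  proof (rule modint_finite_if_Lr_bounded[OF \<delta>(3,2)])
    show "Lr_function \<delta> ?F"
      unfolding Lr_function_def
    proof
      show "integrable lborel (\<lambda>x. norm (?F x) powr \<delta>)"
      proof (rule Bochner_Integration.integrable_bound)
        show "integrable lborel (\<lambda>x. D powr \<delta> * (1 / max 1 \<bar>x\<bar>) powr \<delta>)"
          by (intro integrable_mult_right integrable_inverse_max_powr \<delta>)
        show "AE x in lborel. norm (norm (?F x) powr \<delta>) \<le> norm (D powr \<delta> * (1 / max 1 \<bar>x\<bar>) powr \<delta>)"
        proof (rule AE_I2)
          fix x
          have "norm (?F x) powr \<delta> \<le> (D * (1 / max 1 \<bar>x\<bar>)) powr \<delta>"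
            using \<delta> by (intro powr_mono2 le) auto
          also have "\<dots> = D powr \<delta> * (1 / max 1 \<bar>x\<bar>) powr \<delta>" by (rule powr_mult)
          finally show "norm (norm (?F x) powr \<delta>) \<le> norm (D powr \<delta> * (1 / max 1 \<bar>x\<bar>) powr \<delta>)" by simp
        qed
      qed measurable
    qed measurable
    show "norm (?F x) \<le> D" for x
    proof -
      have "D * (1 / max 1 \<bar>x\<bar>) \<le> D * 1" using D by (intro mult_left_mono) auto
      with le[of x] show ?thesis by linarith
    qed
  qed
qed

lemma integrable_simple_fun_component:
  fixes S :: "((complex ^ 'd ^ 'd) \<times> real set) list"
  assumes "snd ` set S \<subseteq> interval_ring"
  shows "integrable lborel (\<lambda>x. simple_fun S x $ i $ j)"
  using assms
proof (induction S)
  case (Cons p S)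
  have "integrable lborel (indicator (snd p) :: real \<Rightarrow> complex)"
    using Cons.prems by (intro integrable_step_function interval_ring_step_function) simp
  then have "integrable lborel (\<lambda>x. indicator (snd p) x * (fst p $ i $ j))" by simp
  moreover have "indicator (snd p) x *\<^sub>R (fst p $ i $ j) = indicator (snd p) x * (fst p $ i $ j)" for x
    by (simp add: indicator_def)
  ultimately show ?case using Cons by (cases p) simp
qed (simp add: simple_fun_def)

lemma fourier_L1_mat_simple_fun_Cons:
  fixes S :: "((complex ^ 'd ^ 'd) \<times> real set) list"
  assumes S: "snd ` set S \<subseteq> interval_ring" and A: "A \<in> interval_ring"
  shows "fourier_L1_mat (simple_fun ((c, A) # S)) \<mu> = c ** mat (fourier_L1 (indicator A) \<mu>) + fourier_L1_mat (simple_fun S) \<mu>"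
proof -
  have A': "integrable lborel (\<lambda>x. c $ i $ j * indicator A x)" for i j
    using integrable_step_function[OF interval_ring_step_function[OF A]] by simp
  have "indicator A x *\<^sub>R c $ i $ j = c $ i $ j * indicator A x" for x i j by (simp add: indicator_def)
  then have "fourier_L1 (\<lambda>x. simple_fun ((c, A) # S) x $ i $ j) \<mu> = c $ i $ j * fourier_L1 (indicator A) \<mu> + fourier_L1 (\<lambda>x. simple_fun S x $ i $ j) \<mu>" for i j
    using fourier_L1_add[OF A' integrable_simple_fun_component[OF S]] by (simp add: fourier_L1_cmult)
  moreover have "(c ** mat z) $ i $ j = c $ i $ j * z" for z i j
    by (simp add: matrix_matrix_mult_def mat_def if_distrib[of "\<lambda>x. _ * x"] sum.delta cong: if_cong)
  ultimately show ?thesis by (simp add: fourier_L1_mat_def vec_eq_iff)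
qed

lemma good_integral_simple_\<Phi>:
  assumes \<Phi>: "fourier_random_measure M \<Lambda> \<Phi>" and S: "snd ` set S \<subseteq> interval_ring"
  shows "good_integral (\<lambda>\<mu>. (1 / sqrt (2 * pi)) *\<^sub>R fourier_L1_mat (simple_fun S) \<mu>) (simple_integral \<Phi> S)"
  using S
proof (induction S)
  case Nil
  have "fourier_L1_mat (simple_fun ([] :: ((complex ^ 'd ^ 'd) \<times> real set) list)) \<mu> = 0" for \<mu> :: real
    by (simp add: fourier_L1_mat_def fourier_L1_def vec_eq_iff)
  moreover have "simple_integral \<Phi> [] = (\<lambda>\<omega>. 0)" by (simp add: simple_integral_def fun_eq_iff)
  ultimately show ?case using good_integral_zero by (simp only: scaleR_zero_right)
next
  case (Cons p S)
  obtain c A where p: "p = (c, A)" by (cases p)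
  have "good_integral (\<lambda>\<mu>. c ** mat (fourier_const * fourier_L1 (indicator A) \<mu>) + (1 / sqrt (2 * pi)) *\<^sub>R fourier_L1_mat (simple_fun S) \<mu>)
     (\<lambda>\<omega>. c *v \<Phi> A \<omega> + simple_integral \<Phi> S \<omega>)"
    using Cons p by (intro good_integral_add good_integral_left_mult good_integral_\<Phi>[OF \<Phi>]) auto
  moreover have "c ** mat (fourier_const * z) = (1 / sqrt (2 * pi)) *\<^sub>R (c ** mat z)" for z :: complex
    by (simp add: matrix_matrix_mult_def mat_def vec_eq_iff if_distrib[of "\<lambda>x. _ * x"] sum.delta fourier_const_def scaleR_conv_of_real[where 'a=complex] cong: if_cong)
  moreover have "fourier_L1_mat (simple_fun (p # S)) \<mu> = c ** mat (fourier_L1 (indicator A) \<mu>) + fourier_L1_mat (simple_fun S) \<mu>" for \<mu>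
    unfolding p by (rule fourier_L1_mat_simple_fun_Cons) (use Cons.prems p in auto)
  moreover have "simple_integral \<Phi> (p # S) = (\<lambda>\<omega>. c *v \<Phi> A \<omega> + simple_integral \<Phi> S \<omega>)"
    by (simp add: simple_integral_def fun_eq_iff p)
  ultimately show ?case
    by (simp only: scaleR_add_right)
qed

text \<open>After the transform, the approximation that defines the M-integral converges in the
  modular, so \<open>good_integral_limit\<close> applies. The limit g is known only as a version of
  the transform for some exponent r; integrability of f pins it down almost everywhere.\<close>

lemma good_integral_has_M_integral:
  assumes \<Phi>: "fourier_random_measure M \<Lambda> \<Phi>" and int: "has_M_integral M \<alpha> \<Phi> f X"
    and f: "\<And>i j. integrable lborel (\<lambda>x. f x $ i $ j)"
  shows "\<exists>G. good_integral G X \<and> (AE \<mu> in lborel. G \<mu> = (1 / sqrt (2 * pi)) *\<^sub>R fourier_L1_mat f \<mu>)"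
proof -
  obtain r g \<delta> C S where r: "r \<in> {1..2}" and g: "has_fourier_mat r f g" and \<delta>: "0 < \<delta>" "\<delta> < \<alpha>"
    and S: "\<forall>n. simple_over interval_ring (S n)" and lim: "tendsto_Lr \<delta> (\<lambda>n. fourier_L1_mat (simple_fun (S n))) g"
    and C: "\<forall>n \<mu>. norm (fourier_L1_mat (simple_fun (S n)) \<mu> - g \<mu>) + norm (g \<mu>) \<le> C"
    and X: "tendsto_in_prob M (\<lambda>n. simple_integral \<Phi> (S n)) X sequentially"
    using int unfolding has_M_integral_def by blast
  let ?c = "1 / sqrt (2 * pi)"
  have gL: "Lr_function \<delta> g" using lim by (simp add: tendsto_Lr_def)
  then have [measurable]: "g \<in> borel_measurable borel" by (simp add: Lr_function_def)
  have [measurable]: "fourier_L1_mat (simple_fun (S n)) \<in> borel_measurable borel" for n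
    using lim by (simp add: tendsto_Lr_def Lr_function_def)
  have C1: "norm (fourier_L1_mat (simple_fun (S n)) \<mu> - g \<mu>) \<le> C" and C2: "norm (g \<mu>) \<le> C" for n \<mu>
    using C[rule_format, of n \<mu>] norm_ge_zero[of "g \<mu>"] norm_ge_zero[of "fourier_L1_mat (simple_fun (S n)) \<mu> - g \<mu>"] by linarith+
  have c: "0 \<le> ?c" "?c \<le> 1" using pi_gt3 by simp_all
  have "good_integral (\<lambda>\<mu>. ?c *\<^sub>R g \<mu>) X"
  proof (rule good_integral_limit[OF _ _ _ _ X])
    show "\<forall>\<^sub>F n in sequentially. good_integral (\<lambda>\<mu>. ?c *\<^sub>R fourier_L1_mat (simple_fun (S n)) \<mu>) (simple_integral \<Phi> (S n))"
      using S by (intro always_eventually allI good_integral_simple_\<Phi>[OF \<Phi>]) (simp add: simple_over_def)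
    show "(\<lambda>\<mu>. ?c *\<^sub>R g \<mu>) \<in> borel_measurable borel" by measurable
    have le: "norm (?c *\<^sub>R v) \<le> norm v" for v :: "complex ^ 'd ^ 'd"
      using mult_right_mono[OF c(2), of "norm v"] c(1) by (simp only: norm_scaleR abs_of_nonneg) simp
    have "modint (\<lambda>\<mu>. ?c *\<^sub>R g \<mu>) \<le> modint g" by (rule modint_mono) (rule le)
    also have "\<dots> < \<infinity>" by (rule modint_finite_if_Lr_bounded[OF \<delta> gL C2])
    finally show "modint (\<lambda>\<mu>. ?c *\<^sub>R g \<mu>) < \<infinity>" .
    have "modint (\<lambda>\<mu>. ?c *\<^sub>R fourier_L1_mat (simple_fun (S n)) \<mu> - ?c *\<^sub>R g \<mu>) \<le> modint (\<lambda>\<mu>. fourier_L1_mat (simple_fun (S n)) \<mu> - g \<mu>)" for n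
      unfolding scaleR_diff_right[symmetric] by (rule modint_mono) (rule le)
    then show "(\<lambda>n. modint (\<lambda>\<mu>. ?c *\<^sub>R fourier_L1_mat (simple_fun (S n)) \<mu> - ?c *\<^sub>R g \<mu>)) \<longlonglongrightarrow> 0"
      by (rule tendsto_zero_ennreal_le) (rule modint_tendsto_if_Lr_bounded[OF \<delta> lim C1])
  qed simp
  moreover have "AE \<mu> in lborel. g \<mu> $ i $ j = fourier_L1 (\<lambda>x. f x $ i $ j) \<mu>" for i j
    using g r f by (intro has_fourier_eq_fourier_L1[of r]) (auto simp: has_fourier_mat_def)
  then have "AE \<mu> in lborel. \<forall>i j. g \<mu> $ i $ j = fourier_L1 (\<lambda>x. f x $ i $ j) \<mu>"
    by (intro eventually_all_finite)
  then have "AE \<mu> in lborel. ?c *\<^sub>R g \<mu> = ?c *\<^sub>R fourier_L1_mat f \<mu>"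
    by eventually_elim (simp add: fourier_L1_mat_def vec_eq_iff)
  ultimately show ?thesis by blast
qed

end

subsection \<open>Linear recurrences and exponential decay\<close>

definition geometric_growth :: "(nat \<Rightarrow> complex) \<Rightarrow> bool" where
  "geometric_growth y \<longleftrightarrow> (\<exists>c R. \<forall>k. cmod (y k) \<le> c * R ^ k)"

text \<open>Exponential generating function; differentiation acts on it as the shift of \<open>y\<close>.\<close>

definition egf :: "(nat \<Rightarrow> complex) \<Rightarrow> real \<Rightarrow> complex" where
  "egf y u = (\<Sum>k. y k / fact k * of_real u ^ k)"

text \<open>On generating functions this is y' - l y, the action of one linear factor of the
  characteristic polynomial.\<close>

definition shift_diff :: "complex \<Rightarrow> (nat \<Rightarrow> complex) \<Rightarrow> nat \<Rightarrow> complex" where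
  "shift_diff l y k = y (Suc k) - l * y k"

lemma geometric_growthE:
  assumes "geometric_growth y"
  obtains c R where "c \<ge> 0" "R \<ge> 0" "\<And>k. cmod (y k) \<le> c * R ^ k"
proof -
  obtain c R where c: "\<And>k. cmod (y k) \<le> c * R ^ k" using assms by (auto simp: geometric_growth_def)
  have "cmod (y k) \<le> \<bar>c\<bar> * \<bar>R\<bar> ^ k" for k
    using c[of k] by (rule order_trans) (metis abs_ge_self abs_mult power_abs)
  then show thesis by (intro that[of "\<bar>c\<bar>" "\<bar>R\<bar>"]) auto
qed

lemma geometric_growth_shift: "geometric_growth y \<Longrightarrow> geometric_growth (\<lambda>k. y (k + n))"
proof -
  assume "geometric_growth y"
  then obtain c R where c: "\<And>k. cmod (y k) \<le> c * R ^ k" by (auto simp: geometric_growth_def)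
  have "cmod (y (k + n)) \<le> (c * R ^ n) * R ^ k" for k using c[of "k + n"] by (simp add: power_add mult_ac)
  then show ?thesis unfolding geometric_growth_def by blast
qed

lemma geometric_growth_shift_diff:
  assumes "geometric_growth y" shows "geometric_growth (shift_diff l y)"
proof -
  obtain c R where c: "c \<ge> 0" "R \<ge> 0" "\<And>k. cmod (y k) \<le> c * R ^ k" using assms by (rule geometric_growthE) (rule that)
  have "cmod (shift_diff l y k) \<le> (c * R + cmod l * c) * R ^ k" for k
  proof -
    have "cmod (shift_diff l y k) \<le> cmod (y (Suc k)) + cmod l * cmod (y k)"
      unfolding shift_diff_def using norm_triangle_ineq4[of "y (Suc k)" "l * y k"] by (simp add: norm_mult)
    also have "\<dots> \<le> c * R ^ Suc k + cmod l * (c * R ^ k)" by (intro add_mono mult_left_mono c) auto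
    finally show ?thesis by (simp add: algebra_simps)
  qed
  then show ?thesis unfolding geometric_growth_def by blast
qed

lemma egf_summable:
  assumes "geometric_growth y"
  shows "summable (\<lambda>k. y k / fact k * z ^ k)"
proof -
  obtain c R where c: "c \<ge> 0" "R \<ge> 0" "\<And>k. cmod (y k) \<le> c * R ^ k" using assms by (rule geometric_growthE) (rule that)
  show ?thesis
  proof (rule summable_comparison_test)
    show "summable (\<lambda>k. c * (inverse (fact k) * (R * cmod z) ^ k))"
      by (intro summable_mult summable_exp)
    have "norm (y k / fact k * z ^ k) \<le> c * (inverse (fact k) * (R * cmod z) ^ k)" for k
    proof -
      have "norm (y k / fact k * z ^ k) = cmod (y k) * (inverse (fact k) * cmod z ^ k)"
        by (simp add: norm_mult norm_divide norm_power norm_inverse norm_fact divide_inverse mult.assoc)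
      also have "\<dots> \<le> (c * R ^ k) * (inverse (fact k) * cmod z ^ k)" by (intro mult_right_mono c) auto
      finally show ?thesis by (simp add: power_mult_distrib mult_ac)
    qed
    then show "\<exists>N. \<forall>n\<ge>N. norm (y n / fact n * z ^ n) \<le> c * (inverse (fact n) * (R * cmod z) ^ n)" by blast
  qed
qed

lemma egf_has_vector_derivative:
  assumes "geometric_growth y"
  shows "(egf y has_vector_derivative egf (\<lambda>k. y (Suc k)) u) (at u within S)"
proof -
  have "((\<lambda>z. \<Sum>k. y k / fact k * z ^ k) has_field_derivative (\<Sum>k. diffs (\<lambda>k. y k / fact k) k * of_real u ^ k)) (at (of_real u))"
    by (rule termdiffs_strong_converges_everywhere) (rule egf_summable[OF assms])
  moreover have "diffs (\<lambda>k. y k / fact k) k = y (Suc k) / fact k" for k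
    unfolding diffs_def by (simp add: field_simps del: of_nat_Suc)
  ultimately have "((\<lambda>z. \<Sum>k. y k / fact k * z ^ k) has_field_derivative egf (\<lambda>k. y (Suc k)) u) (at (of_real u))"
    by (simp add: egf_def)
  from has_vector_derivative_real_field[OF this] show ?thesis by (simp add: egf_def[abs_def])
qed

lemma continuous_on_egf: "geometric_growth y \<Longrightarrow> continuous_on S (egf y)"
  by (auto simp: continuous_on_eq_continuous_within intro: has_vector_derivative_continuous egf_has_vector_derivative)

lemma egf_0: "egf y 0 = y 0"
  using powser_zero[of "\<lambda>k. y k / fact k"] by (simp add: egf_def)

lemma egf_shift_diff:
  assumes "geometric_growth y"
  shows "egf (shift_diff l y) u = egf (\<lambda>k. y (Suc k)) u - l * egf y u"
proof -
  have "egf (shift_diff l y) u = (\<Sum>k. y (Suc k) / fact k * of_real u ^ k - l * (y k / fact k * of_real u ^ k))"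
    unfolding egf_def shift_diff_def by (intro suminf_cong) (simp add: field_simps)
  also have "\<dots> = egf (\<lambda>k. y (Suc k)) u - l * egf y u"
  proof -
    have "geometric_growth (\<lambda>k. y (Suc k))" using geometric_growth_shift[OF assms, of 1] by simp
    note s2 = egf_summable[OF this, of "of_real u"] and s1 = egf_summable[OF assms, of "of_real u"]
    show ?thesis
      unfolding egf_def suminf_mult[OF s1, of l, symmetric] by (rule suminf_diff[OF s2 summable_mult[OF s1, of l], symmetric])
  qed
  finally show ?thesis .
qed

definition exp_decay :: "real \<Rightarrow> (real \<Rightarrow> complex) \<Rightarrow> bool" where
  "exp_decay c f \<longleftrightarrow> (\<exists>C\<ge>0. \<forall>u\<ge>0. cmod (f u) \<le> C * exp (- c * u))"

text \<open>Variation of constants: \<open>y' = l y + z\<close> with \<open>Re l < - c\<close> inherits the decay of \<open>z\<close>.\<close>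

lemma exp_decay_ode:
  assumes y: "geometric_growth y" and l: "Re l < - c" and z: "exp_decay c (egf (shift_diff l y))"
  shows "exp_decay c (egf y)"
proof -
  obtain C where C: "C \<ge> 0" "\<And>u. u \<ge> 0 \<Longrightarrow> cmod (egf (shift_diff l y) u) \<le> C * exp (- c * u)"
    using z by (auto simp: exp_decay_def)
  \<comment> \<open>The growth rate that is left when the integrating factor exp (- l u) meets a
    source of size exp (- c u). Being positive, it also absorbs the initial value.\<close>
  define a where "a = - Re l - c"
  have a: "a > 0" using l by (simp add: a_def)
  define g where "g u = exp (- l * of_real u) * egf y u" for u
  define b where "b u = C / a * exp (a * u)" for u
  have dg: "(g has_vector_derivative exp (- l * of_real u) * egf (shift_diff l y) u) (at u)" for u
  proof -
    have "((\<lambda>u. exp (- l * of_real u)) has_vector_derivative exp (- l * of_real u) * (- l)) (at u)"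
      by (rule has_vector_derivative_real_field) (auto intro!: derivative_eq_intros)
    then have "(g has_vector_derivative exp (- l * of_real u) * egf (\<lambda>k. y (Suc k)) u + exp (- l * of_real u) * (- l) * egf y u) (at u)"
      unfolding g_def by (intro has_vector_derivative_mult egf_has_vector_derivative[OF y])
    then show ?thesis by (simp add: egf_shift_diff[OF y] algebra_simps)
  qed
  have db: "(b has_vector_derivative C * exp (a * u)) (at u)" for u
    unfolding b_def using a by (auto intro!: derivative_eq_intros simp: has_real_derivative_iff_has_vector_derivative[symmetric])
  have "cmod (egf y u) \<le> (cmod (y 0) + C / a) * exp (- c * u)" if u: "u \<ge> 0" for u
  proof -
    have "norm (g u - g 0) \<le> b u - b 0"
    proof (cases "u = 0")
      case False
      then have "0 < u" using u by simp
      then show ?thesis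
      proof (rule differentiable_bound_general)
        show "continuous_on {0..u} g" "continuous_on {0..u} b"
          using dg db by (auto simp: continuous_on_eq_continuous_within intro: has_vector_derivative_continuous has_vector_derivative_at_within)
        fix x assume x: "0 < x" "x < u"
        have "cmod (exp (- l * of_real x) * egf (shift_diff l y) x) \<le> exp (- Re l * x) * (C * exp (- c * x))"
          using C(2)[of x] x by (auto simp: norm_mult norm_exp_eq_Re intro!: mult_left_mono)
        also have "\<dots> = C * exp (a * x)" by (simp add: a_def mult_exp_exp algebra_simps exp_add[symmetric])
        finally show "norm (exp (- l * of_real x) * egf (shift_diff l y) x) \<le> C * exp (a * x)" .
      qed (use dg db in auto)
    qed simp
    then have "cmod (g u) \<le> cmod (g 0) + (b u - b 0)" using norm_triangle_sub[of "g u" "g 0"] by linarith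
    also have "\<dots> \<le> cmod (y 0) + C / a * exp (a * u)" using a C(1) by (simp add: g_def b_def egf_0)
    also have "\<dots> \<le> cmod (y 0) * exp (a * u) + C / a * exp (a * u)"
      using a u by (intro add_right_mono mult_le_cancel_left1[THEN iffD2]) auto
    finally have gb: "cmod (g u) \<le> (cmod (y 0) + C / a) * exp (a * u)" by (simp add: distrib_right)
    have "egf y u = exp (l * of_real u) * g u" by (simp add: g_def mult.assoc[symmetric] exp_add[symmetric])
    then have "cmod (egf y u) = exp (Re l * u) * cmod (g u)" by (simp add: norm_mult norm_exp_eq_Re)
    also have "\<dots> \<le> exp (Re l * u) * ((cmod (y 0) + C / a) * exp (a * u))" by (intro mult_left_mono gb) simp
    also have "\<dots> = (cmod (y 0) + C / a) * (exp (Re l * u) * exp (a * u))" by (simp only: mult_ac)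
    also have "exp (Re l * u) * exp (a * u) = exp (- c * u)" by (simp add: a_def exp_add[symmetric] algebra_simps)
    finally show ?thesis .
  qed
  then show ?thesis unfolding exp_decay_def using a C(1) by (intro exI[of _ "cmod (y 0) + C / a"]) auto
qed

text \<open>\<open>foldr\<close> applies the last entry of the list first, hence the induction from
  the end: the first-order equation for that entry passes decay from y' - l y on to y.\<close>

lemma exp_decay_annihilated:
  assumes "geometric_growth y" "\<forall>l\<in>set ls. Re l < - c" "foldr shift_diff ls y = (\<lambda>_. 0)"
  shows "exp_decay c (egf y)"
  using assms
proof (induction ls arbitrary: y rule: rev_induct)
  case Nil
  then have "egf y = (\<lambda>_. 0)" by (simp add: egf_def[abs_def])
  then show ?case by (auto simp: exp_decay_def intro: exI[of _ 0])
next
  case (snoc l ls)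
  then have "exp_decay c (egf (shift_diff l y))"
    by (intro snoc.IH geometric_growth_shift_diff) auto
  then show ?case using snoc.prems by (intro exp_decay_ode[of y l c]) auto
qed

lemma exp_decay_integrable:
  assumes y: "geometric_growth y" and d: "exp_decay c (egf y)" and c: "c > 0"
  shows "integrable lborel (\<lambda>u. indicator {0..} u *\<^sub>R (exp (- (\<i> * of_real (\<mu> * u))) * egf y u))"
proof -
  obtain C where C: "C \<ge> 0" "\<And>u. u \<ge> 0 \<Longrightarrow> cmod (egf y u) \<le> C * exp (- c * u)"
    using d by (auto simp: exp_decay_def)
  have [measurable]: "egf y \<in> borel_measurable borel" by (rule borel_measurable_continuous_onI) (rule continuous_on_egf[OF y])
  have "set_integrable lborel {0<..} (\<lambda>x. exp (- (x * c)))" using integrable_I0i_exp_mscale[OF c] .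
  then have i: "integrable lborel (\<lambda>u. C * (indicator {0<..} u *\<^sub>R exp (- (u * c))))"
    unfolding set_integrable_def by (rule integrable_mult_right)
  show ?thesis
  proof (rule Bochner_Integration.integrable_bound[OF i])
    show "AE u in lborel. norm (indicator {0..} u *\<^sub>R (exp (- (\<i> * of_real (\<mu> * u))) * egf y u)) \<le> norm (C * (indicator {0<..} u *\<^sub>R exp (- (u * c))))"
      using AE_lborel_singleton[of 0]
    proof eventually_elim
      case (elim u)
      then show ?case using C(1) C(2)[of u] by (auto simp: indicator_def norm_mult abs_mult mult.commute[of c u])
    qed
  qed measurable
qed

text \<open>Integration by parts on the half-line. Decay removes the boundary term at infinity; the
  one at 0 is \<open>y 0\<close>.\<close>

lemma laplace_shift:
  assumes y: "geometric_growth y" and d: "exp_decay c (egf y)" "exp_decay c (egf (\<lambda>k. y (Suc k)))" and c: "c > 0"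
  shows "(LINT u|lborel. indicator {0..} u *\<^sub>R (exp (- (\<i> * of_real (\<mu> * u))) * egf (\<lambda>k. y (Suc k)) u)) =
    \<i> * of_real \<mu> * (LINT u|lborel. indicator {0..} u *\<^sub>R (exp (- (\<i> * of_real (\<mu> * u))) * egf y u)) - y 0"
proof -
  let ?e = "\<lambda>u. exp (- (\<i> * of_real (\<mu> * u)))"
  have y': "geometric_growth (\<lambda>k. y (Suc k))" using geometric_growth_shift[OF y, of 1] by simp
  note i1 = exp_decay_integrable[OF y d(1) c, of \<mu>] and i2 = exp_decay_integrable[OF y' d(2) c, of \<mu>]
  define F where "F u = ?e u * egf y u" for u
  define f where "f u = ?e u * egf (\<lambda>k. y (Suc k)) u - \<i> * of_real \<mu> * (?e u * egf y u)" for u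
  have dF: "(F has_vector_derivative f u) (at u)" for u
  proof -
    have "((\<lambda>u. exp (- (\<i> * of_real \<mu>) * of_real u)) has_vector_derivative exp (- (\<i> * of_real \<mu>) * of_real u) * (- (\<i> * of_real \<mu>))) (at u)"
      by (rule has_vector_derivative_real_field) (auto intro!: derivative_eq_intros)
    then have "(?e has_vector_derivative ?e u * (- (\<i> * of_real \<mu>))) (at u)" by (simp add: mult.assoc)
    then have "(F has_vector_derivative ?e u * egf (\<lambda>k. y (Suc k)) u + ?e u * (- (\<i> * of_real \<mu>)) * egf y u) (at u)"
      unfolding F_def by (intro has_vector_derivative_mult egf_has_vector_derivative[OF y])
    then show ?thesis by (simp add: f_def mult_ac)
  qed
  have i3: "integrable lborel (\<lambda>u. indicator {0..} u *\<^sub>R f u)"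
  proof -
    have "integrable lborel (\<lambda>u. indicator {0..} u *\<^sub>R (?e u * egf (\<lambda>k. y (Suc k)) u) - \<i> * of_real \<mu> * (indicator {0..} u *\<^sub>R (?e u * egf y u)))"
      using i1 i2 by (intro Bochner_Integration.integrable_diff integrable_mult_right)
    then show ?thesis by (rule Bochner_Integration.integrable_cong[THEN iffD1, rotated 2]) (auto simp: f_def indicator_def)
  qed
  have limF: "(F \<longlongrightarrow> 0) at_top"
  proof -
    obtain C where C: "C \<ge> 0" "\<And>u. u \<ge> 0 \<Longrightarrow> cmod (egf y u) \<le> C * exp (- c * u)"
      using d(1) by (auto simp: exp_decay_def)
    have "((\<lambda>u. C * exp (- (c * u))) \<longlongrightarrow> C * 0) at_top"
      using c by (intro tendsto_intros filterlim_compose[OF exp_at_bot] filterlim_uminus_at_bot_at_top[THEN filterlim_compose] filterlim_tendsto_pos_mult_at_top[OF tendsto_const] filterlim_ident)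
    moreover have "\<forall>\<^sub>F u in at_top. norm (F u) \<le> C * exp (- (c * u))"
      using eventually_ge_at_top[of 0] by eventually_elim (use C in \<open>simp add: F_def norm_mult\<close>)
    ultimately show ?thesis using Lim_null_comparison by fastforce
  qed
  have "(LBINT u=0..\<infinity>. f u) = 0 - y 0"
  proof (rule interval_integral_FTC_integrable)
    show "isCont f u" for u
    proof -
      have "continuous_on UNIV f" unfolding f_def by (intro continuous_intros continuous_on_egf y y')
      then show ?thesis by (simp add: continuous_on_eq_continuous_at)
    qed
    show "(F has_vector_derivative f u) (at u)" for u by (rule dF)
    show "set_integrable lborel (einterval 0 \<infinity>) f"
    proof -
      have "einterval 0 \<infinity> = {0<..}" by (auto simp: einterval_def zero_ereal_def)
      moreover have "set_integrable lborel {0<..} f"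
        by (rule set_integrable_subset[of _ "{0..}"]) (use i3 in \<open>auto simp: set_integrable_def\<close>)
      ultimately show ?thesis by simp
    qed
    show "((F \<circ> real_of_ereal) \<longlongrightarrow> 0) (at_left \<infinity>)"
      using limF by (simp add: ereal_tendsto_simps1)
    have "(F \<longlongrightarrow> F 0) (at_right 0)"
      using dF[of 0] by (auto dest!: has_vector_derivative_continuous simp: continuous_within intro: tendsto_within_subset)
    then show "((F \<circ> real_of_ereal) \<longlongrightarrow> y 0) (at_right 0)"
      by (simp add: zero_ereal_def ereal_tendsto_simps1 F_def egf_0)
  qed simp
  also have "(LBINT u=0..\<infinity>. f u) = (LINT u|lborel. indicator {0..} u *\<^sub>R f u)"
  proof -
    have "(LBINT u=0..\<infinity>. f u) = (LINT u:{0<..}|lborel. f u)"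
      using interval_integral_to_infinity_eq[of lborel 0 f] by (simp add: zero_ereal_def)
    also have "\<dots> = (LINT u|lborel. indicator {0..} u *\<^sub>R f u)"
      unfolding set_lebesgue_integral_def
    proof (rule integral_cong_AE)
      have [measurable]: "f \<in> borel_measurable borel" unfolding f_def
        by (intro borel_measurable_continuous_onI continuous_intros continuous_on_egf y y')
      show "(\<lambda>u. indicator {0<..} u *\<^sub>R f u) \<in> borel_measurable lborel" "(\<lambda>u. indicator {0..} u *\<^sub>R f u) \<in> borel_measurable lborel" by measurable
      show "AE u in lborel. indicator {0<..} u *\<^sub>R f u = indicator {0..} u *\<^sub>R f u"
        using AE_lborel_singleton[of 0] by eventually_elim (auto simp: indicator_def)
    qed
    finally show ?thesis .
  qed
  also have "\<dots> = (LINT u|lborel. indicator {0..} u *\<^sub>R (?e u * egf (\<lambda>k. y (Suc k)) u) - \<i> * of_real \<mu> * (indicator {0..} u *\<^sub>R (?e u * egf y u)))"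
    by (rule Bochner_Integration.integral_cong[OF refl]) (auto simp: f_def indicator_def)
  also have "\<dots> = (LINT u|lborel. indicator {0..} u *\<^sub>R (?e u * egf (\<lambda>k. y (Suc k)) u)) - \<i> * of_real \<mu> * (LINT u|lborel. indicator {0..} u *\<^sub>R (?e u * egf y u))"
    by (subst Bochner_Integration.integral_diff[OF i2 integrable_mult_right[OF i1]]) (simp only: integral_mult_right_zero)
  finally show ?thesis by (simp add: algebra_simps)
qed

section \<open>Matrix recurrences and annihilating polynomials\<close>

lemma mat_mult_entry [simp]: "(mat l ** X) $ i $ j = l * X $ i $ j" for X :: "complex ^ 'm ^ 'n"
  by (simp add: matrix_matrix_mult_def mat_def if_distrib[of "\<lambda>x. x * _"] sum.delta cong: if_cong)

lemma mat_mult_commute: "X ** (mat l ** Y) = mat l ** (X ** Y)" for X :: "complex ^ 'm ^ 'n" and Y :: "complex ^ 'k ^ 'm"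
  by (simp add: vec_eq_iff) (simp add: matrix_matrix_mult_def[of X] sum_distrib_left mult_ac)

lemma mat_mult_mat: "mat (a * b) ** X = mat a ** (mat b ** X)" for X :: "complex ^ 'm ^ 'n"
  by (simp add: vec_eq_iff)

lemma matrix_mult_add_left: "(X + Y) ** Z = X ** Z + Y ** Z" for X :: "'a::semiring_1 ^ 'm ^ 'n"
  by (simp add: matrix_matrix_mult_def vec_eq_iff distrib_right sum.distrib)

lemma matrix_mult_diff_right: "X ** (Y - Z) = X ** Y - X ** Z" for X :: "'a::ring_1 ^ 'm ^ 'n"
  by (simp add: matrix_matrix_mult_def vec_eq_iff right_diff_distrib sum_subtractf)

lemma matrix_mult_sum_left: "(\<Sum>i\<in>I. f i) ** X = (\<Sum>i\<in>I. f i ** X)" for X :: "'a::semiring_1 ^ 'm ^ 'n"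
  by (induction I rule: infinite_finite_induct) (simp_all add: matrix_mult_add_left)

lemma matrix_mult_sum_right: "X ** (\<Sum>i\<in>I. f i) = (\<Sum>i\<in>I. X ** f i)" for X :: "'a::semiring_1 ^ 'm ^ 'n"
  by (induction I rule: infinite_finite_induct) (simp_all add: matrix_add_ldistrib)

definition mat_recurrence :: "nat \<Rightarrow> (nat \<Rightarrow> complex ^ 'd ^ 'd) \<Rightarrow> (nat \<Rightarrow> complex ^ 'd ^ 'd) \<Rightarrow> bool" where
  "mat_recurrence p a x \<longleftrightarrow> (\<forall>k. x (k + p) + (\<Sum>i = 1..p. a i ** x (k + p - i)) = 0)"

definition mat_shift_diff :: "complex \<Rightarrow> (nat \<Rightarrow> complex ^ 'd ^ 'd) \<Rightarrow> nat \<Rightarrow> complex ^ 'd ^ 'd" where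
  "mat_shift_diff l x k = x (Suc k) - mat l ** x k"

lemma foldr_mat_shift_diff_entry:
  "foldr mat_shift_diff ls x k $ i $ j = foldr shift_diff ls (\<lambda>k. x k $ i $ j) k"
  by (induction ls arbitrary: k) (simp_all add: mat_shift_diff_def shift_diff_def)

lemma mat_shift_diff_commute: "mat_shift_diff l (mat_shift_diff m x) = mat_shift_diff m (mat_shift_diff l x)"
  by (simp add: mat_shift_diff_def fun_eq_iff vec_eq_iff algebra_simps)

lemma foldr_mat_shift_diff_commute:
  "mat_shift_diff l (foldr mat_shift_diff ls x) = foldr mat_shift_diff ls (mat_shift_diff l x)"
  by (induction ls) (simp_all add: mat_shift_diff_commute[of l])

text \<open>The coefficients do not depend on k and scalar matrices commute with them, so the shift,
  and with it the shift minus l, maps solutions to solutions.\<close>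

lemma mat_recurrence_shift_diff:
  assumes "mat_recurrence p a x" shows "mat_recurrence p a (mat_shift_diff l x)"
  unfolding mat_recurrence_def
proof
  fix k
  have 1: "x (Suc k + p) + (\<Sum>i = 1..p. a i ** x (Suc k + p - i)) = 0"
    and 2: "x (k + p) + (\<Sum>i = 1..p. a i ** x (k + p - i)) = 0"
    using assms by (simp_all only: mat_recurrence_def)
  have "a i ** mat_shift_diff l x (k + p - i) = a i ** x (Suc k + p - i) - mat l ** (a i ** x (k + p - i))" if "i \<in> {1..p}" for i
    using that by (simp add: mat_shift_diff_def matrix_mult_diff_right mat_mult_commute Suc_diff_le)
  then have "mat_shift_diff l x (k + p) + (\<Sum>i = 1..p. a i ** mat_shift_diff l x (k + p - i)) =
     (x (Suc k + p) + (\<Sum>i = 1..p. a i ** x (Suc k + p - i))) - mat l ** (x (k + p) + (\<Sum>i = 1..p. a i ** x (k + p - i)))"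
    by (simp add: mat_shift_diff_def sum_subtractf matrix_add_ldistrib matrix_mult_sum_right)
  then show "mat_shift_diff l x (k + p) + (\<Sum>i = 1..p. a i ** mat_shift_diff l x (k + p - i)) = 0"
    unfolding 1 2 by simp
qed

lemma mat_recurrence_foldr:
  "mat_recurrence p a x \<Longrightarrow> mat_recurrence p a (foldr mat_shift_diff ls x)"
  by (induction ls) (simp_all add: mat_recurrence_shift_diff)

text \<open>The polynomial m evaluated at the shift operator.\<close>

definition poly_action :: "complex poly \<Rightarrow> (nat \<Rightarrow> complex ^ 'd ^ 'd) \<Rightarrow> nat \<Rightarrow> complex ^ 'd ^ 'd" where
  "poly_action m x k = (\<Sum>l\<le>degree m. mat (coeff m l) ** x (k + l))"

lemma poly_action_linear_factor:
  assumes "m \<noteq> 0"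
  shows "poly_action ([:- r, 1:] * m) x = poly_action m (mat_shift_diff r x)"
proof (rule ext)
  fix k
  define n where "n = degree m"
  have deg: "degree ([:- r, 1:] * m) = Suc n" using assms by (subst degree_mult_eq) (auto simp: n_def)
  have c: "coeff ([:- r, 1:] * m) l = (case l of 0 \<Rightarrow> 0 | Suc l \<Rightarrow> coeff m l) - r * coeff m l" for l
    by (simp add: coeff_pCons)
  have top: "coeff m (Suc n) = 0" by (simp add: n_def coeff_eq_0)
  have s: "(\<Sum>l\<le>Suc n. ((case l of 0 \<Rightarrow> 0 | Suc l \<Rightarrow> coeff m l) - r * coeff m l) * y (k + l)) =
    (\<Sum>l\<le>n. coeff m l * (y (Suc (k + l)) - r * y (k + l)))" for y :: "nat \<Rightarrow> complex"
  proof -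
    have "(\<Sum>l\<le>Suc n. ((case l of 0 \<Rightarrow> 0 | Suc l \<Rightarrow> coeff m l) - r * coeff m l) * y (k + l)) =
      (\<Sum>l\<le>Suc n. (case l of 0 \<Rightarrow> 0 | Suc l \<Rightarrow> coeff m l) * y (k + l)) - (\<Sum>l\<le>Suc n. r * coeff m l * y (k + l))"
      by (simp only: left_diff_distrib sum_subtractf)
    also have "(\<Sum>l\<le>Suc n. (case l of 0 \<Rightarrow> 0 | Suc l \<Rightarrow> coeff m l) * y (k + l)) = (\<Sum>l\<le>n. coeff m l * y (Suc (k + l)))"
      by (subst sum.atMost_Suc_shift) simp
    also have "(\<Sum>l\<le>Suc n. r * coeff m l * y (k + l)) = (\<Sum>l\<le>n. r * coeff m l * y (k + l))" using top by simp
    finally show ?thesis by (simp add: sum_subtractf algebra_simps)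
  qed
  show "poly_action ([:- r, 1:] * m) x k = poly_action m (mat_shift_diff r x) k"
    unfolding poly_action_def deg n_def[symmetric] c vec_eq_iff
  proof (intro allI)
    fix i j
    show "(\<Sum>l\<le>Suc n. mat ((case l of 0 \<Rightarrow> 0 | Suc l \<Rightarrow> coeff m l) - r * coeff m l) ** x (k + l)) $ i $ j =
      (\<Sum>l\<le>n. mat (coeff m l) ** mat_shift_diff r x (k + l)) $ i $ j"
      using s[of "\<lambda>n. x n $ i $ j"] by (simp only: sum_component mat_mult_entry mat_shift_diff_def vector_minus_component)
  qed
qed

text \<open>A root \<open>z\<close> of an annihilating polynomial either can be dropped or yields a solution
  \<open>y k = z\<^sup>k y 0 \<noteq> 0\<close> of the recurrence, in which case the characteristic matrix at \<open>z\<close> is singular.\<close>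

lemma annihilating_roots:
  fixes x :: "nat \<Rightarrow> complex ^ 'd ^ 'd"
  assumes "m \<noteq> 0" "mat_recurrence p a x" "poly_action m x = (\<lambda>_. 0)"
  shows "\<exists>ls. (\<forall>z\<in>set ls. det (mat (z ^ p) + (\<Sum>i = 1..p. mat (z ^ (p - i)) ** a i)) = 0) \<and> foldr mat_shift_diff ls x = (\<lambda>_. 0)"
  using assms
proof (induction "degree m" arbitrary: m x)
  case 0
  obtain c where c: "m = [:c:]" using degree_eq_zeroE[of m] 0 by metis
  have "x k = 0" for k
    using fun_cong[OF 0(4), of k] 0(2) by (simp add: poly_action_def c vec_eq_iff)
  then show ?case by (intro exI[of _ "[]"]) auto
next
  case (Suc n)
  have "\<not> constant (poly m)" using Suc(2) by (simp add: constant_degree)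
  then obtain z where "poly m z = 0" using fundamental_theorem_of_algebra by blast
  then obtain m' where m': "m = [:- z, 1:] * m'" by (auto simp: poly_eq_0_iff_dvd)
  have m'0: "m' \<noteq> 0" using Suc(3) m' by auto
  have "degree m = Suc (degree m')" unfolding m' using m'0 by (subst degree_mult_eq) auto
  then have deg: "n = degree m'" using Suc(2) by simp
  have "poly_action m' (mat_shift_diff z x) = (\<lambda>_. 0)"
    using Suc(5) unfolding m' poly_action_linear_factor[OF m'0] .
  from Suc(1)[OF deg m'0 mat_recurrence_shift_diff[OF Suc(4)] this] obtain ls where
    ls: "\<forall>z\<in>set ls. det (mat (z ^ p) + (\<Sum>i = 1..p. mat (z ^ (p - i)) ** a i)) = 0" "foldr mat_shift_diff ls (mat_shift_diff z x) = (\<lambda>_. 0)"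
    by blast
  \<comment> \<open>The sequence with the factor of z left out; because the factors commute, z alone
    annihilates it.\<close>
  define y where "y = foldr mat_shift_diff ls x"
  have zy: "mat_shift_diff z y = (\<lambda>_. 0)" unfolding y_def foldr_mat_shift_diff_commute by (rule ls(2))
  show ?case
  proof (cases "y = (\<lambda>_. 0)")
    case True
    then show ?thesis using ls(1) unfolding y_def by blast
  next
    case False
    have step: "y (Suc k) = mat z ** y k" for k using fun_cong[OF zy, of k] by (simp add: mat_shift_diff_def)
    have yk: "y k = mat (z ^ k) ** y 0" for k
      by (induction k) (simp_all add: step mat_mult_mat)
    have y0: "y 0 \<noteq> 0"
    proof
      assume "y 0 = 0"
      then have "y k = 0" for k using yk[of k] by simp
      then have "y = (\<lambda>_. 0)" by auto
      then show False using False by simp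
    qed
    have "mat_recurrence p a y" unfolding y_def by (rule mat_recurrence_foldr[OF Suc(4)])
    then have "y (0 + p) + (\<Sum>i = 1..p. a i ** y (0 + p - i)) = 0" by (simp only: mat_recurrence_def)
    then have "mat (z ^ p) ** y 0 + (\<Sum>i = 1..p. a i ** (mat (z ^ (p - i)) ** y 0)) = 0" using yk[of p] yk[of "p - _"] by (simp only: add_0)
    then have eq: "(mat (z ^ p) + (\<Sum>i = 1..p. mat (z ^ (p - i)) ** a i)) ** y 0 = 0"
      by (simp add: matrix_mult_add_left matrix_mult_sum_left mat_mult_commute matrix_mul_assoc[symmetric])
    have "det (mat (z ^ p) + (\<Sum>i = 1..p. mat (z ^ (p - i)) ** a i)) = 0"
    proof (rule ccontr)
      assume "\<not> ?thesis"
      then have "invertible (mat (z ^ p) + (\<Sum>i = 1..p. mat (z ^ (p - i)) ** a i))" by (simp add: invertible_det_nz)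
      then obtain R where "R ** (mat (z ^ p) + (\<Sum>i = 1..p. mat (z ^ (p - i)) ** a i)) = mat 1" by (auto simp: invertible_def)
      then have "y 0 = R ** ((mat (z ^ p) + (\<Sum>i = 1..p. mat (z ^ (p - i)) ** a i)) ** y 0)" by (simp add: matrix_mul_assoc)
      also have "\<dots> = 0" unfolding eq by (simp add: matrix_matrix_mult_def vec_eq_iff)
      finally show False using y0 by simp
    qed
    then show ?thesis using ls(1) zy unfolding y_def by (intro exI[of _ "z # ls"]) auto
  qed
qed

text \<open>More vectors than the dimension are dependent. A repetition among them is treated apart,
  since the set of vectors would then be too small for this.\<close>

lemma finite_dim_dependence:
  fixes v :: "nat \<Rightarrow> 'v::euclidean_space"
  shows "\<exists>c :: nat \<Rightarrow> real. \<exists>N. (\<exists>l\<le>N. c l \<noteq> 0) \<and> (\<Sum>l\<le>N. c l *\<^sub>R v l) = 0"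
proof (cases "inj_on v {..DIM('v)}")
  case True
  let ?S = "v ` {..DIM('v)}"
  have "dependent ?S" using True by (intro dependent_biggerset) (simp add: card_image)
  then obtain u s where s: "s \<in> ?S" "u s \<noteq> 0" and sum: "(\<Sum>s\<in>?S. u s *\<^sub>R s) = 0"
    by (auto simp: dependent_finite)
  have "(\<Sum>l\<le>DIM('v). u (v l) *\<^sub>R v l) = 0" using sum by (simp add: sum.reindex[OF True])
  moreover obtain l where "l \<le> DIM('v)" "s = v l" using s(1) by auto
  ultimately show ?thesis using s(2) by (intro exI[of _ "\<lambda>l. u (v l)"] exI[of _ "DIM('v)"]) auto
next
  case False
  then obtain i j where ij: "i \<le> DIM('v)" "j \<le> DIM('v)" "v i = v j" "i \<noteq> j" by (auto simp: inj_on_def)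
  define c where "c l = (if l = i then 1 else if l = j then -1 else (0::real))" for l
  have "(\<Sum>l\<le>DIM('v). c l *\<^sub>R v l) = (\<Sum>l\<in>{i, j}. c l *\<^sub>R v l)"
    using ij by (intro sum.mono_neutral_right) (auto simp: c_def)
  also have "\<dots> = 0" using ij by (simp add: c_def)
  finally show ?thesis using ij by (intro exI[of _ c] exI[of _ "DIM('v)"]) (auto simp: c_def)
qed

lemma bij_betw_pos: "bij_betw (pos :: 'p::{finite,linorder} \<Rightarrow> nat) UNIV {..<CARD('p)}"
proof -
  have less: "pos k < pos l" if "k < l" for k l :: 'p
    unfolding pos_def using that by (intro psubset_card_mono) auto
  then have inj: "inj (pos :: 'p \<Rightarrow> nat)" by (metis injI less_irrefl linorder_neqE)
  have "pos k < CARD('p)" for k :: 'p unfolding pos_def by (intro psubset_card_mono) auto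
  then have "range (pos :: 'p \<Rightarrow> nat) \<subseteq> {..<CARD('p)}" by auto
  then have "range (pos :: 'p \<Rightarrow> nat) = {..<CARD('p)}" using inj by (intro card_subset_eq) (auto simp: card_image)
  then show ?thesis using inj by (simp add: bij_betw_def)
qed

lemma pos_less: "pos (k :: 'p::{finite,linorder}) < CARD('p)"
  using bij_betwE[OF bij_betw_pos[where 'p='p]] by auto

lemma pos_inj [simp]: "pos k = pos l \<longleftrightarrow> k = (l :: 'p::{finite,linorder})"
  using bij_betw_imp_inj_on[OF bij_betw_pos[where 'p='p]] by (auto simp: inj_on_def)

lemma pos_surj: "n < CARD('p) \<Longrightarrow> \<exists>k :: 'p::{finite,linorder}. pos k = n"
  using bij_betw_imp_surj_on[OF bij_betw_pos[where 'p='p]] by (metis imageE lessThan_iff)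

lemma mat_recurrence_zero:
  assumes "mat_recurrence p a y" "\<And>k. k < p \<Longrightarrow> y k = 0"
  shows "y k = 0"
proof (induction k rule: less_induct)
  case (less k)
  show ?case
  proof (cases "k < p")
    case False
    then obtain j where j: "k = j + p" using le_add_diff_inverse2[of p k] by (metis not_less)
    have "a i ** y (j + p - i) = 0" if "i \<in> {1..p}" for i
    proof -
      have "y (j + p - i) = 0" using that j by (intro less) auto
      then show ?thesis by simp
    qed
    then have "(\<Sum>i = 1..p. a i ** y (j + p - i)) = 0" by (intro sum.neutral) auto
    moreover have "y (j + p) + (\<Sum>i = 1..p. a i ** y (j + p - i)) = 0" using assms(1) by (simp only: mat_recurrence_def)
    ultimately show ?thesis unfolding j by (simp only: add_0_right)
  qed (use assms in auto)
qed

text \<open>Windows of p consecutive terms of x live in a finite-dimensional space and are therefore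
  linearly dependent. The same combination y of shifts of x solves the recurrence with vanishing
  initial values, hence is 0, and its coefficients are those of m.\<close>

lemma mat_recurrence_annihilated:
  fixes x :: "nat \<Rightarrow> complex ^ 'd ^ 'd"
  assumes x: "mat_recurrence CARD('p::{finite,linorder}) a x"
  shows "\<exists>m. m \<noteq> 0 \<and> poly_action m x = (\<lambda>_. 0)"
proof -
  let ?p = "CARD('p)"
  obtain c N where c: "\<exists>l\<le>N. c l \<noteq> 0" "(\<Sum>l\<le>N. c l *\<^sub>R (\<chi> k::'p. x (l + pos k))) = 0"
    using finite_dim_dependence[of "\<lambda>l. \<chi> k::'p. x (l + pos k)"] by blast
  define y where "y k = (\<Sum>l\<le>N. mat (of_real (c l)) ** x (k + l))" for k
  have y_init: "y j = 0" if j: "j < ?p" for j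
  proof -
    obtain k :: 'p where k: "pos k = j" using pos_surj[OF j] by blast
    have "(\<Sum>l\<le>N. c l *\<^sub>R (\<chi> k::'p. x (l + pos k))) $ k = 0" by (simp only: c(2) zero_index)
    then have "(\<Sum>l\<le>N. c l *\<^sub>R x (l + j)) = 0" by (simp add: k)
    moreover have "mat (of_real r) ** X = r *\<^sub>R X" for r and X :: "complex ^ 'd ^ 'd"
      by (simp add: vec_eq_iff scaleR_conv_of_real[where 'a=complex])
    ultimately show ?thesis by (simp add: y_def add.commute)
  qed
  have y_rec: "mat_recurrence ?p a y"
    unfolding mat_recurrence_def
  proof
    fix k
    have "a i ** y (k + ?p - i) = (\<Sum>l\<le>N. mat (of_real (c l)) ** (a i ** x ((k + l) + ?p - i)))" if "i \<in> {1..?p}" for i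
    proof -
      have "k + ?p - i + l = (k + l) + ?p - i" for l using that by auto
      then show ?thesis by (simp add: y_def matrix_mult_sum_right mat_mult_commute)
    qed
    then have "y (k + ?p) + (\<Sum>i = 1..?p. a i ** y (k + ?p - i)) =
      (\<Sum>l\<le>N. mat (of_real (c l)) ** x ((k + l) + ?p)) + (\<Sum>i = 1..?p. \<Sum>l\<le>N. mat (of_real (c l)) ** (a i ** x ((k + l) + ?p - i)))"
      by (simp add: y_def add_ac)
    also have "\<dots> = (\<Sum>l\<le>N. mat (of_real (c l)) ** (x ((k + l) + ?p) + (\<Sum>i = 1..?p. a i ** x ((k + l) + ?p - i))))"
      by (subst sum.swap) (simp add: matrix_add_ldistrib matrix_mult_sum_right sum.distrib)
    also have "\<dots> = 0"
    proof (rule sum.neutral, rule ballI)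
      fix l
      have "x ((k + l) + ?p) + (\<Sum>i = 1..?p. a i ** x ((k + l) + ?p - i)) = 0" using x by (simp only: mat_recurrence_def)
      then show "mat (of_real (c l)) ** (x ((k + l) + ?p) + (\<Sum>i = 1..?p. a i ** x ((k + l) + ?p - i))) = 0" by simp
    qed
    finally show "y (k + ?p) + (\<Sum>i = 1..?p. a i ** y (k + ?p - i)) = 0" .
  qed
  have y0: "y k = 0" for k by (rule mat_recurrence_zero[OF y_rec y_init])
  define m where "m = (\<Sum>l\<le>N. monom (complex_of_real (c l)) l)"
  have cm: "coeff m l = (if l \<le> N then of_real (c l) else 0)" for l
    by (simp add: m_def coeff_sum sum.delta)
  obtain l where "l \<le> N" "c l \<noteq> 0" using c(1) by blast
  then have "coeff m l \<noteq> 0" by (simp add: cm)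
  then have "m \<noteq> 0" by auto
  moreover have "poly_action m x k = 0" for k
  proof -
    have deg: "degree m \<le> N" by (rule degree_le) (simp add: cm)
    have "poly_action m x k = (\<Sum>l\<le>N. mat (coeff m l) ** x (k + l))"
      unfolding poly_action_def using deg by (intro sum.mono_neutral_left) (auto simp: coeff_eq_0)
    also have "\<dots> = y k" unfolding y_def by (intro sum.cong) (auto simp: cm)
    finally show ?thesis by (simp add: y0)
  qed
  ultimately show ?thesis by blast
qed

lemma mat_recurrence_exp_decay:
  fixes x :: "nat \<Rightarrow> complex ^ 'd ^ 'd"
  assumes x: "mat_recurrence CARD('p::{finite,linorder}) a x" and g: "\<And>i j. geometric_growth (\<lambda>k. x k $ i $ j)"
    and neg: "\<And>z. det (mat (z ^ CARD('p)) + (\<Sum>i = 1..CARD('p). mat (z ^ (CARD('p) - i)) ** a i)) = 0 \<Longrightarrow> Re z < 0"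
  shows "\<exists>c>0. \<forall>n i j. exp_decay c (egf (\<lambda>k. x (k + n) $ i $ j))"
proof -
  obtain m where m: "m \<noteq> 0" "poly_action m x = (\<lambda>_. 0)" using mat_recurrence_annihilated[OF x] by blast
  obtain ls where ls: "\<forall>z\<in>set ls. Re z < 0" "foldr mat_shift_diff ls x = (\<lambda>_. 0)"
    using annihilating_roots[OF m(1) x m(2)] neg by blast
  \<comment> \<open>Only finitely many roots occur, all to the left of the imaginary axis; halving
    their distance to it keeps the inequality strict.\<close>
  have "\<exists>c>0. \<forall>l\<in>set ls. Re l < - c"
    using ls(1)
  proof (induction ls)
    case (Cons l ls)
    then obtain c where c: "c > 0" "\<forall>l\<in>set ls. Re l < - c" by auto
    then show ?case using Cons.prems by (intro exI[of _ "min c (- Re l / 2)"]) (auto simp: min_def)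
  qed (auto intro: exI[of _ 1])
  then obtain c where c: "c > 0" "\<forall>l\<in>set ls. Re l < - c" by blast
  have shift: "foldr mat_shift_diff ls (\<lambda>k. x (k + n)) k = foldr mat_shift_diff ls x (k + n)" for n k
    by (induction ls arbitrary: k) (simp_all add: mat_shift_diff_def)
  have "exp_decay c (egf (\<lambda>k. x (k + n) $ i $ j))" for n i j
  proof (rule exp_decay_annihilated[OF geometric_growth_shift[OF g] c(2)])
    show "foldr shift_diff ls (\<lambda>k. x (k + n) $ i $ j) = (\<lambda>_. 0)"
      using ls(2) by (simp add: fun_eq_iff foldr_mat_shift_diff_entry[symmetric] shift)
  qed
  then show ?thesis using c(1) by blast
qed

subsection \<open>The causal kernel and its Laplace transform\<close>

text \<open>The Laplace transform, on the imaginary axis, of the n-th derivative of the function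
  generated by x.\<close>

definition laplace_mat :: "(nat \<Rightarrow> complex ^ 'd ^ 'd) \<Rightarrow> real \<Rightarrow> nat \<Rightarrow> complex ^ 'd ^ 'd" where
  "laplace_mat x \<mu> n = (\<chi> i j. LINT u|lborel. indicator {0..} u *\<^sub>R (exp (- (\<i> * of_real (\<mu> * u))) * egf (\<lambda>k. x (k + n) $ i $ j) u))"

lemma egf_lincomb:
  assumes "finite I" "\<And>s. s \<in> I \<Longrightarrow> geometric_growth (y s)"
  shows "egf (\<lambda>k. \<Sum>s\<in>I. c s * y s k) u = (\<Sum>s\<in>I. c s * egf (y s) u)"
proof -
  have "egf (\<lambda>k. \<Sum>s\<in>I. c s * y s k) u = (\<Sum>k. \<Sum>s\<in>I. c s * (y s k / fact k * of_real u ^ k))"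
    unfolding egf_def by (intro suminf_cong) (simp add: sum_divide_distrib sum_distrib_right sum_distrib_left mult_ac)
  also have "\<dots> = (\<Sum>s\<in>I. \<Sum>k. c s * (y s k / fact k * of_real u ^ k))"
    using assms by (intro suminf_sum summable_mult egf_summable)
  also have "\<dots> = (\<Sum>s\<in>I. c s * egf (y s) u)"
    unfolding egf_def using assms by (intro sum.cong suminf_mult egf_summable) auto
  finally show ?thesis .
qed

text \<open>The transforms T n of the derivatives are evaluated twice. Repeated partial integration
  expresses T n by T 0 and the initial values, and the recurrence is a linear relation among T 0,
  ..., T p. Inserting the former into the latter collects the characteristic matrix in front of T
  0.\<close>

lemma laplace_mat_transfer:
  fixes x :: "nat \<Rightarrow> complex ^ 'd ^ 'd"
  assumes x: "mat_recurrence p a x" and g: "\<And>i j. geometric_growth (\<lambda>k. x k $ i $ j)"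
    and c: "c > 0" and d: "\<And>n i j. exp_decay c (egf (\<lambda>k. x (k + n) $ i $ j))"
  shows "(mat ((\<i> * of_real \<mu>) ^ p) + (\<Sum>i = 1..p. mat ((\<i> * of_real \<mu>) ^ (p - i)) ** a i)) ** laplace_mat x \<mu> 0 =
    (\<Sum>k<p. mat ((\<i> * of_real \<mu>) ^ (p - 1 - k)) ** (x k + (\<Sum>i = 1..k. a i ** x (k - i))))"
proof -
  define z where "z = \<i> * of_real \<mu>"
  let ?T = "laplace_mat x \<mu>"
  have gs: "geometric_growth (\<lambda>k. x (k + n) $ i $ j)" for n i j by (rule geometric_growth_shift[OF g])
  have T_Suc: "?T (Suc n) = mat z ** ?T n - x n" for n
    using laplace_shift[OF gs[of n] d[of n] _ c] d[of "Suc n"]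
    by (simp add: laplace_mat_def vec_eq_iff z_def)
  have T: "?T n = mat (z ^ n) ** ?T 0 - (\<Sum>l<n. mat (z ^ (n - 1 - l)) ** x l)" for n
  proof (induction n)
    case (Suc n)
    have "mat z ** (mat (z ^ (n - 1 - l)) ** x l) = mat (z ^ (Suc n - 1 - l)) ** x l" if "l < n" for l
    proof -
      have "Suc n - 1 - l = Suc (n - 1 - l)" using that by simp
      then show ?thesis by (simp only: power_Suc mat_mult_mat)
    qed
    then have "mat z ** (\<Sum>l<n. mat (z ^ (n - 1 - l)) ** x l) = (\<Sum>l<n. mat (z ^ (Suc n - 1 - l)) ** x l)"
      unfolding matrix_mult_sum_right by (intro sum.cong) auto
    then have "mat z ** ?T n = mat (z ^ Suc n) ** ?T 0 - (\<Sum>l<n. mat (z ^ (Suc n - 1 - l)) ** x l)"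
      by (subst Suc) (simp only: matrix_mult_diff_right power_Suc mat_mult_mat)
    then have "?T (Suc n) = mat (z ^ Suc n) ** ?T 0 - (\<Sum>l<n. mat (z ^ (Suc n - 1 - l)) ** x l) - x n" by (simp only: T_Suc)
    moreover have "mat (z ^ (Suc n - 1 - n)) ** x n = x n" by simp
    ultimately show ?case by (simp only: sum.lessThan_Suc diff_diff_eq)
  qed simp
  have T_rec: "?T p + (\<Sum>i = 1..p. a i ** ?T (p - i)) = 0"
  proof -
    have "?T p $ r $ j = - (\<Sum>i = 1..p. a i ** ?T (p - i)) $ r $ j" for r j
    proof -
      let ?I = "{1..p} \<times> (UNIV :: 'd set)"
      have seq: "x (k + p) $ r $ j = (\<Sum>(i, m)\<in>?I. - (a i $ r $ m) * x (k + (p - i)) $ m $ j)" for k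
      proof -
        have "x (k + p) + (\<Sum>i = 1..p. a i ** x (k + p - i)) = 0" using x by (simp only: mat_recurrence_def)
        then have "x (k + p) $ r $ j = - (\<Sum>i = 1..p. a i ** x (k + p - i)) $ r $ j"
          by (simp only: eq_neg_iff_add_eq_0[symmetric] vector_uminus_component)
        also have "(\<Sum>i = 1..p. a i ** x (k + p - i)) = (\<Sum>i = 1..p. a i ** x (k + (p - i)))" by (intro sum.cong) auto
        also have "- \<dots> $ r $ j = (\<Sum>i = 1..p. \<Sum>m\<in>UNIV. - (a i $ r $ m) * x (k + (p - i)) $ m $ j)"
          by (simp add: matrix_matrix_mult_def sum_negf)
        also have "\<dots> = (\<Sum>(i, m)\<in>?I. - (a i $ r $ m) * x (k + (p - i)) $ m $ j)"
          by (simp only: sum.cartesian_product)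
        finally show ?thesis .
      qed
      have "egf (\<lambda>k. x (k + p) $ r $ j) u = (\<Sum>s\<in>?I. - (a (fst s) $ r $ snd s) * egf (\<lambda>k. x (k + (p - fst s)) $ snd s $ j) u)" for u
        unfolding seq split_beta by (rule egf_lincomb) (auto intro: gs)
      then have "?T p $ r $ j = (LINT u|lborel. (\<Sum>s\<in>?I. - (a (fst s) $ r $ snd s) *
          (indicator {0..} u *\<^sub>R (exp (- (\<i> * of_real (\<mu> * u))) * egf (\<lambda>k. x (k + (p - fst s)) $ snd s $ j) u))))"
        unfolding laplace_mat_def
        by (simp, intro Bochner_Integration.integral_cong refl) (simp add: sum_distrib_left scaleR_sum_right indicator_def mult_ac)
      also have "\<dots> = (\<Sum>s\<in>?I. LINT u|lborel. - (a (fst s) $ r $ snd s) *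
          (indicator {0..} u *\<^sub>R (exp (- (\<i> * of_real (\<mu> * u))) * egf (\<lambda>k. x (k + (p - fst s)) $ snd s $ j) u)))"
        by (intro Bochner_Integration.integral_sum integrable_mult_right exp_decay_integrable[OF gs d c])
      also have "\<dots> = (\<Sum>s\<in>?I. - (a (fst s) $ r $ snd s) * ?T (p - fst s) $ snd s $ j)"
        unfolding integral_mult_right_zero by (simp add: laplace_mat_def)
      also have "\<dots> = (\<Sum>i = 1..p. \<Sum>m\<in>UNIV. - (a i $ r $ m) * ?T (p - i) $ m $ j)"
        by (simp add: sum.cartesian_product split_beta)
      finally show ?thesis by (simp add: matrix_matrix_mult_def sum_negf)
    qed
    then show ?thesis by (simp add: vec_eq_iff)
  qed
  have aT: "a i ** ?T (p - i) = mat (z ^ (p - i)) ** (a i ** ?T 0) - (\<Sum>l<p - i. mat (z ^ (p - i - 1 - l)) ** (a i ** x l))" for i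
    by (subst T) (simp only: matrix_mult_diff_right matrix_mult_sum_right mat_mult_commute)
  have "(mat (z ^ p) + (\<Sum>i = 1..p. mat (z ^ (p - i)) ** a i)) ** ?T 0 = mat (z ^ p) ** ?T 0 + (\<Sum>i = 1..p. mat (z ^ (p - i)) ** (a i ** ?T 0))"
    by (simp only: matrix_mult_add_left matrix_mult_sum_left matrix_mul_assoc)
  also have "\<dots> = (\<Sum>l<p. mat (z ^ (p - 1 - l)) ** x l) + (\<Sum>i = 1..p. \<Sum>l<p - i. mat (z ^ (p - i - 1 - l)) ** (a i ** x l))"
  proof -
    have "a + c = b + d" if "(a - b) + (c - d) = 0" for a b c d :: "complex ^ 'd ^ 'd"
      using that unfolding add_diff_add[symmetric] by simp
    then show ?thesis using T_rec unfolding aT sum_subtractf T[of p] by blast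
  qed
  \<comment> \<open>Collects equal powers of z: the term with a i and x l goes to k = l + i.\<close>
  also have "(\<Sum>i = 1..p. \<Sum>l<p - i. mat (z ^ (p - i - 1 - l)) ** (a i ** x l)) = (\<Sum>k<p. \<Sum>i = 1..k. mat (z ^ (p - 1 - k)) ** (a i ** x (k - i)))"
  proof -
    have "(\<Sum>(i, l)\<in>(SIGMA i:{1..p}. {..<p - i}). mat (z ^ (p - i - 1 - l)) ** (a i ** x l)) =
      (\<Sum>(k, i)\<in>(SIGMA k:{..<p}. {1..k}). mat (z ^ (p - 1 - k)) ** (a i ** x (k - i)))"
      by (rule sum.reindex_bij_witness[of _ "\<lambda>(k, i). (i, k - i)" "\<lambda>(i, l). (l + i, i)"]) (auto simp: add.commute)
    then show ?thesis by (simp add: sum.Sigma)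
  qed
  also have "(\<Sum>l<p. mat (z ^ (p - 1 - l)) ** x l) + \<dots> = (\<Sum>k<p. mat (z ^ (p - 1 - k)) ** (x k + (\<Sum>i = 1..k. a i ** x (k - i))))"
    by (simp add: matrix_add_ldistrib matrix_mult_sum_right sum.distrib)
  finally show ?thesis unfolding z_def .
qed

section \<open>Powers of the companion matrix and Markov parameters\<close>

definition mat_pow :: "real ^ 'n ^ 'n \<Rightarrow> nat \<Rightarrow> real ^ 'n ^ 'n" where
  "mat_pow C k = (((**) C) ^^ k) (mat 1)"

lemma mat_pow_0 [simp]: "mat_pow C 0 = mat 1" and mat_pow_Suc: "mat_pow C (Suc k) = C ** mat_pow C k"
  by (simp_all add: mat_pow_def)

lemma mat_pow_add: "mat_pow C (m + n) = mat_pow C m ** mat_pow C n"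
  by (induction m) (simp_all add: mat_pow_Suc matrix_mul_assoc)

lemma mat_pow_scale: "mat_pow (u *\<^sub>R C) k = u ^ k *\<^sub>R mat_pow C k"
  by (induction k) (simp_all add: mat_pow_Suc matrix_scalar_ac scalar_matrix_assoc[symmetric])

lemma bounded_bilinear_matrix_mult: "bounded_bilinear ((**) :: real ^ 'm ^ 'n \<Rightarrow> real ^ 'k ^ 'm \<Rightarrow> real ^ 'k ^ 'n)"
proof -
  have "bilinear ((**) :: real ^ 'm ^ 'n \<Rightarrow> real ^ 'k ^ 'm \<Rightarrow> real ^ 'k ^ 'n)"
    unfolding bilinear_def
    by (auto intro!: linearI simp: matrix_add_ldistrib matrix_mult_add_left matrix_scalar_ac scalar_matrix_assoc[symmetric])
  then show ?thesis by (simp add: bilinear_conv_bounded_bilinear)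
qed

lemma mat_pow_growth:
  fixes C :: "real ^ 'n ^ 'n"
  shows "\<exists>c R. 0 \<le> R \<and> 0 \<le> c \<and> (\<forall>k. norm (mat_pow C k) \<le> c * R ^ k)"
proof -
  obtain K where K: "K > 0" "\<And>(X :: real ^ 'n ^ 'n) (Y :: real ^ 'n ^ 'n). norm (X ** Y) \<le> norm X * norm Y * K"
    using bounded_bilinear.pos_bounded[OF bounded_bilinear_matrix_mult] by blast
  have "norm (mat_pow C k) \<le> norm (mat 1 :: real ^ 'n ^ 'n) * (norm C * K) ^ k" for k
  proof (induction k)
    case (Suc k)
    have "norm (mat_pow C (Suc k)) \<le> norm C * norm (mat_pow C k) * K" unfolding mat_pow_Suc by (rule K)
    also have "\<dots> \<le> norm C * (norm (mat 1 :: real ^ 'n ^ 'n) * (norm C * K) ^ k) * K"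
      using K(1) by (intro mult_right_mono mult_left_mono Suc) auto
    finally show ?case by (simp add: mult_ac)
  qed simp
  then show ?thesis using K(1) by (intro exI[of _ "norm (mat 1 :: real ^ 'n ^ 'n)"] exI[of _ "norm C * K"]) auto
qed

lemma matrix_exp_sums: "(\<lambda>k. (u ^ k / fact k) *\<^sub>R mat_pow C k) sums matrix_exp (u *\<^sub>R C)"
proof -
  obtain c R where c: "0 \<le> R" "0 \<le> c" "\<And>k. norm (mat_pow C k) \<le> c * R ^ k" using mat_pow_growth[of C] by blast
  have "summable (\<lambda>k. (u ^ k / fact k) *\<^sub>R mat_pow C k)"
  proof (rule summable_comparison_test)
    show "summable (\<lambda>k. c * (inverse (fact k) * (R * \<bar>u\<bar>) ^ k))" by (intro summable_mult summable_exp)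
    have "norm ((u ^ k / fact k) *\<^sub>R mat_pow C k) \<le> c * (inverse (fact k) * (R * \<bar>u\<bar>) ^ k)" for k
    proof -
      have "norm ((u ^ k / fact k) *\<^sub>R mat_pow C k) = (\<bar>u\<bar> ^ k / fact k) * norm (mat_pow C k)" by (simp add: power_abs)
      also have "\<dots> \<le> (\<bar>u\<bar> ^ k / fact k) * (c * R ^ k)" by (intro mult_left_mono c) auto
      finally show ?thesis by (simp add: power_mult_distrib divide_inverse mult_ac)
    qed
    then show "\<exists>N. \<forall>n\<ge>N. norm ((u ^ n / fact n) *\<^sub>R mat_pow C n) \<le> c * (inverse (fact n) * (R * \<bar>u\<bar>) ^ n)" by blast
  qed
  moreover have "matrix_exp (u *\<^sub>R C) = (\<Sum>k. (u ^ k / fact k) *\<^sub>R mat_pow C k)"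
    unfolding matrix_exp_def mat_pow_def[symmetric] mat_pow_scale by (simp add: divide_inverse mult.commute)
  ultimately show ?thesis by (simp add: summable_sums)
qed

lemma block_select:
  fixes f :: "'p::{finite,linorder} \<times> 'd::finite \<Rightarrow> real"
  shows "(\<Sum>r\<in>UNIV. (case r of (l, j) \<Rightarrow> if pos l = pos m then mat 1 $ i $ j else 0) * f r) = f (m, i)"
proof -
  have "(case r of (l, j) \<Rightarrow> if pos l = pos m then mat 1 $ i $ j else 0) * f r = (if r = (m, i) then f r else 0)" for r
    by (cases r) (auto simp: mat_def)
  then show ?thesis by (simp add: sum.delta)
qed

text \<open>The blocks of the observability matrix of the state space system; for k < p they are the
  block unit rows.\<close>

definition block_row :: "(nat \<Rightarrow> real ^ 'd ^ 'd) \<Rightarrow> nat \<Rightarrow> real ^ ('p::{finite,linorder} \<times> 'd) ^ 'd" where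
  "block_row A k = first_block_row ** mat_pow (companion A) k"

lemma block_row_add: "block_row A (k + n) = block_row A n ** mat_pow (companion A) k"
  by (simp add: block_row_def mat_pow_add[symmetric] add.commute matrix_mul_assoc[symmetric])

text \<open>Multiplying a block unit row by the companion matrix selects the corresponding block row
  of that matrix, which is the next unit row until the last block row is reached.\<close>

lemma block_row_small:
  "k < CARD('p) \<Longrightarrow> (block_row A k :: real ^ ('p::{finite,linorder} \<times> 'd) ^ 'd) $ i $ r =
    (case r of (l, j) \<Rightarrow> if pos l = k then mat 1 $ i $ j else 0)"
proof (induction k arbitrary: r)
  case 0
  then show ?case by (simp add: block_row_def first_block_row_def)
next
  case (Suc k)
  have "\<exists>m :: 'p. pos m = k" by (rule pos_surj) (use Suc.prems in simp)
  then obtain m :: 'p where m: "pos m = k" by blast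
  have "(block_row A (1 + k) :: real ^ ('p \<times> 'd) ^ 'd) = block_row A k ** mat_pow (companion A) 1" by (rule block_row_add)
  then have "(block_row A (Suc k) :: real ^ ('p \<times> 'd) ^ 'd) $ i $ r = (block_row A k ** companion A) $ i $ r"
    by (simp add: mat_pow_def)
  also have "\<dots> = (\<Sum>s\<in>UNIV. (case s of (l, j) \<Rightarrow> if pos l = pos m then mat 1 $ i $ j else 0) * companion A $ s $ r)"
    using Suc by (simp add: matrix_matrix_mult_def m)
  also have "\<dots> = companion A $ (m, i) $ r" by (rule block_select)
  finally show ?case using Suc.prems by (cases r) (simp add: companion_def m)
qed

text \<open>One step beyond the unit rows, the last block row of the companion matrix appears, whose
  blocks are the negative coefficients in reversed order; this is the case k = 0. Multiplying by
  powers from the right gives every k, as the coefficients act from the left.\<close>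

lemma block_row_recurrence:
  "(block_row A (k + CARD('p)) :: real ^ ('p::{finite,linorder} \<times> 'd) ^ 'd) + (\<Sum>i = 1..CARD('p). A i ** block_row A (k + CARD('p) - i)) = 0"
proof -
  let ?p = "CARD('p)"
  have p: "?p > 0" by simp
  have base: "(block_row A ?p :: real ^ ('p \<times> 'd) ^ 'd) + (\<Sum>i = 1..?p. A i ** block_row A (?p - i)) = 0"
  proof -
    have "(block_row A ?p :: real ^ ('p \<times> 'd) ^ 'd) $ r $ (l, j) + (\<Sum>i = 1..?p. A i ** block_row A (?p - i)) $ r $ (l, j) = 0" for r l j
    proof -
      have "\<exists>m :: 'p. pos m = ?p - 1" by (rule pos_surj) (use p in simp)
      then obtain m :: 'p where m: "pos m = ?p - 1" by blast
      have Suc: "?p = Suc (?p - 1)" using p by simp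
      have "(block_row A (1 + (?p - 1)) :: real ^ ('p \<times> 'd) ^ 'd) = block_row A (?p - 1) ** mat_pow (companion A) 1" by (rule block_row_add)
      then have "(block_row A ?p :: real ^ ('p \<times> 'd) ^ 'd) = block_row A (?p - 1) ** companion A"
        using p by (simp add: mat_pow_def)
      then have "(block_row A ?p :: real ^ ('p \<times> 'd) ^ 'd) $ r $ (l, j) =
        (\<Sum>s\<in>UNIV. (case s of (l, j) \<Rightarrow> if pos l = pos m then mat 1 $ r $ j else 0) * companion A $ s $ (l, j))"
        using p by (simp add: matrix_matrix_mult_def m block_row_small)
      also have "\<dots> = companion A $ (m, r) $ (l, j)" by (rule block_select)
      also have "\<dots> = - A (?p - pos l) $ r $ j" using p by (simp add: companion_def m)
      finally have 1: "(block_row A ?p :: real ^ ('p \<times> 'd) ^ 'd) $ r $ (l, j) = - A (?p - pos l) $ r $ j" .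
      have "(A i ** (block_row A (?p - i) :: real ^ ('p \<times> 'd) ^ 'd)) $ r $ (l, j) = (if i = ?p - pos l then A i $ r $ j else 0)" if i: "i \<in> {1..?p}" for i
      proof -
        have iff: "pos l = ?p - i \<longleftrightarrow> i = ?p - pos l" using i pos_less[of l] by auto
        have "(A i ** (block_row A (?p - i) :: real ^ ('p \<times> 'd) ^ 'd)) $ r $ (l, j) = (\<Sum>n\<in>UNIV. A i $ r $ n * (if pos l = ?p - i then mat 1 $ n $ j else 0))"
          using i by (simp add: matrix_matrix_mult_def block_row_small)
        also have "\<dots> = (if pos l = ?p - i then A i $ r $ j else 0)"
          by (simp add: mat_def if_distrib[of "\<lambda>x. _ * x"] sum.delta cong: if_cong)
        finally show ?thesis by (simp only: iff)
      qed
      then have "(\<Sum>i = 1..?p. A i ** (block_row A (?p - i) :: real ^ ('p \<times> 'd) ^ 'd)) $ r $ (l, j) = (\<Sum>i = 1..?p. if i = ?p - pos l then A i $ r $ j else 0)"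
        by (simp only: sum_component) (intro sum.cong; simp)
      also have "\<dots> = A (?p - pos l) $ r $ j" using pos_less[of l] by (simp add: sum.delta)
      finally show ?thesis using 1 by simp
    qed
    then show ?thesis by (simp add: vec_eq_iff)
  qed
  have "(block_row A (k + ?p) :: real ^ ('p \<times> 'd) ^ 'd) + (\<Sum>i = 1..?p. A i ** block_row A (k + ?p - i)) =
    block_row A ?p ** mat_pow (companion A) k + (\<Sum>i = 1..?p. A i ** (block_row A (?p - i) ** mat_pow (companion A) k))"
    unfolding block_row_add[symmetric] by (intro arg_cong2[of _ _ _ _ "(+)"] sum.cong) auto
  also have "\<dots> = (block_row A ?p + (\<Sum>i = 1..?p. A i ** block_row A (?p - i))) ** mat_pow (companion A) k"
    by (simp only: matrix_mult_add_left matrix_mult_sum_left matrix_mul_assoc)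
  also have "\<dots> = 0" unfolding base by (simp add: matrix_matrix_mult_def vec_eq_iff)
  finally show ?thesis .
qed

text \<open>The Markov parameters of the state space system, that is, the derivatives of the causal
  kernel at 0.\<close>

definition markov :: "'p::{finite,linorder} itself \<Rightarrow> nat \<Rightarrow> (nat \<Rightarrow> real ^ 'd ^ 'd) \<Rightarrow> (nat \<Rightarrow> real ^ 'd ^ 'd) \<Rightarrow> nat \<Rightarrow> real ^ 'd ^ 'd" where
  "markov _ q A B k = (block_row A k :: real ^ ('p \<times> 'd) ^ 'd) ** beta_column q A B"

lemma markov_recurrence:
  fixes A B :: "nat \<Rightarrow> real ^ 'd ^ 'd"
  shows "markov TYPE('p::{finite,linorder}) q A B (k + CARD('p)) + (\<Sum>i = 1..CARD('p). A i ** markov TYPE('p) q A B (k + CARD('p) - i)) = 0"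
proof -
  have "markov TYPE('p) q A B (k + CARD('p)) + (\<Sum>i = 1..CARD('p). A i ** markov TYPE('p) q A B (k + CARD('p) - i)) =
    ((block_row A (k + CARD('p)) :: real ^ ('p \<times> 'd) ^ 'd) + (\<Sum>i = 1..CARD('p). A i ** block_row A (k + CARD('p) - i))) ** beta_column q A B"
    by (simp only: markov_def matrix_mult_add_left matrix_mult_sum_left matrix_mul_assoc)
  then show ?thesis unfolding block_row_recurrence by (simp add: matrix_matrix_mult_def vec_eq_iff)
qed

text \<open>For k < p the block row is a unit row and picks one block of \<beta>. Positions count
  from 0 and the blocks of \<beta> from 1, hence the \<open>Suc\<close>.\<close>

lemma markov_small:
  fixes A B :: "nat \<Rightarrow> real ^ 'd ^ 'd"
  assumes "k < CARD('p::{finite,linorder})"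
  shows "markov TYPE('p) q A B k = beta_block CARD('p) q A B (Suc k)"
proof -
  obtain m :: 'p where m: "pos m = k" using pos_surj[OF assms] by blast
  have "markov TYPE('p) q A B k $ i $ j = beta_block CARD('p) q A B (Suc k) $ i $ j" for i j
  proof -
    have "markov TYPE('p) q A B k $ i $ j =
      (\<Sum>s\<in>UNIV. (case s of (l, j) \<Rightarrow> if pos l = pos m then mat 1 $ i $ j else 0) * (beta_column q A B :: real ^ 'd ^ ('p \<times> 'd)) $ s $ j)"
      using assms by (simp add: markov_def matrix_matrix_mult_def m block_row_small)
    also have "\<dots> = (beta_column q A B :: real ^ 'd ^ ('p \<times> 'd)) $ (m, i) $ j" by (rule block_select)
    finally show ?thesis by (simp add: beta_column_def m)
  qed
  then show ?thesis by (simp add: vec_eq_iff)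
qed

lemma cmat_add: "cmat (X + Y) = cmat X + cmat Y" and cmat_zero: "cmat 0 = 0"
  and cmat_mult: "cmat (X ** Z) = cmat X ** cmat Z" and cmat_sum: "cmat (\<Sum>i\<in>I. f i) = (\<Sum>i\<in>I. cmat (f i))"
  by (simp_all add: cmat_def vec_eq_iff matrix_matrix_mult_def)

lemma markov_growth:
  fixes A B :: "nat \<Rightarrow> real ^ 'd ^ 'd"
  shows "geometric_growth (\<lambda>k. cmat (markov TYPE('p::{finite,linorder}) q A B k) $ i $ j)"
proof -
  let ?C = "companion A :: real ^ ('p \<times> 'd) ^ ('p \<times> 'd)"
  obtain c R where c: "0 \<le> R" "0 \<le> c" "\<And>k. norm (mat_pow ?C k) \<le> c * R ^ k" using mat_pow_growth[of ?C] by blast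
  obtain K where K: "K > 0" "\<And>(X :: real ^ ('p \<times> 'd) ^ 'd) (Y :: real ^ ('p \<times> 'd) ^ ('p \<times> 'd)). norm (X ** Y) \<le> norm X * norm Y * K"
    using bounded_bilinear.pos_bounded[OF bounded_bilinear_matrix_mult] by blast
  obtain K' where K': "K' > 0" "\<And>(X :: real ^ ('p \<times> 'd) ^ 'd) (Y :: real ^ 'd ^ ('p \<times> 'd)). norm (X ** Y) \<le> norm X * norm Y * K'"
    using bounded_bilinear.pos_bounded[OF bounded_bilinear_matrix_mult] by blast
  let ?E = "first_block_row :: real ^ ('p \<times> 'd) ^ 'd" and ?b = "beta_column q A B :: real ^ 'd ^ ('p \<times> 'd)"
  have "cmod (cmat (markov TYPE('p) q A B k) $ i $ j) \<le> (norm ?E * c * K * norm ?b * K') * R ^ k" for k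
  proof -
    have "cmod (cmat (markov TYPE('p) q A B k) $ i $ j) = \<bar>markov TYPE('p) q A B k $ i $ j\<bar>" by (simp add: cmat_def)
    also have "\<dots> \<le> norm (markov TYPE('p) q A B k)"
      using Finite_Cartesian_Product.norm_nth_le[of "markov TYPE('p) q A B k $ i" j] Finite_Cartesian_Product.norm_nth_le[of "markov TYPE('p) q A B k" i] by simp
    also have "\<dots> \<le> norm (?E ** mat_pow ?C k) * norm ?b * K'" unfolding markov_def block_row_def by (rule K')
    also have "\<dots> \<le> (norm ?E * norm (mat_pow ?C k) * K) * norm ?b * K'" using K' by (intro mult_right_mono K) auto
    also have "\<dots> \<le> (norm ?E * (c * R ^ k) * K) * norm ?b * K'" using K K' by (intro mult_right_mono mult_left_mono c) auto
    finally show ?thesis by (simp add: mult_ac)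
  qed
  then show ?thesis unfolding geometric_growth_def by blast
qed

text \<open>The exponential series may be multiplied from both sides term by term. In this form
  differentiating the kernel means shifting its Markov parameters.\<close>

lemma causal_kernel_egf:
  fixes A B :: "nat \<Rightarrow> real ^ 'd ^ 'd"
  shows "cmat (causal_kernel TYPE('p::{finite,linorder}) q A B u) $ i $ j = egf (\<lambda>k. cmat (markov TYPE('p) q A B k) $ i $ j) u"
proof -
  let ?C = "companion A :: real ^ ('p \<times> 'd) ^ ('p \<times> 'd)"
  let ?E = "first_block_row :: real ^ ('p \<times> 'd) ^ 'd" and ?b = "beta_column q A B :: real ^ 'd ^ ('p \<times> 'd)"
  have "bounded_linear (\<lambda>X. (?E ** X ** ?b) $ i $ j)"
    by (intro bounded_linear_compose[OF bounded_linear_vec_nth] bounded_linear_compose[OF bounded_bilinear.bounded_linear_left[OF bounded_bilinear_matrix_mult]] bounded_bilinear.bounded_linear_right[OF bounded_bilinear_matrix_mult])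
  from bounded_linear.sums[OF this matrix_exp_sums[of u ?C]]
  have "(\<lambda>k. (?E ** ((u ^ k / fact k) *\<^sub>R mat_pow ?C k) ** ?b) $ i $ j) sums causal_kernel TYPE('p) q A B u $ i $ j"
    by (simp add: causal_kernel_def)
  moreover have "(?E ** ((u ^ k / fact k) *\<^sub>R mat_pow ?C k) ** ?b) $ i $ j = (u ^ k / fact k) * markov TYPE('p) q A B k $ i $ j" for k
    by (simp add: markov_def block_row_def matrix_scalar_ac scalar_matrix_assoc[symmetric])
  ultimately have "(\<lambda>k. (u ^ k / fact k) * markov TYPE('p) q A B k $ i $ j) sums causal_kernel TYPE('p) q A B u $ i $ j" by simp
  then have "(\<lambda>k. complex_of_real ((u ^ k / fact k) * markov TYPE('p) q A B k $ i $ j)) sums of_real (causal_kernel TYPE('p) q A B u $ i $ j)"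
    by (simp only: sums_of_real_iff)
  then show ?thesis by (simp add: egf_def cmat_def sums_iff mult_ac)
qed

lemma transfer_fun_laplace:
  fixes A B :: "nat \<Rightarrow> real ^ 'd ^ 'd"
  assumes p: "p = CARD('p::{finite,linorder})" and "q < p" and neg: "ar_zeros p A \<subseteq> {z. Re z < 0}"
  shows "\<exists>c>0. (\<forall>n i j. exp_decay c (egf (\<lambda>k. cmat (markov TYPE('p) q A B (k + n)) $ i $ j))) \<and>
    (\<forall>\<mu>. transfer_fun p q A B \<mu> = laplace_mat (\<lambda>k. cmat (markov TYPE('p) q A B k)) \<mu> 0)"
proof -
  define x where "x k = cmat (markov TYPE('p) q A B k)" for k
  define a where "a i = cmat (A i)" for i
  have x: "mat_recurrence p a x"
    unfolding mat_recurrence_def x_def a_def p cmat_mult[symmetric] cmat_sum[symmetric] cmat_add[symmetric] markov_recurrence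
    by (simp add: cmat_zero)
  have g: "geometric_growth (\<lambda>k. x k $ i $ j)" for i j unfolding x_def by (rule markov_growth)
  have ar: "ar_poly p A z = mat (z ^ p) + (\<Sum>i = 1..p. mat (z ^ (p - i)) ** a i)" for z
    by (simp add: ar_poly_def a_def)
  have "Re z < 0" if "det (mat (z ^ CARD('p)) + (\<Sum>i = 1..CARD('p). mat (z ^ (CARD('p) - i)) ** a i)) = 0" for z
  proof -
    have "z \<in> ar_zeros p A" unfolding ar_zeros_def ar using that by (simp add: p)
    then show ?thesis using neg by auto
  qed
  from mat_recurrence_exp_decay[OF x[unfolded p] g this] obtain c where c: "c > 0" "\<And>n i j. exp_decay c (egf (\<lambda>k. x (k + n) $ i $ j))"
    by blast
  have "transfer_fun p q A B \<mu> = laplace_mat x \<mu> 0" for \<mu>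
  proof -
    define z where "z = \<i> * complex_of_real \<mu>"
    have "ar_poly p A z ** laplace_mat x \<mu> 0 = (\<Sum>k<p. mat (z ^ (p - 1 - k)) ** (x k + (\<Sum>i = 1..k. a i ** x (k - i))))"
      unfolding ar z_def by (rule laplace_mat_transfer[OF x g c])
    also have "\<dots> = (\<Sum>k<p. mat (z ^ (p - 1 - k)) ** cmat (if p - Suc k \<le> q then B (q - (p - Suc k)) else 0))"
    proof (rule sum.cong[OF refl])
      fix k assume k: "k \<in> {..<p}"
      have "(\<Sum>i = 1..k. a i ** x (k - i)) = cmat (\<Sum>i = 1..k. A i ** beta_block p q A B (Suc k - i))"
        unfolding cmat_sum cmat_mult
      proof (rule sum.cong[OF refl])
        fix i assume "i \<in> {1..k}"
        then have "Suc (k - i) = Suc k - i" "k - i < CARD('p)" using k p by auto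
        then show "a i ** x (k - i) = cmat (A i) ** cmat (beta_block p q A B (Suc k - i))"
          by (simp only: x_def a_def markov_small p)
      qed
      moreover have "x k = cmat (beta_block p q A B (Suc k))" using k p by (simp only: x_def markov_small lessThan_iff)
      ultimately have "x k + (\<Sum>i = 1..k. a i ** x (k - i)) = cmat (beta_block p q A B (Suc k) + (\<Sum>i = 1..k. A i ** beta_block p q A B (Suc k - i)))"
        by (simp only: cmat_add)
      \<comment> \<open>One unfolding of the recursion for \<beta>: the sums cancel, and only the
        coefficient of Q remains.\<close>
      also have "beta_block p q A B (Suc k) + (\<Sum>i = 1..k. A i ** beta_block p q A B (Suc k - i)) = (if p - Suc k \<le> q then B (q - (p - Suc k)) else 0)"
        by (subst beta_block.simps) simp
      finally show "mat (z ^ (p - 1 - k)) ** (x k + (\<Sum>i = 1..k. a i ** x (k - i))) = mat (z ^ (p - 1 - k)) ** cmat (if p - Suc k \<le> q then B (q - (p - Suc k)) else 0)"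
        by simp
    qed
    \<comment> \<open>With m = p - 1 - k the sum runs over the powers of z. Terms with m > q vanish,
      and q < p ensures that no power up to q is missing.\<close>
    also have "\<dots> = (\<Sum>m<p. mat (z ^ m) ** cmat (if m \<le> q then B (q - m) else 0))"
      by (rule sum.reindex_bij_witness[of _ "\<lambda>m. p - 1 - m" "\<lambda>k. p - 1 - k"]) auto
    also have "\<dots> = (\<Sum>m\<in>{..q}. mat (z ^ m) ** cmat (B (q - m)))"
    proof -
      have "(\<Sum>m\<in>{..q}. mat (z ^ m) ** cmat (B (q - m))) = (\<Sum>m\<in>{..q}. mat (z ^ m) ** cmat (if m \<le> q then B (q - m) else 0))"
        by (intro sum.cong) auto
      also have "\<dots> = (\<Sum>m<p. mat (z ^ m) ** cmat (if m \<le> q then B (q - m) else 0))"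
        using \<open>q < p\<close> by (intro sum.mono_neutral_left) (auto simp: cmat_zero)
      finally show ?thesis by simp
    qed
    also have "\<dots> = ma_poly q B z"
      unfolding ma_poly_def by (rule sum.reindex_bij_witness[of _ "\<lambda>m. q - m" "\<lambda>m. q - m"]) auto
    finally have PT: "ar_poly p A z ** laplace_mat x \<mu> 0 = ma_poly q B z" .
    have "z \<notin> ar_zeros p A" using neg by (auto simp: z_def)
    then have "invertible (ar_poly p A z)" by (simp add: ar_zeros_def invertible_det_nz)
    then have "matrix_inv (ar_poly p A z) ** ar_poly p A z = mat 1"
      unfolding invertible_def matrix_inv_def by (rule someI2_ex) auto
    then have "laplace_mat x \<mu> 0 = matrix_inv (ar_poly p A z) ** (ar_poly p A z ** laplace_mat x \<mu> 0)"
      by (simp add: matrix_mul_assoc)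
    then have "laplace_mat x \<mu> 0 = matrix_inv (ar_poly p A z) ** ma_poly q B z" unfolding PT .
    then show ?thesis by (simp add: transfer_fun_def z_def)
  qed
  then show ?thesis using c unfolding x_def by blast
qed

subsection \<open>Fejer means\<close>

text \<open>The Fejer kernel of the line, normalised to mass 1; the value 1 / 2 is the limit of the
  quotient at 0.\<close>

definition fejer :: "real \<Rightarrow> real" where
  "fejer x = (if x = 0 then 1 / 2 else (1 - cos x) / x\<^sup>2) / pi"

lemma fejer_nonneg: "0 \<le> fejer x"
  by (simp add: fejer_def)

lemma fejer_measurable [measurable]: "fejer \<in> borel_measurable borel"
  unfolding fejer_def[abs_def] by measurable

lemma fejer_even: "fejer (- x) = fejer x"
  by (simp add: fejer_def)

lemma nn_integral_fejer: "(\<integral>\<^sup>+x. ennreal (fejer x) \<partial>lborel) = 1"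
proof -
  \<comment> \<open>The antiderivative found by partial integration of (1 - cos x) / x^2. As
    division by 0 yields 0, the second term takes its limiting value at 0, so A is differentiable
    there too. Since Si tends to pi / 2, each half-line has mass 1 / 2.\<close>
  define A where "A x = (Si x - (1 - cos x) / x) / pi" for x
  have "(\<integral>\<^sup>+x. ennreal (fejer x) * indicator {0..} x \<partial>lborel) = ennreal (1 / 2 - A 0)"
  proof (rule nn_integral_FTC_atLeast)
    fix x :: real assume "0 \<le> x"
    show "(A has_real_derivative fejer x) (at x)"
    proof (cases "x = 0")
      case True
      have "((\<lambda>h::real. ((1 - cos h) / h - 0) / (h - 0)) \<longlongrightarrow> 1 / 2) (at 0)" by real_asymp
      then have "((\<lambda>x. (1 - cos x) / x) has_real_derivative 1 / 2) (at 0)"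
        by (simp add: has_field_derivative_iff)
      then have "(A has_real_derivative (sinc 0 - 1 / 2) / pi) (at 0)"
        unfolding A_def by (intro DERIV_cdivide DERIV_diff DERIV_Si)
      then show ?thesis using True by (simp add: fejer_def)
    next
      case False
      have "((\<lambda>x. (1 - cos x) / x) has_real_derivative (sin x * x - (1 - cos x)) / x\<^sup>2) (at x)"
        using False by (auto intro!: derivative_eq_intros simp: power2_eq_square)
      then have "(A has_real_derivative (sinc x - (sin x * x - (1 - cos x)) / x\<^sup>2) / pi) (at x)"
        unfolding A_def by (intro DERIV_cdivide DERIV_diff DERIV_Si)
      moreover have "sinc x - (sin x * x - (1 - cos x)) / x\<^sup>2 = (1 - cos x) / x\<^sup>2"
        using False by (simp add: field_simps power2_eq_square)
      ultimately show ?thesis using False by (simp add: fejer_def)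
    qed
  next
    have "((\<lambda>x::real. (1 - cos x) / x) \<longlongrightarrow> 0) at_top"
    proof (rule Lim_null_comparison)
      show "\<forall>\<^sub>F x::real in at_top. norm ((1 - cos x) / x) \<le> 2 * inverse x"
        using eventually_gt_at_top[of 0]
      proof eventually_elim
        case (elim x)
        have "\<bar>1 - cos x\<bar> \<le> 2" using cos_ge_minus_one[of x] cos_le_one[of x] by linarith
        then show ?case using elim by (simp add: divide_right_mono divide_inverse)
      qed
      have "((\<lambda>x::real. 2 * inverse x) \<longlongrightarrow> 2 * 0) at_top" by (intro tendsto_intros tendsto_inverse_0_at_top filterlim_ident)
      then show "((\<lambda>x::real. 2 * inverse x) \<longlongrightarrow> 0) at_top" by simp
    qed
    then have "(A \<longlongrightarrow> (pi / 2 - 0) / pi) at_top" unfolding A_def by (intro tendsto_intros Si_at_top) auto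
    then show "(A \<longlongrightarrow> 1 / 2) at_top" by simp
  qed (auto simp: fejer_nonneg)
  also have "A 0 = 0" by (simp add: A_def Si_alt_def zero_ereal_def)
  finally have half: "(\<integral>\<^sup>+x. ennreal (fejer x) * indicator {0..} x \<partial>lborel) = ennreal (1 / 2)" by simp
  have half': "(\<integral>\<^sup>+x. ennreal (fejer x) * indicator {..0} x \<partial>lborel) = ennreal (1 / 2)"
    using half nn_integral_real_affine[of "\<lambda>x. ennreal (fejer x) * indicator {0..} x" "-1" 0]
    by (simp add: fejer_even indicator_def)
  have "(\<integral>\<^sup>+x. ennreal (fejer x) \<partial>lborel) = (\<integral>\<^sup>+x. ennreal (fejer x) * indicator {0..} x + ennreal (fejer x) * indicator {..0} x \<partial>lborel)"
    using AE_lborel_singleton[of "0::real"] by (intro nn_integral_cong_AE) (auto simp: indicator_def elim!: eventually_mono)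
  also have "\<dots> = ennreal (1 / 2) + ennreal (1 / 2)" by (subst nn_integral_add) (auto simp: half half')
  also have "\<dots> = ennreal (1 / 2 + 1 / 2)" by (rule ennreal_plus[symmetric]) auto
  finally show ?thesis by simp
qed

lemma integrable_fejer: "integrable lborel fejer" and integral_fejer: "(LINT x|lborel. fejer x) = 1"
proof -
  show i: "integrable lborel fejer"
    by (rule integrableI_bounded) (simp_all add: fejer_nonneg nn_integral_fejer)
  have "ennreal (LINT x|lborel. fejer x) = 1"
    using nn_integral_eq_integral[OF i] by (simp add: fejer_nonneg nn_integral_fejer)
  then show "(LINT x|lborel. fejer x) = 1" by (simp add: ennreal_eq_1)
qed

definition triangle :: "real \<Rightarrow> real \<Rightarrow> complex" where
  "triangle \<rho> \<mu> = indicator {-\<rho>..\<rho>} \<mu> * of_real (1 - \<bar>\<mu>\<bar> / \<rho>)"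

lemma triangle_measurable [measurable]: "triangle \<rho> \<in> borel_measurable borel"
  unfolding triangle_def[abs_def] by measurable

text \<open>The weight is linear on each half of its support, so a polynomial of degree 1 times an
  exponential is integrated twice. The antiderivative divides by v, hence v is nonzero.\<close>

lemma triangle_transform:
  assumes \<rho>: "\<rho> > 0" and v: "v \<noteq> 0"
  shows "(LINT \<mu>|lborel. triangle \<rho> \<mu> * exp (\<i> * of_real (\<mu> * v))) = of_real (2 * pi * (\<rho> * fejer (\<rho> * v)))"
proof -
  define e where "e \<mu> = exp (\<i> * of_real v * of_real \<mu>)" for \<mu> :: real
  define w where "w = \<i> * complex_of_real v"
  have w: "w \<noteq> 0" using v by (simp add: w_def)
  have r: "complex_of_real \<rho> \<noteq> 0" using \<rho> by simp
  have de: "(e has_vector_derivative e x * w) (at x within S)" for x S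
    unfolding e_def w_def by (rule has_vector_derivative_real_field) (auto intro!: derivative_eq_intros)
  have da: "((\<lambda>\<mu>. 1 + s * complex_of_real \<mu> / of_real \<rho>) has_vector_derivative s / of_real \<rho>) (at x within S)" for x S s
    by (rule has_vector_derivative_real_field) (use \<rho> in \<open>auto intro!: derivative_eq_intros\<close>)
  \<comment> \<open>The sign s of the slope is -1 on [0, \<rho>] and 1 on [-\<rho>, 0]; one
    antiderivative covers both halves.\<close>
  have anti: "((\<lambda>\<mu>. (1 + s * complex_of_real \<mu> / of_real \<rho>) * e \<mu> / w - s / of_real \<rho> * e \<mu> / w\<^sup>2) has_vector_derivative (1 + s * complex_of_real x / of_real \<rho>) * e x) (at x within S)" for x S s
  proof -
    have "((\<lambda>\<mu>. (1 + s * complex_of_real \<mu> / of_real \<rho>) * e \<mu> / w - s / of_real \<rho> * e \<mu> / w\<^sup>2) has_vector_derivative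
      ((1 + s * complex_of_real x / of_real \<rho>) * (e x * w) + s / of_real \<rho> * e x) / w - s / of_real \<rho> * (e x * w) / w\<^sup>2) (at x within S)"
      unfolding divide_inverse[of _ w] divide_inverse[of _ "w\<^sup>2"]
      by (intro has_vector_derivative_diff has_vector_derivative_mult_left has_vector_derivative_mult_right has_vector_derivative_mult de da)
    moreover have "((1 + s * complex_of_real x / of_real \<rho>) * (e x * w) + s / of_real \<rho> * e x) / w - s / of_real \<rho> * (e x * w) / w\<^sup>2 = (1 + s * complex_of_real x / of_real \<rho>) * e x"
      using w r by (simp add: field_simps power2_eq_square)
    ultimately show ?thesis by simp
  qed
  have cont: "continuous_on S (\<lambda>x. (1 + s * complex_of_real x / of_real \<rho>) * e x)" for S s
    unfolding e_def by (intro continuous_intros) (use r in auto)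
  have P: "has_bochner_integral lborel (\<lambda>x. indicator {0..\<rho>} x *\<^sub>R ((1 + (- 1) * complex_of_real x / of_real \<rho>) * e x))
     (((1 + (- 1) * complex_of_real \<rho> / of_real \<rho>) * e \<rho> / w - (- 1) / of_real \<rho> * e \<rho> / w\<^sup>2) - ((1 + (- 1) * complex_of_real 0 / of_real \<rho>) * e 0 / w - (- 1) / of_real \<rho> * e 0 / w\<^sup>2))"
    by (rule has_bochner_integral_FTC_Icc[OF _ anti cont]) (use \<rho> in simp)
  have N: "has_bochner_integral lborel (\<lambda>x. indicator {-\<rho>..0} x *\<^sub>R ((1 + 1 * complex_of_real x / of_real \<rho>) * e x))
     (((1 + 1 * complex_of_real 0 / of_real \<rho>) * e 0 / w - 1 / of_real \<rho> * e 0 / w\<^sup>2) - ((1 + 1 * complex_of_real (-\<rho>) / of_real \<rho>) * e (-\<rho>) / w - 1 / of_real \<rho> * e (-\<rho>) / w\<^sup>2))"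
    by (rule has_bochner_integral_FTC_Icc[OF _ anti cont]) (use \<rho> in simp)
  have "(LINT \<mu>|lborel. triangle \<rho> \<mu> * exp (\<i> * of_real (\<mu> * v))) =
    (LINT x|lborel. indicator {0..\<rho>} x *\<^sub>R ((1 + (- 1) * complex_of_real x / of_real \<rho>) * e x) + indicator {-\<rho>..0} x *\<^sub>R ((1 + 1 * complex_of_real x / of_real \<rho>) * e x))"
  proof (rule integral_cong_AE)
    have [measurable]: "e \<in> borel_measurable borel" unfolding e_def[abs_def] by measurable
    show "(\<lambda>\<mu>. triangle \<rho> \<mu> * exp (\<i> * of_real (\<mu> * v))) \<in> borel_measurable lborel" by measurable
    show "(\<lambda>x. indicator {0..\<rho>} x *\<^sub>R ((1 + (- 1) * complex_of_real x / of_real \<rho>) * e x) + indicator {-\<rho>..0} x *\<^sub>R ((1 + 1 * complex_of_real x / of_real \<rho>) * e x)) \<in> borel_measurable lborel" by measurable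
    show "AE \<mu> in lborel. triangle \<rho> \<mu> * exp (\<i> * of_real (\<mu> * v)) =
      indicator {0..\<rho>} \<mu> *\<^sub>R ((1 + (- 1) * complex_of_real \<mu> / of_real \<rho>) * e \<mu>) + indicator {-\<rho>..0} \<mu> *\<^sub>R ((1 + 1 * complex_of_real \<mu> / of_real \<rho>) * e \<mu>)"
      using AE_lborel_singleton[of "0::real"]
      by eventually_elim (use \<rho> in \<open>auto simp: triangle_def e_def indicator_def abs_if mult_ac\<close>)
  qed
  also have "\<dots> = (1 / of_real \<rho> * e \<rho> / w\<^sup>2 + 1 / of_real \<rho> * e (-\<rho>) / w\<^sup>2) - 2 / of_real \<rho> / w\<^sup>2"
    using has_bochner_integral_integral_eq[OF has_bochner_integral_add[OF P N]] r by (simp add: e_def)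
  also have "\<dots> = (e \<rho> + e (-\<rho>) - 2) / (of_real \<rho> * w\<^sup>2)"
    using w r by (simp add: field_simps)
  also have "e \<rho> + e (-\<rho>) = 2 * of_real (cos (\<rho> * v))"
    by (simp add: e_def complex_eq_iff Re_exp Im_exp mult.commute)
  also have "(2 * of_real (cos (\<rho> * v)) - 2) / (of_real \<rho> * w\<^sup>2) = of_real (2 * pi * (\<rho> * fejer (\<rho> * v)))"
    using v \<rho> by (simp add: w_def fejer_def field_simps power2_eq_square)
  finally show ?thesis .
qed

text \<open>\<open>one_sided y\<close> is the kernel \<open>k\<close> of the moving average; its Cesaro means are convolutions with the Fejer
  kernel, an approximate identity, hence they converge to \<open>k\<close> in \<open>L\<^sup>1\<close>.\<close>

definition one_sided :: "(nat \<Rightarrow> complex) \<Rightarrow> real \<Rightarrow> complex" where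
  "one_sided y u = indicator {0..} u *\<^sub>R egf y u"

lemma one_sided_measurable [measurable]: "geometric_growth y \<Longrightarrow> one_sided y \<in> borel_measurable borel"
  using borel_measurable_continuous_onI[OF continuous_on_egf] unfolding one_sided_def[abs_def] by measurable

lemma exp_tail: "c > 0 \<Longrightarrow> (\<integral>\<^sup>+u. ennreal (C * exp (- c * (u - a))) * indicator {a..} u \<partial>lborel) = ennreal (C / c)" if "C \<ge> 0" for C :: real
proof -
  assume c: "c > 0"
  have "(\<integral>\<^sup>+u. ennreal (C * exp (- c * (u - a))) * indicator {a..} u \<partial>lborel) = ennreal (0 - (- (C / c) * exp (- c * (a - a))))"
  proof (rule nn_integral_FTC_atLeast[where F = "\<lambda>u. - (C / c) * exp (- c * (u - a))"])
    show "((\<lambda>u. - (C / c) * exp (- c * (u - a))) has_real_derivative C * exp (- c * (x - a))) (at x)" for x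
      using c by (auto intro!: derivative_eq_intros)
    have "((\<lambda>u. exp (- (c * u) + c * a)) \<longlongrightarrow> 0) at_top" using c by real_asymp
    then have "((\<lambda>u. - (C / c) * exp (- (c * u) + c * a)) \<longlongrightarrow> - (C / c) * 0) at_top" by (intro tendsto_intros)
    then show "((\<lambda>u. - (C / c) * exp (- c * (u - a))) \<longlongrightarrow> 0) at_top" by (simp add: right_diff_distrib)
  qed (use that in auto)
  then show ?thesis by simp
qed

text \<open>The third bound concerns the L^1 modulus of translation. It is linear in h because the
  function has an integrable derivative on the half-line, contributing C2 / c, and a single jump at
  0, contributing at most C1; for large h the triangle inequality caps it.\<close>

lemma one_sided_bounds:
  assumes y: "geometric_growth y" and c: "c > 0" and d: "exp_decay c (egf y)" "exp_decay c (egf (\<lambda>k. y (Suc k)))"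
  shows "\<exists>C\<ge>0. (\<forall>u. cmod (one_sided y u) \<le> C) \<and> (\<integral>\<^sup>+u. ennreal (cmod (one_sided y u)) \<partial>lborel) \<le> ennreal C \<and>
    (\<forall>h. (\<integral>\<^sup>+u. ennreal (cmod (one_sided y (u - h) - one_sided y u)) \<partial>lborel) \<le> ennreal (C * min 1 \<bar>h\<bar>))"
proof -
  note [measurable] = one_sided_measurable[OF y]
  obtain C1 where C1: "C1 \<ge> 0" "\<And>u. u \<ge> 0 \<Longrightarrow> cmod (egf y u) \<le> C1 * exp (- c * u)" using d(1) by (auto simp: exp_decay_def)
  obtain C2 where C2: "C2 \<ge> 0" "\<And>u. u \<ge> 0 \<Longrightarrow> cmod (egf (\<lambda>k. y (Suc k)) u) \<le> C2 * exp (- c * u)" using d(2) by (auto simp: exp_decay_def)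
  have b1: "cmod (one_sided y u) \<le> C1" for u
  proof (cases "u \<ge> 0")
    case True
    have "C1 * exp (- c * u) \<le> C1 * 1" using True c C1 by (intro mult_left_mono) auto
    then show ?thesis using C1(2)[OF True] True by (simp add: one_sided_def)
  qed (use C1 in \<open>simp add: one_sided_def\<close>)
  have i1: "(\<integral>\<^sup>+u. ennreal (cmod (one_sided y u)) \<partial>lborel) \<le> ennreal (C1 / c)"
  proof -
    have "(\<integral>\<^sup>+u. ennreal (cmod (one_sided y u)) \<partial>lborel) \<le> (\<integral>\<^sup>+u. ennreal (C1 * exp (- c * (u - 0))) * indicator {0..} u \<partial>lborel)"
      using C1 by (intro nn_integral_mono) (auto simp: one_sided_def indicator_def intro!: ennreal_leI)
    then show ?thesis using exp_tail[OF C1(1) c, of 0] by simp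
  qed
  have shift: "(\<integral>\<^sup>+u. ennreal (cmod (one_sided y (u - h))) \<partial>lborel) = (\<integral>\<^sup>+u. ennreal (cmod (one_sided y u)) \<partial>lborel)" for h
    using nn_integral_real_affine[of "\<lambda>u. ennreal (cmod (one_sided y u))" 1 "- h"] by (simp add: add.commute)
  have far: "(\<integral>\<^sup>+u. ennreal (cmod (one_sided y (u - h) - one_sided y u)) \<partial>lborel) \<le> ennreal (2 * (C1 / c))" for h
  proof -
    have "(\<integral>\<^sup>+u. ennreal (cmod (one_sided y (u - h) - one_sided y u)) \<partial>lborel) \<le>
      (\<integral>\<^sup>+u. ennreal (cmod (one_sided y (u - h))) + ennreal (cmod (one_sided y u)) \<partial>lborel)"
      by (intro nn_integral_mono) (simp add: ennreal_plus[symmetric] norm_triangle_ineq4 ennreal_leI del: ennreal_plus)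
    also have "\<dots> = (\<integral>\<^sup>+u. ennreal (cmod (one_sided y (u - h))) \<partial>lborel) + (\<integral>\<^sup>+u. ennreal (cmod (one_sided y u)) \<partial>lborel)"
      by (rule nn_integral_add) measurable
    also have "\<dots> \<le> ennreal (C1 / c) + ennreal (C1 / c)" unfolding shift by (intro add_mono i1)
    also have "\<dots> = ennreal (2 * (C1 / c))" using C1 c by (simp add: ennreal_plus[symmetric] del: ennreal_plus)
    finally show ?thesis .
  qed
  have near_pos: "(\<integral>\<^sup>+u. ennreal (cmod (one_sided y (u - h) - one_sided y u)) \<partial>lborel) \<le> ennreal ((C1 + C2 / c) * h)" if h: "h \<ge> 0" for h
  proof -
    have pw: "cmod (one_sided y (u - h) - one_sided y u) \<le> C1 * indicator {0..h} u + h * C2 * exp (- c * (u - h)) * indicator {h..} u" for u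
    proof -
      consider "u < 0" | "0 \<le> u" "u < h" | "u \<ge> h" by linarith
      then show ?thesis
      proof cases
        case 1
        then show ?thesis using h C1 by (simp add: one_sided_def)
      next
        case 2
        then have "one_sided y (u - h) = 0" by (simp add: one_sided_def)
        then show ?thesis using 2 b1[of u] by simp
      next
        case 3
        have "norm (egf y u - egf y (u - h)) \<le> (C2 * exp (- c * (u - h))) * norm (u - (u - h))"
        proof (rule differentiable_bound[where S = "{u - h..u}" and f' = "\<lambda>x s. s *\<^sub>R egf (\<lambda>k. y (Suc k)) x"])
          fix x assume "x \<in> {u - h..u}"
          then have x: "x \<ge> u - h" "x \<ge> 0" using 3 by auto
          show "(egf y has_derivative (\<lambda>s. s *\<^sub>R egf (\<lambda>k. y (Suc k)) x)) (at x within {u - h..u})"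
            using egf_has_vector_derivative[OF y] by (simp add: has_vector_derivative_def)
          have "onorm (\<lambda>s. s *\<^sub>R egf (\<lambda>k. y (Suc k)) x) = norm (egf (\<lambda>k. y (Suc k)) x)"
            by (simp add: onorm_scaleR_left onorm_id)
          also have "\<dots> \<le> C2 * exp (- c * x)" by (rule C2(2)[OF x(2)])
          also have "\<dots> \<le> C2 * exp (- c * (u - h))" using x c C2 by (intro mult_left_mono) auto
          finally show "onorm (\<lambda>s. s *\<^sub>R egf (\<lambda>k. y (Suc k)) x) \<le> C2 * exp (- c * (u - h))" .
        qed (use h in auto)
        then have "cmod (one_sided y (u - h) - one_sided y u) \<le> h * C2 * exp (- c * (u - h))"
          using 3 h by (simp add: one_sided_def norm_minus_commute mult_ac)
        then show ?thesis using 3 C1 by (simp add: indicator_def add_increasing)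
      qed
    qed
    have "(\<integral>\<^sup>+u. ennreal (cmod (one_sided y (u - h) - one_sided y u)) \<partial>lborel) \<le>
      (\<integral>\<^sup>+u. ennreal C1 * indicator {0..h} u + ennreal (h * C2 * exp (- c * (u - h))) * indicator {h..} u \<partial>lborel)"
    proof (rule nn_integral_mono)
      fix u
      have "ennreal (cmod (one_sided y (u - h) - one_sided y u)) \<le> ennreal (C1 * indicator {0..h} u + h * C2 * exp (- c * (u - h)) * indicator {h..} u)"
        by (rule ennreal_leI[OF pw])
      also have "\<dots> = ennreal C1 * indicator {0..h} u + ennreal (h * C2 * exp (- c * (u - h))) * indicator {h..} u"
        using C1 C2 h by (auto simp: indicator_def)
      finally show "ennreal (cmod (one_sided y (u - h) - one_sided y u)) \<le> \<dots>" .
    qed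
    also have "\<dots> = ennreal C1 * ennreal h + ennreal (h * C2 / c)"
      using h C2 exp_tail[of "h * C2", OF _ c, of h] by (subst nn_integral_add) (auto simp: nn_integral_cmult_indicator)
    also have "\<dots> = ennreal ((C1 + C2 / c) * h)"
      using C1 C2 c h by (simp add: ennreal_mult'[symmetric] ennreal_plus[symmetric] algebra_simps del: ennreal_plus)
    finally show ?thesis .
  qed
  \<comment> \<open>Shifting by - h and shifting by h give differences that are translates of each
    other up to sign, so negative h reduce to positive ones.\<close>
  have near: "(\<integral>\<^sup>+u. ennreal (cmod (one_sided y (u - h) - one_sided y u)) \<partial>lborel) \<le> ennreal ((C1 + C2 / c) * \<bar>h\<bar>)" for h
  proof (cases "h \<ge> 0")
    case False
    have "(\<integral>\<^sup>+u. ennreal (cmod (one_sided y (u - h) - one_sided y u)) \<partial>lborel) = (\<integral>\<^sup>+u. ennreal (cmod (one_sided y (u - - h) - one_sided y u)) \<partial>lborel)"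
      using nn_integral_real_affine[of "\<lambda>u. ennreal (cmod (one_sided y (u - h) - one_sided y u))" 1 h]
      by (simp add: add.commute norm_minus_commute)
    then show ?thesis using near_pos[of "- h"] False by simp
  qed (use near_pos in simp)
  define C where "C = C1 + C1 / c + 2 * (C1 / c) + (C1 + C2 / c)"
  have nn: "0 \<le> C1 / c" "0 \<le> C2 / c" using C1 C2 c by auto
  show ?thesis
  proof (intro exI[of _ C] conjI allI)
    show "0 \<le> C" using C1 nn by (simp add: C_def)
    show "cmod (one_sided y u) \<le> C" for u using b1[of u] C1 nn by (simp add: C_def)
    show "(\<integral>\<^sup>+u. ennreal (cmod (one_sided y u)) \<partial>lborel) \<le> ennreal C"
      by (rule order_trans[OF i1 ennreal_leI]) (use C1 nn in \<open>simp add: C_def\<close>)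
    show "(\<integral>\<^sup>+u. ennreal (cmod (one_sided y (u - h) - one_sided y u)) \<partial>lborel) \<le> ennreal (C * min 1 \<bar>h\<bar>)" for h
    proof (cases "\<bar>h\<bar> \<le> 1")
      case True
      have "(C1 + C2 / c) * \<bar>h\<bar> \<le> C * \<bar>h\<bar>" using C1 nn by (intro mult_right_mono) (auto simp: C_def)
      then show ?thesis using near[of h] True by (simp add: min_def) (meson ennreal_leI order_trans)
    next
      case False
      then show ?thesis using C1 nn by (intro order_trans[OF far ennreal_leI]) (simp add: C_def min_def)
    qed
  qed
qed

lemma integrable_one_sided:
  assumes y: "geometric_growth y" and c: "c > 0" and d: "exp_decay c (egf y)"
  shows "integrable lborel (one_sided y)"
  using exp_decay_integrable[OF y d c, of 0] by (simp add: one_sided_def[abs_def])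

lemma borel_measurable_vec:
  fixes f :: "'x \<Rightarrow> 'a::euclidean_space ^ 'n"
  assumes "\<And>i. (\<lambda>x. f x $ i) \<in> borel_measurable N"
  shows "f \<in> borel_measurable N"
proof (rule borel_measurable_euclidean_space[THEN iffD2], rule ballI)
  fix b :: "'a ^ 'n"
  assume "b \<in> Basis"
  then obtain i c where b: "b = axis i c" unfolding Basis_vec_def by blast
  show "(\<lambda>x. f x \<bullet> b) \<in> borel_measurable N" unfolding b inner_axis
    by (rule borel_measurable_inner[OF assms borel_measurable_const])
qed

lemma integrable_triangle: "\<rho> > 0 \<Longrightarrow> integrable lborel (triangle \<rho>)"
proof (rule Bochner_Integration.integrable_bound)
  assume \<rho>: "\<rho> > 0"
  show "integrable lborel (indicator {-\<rho>..\<rho>} :: real \<Rightarrow> real)"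
    by (rule integrable_real_indicator) (use emeasure_bounded_finite[of "{-\<rho>..\<rho>}"] in simp_all)
  show "AE x in lborel. norm (triangle \<rho> x) \<le> norm (indicator {-\<rho>..\<rho>} x :: real)"
  proof (rule AE_I2)
    fix x
    show "norm (triangle \<rho> x) \<le> norm (indicator {-\<rho>..\<rho>} x :: real)"
    proof (cases "x \<in> {-\<rho>..\<rho>}")
      case True
      then have "\<bar>x\<bar> / \<rho> \<le> 1" "0 \<le> \<bar>x\<bar> / \<rho>" using \<rho> by auto
      then have "\<bar>1 - \<bar>x\<bar> / \<rho>\<bar> \<le> 1" by linarith
      then show ?thesis using True unfolding triangle_def norm_mult norm_of_real by simp
    qed (simp add: triangle_def)
  qed
qed measurable

section \<open>Cesaro means of the transfer function\<close>

definition one_sided_transform :: "(nat \<Rightarrow> complex) \<Rightarrow> real \<Rightarrow> complex" where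
  "one_sided_transform y \<mu> = (LINT u|lborel. fourier_kernel \<mu> u * one_sided y u)"

lemma one_sided_transform_measurable [measurable]:
  "geometric_growth y \<Longrightarrow> one_sided_transform y \<in> borel_measurable borel"
  using one_sided_measurable[of y] unfolding one_sided_transform_def[abs_def] by measurable

lemma one_sided_transform_bound: "cmod (one_sided_transform y \<mu>) \<le> (LINT u|lborel. cmod (one_sided y u))"
proof -
  have "cmod (one_sided_transform y \<mu>) \<le> (LINT u|lborel. cmod (fourier_kernel \<mu> u * one_sided y u))"
    unfolding one_sided_transform_def by (rule integral_norm_bound)
  then show ?thesis by (simp add: norm_mult)
qed

definition cesaro_weight :: "real \<Rightarrow> real \<Rightarrow> real \<Rightarrow> complex" where
  "cesaro_weight \<rho> t \<mu> = triangle \<rho> \<mu> * exp (\<i> * of_real (t * \<mu>))"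

lemma cesaro_weight_measurable [measurable]: "cesaro_weight \<rho> t \<in> borel_measurable borel"
  unfolding cesaro_weight_def[abs_def] by measurable

lemma norm_cesaro_weight: "cmod (cesaro_weight \<rho> t \<mu>) = cmod (triangle \<rho> \<mu>)"
  by (simp add: cesaro_weight_def norm_mult)

lemma integrable_cesaro:
  assumes y: "geometric_growth y" and \<rho>: "\<rho> > 0"
  shows "integrable lborel (\<lambda>\<mu>. cesaro_weight \<rho> t \<mu> * one_sided_transform y \<mu>)"
proof (rule Bochner_Integration.integrable_bound)
  note [measurable] = one_sided_transform_measurable[OF y]
  show "integrable lborel (\<lambda>\<mu>. triangle \<rho> \<mu> * of_real (LINT u|lborel. cmod (one_sided y u)))"
    using integrable_triangle[OF \<rho>] by simp
  show "AE \<mu> in lborel. norm (cesaro_weight \<rho> t \<mu> * one_sided_transform y \<mu>) \<le> norm (triangle \<rho> \<mu> * of_real (LINT u|lborel. cmod (one_sided y u)))"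
    using one_sided_transform_bound[of y] by (intro AE_I2) (simp add: norm_mult norm_cesaro_weight mult_left_mono)
  show "(\<lambda>\<mu>. cesaro_weight \<rho> t \<mu> * one_sided_transform y \<mu>) \<in> borel_measurable lborel" by measurable
qed

text \<open>Fubini leaves \<open>triangle_transform\<close> as the inner integral, and the two
  factors 1 / sqrt (2 pi) cancel its 2 pi. The point u = t - s, excluded there, is a null
  set.\<close>

lemma cesaro_eq_convolution:
  assumes y: "geometric_growth y" and c: "c > 0" and d: "exp_decay c (egf y)" and \<rho>: "\<rho> > 0"
  shows "of_real (1 / sqrt (2 * pi)) * fourier_L1 (\<lambda>\<mu>. cesaro_weight \<rho> t \<mu> * one_sided_transform y \<mu>) s =
    (LINT v|lborel. one_sided y (t - s - v) * of_real (\<rho> * fejer (\<rho> * v)))"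
proof -
  note [measurable] = one_sided_measurable[OF y] one_sided_transform_measurable[OF y]
  note k = integrable_one_sided[OF y c d]
  let ?g = "\<lambda>\<mu> u. fourier_kernel s \<mu> * cesaro_weight \<rho> t \<mu> * (fourier_kernel \<mu> u * one_sided y u)"
  have int: "integrable (lborel \<Otimes>\<^sub>M lborel) (\<lambda>(\<mu>, u). ?g \<mu> u)"
  proof (rule lborel_pair.Fubini_integrable)
    show "(\<lambda>(\<mu>, u). ?g \<mu> u) \<in> borel_measurable (lborel \<Otimes>\<^sub>M lborel)" by measurable
    have "(LINT u|lborel. norm (case (\<mu>, u) of (\<mu>, u) \<Rightarrow> ?g \<mu> u)) = cmod (triangle \<rho> \<mu>) * (LINT u|lborel. cmod (one_sided y u))" for \<mu>
      by (simp add: norm_mult norm_cesaro_weight)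
    then show "integrable lborel (\<lambda>\<mu>. LINT u|lborel. norm (case (\<mu>, u) of (\<mu>, u) \<Rightarrow> ?g \<mu> u))"
      using integrable_triangle[OF \<rho>] by simp
    show "AE \<mu> in lborel. integrable lborel (\<lambda>u. case (\<mu>, u) of (\<mu>, u) \<Rightarrow> ?g \<mu> u)"
      using integrable_fourier_kernel[OF k] by (intro AE_I2) simp
  qed
  have const: "complex_of_real (1 / sqrt (2 * pi)) * (1 / sqrt (2 * pi)) = of_real (1 / (2 * pi))"
    by (simp add: of_real_mult[symmetric] del: of_real_mult)
  have "of_real (1 / sqrt (2 * pi)) * fourier_L1 (\<lambda>\<mu>. cesaro_weight \<rho> t \<mu> * one_sided_transform y \<mu>) s =
    of_real (1 / (2 * pi)) * (LINT \<mu>|lborel. (LINT u|lborel. ?g \<mu> u))"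
    unfolding fourier_L1_alt const[symmetric] one_sided_transform_def by (simp add: mult.assoc)
  also have "(LINT \<mu>|lborel. (LINT u|lborel. ?g \<mu> u)) = (LINT u|lborel. (LINT \<mu>|lborel. ?g \<mu> u))"
    by (rule lborel_pair.Fubini_integral[OF int, symmetric])
  also have "\<dots> = (LINT u|lborel. one_sided y u * of_real (2 * pi * (\<rho> * fejer (\<rho> * (t - s - u)))))"
  proof (rule integral_cong_AE)
    show "AE u in lborel. (LINT \<mu>|lborel. ?g \<mu> u) = one_sided y u * of_real (2 * pi * (\<rho> * fejer (\<rho> * (t - s - u))))"
      using AE_lborel_singleton[of "t - s"]
    proof eventually_elim
      case (elim u)
      have "?g \<mu> u = one_sided y u * (triangle \<rho> \<mu> * exp (\<i> * of_real (\<mu> * (t - s - u))))" for \<mu>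
      proof -
        have "fourier_kernel s \<mu> * exp (\<i> * of_real (t * \<mu>)) * fourier_kernel \<mu> u = exp (\<i> * of_real (\<mu> * (t - s - u)))"
          unfolding fourier_kernel_def mult_exp_exp by (rule arg_cong[of _ _ exp]) (simp add: algebra_simps)
        then have "one_sided y u * (triangle \<rho> \<mu> * (fourier_kernel s \<mu> * exp (\<i> * of_real (t * \<mu>)) * fourier_kernel \<mu> u)) =
          one_sided y u * (triangle \<rho> \<mu> * exp (\<i> * of_real (\<mu> * (t - s - u))))" by simp
        then show ?thesis unfolding cesaro_weight_def by (simp only: mult_ac)
      qed
      then have "(LINT \<mu>|lborel. ?g \<mu> u) = one_sided y u * (LINT \<mu>|lborel. triangle \<rho> \<mu> * exp (\<i> * of_real (\<mu> * (t - s - u))))"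
        by (simp only: integral_mult_right_zero)
      also have "(LINT \<mu>|lborel. triangle \<rho> \<mu> * exp (\<i> * of_real (\<mu> * (t - s - u)))) = of_real (2 * pi * (\<rho> * fejer (\<rho> * (t - s - u))))"
        by (rule triangle_transform[OF \<rho>]) (use elim in auto)
      finally show ?case .
    qed
  qed measurable
  also have "\<dots> = of_real (2 * pi) * (LINT u|lborel. one_sided y u * of_real (\<rho> * fejer (\<rho> * (t - s - u))))"
    by (subst integral_mult_right_zero[symmetric]) (simp add: mult_ac)
  also have "(LINT u|lborel. one_sided y u * of_real (\<rho> * fejer (\<rho> * (t - s - u)))) = (LINT v|lborel. one_sided y (t - s - v) * of_real (\<rho> * fejer (\<rho> * v)))"
    using lborel_integral_real_affine[of "-1" "\<lambda>u. one_sided y u * of_real (\<rho> * fejer (\<rho> * (t - s - u)))" "t - s"] by simp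
  finally show ?thesis by simp
qed

text \<open>D n averages translation differences of the kernel against the rescaled Fejer kernel F n
  of mass 1. Hence it is bounded by twice the bound of the kernel, and its L^1 norm is at most the
  average of the L^1 modulus of translation.\<close>

lemma cesaro_tendsto:
  fixes t :: real
  assumes y: "geometric_growth y" and c: "c > 0" and d: "exp_decay c (egf y)" "exp_decay c (egf (\<lambda>k. y (Suc k)))"
  defines "D \<equiv> \<lambda>n s. of_real (1 / sqrt (2 * pi)) * fourier_L1 (\<lambda>\<mu>. cesaro_weight (real (Suc n)) t \<mu> * one_sided_transform y \<mu>) s - one_sided y (t - s)"
  shows "\<exists>B. \<forall>n s. cmod (D n s) \<le> B" and "(\<lambda>n. \<integral>\<^sup>+s. ennreal (cmod (D n s)) \<partial>lborel) \<longlonglongrightarrow> 0"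
proof -
  note [measurable] = one_sided_measurable[OF y]
  obtain C where C: "C \<ge> 0" "\<And>u. cmod (one_sided y u) \<le> C"
    "\<And>h. (\<integral>\<^sup>+u. ennreal (cmod (one_sided y (u - h) - one_sided y u)) \<partial>lborel) \<le> ennreal (C * min 1 \<bar>h\<bar>)"
    using one_sided_bounds[OF y c d] by blast
  define F where "F n v = real (Suc n) * fejer (real (Suc n) * v)" for n v
  have [measurable]: "F n \<in> borel_measurable borel" for n unfolding F_def[abs_def] by measurable
  have F_nn: "F n v \<ge> 0" for n v by (simp add: F_def fejer_nonneg)
  have F_int: "integrable lborel (F n)" for n
    using lborel_integrable_real_affine[OF integrable_fejer, of "real (Suc n)" 0] by (simp add: F_def[abs_def])
  have F_1: "(LINT v|lborel. F n v) = 1" for n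
    using lborel_integral_real_affine[of "real (Suc n)" fejer 0] integral_fejer by (simp add: F_def)
  have kF: "integrable lborel (\<lambda>v. one_sided y (\<tau> - v) * of_real (F n v))" for \<tau> n
  proof (rule Bochner_Integration.integrable_bound)
    show "integrable lborel (\<lambda>v. C * F n v)" using F_int by simp
    show "AE v in lborel. norm (one_sided y (\<tau> - v) * of_real (F n v)) \<le> norm (C * F n v)"
      using C(1,2) F_nn by (intro AE_I2) (simp add: norm_mult mult_right_mono)
  qed measurable
  have conv: "of_real (1 / sqrt (2 * pi)) * fourier_L1 (\<lambda>\<mu>. cesaro_weight (real (Suc n)) t \<mu> * one_sided_transform y \<mu>) s =
    (LINT v|lborel. one_sided y (t - s - v) * of_real (F n v))" for n s
    unfolding F_def by (rule cesaro_eq_convolution[OF y c d(1)]) simp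
  have D_eq: "D n s = (LINT v|lborel. (one_sided y (t - s - v) - one_sided y (t - s)) * of_real (F n v))" for n s
  proof -
    have "D n s = (LINT v|lborel. one_sided y (t - s - v) * of_real (F n v)) - one_sided y (t - s) * of_real (LINT v|lborel. F n v)"
      by (simp only: D_def conv F_1 of_real_1 mult_1_right)
    also have "one_sided y (t - s) * of_real (LINT v|lborel. F n v) = (LINT v|lborel. one_sided y (t - s) * of_real (F n v))"
      by simp
    also have "(LINT v|lborel. one_sided y (t - s - v) * of_real (F n v)) - \<dots> =
       (LINT v|lborel. one_sided y (t - s - v) * of_real (F n v) - one_sided y (t - s) * of_real (F n v))"
      using kF F_int by (intro Bochner_Integration.integral_diff[symmetric] integrable_mult_right integrable_of_real)
    finally show ?thesis by (simp only: left_diff_distrib)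
  qed
  have D_le: "ennreal (cmod (D n s)) \<le> (\<integral>\<^sup>+v. ennreal (cmod (one_sided y (t - s - v) - one_sided y (t - s))) * ennreal (F n v) \<partial>lborel)" for n s
  proof -
    have "integrable lborel (\<lambda>v. one_sided y (t - s - v) * of_real (F n v) - one_sided y (t - s) * of_real (F n v))"
      using kF F_int by (intro Bochner_Integration.integrable_diff integrable_mult_right integrable_of_real)
    then have i: "integrable lborel (\<lambda>v. (one_sided y (t - s - v) - one_sided y (t - s)) * of_real (F n v))" by (simp only: left_diff_distrib)
    show ?thesis
      unfolding D_eq using integral_norm_bound_ennreal[OF i] F_nn by (simp add: norm_mult ennreal_mult')
  qed
  show "\<exists>B. \<forall>n s. cmod (D n s) \<le> B"
  proof (intro exI[of _ "2 * C"] allI)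
    fix n s
    have "ennreal (cmod (D n s)) \<le> (\<integral>\<^sup>+v. ennreal (2 * C) * ennreal (F n v) \<partial>lborel)"
    proof (rule order_trans[OF D_le nn_integral_mono])
      fix v
      have "cmod (one_sided y (t - s - v) - one_sided y (t - s)) \<le> C + C"
        by (rule order_trans[OF norm_triangle_ineq4 add_mono[OF C(2) C(2)]])
      then show "ennreal (cmod (one_sided y (t - s - v) - one_sided y (t - s))) * ennreal (F n v) \<le> ennreal (2 * C) * ennreal (F n v)"
        by (intro mult_right_mono ennreal_leI) auto
    qed
    also have "\<dots> = ennreal (2 * C) * (\<integral>\<^sup>+v. ennreal (F n v) \<partial>lborel)" by (rule nn_integral_cmult) measurable
    also have "(\<integral>\<^sup>+v. ennreal (F n v) \<partial>lborel) = ennreal (LINT v|lborel. F n v)"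
      using F_int F_nn by (intro nn_integral_eq_integral) auto
    finally show "cmod (D n s) \<le> 2 * C" using C(1) by (simp add: F_1)
  qed
  have le: "(\<integral>\<^sup>+s. ennreal (cmod (D n s)) \<partial>lborel) \<le> (\<integral>\<^sup>+z. ennreal (fejer z * (C * min 1 (\<bar>z\<bar> / real (Suc n)))) \<partial>lborel)" for n
  proof -
    have "(\<integral>\<^sup>+s. ennreal (cmod (D n s)) \<partial>lborel) \<le>
      (\<integral>\<^sup>+s. (\<integral>\<^sup>+v. ennreal (cmod (one_sided y (t - s - v) - one_sided y (t - s))) * ennreal (F n v) \<partial>lborel) \<partial>lborel)"
      by (intro nn_integral_mono D_le)
    also have "\<dots> = (\<integral>\<^sup>+v. (\<integral>\<^sup>+s. ennreal (cmod (one_sided y (t - s - v) - one_sided y (t - s))) * ennreal (F n v) \<partial>lborel) \<partial>lborel)"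
      by (rule lborel_pair.Fubini'[symmetric]) measurable
    also have "\<dots> \<le> (\<integral>\<^sup>+v. ennreal (C * min 1 \<bar>v\<bar> * F n v) \<partial>lborel)"
    proof (rule nn_integral_mono)
      fix v
      have "(\<integral>\<^sup>+s. ennreal (cmod (one_sided y (t - s - v) - one_sided y (t - s))) * ennreal (F n v) \<partial>lborel) =
        (\<integral>\<^sup>+s. ennreal (cmod (one_sided y (t - s - v) - one_sided y (t - s))) \<partial>lborel) * ennreal (F n v)"
        by (rule nn_integral_multc) measurable
      also have "(\<integral>\<^sup>+s. ennreal (cmod (one_sided y (t - s - v) - one_sided y (t - s))) \<partial>lborel) = (\<integral>\<^sup>+u. ennreal (cmod (one_sided y (u - v) - one_sided y u)) \<partial>lborel)"
        using nn_integral_real_affine[of "\<lambda>u. ennreal (cmod (one_sided y (u - v) - one_sided y u))" "-1" t] by simp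
      also have "\<dots> * ennreal (F n v) \<le> ennreal (C * min 1 \<bar>v\<bar>) * ennreal (F n v)"
        by (intro mult_right_mono C) simp
      also have "\<dots> = ennreal (C * min 1 \<bar>v\<bar> * F n v)" by (rule ennreal_mult[symmetric]) (use C F_nn in auto)
      finally show "(\<integral>\<^sup>+s. ennreal (cmod (one_sided y (t - s - v) - one_sided y (t - s))) * ennreal (F n v) \<partial>lborel) \<le> ennreal (C * min 1 \<bar>v\<bar> * F n v)" .
    qed
    also have "\<dots> = (\<integral>\<^sup>+z. ennreal (fejer z * (C * min 1 (\<bar>z\<bar> / real (Suc n)))) \<partial>lborel)"
    proof -
      define r where "r = real (Suc n)"
      have r: "r > 0" by (simp add: r_def)
      have "(\<integral>\<^sup>+z. ennreal (fejer z * (C * min 1 (\<bar>z\<bar> / r))) \<partial>lborel) = ennreal \<bar>r\<bar> * (\<integral>\<^sup>+v. ennreal (fejer (0 + r * v) * (C * min 1 (\<bar>0 + r * v\<bar> / r))) \<partial>lborel)"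
        using r by (intro nn_integral_real_affine) auto
      also have "\<dots> = (\<integral>\<^sup>+v. ennreal r * ennreal (fejer (0 + r * v) * (C * min 1 (\<bar>0 + r * v\<bar> / r))) \<partial>lborel)"
        using r by (subst nn_integral_cmult) auto
      also have "\<dots> = (\<integral>\<^sup>+v. ennreal (C * min 1 \<bar>v\<bar> * F n v) \<partial>lborel)"
        using r by (intro nn_integral_cong) (simp add: ennreal_mult'[symmetric] F_def r_def[symmetric] abs_mult mult_ac del: of_nat_Suc)
      finally show ?thesis by (simp add: r_def)
    qed
    finally show ?thesis .
  qed
  \<comment> \<open>The Fejer kernel has no finite first moment, so a modulus that is merely linear
    would not be integrable against it; the cap at 1 supplies the dominating function C * fejer
    z.\<close>
  have "(\<lambda>n. \<integral>\<^sup>+z. ennreal (fejer z * (C * min 1 (\<bar>z\<bar> / real (Suc n)))) \<partial>lborel) \<longlonglongrightarrow> (\<integral>\<^sup>+(z::real). 0 \<partial>lborel)"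
  proof (rule nn_integral_dominated_convergence[where w="\<lambda>z. ennreal (C * fejer z)"])
    show "(\<lambda>z. ennreal (fejer z * (C * min 1 (\<bar>z\<bar> / real (Suc n))))) \<in> borel_measurable lborel" for n by measurable
    show "(\<integral>\<^sup>+z. ennreal (C * fejer z) \<partial>lborel) < \<infinity>"
      using C(1) by (simp add: ennreal_mult' nn_integral_cmult nn_integral_fejer)
    show "AE z in lborel. ennreal (fejer z * (C * min 1 (\<bar>z\<bar> / real (Suc n)))) \<le> ennreal (C * fejer z)" for n
    proof (rule AE_I2)
      fix z
      have "fejer z * (C * min 1 (\<bar>z\<bar> / real (Suc n))) \<le> fejer z * (C * 1)"
        using C(1) fejer_nonneg by (intro mult_left_mono) auto
      then show "ennreal (fejer z * (C * min 1 (\<bar>z\<bar> / real (Suc n)))) \<le> ennreal (C * fejer z)"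
        by (intro ennreal_leI) (simp add: mult.commute)
    qed
    show "AE z in lborel. (\<lambda>n. ennreal (fejer z * (C * min 1 (\<bar>z\<bar> / real (Suc n))))) \<longlonglongrightarrow> 0"
    proof (rule AE_I2)
      fix z
      have "(\<lambda>n. fejer z * (C * min 1 (\<bar>z\<bar> * inverse (real (Suc n))))) \<longlonglongrightarrow> fejer z * (C * min 1 (\<bar>z\<bar> * 0))"
        by (intro tendsto_intros LIMSEQ_inverse_real_of_nat)
      then have "(\<lambda>n. fejer z * (C * min 1 (\<bar>z\<bar> / real (Suc n)))) \<longlonglongrightarrow> 0" by (simp add: divide_inverse)
      then show "(\<lambda>n. ennreal (fejer z * (C * min 1 (\<bar>z\<bar> / real (Suc n))))) \<longlonglongrightarrow> 0" using tendsto_ennrealI[of _ 0] by simp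
    qed
  qed auto
  then show "(\<lambda>n. \<integral>\<^sup>+s. ennreal (cmod (D n s)) \<partial>lborel) \<longlonglongrightarrow> 0"
    by (intro tendsto_zero_ennreal_le[OF le]) simp
qed

lemma norm_matrix_le_sum: "norm (X :: complex ^ 'n ^ 'm) \<le> (\<Sum>i\<in>UNIV. \<Sum>j\<in>UNIV. cmod (X $ i $ j))"
proof -
  have "norm X \<le> (\<Sum>i\<in>UNIV. norm (X $ i))" unfolding norm_vec_def[of X] by (rule L2_set_le_sum) simp
  also have "\<dots> \<le> (\<Sum>i\<in>UNIV. \<Sum>j\<in>UNIV. cmod (X $ i $ j))"
    by (intro sum_mono) (simp add: norm_vec_def L2_set_le_sum)
  finally show ?thesis .
qed

section \<open>The moving average representation\<close>

context levy_integrator_index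
begin

text \<open>The limit over \<rho> is taken along n + 1, and the kernels are compared entry by entry.
  Smallness of the errors D in L^1 becomes smallness in the modular by \<open>modint_le_powr\<close>
  with \<delta> = 1, so \<open>Y t\<close> is an integral of h. A real-valued integral of h is
  constructed separately, and uniqueness joins the two.\<close>

lemma causal_representation:
  fixes A B :: "nat \<Rightarrow> real ^ 'd ^ 'd" and Y :: "real \<Rightarrow> 'w \<Rightarrow> complex ^ 'd" and t :: real
  assumes \<Phi>: "fourier_random_measure M \<Lambda> \<Phi>"
    and p: "p = CARD('p::{finite,linorder})" "q < p" and Y: "regularly_varying_mcarma M \<alpha> \<Phi> p q A B Y"
    and neg: "ar_zeros p A \<subseteq> {z. Re z < 0}"
  shows "\<exists>Z :: 'w \<Rightarrow> real ^ 'd.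
           has_levy_integral M \<Lambda> (\<lambda>s. indicator {..t} s *\<^sub>R cmat (causal_kernel TYPE('p) q A B (t - s))) (\<lambda>\<omega>. cvec (Z \<omega>)) \<and>
           (AE \<omega> in M. Y t \<omega> = cvec (Z \<omega>))"
proof -
  obtain c where c: "c > 0" and dec: "\<And>n i j. exp_decay c (egf (\<lambda>k. cmat (markov TYPE('p) q A B (k + n)) $ i $ j))"
    and tr: "\<And>\<mu>. transfer_fun p q A B \<mu> = laplace_mat (\<lambda>k. cmat (markov TYPE('p) q A B k)) \<mu> 0"
    using transfer_fun_laplace[OF p neg] by blast
  define y where "y i j k = cmat (markov TYPE('p) q A B k) $ i $ j" for i j :: 'd and k :: nat
  have g: "geometric_growth (y i j)" for i j unfolding y_def[abs_def] by (rule markov_growth)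
  have d1: "exp_decay c (egf (y i j))" for i j using dec[of 0 i j] by (simp add: y_def[abs_def])
  have d2: "exp_decay c (egf (\<lambda>k. y i j (Suc k)))" for i j using dec[of 1 i j] by (simp add: y_def[abs_def])
  note [measurable] = one_sided_measurable[OF g] one_sided_transform_measurable[OF g]
  \<comment> \<open>The real kernel comes first because \<open>has_levy_integral_real_exists\<close>
    obtains a real-valued Z from a real integrand; h is its complexification.\<close>
  define kr where "kr s = indicator {..t} s *\<^sub>R causal_kernel TYPE('p) q A B (t - s)" for s
  define h where "h s = cmat (kr s)" for s
  have h_alt: "h s = indicator {..t} s *\<^sub>R cmat (causal_kernel TYPE('p) q A B (t - s))" for s
    unfolding h_def kr_def by (rule linear_cmul[OF linear_cmat])
  have h_entry: "h s $ i $ j = one_sided (y i j) (t - s)" for s i j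
    by (simp add: h_alt causal_kernel_egf one_sided_def y_def[abs_def] indicator_def)
  have kr_entry: "kr s $ i $ j = Re (one_sided (y i j) (t - s))" for s i j
    unfolding h_entry[symmetric] h_def by (simp add: cmat_def)
  have kr_meas [measurable]: "kr \<in> borel_measurable borel"
  proof -
    have "kr = (\<lambda>s. \<chi> i j. Re (one_sided (y i j) (t - s)))" by (simp add: fun_eq_iff vec_eq_iff kr_entry)
    moreover have "(\<lambda>s. \<chi> i j. Re (one_sided (y i j) (t - s))) \<in> borel_measurable borel" by (intro borel_measurable_vec, simp only: vec_lambda_beta, measurable)
    ultimately show ?thesis by simp
  qed
  have h_meas [measurable]: "h \<in> borel_measurable borel"
    using linear_borel_measurable[OF linear_cmat] unfolding h_def[abs_def] by measurable
  have h_fin: "modint h < \<infinity>"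
  proof -
    have ex: "\<exists>C. (\<forall>u. cmod (one_sided (y i j) u) \<le> C)" for i j
      using one_sided_bounds[OF g c d1 d2, of i j] by blast
    define C where "C i j = (SOME C. \<forall>u. cmod (one_sided (y i j) u) \<le> C)" for i j
    have C: "cmod (one_sided (y i j) u) \<le> C i j" for i j u using someI_ex[OF ex[of i j]] by (simp add: C_def)
    have nb: "norm (h s) \<le> (\<Sum>i\<in>UNIV. \<Sum>j\<in>UNIV. cmod (one_sided (y i j) (t - s)))" for s
      using norm_matrix_le_sum[of "h s"] by (simp add: h_entry)
    show ?thesis
    proof (rule modint_finite_if_Lr_bounded[of 1])
      show "norm (h s) \<le> (\<Sum>i\<in>UNIV. \<Sum>j\<in>UNIV. C i j)" for s
        by (rule order_trans[OF nb]) (intro sum_mono C)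
      have "integrable lborel (\<lambda>s. norm (h s))"
      proof (rule Bochner_Integration.integrable_bound)
        have "integrable lborel (\<lambda>s. one_sided (y i j) (t + (-1) * s))" for i j
          by (rule lborel_integrable_real_affine[OF integrable_one_sided[OF g c d1]]) simp
        then show "integrable lborel (\<lambda>s. \<Sum>i\<in>UNIV. \<Sum>j\<in>UNIV. cmod (one_sided (y i j) (t - s)))"
          by (intro Bochner_Integration.integrable_sum integrable_norm) simp
        show "AE s in lborel. norm (norm (h s)) \<le> norm (\<Sum>i\<in>UNIV. \<Sum>j\<in>UNIV. cmod (one_sided (y i j) (t - s)))"
          using nb by (intro AE_I2) (auto simp: sum_nonneg)
      qed measurable
      then show "Lr_function 1 h" by (simp add: Lr_function_def)
    qed (use \<alpha> in auto)
  qed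
  obtain J where J: "\<And>\<rho>. \<rho> > 0 \<Longrightarrow> has_M_integral M \<alpha> \<Phi>
                 (\<lambda>\<mu>. indicator {-\<rho>..\<rho>} \<mu> *\<^sub>R
                       (mat (exp (\<i> * of_real (t * \<mu>)) * of_real (1 - \<bar>\<mu>\<bar> / \<rho>))
                        ** transfer_fun p q A B \<mu>)) (J \<rho>)" and JY: "tendsto_in_prob M J (Y t) at_top"
    using Y unfolding regularly_varying_mcarma_def by blast
  define f where "f n \<mu> = indicator {- real (Suc n)..real (Suc n)} \<mu> *\<^sub>R
                       (mat (exp (\<i> * of_real (t * \<mu>)) * of_real (1 - \<bar>\<mu>\<bar> / real (Suc n)))
                        ** transfer_fun p q A B \<mu>)" for n \<mu>
  have f_entry: "f n \<mu> $ i $ j = cesaro_weight (real (Suc n)) t \<mu> * one_sided_transform (y i j) \<mu>" for n \<mu> i j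
  proof -
    have "transfer_fun p q A B \<mu> $ i $ j = one_sided_transform (y i j) \<mu>"
      unfolding tr one_sided_transform_def laplace_mat_def
      by (simp add: y_def[abs_def] one_sided_def fourier_kernel_def)
    then show ?thesis
      by (auto simp: f_def cesaro_weight_def triangle_def indicator_def)
  qed
  define H where "H n s = (1 / sqrt (2 * pi)) *\<^sub>R fourier_L1_mat (f n) s" for n s
  define D where "D i j n s = of_real (1 / sqrt (2 * pi)) * fourier_L1 (\<lambda>\<mu>. cesaro_weight (real (Suc n)) t \<mu> * one_sided_transform (y i j) \<mu>) s - one_sided (y i j) (t - s)" for i j n s
  have HD: "(H n s - h s) $ i $ j = D i j n s" for n s i j
    by (simp add: H_def h_entry D_def fourier_L1_mat_def f_entry scaleR_conv_of_real[where 'a=complex])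
  have "\<exists>G. good_integral G (J (real (Suc n))) \<and> (AE s in lborel. G s = H n s)" for n
    unfolding H_def
  proof (rule good_integral_has_M_integral[OF \<Phi>])
    show "has_M_integral M \<alpha> \<Phi> (f n) (J (real (Suc n)))" unfolding f_def by (rule J) simp
    show "integrable lborel (\<lambda>x. f n x $ i $ j)" for i j
      unfolding f_entry by (rule integrable_cesaro[OF g]) simp
  qed
  then obtain G where G: "\<And>n. good_integral (G n) (J (real (Suc n)))" "\<And>n. AE s in lborel. G n s = H n s" by metis
  have fm [measurable]: "(\<lambda>s. fourier_L1 (\<lambda>\<mu>. cesaro_weight (real (Suc n)) t \<mu> * one_sided_transform (y i j) \<mu>) s) \<in> borel_measurable borel" for n i j
    by measurable
  have D_meas [measurable]: "D i j n \<in> borel_measurable borel" for i j n unfolding D_def[abs_def] by measurable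
  have diff_alt: "H n s - h s = (\<chi> i j. D i j n s)" for n s by (simp only: vec_eq_iff HD vec_lambda_beta simp_thms)
  have diff_meas: "(\<lambda>s. H n s - h s) \<in> borel_measurable borel" for n
    unfolding diff_alt by (intro borel_measurable_vec, simp only: vec_lambda_beta, measurable)
  have nle: "norm (H n s - h s) \<le> (\<Sum>i\<in>UNIV. \<Sum>j\<in>UNIV. cmod (D i j n s))" for n s
    using norm_matrix_le_sum[of "H n s - h s"] by (simp only: HD)
  have exB: "\<exists>B. \<forall>n s. cmod (D i j n s) \<le> B" for i j unfolding D_def by (rule cesaro_tendsto(1)[OF g c d1 d2])
  define Bd where "Bd i j = (SOME B. \<forall>n s. cmod (D i j n s) \<le> B)" for i j
  have Bd: "cmod (D i j n s) \<le> Bd i j" for i j n s using someI_ex[OF exB[of i j]] by (simp add: Bd_def)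
  have bnd: "norm (H n s - h s) \<le> (\<Sum>i\<in>UNIV. \<Sum>j\<in>UNIV. Bd i j)" for n s
    by (rule order_trans[OF nle]) (intro sum_mono Bd)
  have "\<exists>K\<ge>0. \<forall>H :: real \<Rightarrow> complex ^ 'd ^ 'd. H \<in> borel_measurable borel \<longrightarrow> (\<forall>x. norm (H x) \<le> (\<Sum>i\<in>UNIV. \<Sum>j\<in>UNIV. Bd i j)) \<longrightarrow>
     modint H \<le> ennreal K * (\<integral>\<^sup>+x. ennreal (norm (H x) powr 1) \<partial>lborel)"
    by (rule modint_le_powr) (use \<alpha> in auto)
  then obtain K where K: "\<forall>H :: real \<Rightarrow> complex ^ 'd ^ 'd. H \<in> borel_measurable borel \<longrightarrow> (\<forall>x. norm (H x) \<le> (\<Sum>i\<in>UNIV. \<Sum>j\<in>UNIV. Bd i j)) \<longrightarrow>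
     modint H \<le> ennreal K * (\<integral>\<^sup>+x. ennreal (norm (H x) powr 1) \<partial>lborel)" by blast
  have le: "modint (\<lambda>s. G n s - h s) \<le> ennreal K * (\<Sum>i\<in>UNIV. \<Sum>j\<in>UNIV. (\<integral>\<^sup>+s. ennreal (cmod (D i j n s)) \<partial>lborel))" for n
  proof -
    \<comment> \<open>G n agrees with the explicit kernel H n only almost everywhere, which the
      modular does not see.\<close>
    have "modint (\<lambda>s. G n s - h s) = modint (\<lambda>s. H n s - h s)"
      using G(2)[of n] by (intro modint_cong_AE) (auto elim!: eventually_mono)
    also have "\<dots> \<le> ennreal K * (\<integral>\<^sup>+s. ennreal (norm (H n s - h s) powr 1) \<partial>lborel)" using K diff_meas bnd by blast
    also have "\<dots> \<le> ennreal K * (\<integral>\<^sup>+s. (\<Sum>i\<in>UNIV. \<Sum>j\<in>UNIV. ennreal (cmod (D i j n s))) \<partial>lborel)"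
    proof (intro mult_left_mono nn_integral_mono)
      fix s
      have "ennreal (norm (H n s - h s) powr 1) \<le> ennreal (\<Sum>i\<in>UNIV. \<Sum>j\<in>UNIV. cmod (D i j n s))"
        using nle[of n s] by (intro ennreal_leI) simp
      also have "\<dots> = (\<Sum>i\<in>UNIV. \<Sum>j\<in>UNIV. ennreal (cmod (D i j n s)))" by (simp add: sum_ennreal sum_nonneg)
      finally show "ennreal (norm (H n s - h s) powr 1) \<le> (\<Sum>i\<in>UNIV. \<Sum>j\<in>UNIV. ennreal (cmod (D i j n s)))" .
    qed simp
    also have "(\<integral>\<^sup>+s. (\<Sum>i\<in>UNIV. \<Sum>j\<in>UNIV. ennreal (cmod (D i j n s))) \<partial>lborel) = (\<Sum>i\<in>UNIV. \<Sum>j\<in>UNIV. (\<integral>\<^sup>+s. ennreal (cmod (D i j n s)) \<partial>lborel))"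
      by (simp add: nn_integral_sum del: sum_ennreal)
    finally show ?thesis .
  qed
  have "(\<lambda>n. ennreal K * (\<Sum>i\<in>UNIV. \<Sum>j\<in>UNIV. (\<integral>\<^sup>+s. ennreal (cmod (D i j n s)) \<partial>lborel))) \<longlonglongrightarrow> ennreal K * (\<Sum>i\<in>(UNIV::'d set). \<Sum>j\<in>(UNIV::'d set). 0)"
    unfolding D_def by (intro ennreal_tendsto_cmult tendsto_sum cesaro_tendsto(2)[OF g c d1 d2]) simp
  then have lim: "(\<lambda>n. modint (\<lambda>s. G n s - h s)) \<longlonglongrightarrow> 0" by (intro tendsto_zero_ennreal_le[OF le]) simp
  have fl: "filterlim (\<lambda>n. real (Suc n)) at_top sequentially"
    by (rule filterlim_compose[OF filterlim_real_sequentially filterlim_Suc])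
  have JY': "tendsto_in_prob M (\<lambda>n. J (real (Suc n))) (Y t) sequentially"
    unfolding tendsto_in_prob_def
  proof (intro conjI allI impI)
    note JY = JY[unfolded tendsto_in_prob_def]
    show "\<forall>\<^sub>F n in sequentially. J (real (Suc n)) \<in> borel_measurable M"
      by (rule eventually_compose_filterlim[OF conjunct1[OF JY] fl])
    show "Y t \<in> borel_measurable M" using JY by blast
    fix e :: real
    assume "e > 0"
    then have "((\<lambda>i. measure M {\<omega> \<in> space M. dist (J i \<omega>) (Y t \<omega>) > e}) \<longlongrightarrow> 0) at_top" using JY by blast
    from filterlim_compose[OF this fl]
    show "(\<lambda>n. measure M {\<omega> \<in> space M. dist (J (real (Suc n)) \<omega>) (Y t \<omega>) > e}) \<longlonglongrightarrow> 0" .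
  qed
  have hY: "good_integral h (Y t)"
    by (rule good_integral_limit[OF _ h_meas h_fin lim JY']) (use G(1) in auto)
  have "modint kr = modint h" unfolding modint_def h_def norm_cmat ..
  then have "modint kr < \<infinity>" using h_fin by simp
  from has_levy_integral_real_exists[OF kr_meas this] obtain Z where
    Z: "good_integral h (\<lambda>\<omega>. cvec (Z \<omega>))" "has_levy_integral M \<Lambda> h (\<lambda>\<omega>. cvec (Z \<omega>))"
    unfolding h_def[abs_def] by (elim exE conjE)
  have "AE \<omega> in M. Y t \<omega> = cvec (Z \<omega>)" by (rule good_integral_unique[OF hY Z(1)]) simp
  with Z(2) show ?thesis unfolding h_alt[abs_def] by (intro exI conjI)
qed

end

theorem mainTheorem13:
  fixes M :: "'w measure"
    and L :: "real \<Rightarrow> 'w \<Rightarrow> real ^ 'd"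
    and \<gamma> :: "real ^ 'd" and \<Sigma> :: "real ^ 'd ^ 'd" and \<nu> :: "(real ^ 'd) measure"
    and \<alpha> :: real and \<kappa> :: "(ereal ^ 'd) measure"
    and \<Lambda> :: "real set \<Rightarrow> 'w \<Rightarrow> real ^ 'd"
    and \<Phi> :: "real set \<Rightarrow> 'w \<Rightarrow> complex ^ 'd"
    and p q :: nat
    and A B :: "nat \<Rightarrow> real ^ 'd ^ 'd"
    and g_hat :: "real \<Rightarrow> complex ^ 'd ^ 'd"
    and Y :: "real \<Rightarrow> 'w \<Rightarrow> complex ^ 'd"
  assumes "two_sided_levy_process M L"
    and "has_generating_triplet M L \<gamma> \<Sigma> \<nu>"
    and "1 < \<alpha>" and "\<alpha> \<le> 2"
    and "regularly_varying_measure \<nu> \<alpha> \<kappa>"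
    and "integrable M (L 1)" and "(LINT \<omega>|M. L 1 \<omega>) = 0"
    and "levy_random_measure M L \<Lambda>"
    and "fourier_random_measure M \<Lambda> \<Phi>"
    and "p = CARD('p::{finite,linorder})" and "q < p" and "B 0 \<noteq> 0"
    and "\<forall>z\<in>ar_zeros p A. Re z \<noteq> 0"
    and "has_fourier_mat 2 (transfer_fun p q A B) g_hat"
    and "nondegenerate_kernel \<kappa> (\<lambda>s. g_hat (- s))"
    and "regularly_varying_mcarma M \<alpha> \<Phi> p q A B Y"
    and "ar_zeros p A \<subseteq> {z. Re z < 0}"
  shows "\<forall>t. \<exists>Z :: 'w \<Rightarrow> real ^ 'd.
           has_levy_integral M \<Lambda>
             (\<lambda>s. indicator {..t} s *\<^sub>R cmat (causal_kernel TYPE('p) q A B (t - s)))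
             (\<lambda>\<omega>. cvec (Z \<omega>)) \<and>
           (AE \<omega> in M. Y t \<omega> = cvec (Z \<omega>))"
proof -
  note levy = assms(1)[unfolded two_sided_levy_process_def]
  note triplet = assms(2)[unfolded has_generating_triplet_def]
  interpret reg_var_levy \<Sigma> \<nu> \<alpha> \<kappa>
    using triplet assms(3-5) by unfold_locales auto
  interpret prob_space M using levy by simp
  have [measurable]: "L t \<in> borel_measurable M" for t using levy by simp
  have cf: "(LINT \<omega>|M. exp (\<i> * of_real (u \<bullet> L t \<omega>))) = exp (of_real t * levy_exponent \<gamma> \<Sigma> \<nu> u)" if "t \<ge> 0" for t u
    using triplet that by blast
  \<comment> \<open>The drift is the mean of L 1. With mean 0 the exponent is the centred one, to
    which the modular bound applies.\<close>
  have "drift \<gamma> = 0"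
    using cf[of 1] by (intro drift_eq_0[OF prob_space_axioms assms(6,7)]) simp
  then have exponent: "levy_exponent \<gamma> \<Sigma> \<nu> u = centred u" for u by (simp add: levy_exponent_eq_centred)
  define \<beta> where "\<beta> = (1 + \<alpha>) / 2"
  have \<beta>: "1 < \<beta>" "\<beta> < \<alpha>" using assms(3) by (auto simp: \<beta>_def)
  interpret levy_integrator_index w M L \<Lambda> centred \<alpha>
  proof unfold_locales
    show "(w \<longlongrightarrow> 0) (at_right 0)"
    proof -
      obtain C where C: "\<And>x. 0 \<le> x \<Longrightarrow> w x \<le> C * (x\<^sup>2 + x powr \<beta>)" using modular_le_powr[OF \<beta>] by metis
      show ?thesis
      proof (rule tendsto_sandwich)
        show "eventually (\<lambda>x. 0 \<le> w x) (at_right 0)" by (simp add: modular_nonneg)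
        show "eventually (\<lambda>x. w x \<le> C * (x\<^sup>2 + x powr \<beta>)) (at_right 0)"
          by (auto simp: eventually_at_right_less C intro!: eventually_at_rightI[of 0 1])
        have "((\<lambda>x. x powr \<beta>) \<longlongrightarrow> 0) (at_right (0::real))"
          by (rule tendsto_powr'[OF tendsto_ident_at tendsto_const, of 0, simplified])
             (use \<beta> in \<open>auto simp: eventually_at_filter\<close>)
        then have "((\<lambda>x. C * (x\<^sup>2 + x powr \<beta>)) \<longlongrightarrow> C * (0\<^sup>2 + 0)) (at_right 0)"
          by (intro tendsto_intros)
        then show "((\<lambda>x. C * (x\<^sup>2 + x powr \<beta>)) \<longlongrightarrow> 0) (at_right 0)" by simp
      qed simp
    qed
    show "\<exists>C\<ge>0. \<forall>x\<ge>0. w x \<le> C * (x\<^sup>2 + x powr \<beta>)" if "1 < \<beta>" "\<beta> < \<alpha>" for \<beta>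
      using modular_le_powr[OF that] by metis
    fix a b :: real and u :: "real ^ 'd"
    assume "a \<le> b"
    \<comment> \<open>Stationarity moves the increment to [0, b - a], where the formula for the
      characteristic function of L (b - a) applies because L 0 = 0 almost surely.\<close>
    have "distr M borel (\<lambda>\<omega>. L ((b - a) + a) \<omega> - L (0 + a) \<omega>) = distr M borel (\<lambda>\<omega>. L (b - a) \<omega> - L 0 \<omega>)"
      using levy by blast
    then have stat: "distr M borel (\<lambda>\<omega>. L b \<omega> - L a \<omega>) = distr M borel (\<lambda>\<omega>. L (b - a) \<omega> - L 0 \<omega>)" by simp
    have "(LINT \<omega>|M. exp (\<i> * of_real (u \<bullet> (L b \<omega> - L a \<omega>)))) = (LINT x|distr M borel (\<lambda>\<omega>. L b \<omega> - L a \<omega>). exp (\<i> * of_real (u \<bullet> x)))"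
      by (subst integral_distr) auto
    also have "\<dots> = (LINT \<omega>|M. exp (\<i> * of_real (u \<bullet> (L (b - a) \<omega> - L 0 \<omega>))))"
      unfolding stat by (subst integral_distr) auto
    also have "\<dots> = (LINT \<omega>|M. exp (\<i> * of_real (u \<bullet> L (b - a) \<omega>)))"
      using levy by (intro integral_cong_AE) (auto elim!: eventually_mono)
    also have "\<dots> = exp (of_real (b - a) * centred u)"
      using cf[of "b - a"] \<open>a \<le> b\<close> by (simp add: exponent)
    finally show "(LINT \<omega>|M. exp (\<i> * of_real (u \<bullet> (L b \<omega> - L a \<omega>)))) = exp (of_real (b - a) * centred u)" .
  qed (use assms(3,4,8) in \<open>auto simp: modular_nonneg modular_zero intro: modular_mono modular_scale centred_bound\<close>)
  show ?thesis
    using causal_representation[OF assms(9-11) assms(16,17)] by blast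
qed

end
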